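(* Let $\Omega$ be an open subset of $\mathbb{R}^d$ and let $H_\Omega=-\sum_{i,j=1}^d\partial_i\,c_{ij}\,\partial_j$ be the second-order partial differential operator with domain $D(H_\Omega)=C_c^\infty(\Omega)$, where the coefficients $c_{ij}=c_{ji}\in W^{1,\infty}(\Omega)$ are real and the matrix $C(x)=(c_{ij}(x))$ is strictly positive-definite for all $x\in\Omega$. Assume $p\in[1,2]$. If there exists a sequence $\eta_n\in C_c^\infty(\Omega)$ such that $0\le\eta_n\le 1_\Omega$, $\|(\eta_n-1_\Omega)\psi\|_2\to0$ for all $\psi\in L_2(\Omega)$ and $\|\Gamma(\eta_n)\|_{p/(2-p)}\to0$ as $n\to\infty$, then $H_\Omega$ is $L_p$-unique.
   Context: Functions are real-valued, $\partial_i=\partial/\partial x_i$, $1_\Omega$ is the constant function $1$ on $\Omega$, and $\|\cdot\|_q$ is the norm of $L_q(\Omega)$; if $p=2$ then $p/(2-p)$ is understood to be $\infty$. The carré du champ is $\Gamma(\eta)=\sum_{i,j=1}^d c_{ij}\,(\partial_i\eta)(\partial_j\eta)$. Viewing $H_\Omega$ as an operator on $L_p(\Omega)$ with domain $C_c^\infty(\Omega)$, $H_\Omega$ is $L_p$-unique if it has a unique extension which generates an $L_p$-continuous (i.e. strongly continuous) semigroup on $L_p(\Omega)$. *)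

theory Defs
  imports "HOL-Analysis.Analysis" "HOL-Probability.Essential_Supremum"
begin

section \<open>Lebesgue spaces of real functions\<close>

text \<open>
  The spaces \<open>L\<^sub>q\<close> are spaces of functions, not of equivalence classes; wherever the identification
  of almost everywhere equal functions matters, it is made explicitly.
  The exponent \<open>q\<close> ranges over \<open>[1, \<infinity>]\<close>.
\<close>

definition Lq_norm :: "ennreal \<Rightarrow> 'a measure \<Rightarrow> ('a \<Rightarrow> real) \<Rightarrow> ennreal" where
  "Lq_norm q M f =
     (if q = \<infinity> then esssup M (\<lambda>x. ennreal \<bar>f x\<bar>)
      else let I = (\<integral>\<^sup>+ x. ennreal (\<bar>f x\<bar> powr enn2real q) \<partial>M)
           in if I = \<infinity> then \<infinity> else ennreal (enn2real I powr (1 / enn2real q)))"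

definition Lq :: "ennreal \<Rightarrow> 'a measure \<Rightarrow> ('a \<Rightarrow> real) set" where
  "Lq q M = {f \<in> borel_measurable M. Lq_norm q M f < \<infinity>}"


section \<open>Test functions, weak derivatives and \<open>W\<^sup>1\<^sup>,\<^sup>\<infinity>\<close>\<close>

definition pd :: "'n::finite \<Rightarrow> (real^'n \<Rightarrow> real) \<Rightarrow> real^'n \<Rightarrow> real" where
  "pd i f x = frechet_derivative f (at x) (axis i 1)"

primrec Ck :: "nat \<Rightarrow> (real^'n::finite \<Rightarrow> real) \<Rightarrow> bool" where
  "Ck 0 f \<longleftrightarrow> continuous_on UNIV f"
| "Ck (Suc k) f \<longleftrightarrow> (\<forall>x. f differentiable (at x)) \<and> (\<forall>i. Ck k (pd i f))"

text \<open>Elements of \<open>C\<^sub>c\<^sup>\<infinity>(\<Omega>)\<close> are regarded as functions on the whole space, extended by zero.\<close>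

definition test_functions :: "(real^'n::finite) set \<Rightarrow> (real^'n \<Rightarrow> real) set" where
  "test_functions \<Omega> =
     {\<phi>. (\<forall>k. Ck k \<phi>) \<and> compact (closure {x. \<phi> x \<noteq> 0}) \<and> closure {x. \<phi> x \<noteq> 0} \<subseteq> \<Omega>}"

definition locally_integrable :: "(real^'n::finite) set \<Rightarrow> (real^'n \<Rightarrow> real) \<Rightarrow> bool" where
  "locally_integrable \<Omega> f \<longleftrightarrow> (\<forall>K. compact K \<and> K \<subseteq> \<Omega> \<longrightarrow> set_integrable lebesgue K f)"

definition has_weak_pd ::
  "(real^'n::finite) set \<Rightarrow> 'n \<Rightarrow> (real^'n \<Rightarrow> real) \<Rightarrow> (real^'n \<Rightarrow> real) \<Rightarrow> bool" where
  "has_weak_pd \<Omega> i f g \<longleftrightarrow>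
     locally_integrable \<Omega> f \<and> locally_integrable \<Omega> g \<and>
     (\<forall>\<phi>\<in>test_functions \<Omega>.
        (LINT x|lebesgue_on \<Omega>. f x * pd i \<phi> x) = - (LINT x|lebesgue_on \<Omega>. g x * \<phi> x))"

text \<open>A representative of the weak derivative; it is determined up to null sets.\<close>

definition weak_pd ::
  "(real^'n::finite) set \<Rightarrow> 'n \<Rightarrow> (real^'n \<Rightarrow> real) \<Rightarrow> real^'n \<Rightarrow> real" where
  "weak_pd \<Omega> i f = (SOME g. has_weak_pd \<Omega> i f g)"

text \<open>
  Every class in \<open>W\<^sup>1\<^sup>,\<^sup>\<infinity>(\<Omega>)\<close> has exactly one continuous (in fact locally Lipschitz)
  representative on the open set \<open>\<Omega>\<close>. Pointwise statements about elements of \<open>W\<^sup>1\<^sup>,\<^sup>\<infinity>(\<Omega>)\<close>, such as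
  positive-definiteness of the coefficient matrix at every point, refer to that representative, so
  the space is defined here as the set of continuous representatives.
\<close>

definition W1_infty :: "(real^'n::finite) set \<Rightarrow> (real^'n \<Rightarrow> real) set" where
  "W1_infty \<Omega> =
     {f. continuous_on \<Omega> f \<and> f \<in> Lq \<infinity> (lebesgue_on \<Omega>) \<and>
         (\<forall>i. \<exists>g \<in> Lq \<infinity> (lebesgue_on \<Omega>). has_weak_pd \<Omega> i f g)}"


section \<open>The elliptic operator\<close>

text \<open>
  The operator \<open>\<phi> \<mapsto> - \<Sum>\<^sub>i\<^sub>j \<partial>\<^sub>i (c\<^sub>i\<^sub>j \<partial>\<^sub>j \<phi>)\<close>. The function \<open>c\<^sub>i\<^sub>j \<partial>\<^sub>j \<phi>\<close> is in general only
  Lipschitz, so the outer derivative is a weak one.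
\<close>

definition elliptic_op ::
  "(real^'n::finite) set \<Rightarrow> (real^'n \<Rightarrow> real^'n^'n) \<Rightarrow> (real^'n \<Rightarrow> real) \<Rightarrow> real^'n \<Rightarrow> real" where
  "elliptic_op \<Omega> C \<phi> x = - (\<Sum>i\<in>UNIV. \<Sum>j\<in>UNIV. weak_pd \<Omega> i (\<lambda>y. C y $ i $ j * pd j \<phi> y) x)"

definition elliptic_graph ::
  "(real^'n::finite) set \<Rightarrow> (real^'n \<Rightarrow> real^'n^'n) \<Rightarrow> ((real^'n \<Rightarrow> real) \<times> (real^'n \<Rightarrow> real)) set" where
  "elliptic_graph \<Omega> C = (\<lambda>\<phi>. (\<phi>, elliptic_op \<Omega> C \<phi>)) ` test_functions \<Omega>"

definition carre_du_champ ::
  "(real^'n::finite \<Rightarrow> real^'n^'n) \<Rightarrow> (real^'n \<Rightarrow> real) \<Rightarrow> real^'n \<Rightarrow> real" where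
  "carre_du_champ C \<eta> x = (\<Sum>i\<in>UNIV. \<Sum>j\<in>UNIV. C x $ i $ j * pd i \<eta> x * pd j \<eta> x)"


section \<open>Strongly continuous semigroups on \<open>L\<^sub>p\<close> and uniqueness\<close>

text \<open>
  Linearity together with the norm bound implies that \<open>T\<close> respects almost everywhere equality, so
  \<open>T\<close> represents a bounded linear operator on the space of classes.
\<close>

definition Lq_bounded_linear ::
  "ennreal \<Rightarrow> 'a measure \<Rightarrow> (('a \<Rightarrow> real) \<Rightarrow> ('a \<Rightarrow> real)) \<Rightarrow> bool" where
  "Lq_bounded_linear p M T \<longleftrightarrow>
     (\<forall>f\<in>Lq p M. T f \<in> Lq p M) \<and>
     (\<forall>f\<in>Lq p M. \<forall>g\<in>Lq p M. AE x in M. T (\<lambda>y. f y + g y) x = T f x + T g x) \<and>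
     (\<forall>a. \<forall>f\<in>Lq p M. AE x in M. T (\<lambda>y. a * f y) x = a * T f x) \<and>
     (\<exists>K::real. \<forall>f\<in>Lq p M. Lq_norm p M (T f) \<le> ennreal K * Lq_norm p M f)"

definition Lq_C0_semigroup ::
  "ennreal \<Rightarrow> 'a measure \<Rightarrow> (real \<Rightarrow> ('a \<Rightarrow> real) \<Rightarrow> ('a \<Rightarrow> real)) \<Rightarrow> bool" where
  "Lq_C0_semigroup p M S \<longleftrightarrow>
     (\<forall>t\<ge>0. Lq_bounded_linear p M (S t)) \<and>
     (\<forall>f\<in>Lq p M. AE x in M. S 0 f x = f x) \<and>
     (\<forall>s\<ge>0. \<forall>t\<ge>0. \<forall>f\<in>Lq p M. AE x in M. S (s + t) f x = S s (S t f) x) \<and>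
     (\<forall>f\<in>Lq p M. \<forall>t\<ge>0.
        ((\<lambda>s. Lq_norm p M (\<lambda>x. S s f x - S t f x)) \<longlongrightarrow> 0) (at t within {0..}))"

text \<open>
  Sign convention: \<open>H\<close> generates \<open>S\<close> if \<open>S\<^sub>t = exp (- t H)\<close>, that is
  \<open>H f = lim (f - S\<^sub>t f) / t\<close> as \<open>t\<close> decreases to \<open>0\<close>, on the set of all \<open>f\<close> for which the limit
  exists in \<open>L\<^sub>p\<close>. The graph contains all representatives \<open>(f, g)\<close>, so equality of graphs is equality
  of operators on the space of classes.
\<close>

definition Lq_generator ::
  "ennreal \<Rightarrow> 'a measure \<Rightarrow> (real \<Rightarrow> ('a \<Rightarrow> real) \<Rightarrow> ('a \<Rightarrow> real)) \<Rightarrow> (('a \<Rightarrow> real) \<times> ('a \<Rightarrow> real)) set"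
  where
  "Lq_generator p M S =
     {(f, g). f \<in> Lq p M \<and> g \<in> Lq p M \<and>
        ((\<lambda>t. Lq_norm p M (\<lambda>x. (f x - S t f x) / t - g x)) \<longlongrightarrow> 0) (at_right 0)}"

definition Lq_unique ::
  "ennreal \<Rightarrow> 'a measure \<Rightarrow> (('a \<Rightarrow> real) \<times> ('a \<Rightarrow> real)) set \<Rightarrow> bool" where
  "Lq_unique p M H \<longleftrightarrow>
     (\<exists>!G. H \<subseteq> G \<and> (\<exists>S. Lq_C0_semigroup p M S \<and> G = Lq_generator p M S))"

end

theory Submission
 imports Defs "HOL-Library.Function_Algebras"
begin

text \<open>
  Let \<open>L\<close> denote the operator on test functions. Uniqueness is a consequence of two facts: \<open>L\<close> is
  accretive in \<open>L\<^sub>p\<close>, and \<open>1 + h L\<close> maps the test functions onto a dense subspace of \<open>L\<^sub>p\<close> for every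
  \<open>h > 0\<close>. Then the closure of \<open>L\<close> generates a contraction semigroup, constructed here as the limit of
  backward Euler approximations with \<open>2\<^sup>k\<close> steps, and every generator that extends \<open>L\<close> equals this
  closure (\<open>unique_generator\<close>). The abstract part is developed in a complete seminormed space, so that
  it applies to spaces of functions without passing to classes.

  Accretivity (\<open>Lop_accretive\<close>) results from testing \<open>L \<phi>\<close> with a smooth
  approximation of \<open>\<phi> \<bar>\<phi>\<bar>\<^bsup>p-2\<^esup>\<close>.

  Density of the range is where the cutoff functions \<open>\<eta>\<^sub>n\<close> enter. Suppose that \<open>g\<close> is locally square
  integrable and annihilates the range. Then \<open>g + h L g = 0\<close> in the sense of distributions, and formally
  multiplication by \<open>\<eta>\<^sup>2 g\<close> gives the inequality
  \<open>\<integral> \<eta>\<^sup>2 g\<^sup>2 \<le> h \<integral> \<Gamma>(\<eta>) g\<^sup>2\<close> (\<open>energy\<close>). As \<open>g\<close> has no derivatives a priori, the equation is mollified;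
  by Friedrichs' lemma (\<open>flux_error_L2\<close>) the commutator of mollification with the flux tends to zero in
  \<open>L\<^sub>2\<close> on compact sets, since the coefficients are locally Lipschitz. If \<open>p = 2\<close>, the right-hand side
  with \<open>\<eta> = \<eta>\<^sub>n\<close> tends to zero and the left-hand side to \<open>\<integral> g\<^sup>2\<close>, so \<open>g = 0\<close>.

  If \<open>p < 2\<close>, the same argument works in a weighted Hilbert space: put \<open>q = p / (2 - p)\<close> and choose a weight
  \<open>W\<close> with \<open>W\<^sup>q\<close> integrable and \<open>\<Gamma>(\<eta>\<^sub>n) \<le> \<epsilon>\<^sub>n W\<close> along a subsequence, \<open>\<epsilon>\<^sub>n\<close> tending to zero
  (\<open>range_dense_below_2\<close>). In \<open>L\<^sub>2(W\<^sup>-\<^sup>1)\<close> density follows from orthogonality as above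
  (\<open>weighted_range_dense\<close>), and \<open>L\<^sub>2(W\<^sup>-\<^sup>1)\<close> is continuously embedded in \<open>L\<^sub>p\<close>.

  The mollifier comes from the hypotheses: its profile is one of the \<open>\<eta>\<^sub>n\<close>.
\<close>

section \<open>Semigroups in complete seminormed spaces\<close>

lemma null_le:
 fixes f :: "nat => real"
 assumes "g \<longlonglongrightarrow> 0" "\<And>n. f n \<le> g n" "\<And>n. 0 \<le> f n"
 shows "f \<longlonglongrightarrow> 0"
 by (rule tendsto_sandwich[OF _ _ tendsto_const assms(1)]) (use assms in auto)

text \<open>The elements of \<open>L\<^sub>p\<close> are functions here, not classes, so the abstract setting is a complete
  seminormed space; equality of classes is seminorm zero of the difference.\<close>

locale complete_seminorm =
 fixes X :: "'v::real_vector set" and N :: "'v => real"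
 assumes X_sub: "subspace X"
  and N_add: "x \<in> X ==> y \<in> X ==> N (x + y) \<le> N x + N y"
  and N_scale: "x \<in> X ==> N (a *\<^sub>R x) = \<bar>a\<bar> * N x"
  and N_complete: "(\<And>n::nat. u n \<in> X) ==>
     (\<And>e. e > 0 ==> \<exists>M. \<forall>m\<ge>M. \<forall>n\<ge>M. N (u m - u n) < e) ==>
     \<exists>x\<in>X. (\<lambda>n. N (u n - x)) \<longlonglongrightarrow> 0"
begin

lemma X_0 [simp, intro]: "0 \<in> X"
 and X_add [simp, intro]: "x \<in> X ==> y \<in> X ==> x + y \<in> X"
 and X_diff [simp, intro]: "x \<in> X ==> y \<in> X ==> x - y \<in> X"
 and X_scale [simp, intro]: "x \<in> X ==> a *\<^sub>R x \<in> X"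
 and X_minus [simp, intro]: "x \<in> X ==> - x \<in> X"
 using X_sub by (auto intro: subspace_0 subspace_add subspace_diff subspace_scale subspace_neg)

lemma N_0 [simp]: "N 0 = 0"
 using N_scale[of 0 0] by simp

lemma N_commute: "x \<in> X ==> y \<in> X ==> N (x - y) = N (y - x)"
 using N_scale[of "x - y" "-1"] by simp

lemma N_nonneg: "x \<in> X ==> 0 \<le> N x"
 using N_add[of x "-1 *\<^sub>R x"] N_scale[of x "-1"] X_scale[of x "-1"] by simp

lemma N_diff: "x \<in> X ==> y \<in> X ==> N (x - y) \<le> N x + N y"
 using N_add[of x "-1 *\<^sub>R y"] N_scale[of y "-1"] X_scale[of y "-1"] by simp

lemma N_triangle: "x \<in> X ==> y \<in> X ==> z \<in> X ==> N (x - z) \<le> N (x - y) + N (y - z)"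
 using N_add[of "x - y" "y - z"] by simp

lemma N_le: "x \<in> X ==> y \<in> X ==> N x \<le> N y + N (x - y)"
 using N_add[of y "x - y"] by simp

lemma N_abs_diff: "x \<in> X ==> y \<in> X ==> \<bar>N x - N y\<bar> \<le> N (x - y)"
 using N_le[of x y] N_le[of y x] N_commute[of x y] by simp

definition lin :: "('v => 'v) => bool" where
 "lin T \<longleftrightarrow> (\<forall>x\<in>X. T x \<in> X) \<and>
   (\<forall>x\<in>X. \<forall>y\<in>X. N (T (x + y) - (T x + T y)) = 0) \<and>
   (\<forall>a. \<forall>x\<in>X. N (T (a *\<^sub>R x) - a *\<^sub>R T x) = 0)"

lemma linD:
 assumes "lin T"
 shows "x \<in> X ==> T x \<in> X"
  and "x \<in> X ==> y \<in> X ==> N (T (x + y) - (T x + T y)) = 0"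
  and "x \<in> X ==> N (T (a *\<^sub>R x) - a *\<^sub>R T x) = 0"
 using assms by (auto simp: lin_def)

lemma lin_diff0:
 assumes "lin T" "x \<in> X" "y \<in> X" shows "N (T (x - y) - (T x - T y)) = 0"
proof -
 have "N (T (y + (x - y)) - (T y + T (x - y))) = 0"
  using linD(2)[OF assms(1), of y "x - y"] assms by simp
 moreover have "T (x - y) - (T x - T y) = (-1) *\<^sub>R (T (y + (x - y)) - (T y + T (x - y)))"
  by (simp add: algebra_simps)
 ultimately show ?thesis
  using N_scale[of "T (y + (x - y)) - (T y + T (x - y))" "-1"] assms linD(1)[OF assms(1)]
  by (simp only:) (simp add: linD(1)[OF assms(1)])
qed

lemma lin_diff: "lin T ==> x \<in> X ==> y \<in> X ==> N (T (x - y)) = N (T x - T y)"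
 using lin_diff0[of T x y] linD(1)[of T] N_abs_diff[of "T (x - y)" "T x - T y"] by simp

lemma lin_scale: "lin T ==> x \<in> X ==> N (T (a *\<^sub>R x)) = \<bar>a\<bar> * N (T x)"
 using linD[of T] N_abs_diff[of "T (a *\<^sub>R x)" "a *\<^sub>R T x"] N_scale[of "T x" a] by simp

lemma limit_unique:
 assumes "\<And>n. u n \<in> X" "x \<in> X" "y \<in> X"
  and "(\<lambda>n. N (u n - x)) \<longlonglongrightarrow> 0" "(\<lambda>n. N (u n - y)) \<longlonglongrightarrow> 0"
 shows "N (x - y) = 0"
proof -
 have "(\<lambda>n. N (u n - x) + N (u n - y)) \<longlonglongrightarrow> 0"
  using tendsto_add[OF assms(4,5)] by simp
 moreover have "N (x - y) \<le> N (u n - x) + N (u n - y)" for n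
  using N_triangle[of x "u n" y] N_commute[of "u n" x] assms by simp
 ultimately have "N (x - y) \<le> 0"
  by (intro LIMSEQ_le_const) auto
 thus ?thesis using N_nonneg[of "x - y"] assms by simp
qed

lemma limit_norm:
 assumes "\<And>n. u n \<in> X" "x \<in> X" "(\<lambda>n. N (u n - x)) \<longlonglongrightarrow> 0"
 shows "(\<lambda>n. N (u n)) \<longlonglongrightarrow> N x"
proof -
 have "(\<lambda>n. N (u n) - N x) \<longlonglongrightarrow> 0"
  by (rule tendsto_rabs_zero_cancel, rule tendsto_sandwich[OF _ _ tendsto_const assms(3)])
    (use N_abs_diff assms in auto)
 thus ?thesis using LIM_zero_iff by blast
qed

text \<open>A semigroup of bounded operators need not be linear on the nose: all its laws hold up to
  elements of seminorm zero.\<close>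

definition C0_semigroup :: "(real => 'v => 'v) => bool" where
 "C0_semigroup S \<longleftrightarrow>
   (\<forall>t\<ge>0. lin (S t) \<and> (\<exists>K. \<forall>x\<in>X. N (S t x) \<le> K * N x)) \<and>
   (\<forall>x\<in>X. N (S 0 x - x) = 0) \<and>
   (\<forall>s\<ge>0. \<forall>t\<ge>0. \<forall>x\<in>X. N (S (s + t) x - S s (S t x)) = 0) \<and>
   (\<forall>x\<in>X. \<forall>t\<ge>0. ((\<lambda>s. N (S s x - S t x)) \<longlongrightarrow> 0) (at t within {0..}))"

definition generator :: "(real => 'v => 'v) => ('v \<times> 'v) set" where
 "generator S = {(x, y). x \<in> X \<and> y \<in> X \<and>
   ((\<lambda>t. N ((1 / t) *\<^sub>R (x - S t x) - y)) \<longlongrightarrow> 0) (at_right 0)}"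

text \<open>The gliding hump. Suppose that there are operators of norm at least \<open>4\<^sup>k\<close> for all \<open>k\<close>. An operator of
  large norm is large at one of \<open>y + r x\<close> and \<open>y - r x\<close> for a suitable unit vector \<open>x\<close>, whatever \<open>y\<close> is.
  Successive corrections of size \<open>3\<^sup>-\<^sup>k\<close> give a Cauchy sequence, and its limit violates pointwise
  boundedness.\<close>

lemma uniform_boundedness:
 assumes U: "\<And>i. i \<in> I ==> lin (U i)"
  and bdd: "\<And>i. i \<in> I ==> \<exists>K. \<forall>x\<in>X. N (U i x) \<le> K * N x"
  and ptw: "\<And>x. x \<in> X ==> \<exists>B. \<forall>i\<in>I. N (U i x) \<le> B"
 shows "\<exists>M\<ge>0. \<forall>i\<in>I. \<forall>x\<in>X. N (U i x) \<le> M * N x"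
proof (rule ccontr)
 assume neg: "\<not> ?thesis"
 define p where "p i = (SUP x\<in>{x\<in>X. N x \<le> 1}. N (U i x))" for i
 have bdd_above: "bdd_above ((\<lambda>x. N (U i x)) ` {x\<in>X. N x \<le> 1})" if i: "i \<in> I" for i
 proof -
  obtain K where K: "\<And>x. x \<in> X ==> N (U i x) \<le> K * N x" using bdd[OF i] by blast
  have "N (U i x) \<le> \<bar>K\<bar>" if "x \<in> X" "N x \<le> 1" for x
  proof -
   have "K * N x \<le> \<bar>K\<bar> * N x" using N_nonneg[OF that(1)] by (intro mult_right_mono) auto
   also have "\<dots> \<le> \<bar>K\<bar> * 1" using that by (intro mult_left_mono) auto
   finally show ?thesis using K[OF that(1)] by simp
  qed
  thus ?thesis by (auto intro!: bdd_aboveI2)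
 qed
 have p_upper: "N (U i x) \<le> p i * N x" if i: "i \<in> I" and x: "x \<in> X" for i x
 proof (cases "N x = 0")
  case True
  thus ?thesis using bdd[OF i] x by force
 next
  case False
  hence pos: "N x > 0" using N_nonneg[OF x] by simp
  have "N (U i ((1 / N x) *\<^sub>R x)) \<le> p i"
   unfolding p_def using x pos N_scale[OF x, of "1 / N x"] by (intro cSUP_upper bdd_above i) auto
  thus ?thesis using lin_scale[OF U[OF i] x, of "1 / N x"] pos by (simp add: field_simps)
 qed
 have p_nonneg: "0 \<le> p i" if i: "i \<in> I" for i
 proof -
  have "N (U i 0) \<le> p i" unfolding p_def using X_0 by (intro cSUP_upper bdd_above i) auto
  thus ?thesis using N_nonneg[of "U i 0"] linD(1)[OF U[OF i]] by fastforce
 qed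
 have bump: "\<exists>z\<in>X. N (z - y) \<le> r \<and> 2/3 * r * p i \<le> N (U i z)" if i: "i \<in> I" and y: "y \<in> X" and r: "r > 0" for i y r
 proof (cases "p i = 0")
  case True
  thus ?thesis using y r N_nonneg[OF linD(1)[OF U[OF i] y]] by (intro bexI[of _ y]) auto
 next
  case False
  hence "2/3 * p i < p i" using p_nonneg[OF i] by simp
  moreover have "{x\<in>X. N x \<le> 1} \<noteq> {}" using X_0 by force
  ultimately obtain x where x: "x \<in> X" "N x \<le> 1" "2/3 * p i < N (U i x)"
   using less_cSUP_iff[OF _ bdd_above[OF i], of "2/3 * p i"] unfolding p_def by auto
  define z1 z2 where "z1 = y + r *\<^sub>R x" and "z2 = y - r *\<^sub>R x"
  have z: "z1 \<in> X" "z2 \<in> X" using x y by (auto simp: z1_def z2_def)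
  have zy: "N (z1 - y) \<le> r" "N (z2 - y) \<le> r"
   using N_scale[OF x(1), of r] N_scale[OF x(1), of "-r"] x r by (auto simp: z1_def z2_def)
  have "z1 - z2 = r *\<^sub>R x + r *\<^sub>R x" by (simp add: z1_def z2_def)
  hence zz: "z1 - z2 = (2 * r) *\<^sub>R x" unfolding scaleR_add_left[symmetric] mult_2 .
  have "2 * r * N (U i x) = N (U i (z1 - z2))"
   unfolding zz using lin_scale[OF U[OF i] x(1), of "2 * r"] r by simp
  also have "\<dots> \<le> N (U i z1) + N (U i z2)"
   using lin_diff[OF U[OF i] z] N_diff[OF linD(1)[OF U[OF i] z(1)] linD(1)[OF U[OF i] z(2)]] by simp
  finally have "2 * r * N (U i x) \<le> N (U i z1) + N (U i z2)" .
  moreover have "r * (2/3 * p i) \<le> r * N (U i x)" using x r by (intro mult_left_mono) auto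
  ultimately have "2/3 * r * p i \<le> N (U i z1) \<or> 2/3 * r * p i \<le> N (U i z2)" by argo
  thus ?thesis using z zy by blast
 qed
 have "\<exists>i\<in>I. 4 ^ n \<le> p i" for n :: nat
 proof (rule ccontr)
  assume "\<not> ?thesis"
  hence "p i \<le> 4 ^ n" if "i \<in> I" for i using that by force
  hence "N (U i x) \<le> 4 ^ n * N x" if "i \<in> I" "x \<in> X" for i x
   using order_trans[OF p_upper[OF that] mult_right_mono[OF _ N_nonneg[OF that(2)]]] that by blast
  hence "(0::real) \<le> 4 ^ n \<and> (\<forall>i\<in>I. \<forall>x\<in>X. N (U i x) \<le> 4 ^ n * N x)" by simp
  hence "\<exists>M\<ge>0. \<forall>i\<in>I. \<forall>x\<in>X. N (U i x) \<le> M * N x" by (rule exI)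
  thus False using neg by contradiction
 qed
 then obtain i where i: "\<And>n::nat. i n \<in> I" "\<And>n. 4 ^ n \<le> p (i n)" by metis
 have "\<exists>x. \<forall>n. x n \<in> X \<and> (N (x (Suc n) - x n) \<le> (1/3) ^ Suc n \<and> 2/3 * (1/3) ^ Suc n * p (i (Suc n)) \<le> N (U (i (Suc n)) (x (Suc n))))"
 proof (rule dependent_nat_choice)
  fix x n assume "x \<in> X"
  thus "\<exists>y. y \<in> X \<and> (N (y - x) \<le> (1/3) ^ Suc n \<and> 2/3 * (1/3) ^ Suc n * p (i (Suc n)) \<le> N (U (i (Suc n)) y))"
   using bump[OF i(1), of x "(1/3) ^ Suc n" "Suc n"] by auto
 qed (use X_0 in blast)
 then obtain x where x: "\<And>n. x n \<in> X" "\<And>n. N (x (Suc n) - x n) \<le> (1/3) ^ Suc n"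
  "\<And>n. 2/3 * (1/3) ^ Suc n * p (i (Suc n)) \<le> N (U (i (Suc n)) (x (Suc n)))" by blast
 have dist: "N (x m - x n) \<le> 1/2 * ((1/3) ^ n - (1/3) ^ m)" if "n \<le> m" for m n
  using that
 proof (induction m rule: dec_induct)
  case (step m)
  have "N (x (Suc m) - x n) \<le> N (x (Suc m) - x m) + N (x m - x n)" using x(1) by (intro N_triangle) auto
  also have "\<dots> \<le> (1/3) ^ Suc m + 1/2 * ((1/3) ^ n - (1/3) ^ m)" using x(2) step by (intro add_mono) auto
  also have "\<dots> = 1/2 * ((1/3) ^ n - (1/3) ^ Suc m)" by (simp add: field_simps)
  finally show ?case .
 qed simp
 have pw: "0 < (1/3::real) ^ k" for k by simp
 have pow0: "(\<lambda>n. 1/2 * (1/3::real) ^ n) \<longlonglongrightarrow> 0" by (intro tendsto_mult_right_zero LIMSEQ_realpow_zero) auto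
 have "\<exists>x'\<in>X. (\<lambda>n. N (x n - x')) \<longlonglongrightarrow> 0"
 proof (rule N_complete[OF x(1)])
  fix e :: real assume "e > 0"
  then obtain M where M: "\<And>n. n \<ge> M ==> 1/2 * (1/3::real) ^ n < e"
   using order_tendstoD(2)[OF pow0] by (auto simp: eventually_sequentially)
  have "N (x m - x n) < e" if "n \<ge> M" "n \<le> m" for m n
  proof -
   have "1/2 * ((1/3::real) ^ n - (1/3) ^ m) \<le> 1/2 * (1/3) ^ n" by (intro mult_left_mono) auto
   from order_trans[OF dist[OF that(2)] this] M[OF that(1)] show ?thesis by (rule le_less_trans)
  qed
  note wlog = this
  have "N (x m - x n) < e" if "m \<ge> M" "n \<ge> M" for m n
  proof (cases "n \<le> m")
   case False
   thus ?thesis unfolding N_commute[OF x(1) x(1), of m n] using wlog[of m n] that by simp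
  qed (use wlog that in auto)
  thus "\<exists>M. \<forall>m\<ge>M. \<forall>n\<ge>M. N (x m - x n) < e" by blast
 qed
 then obtain x' where x': "x' \<in> X" "(\<lambda>n. N (x n - x')) \<longlonglongrightarrow> 0" by blast
 have near: "N (x' - x n) \<le> 1/2 * (1/3) ^ n" for n
 proof -
  have "(\<lambda>m. N (x m - x') + 1/2 * (1/3) ^ n) \<longlonglongrightarrow> 0 + 1/2 * (1/3) ^ n"
   by (intro tendsto_add x' tendsto_const)
  moreover have "N (x' - x n) \<le> N (x m - x') + 1/2 * (1/3) ^ n" if "m \<ge> n" for m
  proof -
   have "1/2 * ((1/3::real) ^ n - (1/3) ^ m) \<le> 1/2 * (1/3) ^ n" by (intro mult_left_mono) auto
   from order_trans[OF dist[OF that] this]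
   show ?thesis using N_triangle[OF x'(1) x(1) x(1), of n m] N_commute[OF x'(1) x(1), of m] by simp
  qed
  ultimately show ?thesis by (intro LIMSEQ_le_const[of _ "1/2 * (1/3) ^ n"]) auto
 qed
 obtain B where B: "\<And>j. j \<in> I ==> N (U j x') \<le> B" using ptw[OF x'(1)] by blast
 have "1/6 * (4/3) ^ Suc n \<le> B" for n
 proof -
  define m where "m = Suc n"
  have UX: "U (i m) x' \<in> X" "U (i m) (x m) \<in> X" using linD(1)[OF U[OF i(1)]] x x' by auto
  have "N (U (i m) (x m)) \<le> N (U (i m) x') + N (U (i m) (x m - x'))"
   using N_le[OF UX(2,1)] lin_diff[OF U[OF i(1)] x(1) x'(1)] by simp
  moreover have "N (U (i m) (x m - x')) \<le> p (i m) * (1/2 * (1/3) ^ m)"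
   using p_upper[OF i(1) X_diff[OF x(1) x'(1)], of m m] near[of m] N_commute[OF x'(1) x(1), of m]
    mult_left_mono[OF near p_nonneg[OF i(1)], of m m] by simp
  ultimately have "2/3 * (1/3) ^ m * p (i m) \<le> B + p (i m) * (1/2 * (1/3) ^ m)"
   using x(3)[of n] B[OF i(1), of m] by (simp add: m_def)
  hence "1/6 * (1/3) ^ m * p (i m) \<le> B" by (simp add: mult.commute)
  moreover have "1/6 * (1/3) ^ m * 4 ^ m \<le> 1/6 * (1/3) ^ m * p (i m)" using i(2) by (intro mult_left_mono) auto
  ultimately have "1/6 * (1/3) ^ m * 4 ^ m \<le> B" by linarith
  moreover have "1/6 * (1/3) ^ m * 4 ^ m = 1/6 * (4/3::real) ^ m" by (simp add: power_divide)
  ultimately show ?thesis by (simp add: m_def)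
 qed
 moreover obtain n where "6 * B < (4/3::real) ^ n" using real_arch_pow[of "4/3" "6 * B"] by auto
 moreover have "(4/3::real) ^ n \<le> (4/3) ^ Suc n" by (rule power_increasing) auto
 ultimately show False using \<open>\<And>n. 1/6 * (4/3) ^ Suc n \<le> B\<close>[of n] by simp
qed

lemma C0_semigroupD:
 assumes "C0_semigroup S"
 shows "t \<ge> 0 ==> lin (S t)"
  and "x \<in> X ==> N (S 0 x - x) = 0"
  and "s \<ge> 0 ==> t \<ge> 0 ==> x \<in> X ==> N (S (s + t) x - S s (S t x)) = 0"
 using assms by (auto simp: C0_semigroup_def)

lemma C0_semigroup_bounded:
 assumes S: "C0_semigroup S"
 obtains M where "M \<ge> 0" "\<And>t x. 0 \<le> t ==> t \<le> 1 ==> x \<in> X ==> N (S t x) \<le> M * N x"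
proof -
 have "\<exists>M\<ge>0. \<forall>t\<in>{0..1}. \<forall>x\<in>X. N (S t x) \<le> M * N x"
 proof (rule uniform_boundedness)
  fix x assume x: "x \<in> X"
  have SX: "S t x \<in> X" if "t \<ge> 0" for t using linD(1)[OF C0_semigroupD(1)[OF S that] x] .
  have "continuous_on {0..} (\<lambda>t. N (S t x))"
   unfolding continuous_on_def
  proof
   fix t :: real assume t: "t \<in> {0..}"
   have "((\<lambda>s. N (S s x - S t x)) \<longlongrightarrow> 0) (at t within {0..})"
    using S x t by (auto simp: C0_semigroup_def)
   moreover have "eventually (\<lambda>s. norm (N (S s x) - N (S t x)) \<le> N (S s x - S t x)) (at t within {0..})"
    using t SX N_abs_diff by (auto simp: eventually_at intro!: exI[of _ 1])
   ultimately have "((\<lambda>s. N (S s x) - N (S t x)) \<longlongrightarrow> 0) (at t within {0..})"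
    by (rule Lim_null_comparison[rotated])
   thus "((\<lambda>s. N (S s x)) \<longlongrightarrow> N (S t x)) (at t within {0..})" by (rule LIM_zero_cancel)
  qed
  hence "continuous_on {0..1} (\<lambda>t. N (S t x))" by (rule continuous_on_subset) auto
  hence "compact ((\<lambda>t. N (S t x)) ` {0..1})" by (rule compact_continuous_image) simp
  hence "bounded ((\<lambda>t. N (S t x)) ` {0..1})" by (rule compact_imp_bounded)
  then obtain B where B: "\<forall>t\<in>{0..1}. norm (N (S t x)) \<le> B" unfolding bounded_iff by blast
  have "N (S t x) \<le> B" if "t \<in> {0..1}" for t using bspec[OF B that] by simp
  thus "\<exists>B. \<forall>t\<in>{0..1}. N (S t x) \<le> B" by blast
 qed (use S in \<open>auto simp: C0_semigroup_def\<close>)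
 thus ?thesis using that by fastforce
qed

lemma generator_X: "(f, g) \<in> generator S ==> f \<in> X" "(f, g) \<in> generator S ==> g \<in> X"
 by (auto simp: generator_def)

lemma generator_seq:
 assumes "(f, g) \<in> generator S" "t > 0"
 shows "(\<lambda>n. N ((1 / (t / real (Suc n))) *\<^sub>R (f - S (t / real (Suc n)) f) - g)) \<longlonglongrightarrow> 0"
proof -
 have "filterlim (\<lambda>n. t / real (Suc n)) (at_right 0) sequentially"
  unfolding filterlim_at
 proof
  show "(\<lambda>n. t / real (Suc n)) \<longlonglongrightarrow> 0"
   using tendsto_mult_right_zero[OF LIMSEQ_inverse_real_of_nat, of t] by (simp add: divide_inverse)
 qed (use assms in \<open>auto intro: always_eventually\<close>)
 moreover have "((\<lambda>t. N ((1 / t) *\<^sub>R (f - S t f) - g)) \<longlongrightarrow> 0) (at_right 0)"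
  using assms(1) by (auto simp: generator_def)
 ultimately show ?thesis by (rule filterlim_compose[rotated])
qed

lemma generator_diff:
 assumes S: "C0_semigroup S" and fg: "(f, g) \<in> generator S" and uw: "(u, w) \<in> generator S"
 shows "(f - u, g - w) \<in> generator S"
proof -
 note X = generator_X[OF fg] generator_X[OF uw]
 have lim: "((\<lambda>t. N ((1 / t) *\<^sub>R (f - S t f) - g) + N ((1 / t) *\<^sub>R (u - S t u) - w)) \<longlongrightarrow> 0) (at_right 0)"
  using fg uw by (auto simp: generator_def intro: tendsto_add_zero)
 have "norm (N ((1 / t) *\<^sub>R (f - u - S t (f - u)) - (g - w)))
   \<le> N ((1 / t) *\<^sub>R (f - S t f) - g) + N ((1 / t) *\<^sub>R (u - S t u) - w)" if t: "t > 0" for t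
 proof -
  note L = C0_semigroupD(1)[OF S less_imp_le[OF t]]
  have SX: "S t f \<in> X" "S t u \<in> X" "S t (f - u) \<in> X" using linD(1)[OF L] X by auto
  have eq: "(1 / t) *\<^sub>R (f - u - S t (f - u)) - (g - w) = (-1/t) *\<^sub>R (S t (f - u) - (S t f - S t u)) +
    (((1 / t) *\<^sub>R (f - S t f) - g) - ((1 / t) *\<^sub>R (u - S t u) - w))"
   by (simp add: algebra_simps)
  have "N ((1 / t) *\<^sub>R (f - u - S t (f - u)) - (g - w)) \<le> N ((-1/t) *\<^sub>R (S t (f - u) - (S t f - S t u))) +
    (N ((1 / t) *\<^sub>R (f - S t f) - g) + N ((1 / t) *\<^sub>R (u - S t u) - w))"
   unfolding eq using X SX by (intro order_trans[OF N_add] add_left_mono N_diff) auto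
  also have "N ((-1/t) *\<^sub>R (S t (f - u) - (S t f - S t u))) = 0"
   using N_scale[of "S t (f - u) - (S t f - S t u)" "-1/t"] lin_diff0[OF L, of f u] X SX by simp
  finally show ?thesis using N_nonneg[of "(1 / t) *\<^sub>R (f - u - S t (f - u)) - (g - w)"] X SX by simp
 qed
 hence "eventually (\<lambda>t. norm (N ((1 / t) *\<^sub>R (f - u - S t (f - u)) - (g - w)))
   \<le> N ((1 / t) *\<^sub>R (f - S t f) - g) + N ((1 / t) *\<^sub>R (u - S t u) - w)) (at_right 0)"
  by (intro eventually_at_rightI[of 0 1]) auto
 from Lim_null_comparison[OF this lim] X show ?thesis by (simp add: generator_def)
qed

text \<open>Splitting \<open>[0, t]\<close> into \<open>n\<close> equal steps bounds \<open>f - S t f\<close> by \<open>M t\<close> times the difference quotient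
  over one step, which tends to the generator. This is a discrete form of
  integrating the derivative of the orbit.\<close>

lemma generator_lipschitz:
 assumes S: "C0_semigroup S" and M: "M \<ge> 0" "\<And>t x. 0 \<le> t ==> t \<le> 1 ==> x \<in> X ==> N (S t x) \<le> M * N x"
  and fg: "(f, g) \<in> generator S" and t: "0 < t" "t \<le> 1"
 shows "N (f - S t f) \<le> M * t * N g"
proof -
 note X = generator_X[OF fg]
 have SX: "S s x \<in> X" if "s \<ge> 0" "x \<in> X" for s x using linD(1)[OF C0_semigroupD(1)[OF S that(1)] that(2)] .
 have step: "N (f - S (real k * h) f) \<le> real k * (M * N (f - S h f))" if "h \<ge> 0" "real k * h \<le> 1" for k h
  using that
 proof (induction k)
  case 0
  thus ?case using C0_semigroupD(2)[OF S X(1)] N_commute[of "S 0 f" f] SX X by simp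
 next
  case (Suc k)
  have kh: "0 \<le> real k * h" "real k * h \<le> 1" using Suc.prems by (auto simp: algebra_simps)
  have "N (f - S (real k * h + h) f) \<le> N (f - S (real k * h) f) + (N (S (real k * h) f - S (real k * h) (S h f)) + N (S (real k * h) (S h f) - S (real k * h + h) f))"
   using X SX kh Suc.prems
   by (intro order_trans[OF N_triangle[of _ "S (real k * h) f"]] add_left_mono N_triangle) auto
  moreover have "N (S (real k * h) (S h f) - S (real k * h + h) f) = 0"
   using C0_semigroupD(3)[OF S kh(1) Suc.prems(1) X(1)] N_commute[of "S (real k * h) (S h f)" "S (real k * h + h) f"] SX X kh Suc.prems by simp
  moreover have "N (S (real k * h) f - S (real k * h) (S h f)) \<le> M * N (f - S h f)"
   using lin_diff[OF C0_semigroupD(1)[OF S kh(1)], of f "S h f"] M(2)[OF kh, of "f - S h f"] X SX Suc.prems by simp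
  ultimately show ?case using Suc.IH[OF Suc.prems(1) kh(2)] by (simp add: algebra_simps)
 qed
 define q where "q n = (1 / (t / real (Suc n))) *\<^sub>R (f - S (t / real (Suc n)) f)" for n
 have qX: "q n \<in> X" for n using X SX t by (auto simp: q_def)
 have "N (f - S t f) \<le> M * t * N (q n)" for n
 proof -
  have "N (f - S t f) \<le> real (Suc n) * (M * N (f - S (t / real (Suc n)) f))"
   using step[of "t / real (Suc n)" "Suc n"] t by simp
  also have "N (f - S (t / real (Suc n)) f) = t / real (Suc n) * N (q n)"
   using N_scale[of "f - S (t / real (Suc n)) f" "1 / (t / real (Suc n))"] X SX t by (simp add: q_def)
  also have "real (Suc n) * (M * (t / real (Suc n) * N (q n))) = M * t * N (q n)" by (simp del: of_nat_Suc)
  finally show ?thesis .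
 qed
 moreover have "(\<lambda>n. M * t * N (q n)) \<longlonglongrightarrow> M * t * N g"
  using limit_norm[OF qX X(2)] generator_seq[OF fg t(1)] by (intro tendsto_mult_left) (simp add: q_def)
 ultimately show ?thesis by (intro LIMSEQ_le_const) auto
qed

text \<open>An eigenvector of the generator is an eigenvector of the semigroup, so that the operator norm
  at time one bounds the exponential of the eigenvalue.\<close>

lemma generator_eigenvector:
 assumes S: "C0_semigroup S" and M: "M \<ge> 0" "\<And>t x. 0 \<le> t ==> t \<le> 1 ==> x \<in> X ==> N (S t x) \<le> M * N x"
  and fg: "(f, g) \<in> generator S" and ev: "N (g + c *\<^sub>R f) = 0" and c: "c \<ge> 0"
 shows "N (S 1 f - exp c *\<^sub>R f) = 0"
proof -
 note X = generator_X[OF fg]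
 have SX: "S s x \<in> X" if "s \<ge> 0" "x \<in> X" for s x using linD(1)[OF C0_semigroupD(1)[OF S that(1)] that(2)] .
 have step: "N (S (real k * h) f - exp (c * (real k * h)) *\<^sub>R f) \<le> real k * (M * N (S h f - exp (c * h) *\<^sub>R f)) * exp (c * (real k * h))"
  if "h \<ge> 0" "real k * h \<le> 1" for k h
  using that
 proof (induction k)
  case 0
  thus ?case using C0_semigroupD(2)[OF S X(1)] by simp
 next
  case (Suc k)
  define d where "d = N (S h f - exp (c * h) *\<^sub>R f)"
  have d: "d \<ge> 0" unfolding d_def using SX X Suc.prems by (intro N_nonneg) auto
  define a where "a = real k * h"
  have a: "0 \<le> a" "a \<le> 1" using Suc.prems by (auto simp: algebra_simps a_def)
  note L = C0_semigroupD(1)[OF S a(1)]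
  have X': "S a f \<in> X" "S h f \<in> X" "S a (S h f) \<in> X" "S (a + h) f \<in> X" "S a (exp (c * h) *\<^sub>R f) \<in> X" using SX X a Suc.prems by auto
  have eq: "S (a + h) f - exp (c * (a + h)) *\<^sub>R f = (S (a + h) f - S a (S h f)) + ((S a (S h f) - S a (exp (c * h) *\<^sub>R f))
     + ((S a (exp (c * h) *\<^sub>R f) - exp (c * h) *\<^sub>R S a f) + exp (c * h) *\<^sub>R (S a f - exp (c * a) *\<^sub>R f)))"
   by (simp add: algebra_simps exp_add)
  have "N (S (a + h) f - exp (c * (a + h)) *\<^sub>R f) \<le> N (S (a + h) f - S a (S h f)) + (N (S a (S h f) - S a (exp (c * h) *\<^sub>R f))
     + (N (S a (exp (c * h) *\<^sub>R f) - exp (c * h) *\<^sub>R S a f) + N (exp (c * h) *\<^sub>R (S a f - exp (c * a) *\<^sub>R f))))"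
   unfolding eq using X X' by (intro order_trans[OF N_add] add_left_mono N_add; simp)
  also have "N (S (a + h) f - S a (S h f)) = 0" using C0_semigroupD(3)[OF S a(1) _ X(1)] Suc.prems by simp
  also have "N (S a (exp (c * h) *\<^sub>R f) - exp (c * h) *\<^sub>R S a f) = 0" using linD(3)[OF L X(1)] .
  also have "N (exp (c * h) *\<^sub>R (S a f - exp (c * a) *\<^sub>R f)) = exp (c * h) * N (S a f - exp (c * a) *\<^sub>R f)"
   using N_scale[of "S a f - exp (c * a) *\<^sub>R f" "exp (c * h)"] X X' by simp
  also have "N (S a (S h f) - S a (exp (c * h) *\<^sub>R f)) \<le> M * d"
   using lin_diff[OF L, of "S h f" "exp (c * h) *\<^sub>R f"] M(2)[OF a, of "S h f - exp (c * h) *\<^sub>R f"] X X' by (simp add: d_def)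
  also have "exp (c * h) * N (S a f - exp (c * a) *\<^sub>R f) \<le> exp (c * h) * (real k * (M * d) * exp (c * a))"
   using Suc.IH a Suc.prems by (intro mult_left_mono) (auto simp: a_def d_def)
  also have "exp (c * h) * (real k * (M * d) * exp (c * a)) = real k * (M * d) * exp (c * (a + h))"
   by (simp add: exp_add algebra_simps)
  also have "0 + (M * d + (0 + real k * (M * d) * exp (c * (a + h)))) \<le> real (Suc k) * (M * d) * exp (c * (a + h))"
  proof -
   have "M * d * 1 \<le> M * d * exp (c * (a + h))" using M d c a Suc.prems by (intro mult_left_mono) auto
   thus ?thesis by (simp add: algebra_simps)
  qed
  finally show ?case by (simp add: a_def d_def algebra_simps)
 qed
 define h where "h n = 1 / real (Suc n)" for n
 have h: "h n > 0" for n by (simp add: h_def)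
 have h0: "filterlim h (at 0) sequentially"
  unfolding filterlim_at h_def using LIMSEQ_inverse_real_of_nat by (auto simp: divide_inverse)
 define q where "q n = (1 / h n) *\<^sub>R (f - S (h n) f)" for n
 define r where "r n = (exp (c * h n) - 1) / h n - c" for n
 have qX: "q n \<in> X" for n using X SX h[of n] by (auto simp: q_def)
 have "((\<lambda>x. exp (c * x)) has_real_derivative exp (c * 0) * c) (at 0)"
  by (auto intro!: derivative_eq_intros)
 hence "(\<lambda>x. (exp (c * x) - 1) / x) \<midarrow>0\<rightarrow> c" by (simp add: has_field_derivative_def has_derivative_at2 DERIV_def field_has_derivative_at flip: has_field_derivative_def)
 from tendsto_diff[OF filterlim_compose[OF this h0] tendsto_const, of c] have r0: "r \<longlonglongrightarrow> 0" by (simp add: r_def[abs_def])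
 have q0: "(\<lambda>n. N (q n - g)) \<longlonglongrightarrow> 0" using generator_seq[OF fg, of 1] by (simp add: q_def h_def)
 have bound: "N (S 1 f - exp c *\<^sub>R f) \<le> M * exp c * (N (q n - g) + \<bar>r n\<bar> * N f)" for n
 proof -
  have "N (S 1 f - exp c *\<^sub>R f) \<le> real (Suc n) * (M * N (S (h n) f - exp (c * h n) *\<^sub>R f)) * exp c"
   using step[of "h n" "Suc n"] by (simp add: h_def)
  also have "S (h n) f - exp (c * h n) *\<^sub>R f = (- h n) *\<^sub>R ((q n - g) + ((g + c *\<^sub>R f) + r n *\<^sub>R f))"
  proof -
   have "h n *\<^sub>R q n = f - S (h n) f" using h[of n] by (simp add: q_def)
   moreover have "h n * r n = exp (c * h n) - 1 - c * h n" using h[of n] by (simp add: r_def field_simps)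
   ultimately show ?thesis by (simp add: scaleR_add_right scaleR_diff_right) (simp add: algebra_simps)
  qed
  also have "N \<dots> \<le> h n * (N (q n - g) + (N (g + c *\<^sub>R f) + \<bar>r n\<bar> * N f))"
   using h[of n] X qX N_scale[of "(q n - g) + ((g + c *\<^sub>R f) + r n *\<^sub>R f)" "- h n"]
    N_add[of "q n - g" "(g + c *\<^sub>R f) + r n *\<^sub>R f"] N_add[of "g + c *\<^sub>R f" "r n *\<^sub>R f"] N_scale[of f "r n"] by simp
  finally have "N (S 1 f - exp c *\<^sub>R f) \<le> real (Suc n) * (M * (h n * (N (q n - g) + (N (g + c *\<^sub>R f) + \<bar>r n\<bar> * N f)))) * exp c"
   using M by (simp add: mult_left_mono mult_right_mono)
  also have "\<dots> = M * exp c * (N (q n - g) + \<bar>r n\<bar> * N f)" by (simp add: h_def ev del: of_nat_Suc)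
  finally show ?thesis .
 qed
 have "(\<lambda>n. M * exp c * (N (q n - g) + \<bar>r n\<bar> * N f)) \<longlonglongrightarrow> M * exp c * (0 + \<bar>0\<bar> * N f)"
  by (intro tendsto_intros q0 r0)
 with bound have "N (S 1 f - exp c *\<^sub>R f) \<le> M * exp c * (0 + \<bar>0\<bar> * N f)" by (intro LIMSEQ_le_const) auto
 thus ?thesis using N_nonneg[of "S 1 f - exp c *\<^sub>R f"] SX X by simp
qed

end

section \<open>Closures of accretive relations generate semigroups\<close>

text \<open>Properties that make a relation \<open>H\<close> a core of the generator of a contraction semigroup: up to
  seminorm zero it is a densely defined linear accretive operator, and \<open>1 + h H\<close> has dense range for
  all \<open>h > 0\<close>.\<close>

locale dissipative_core = complete_seminorm X N for X :: "'v::real_vector set" and N +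
 fixes H :: "('v \<times> 'v) set"
 assumes H_X: "(x, y) \<in> H ==> x \<in> X \<and> y \<in> X"
  and H_lin: "(x, y) \<in> H ==> (x', y') \<in> H ==>
     \<exists>z. (a *\<^sub>R x + b *\<^sub>R x', z) \<in> H \<and> N (z - (a *\<^sub>R y + b *\<^sub>R y')) = 0"
  and H_accretive: "(x, y) \<in> H ==> h > 0 ==> N x \<le> N (x + h *\<^sub>R y)"
  and H_domain: "f \<in> X ==> e > 0 ==> \<exists>(x, y)\<in>H. N (f - x) < e"
  and H_range: "f \<in> X ==> e > 0 ==> h > 0 ==> \<exists>(x, y)\<in>H. N (f - (x + h *\<^sub>R y)) < e"
begin

text \<open>The closure of \<open>H\<close>.\<close>

definition A :: "('v \<times> 'v) set" where
 "A = {(f, g). f \<in> X \<and> g \<in> X \<and> (\<forall>e>0. \<exists>(x, y)\<in>H. N (f - x) < e \<and> N (g - y) < e)}"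

lemma A_X: "(f, g) \<in> A ==> f \<in> X" "(f, g) \<in> A ==> g \<in> X"
 by (auto simp: A_def)

lemma H_A: "H \<subseteq> A"
 using H_X by (force simp: A_def)

lemma A_closed:
 assumes "f \<in> X" "g \<in> X" "\<And>e. e > 0 ==> \<exists>(x, y)\<in>A. N (f - x) < e \<and> N (g - y) < e"
 shows "(f, g) \<in> A"
 unfolding A_def
proof (clarsimp simp: assms(1,2))
 fix e :: real assume "e > 0"
 then obtain x y where xy: "(x, y) \<in> A" "N (f - x) < e/2" "N (g - y) < e/2"
  using assms(3)[of "e/2"] by auto
 moreover from \<open>e > 0\<close> xy obtain x' y' where xy': "(x', y') \<in> H" "N (x - x') < e/2" "N (y - y') < e/2"
  unfolding A_def using half_gt_zero by blast
 moreover have "x \<in> X" "y \<in> X" "x' \<in> X" "y' \<in> X" using A_X xy H_X xy' by auto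
 ultimately show "\<exists>(x, y)\<in>H. N (f - x) < e \<and> N (g - y) < e"
  using N_triangle[of f x x'] N_triangle[of g y y'] assms(1,2)
  by (intro bexI[of _ "(x', y')"]) auto
qed

lemma A_cong:
 assumes "(f, g) \<in> A" "f' \<in> X" "g' \<in> X" "N (f' - f) = 0" "N (g' - g) = 0"
 shows "(f', g') \<in> A"
 by (rule A_closed, fact, fact) (use assms in \<open>auto intro!: bexI[of _ "(f, g)"]\<close>)

lemma A_lim:
 assumes "\<And>n::nat. (u n, w n) \<in> A" "f \<in> X" "g \<in> X"
  "(\<lambda>n. N (u n - f)) \<longlonglongrightarrow> 0" "(\<lambda>n. N (w n - g)) \<longlonglongrightarrow> 0"
 shows "(f, g) \<in> A"
proof (rule A_closed[OF assms(2,3)])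
 fix e :: real assume "e > 0"
 have "eventually (\<lambda>n. N (u n - f) < e \<and> N (w n - g) < e) sequentially"
  using order_tendstoD(2)[OF assms(4) \<open>e > 0\<close>] order_tendstoD(2)[OF assms(5) \<open>e > 0\<close>]
  by eventually_elim auto
 then obtain n where "N (u n - f) < e" "N (w n - g) < e"
  by (auto simp: eventually_sequentially)
 thus "\<exists>(x, y)\<in>A. N (f - x) < e \<and> N (g - y) < e"
  using assms(1)[of n] A_X[OF assms(1)[of n]] N_commute assms(2,3)
  by (intro bexI[of _ "(u n, w n)"]) auto
qed

lemma A_comb:
 assumes "(f, g) \<in> A" "(f', g') \<in> A"
 shows "(a *\<^sub>R f + b *\<^sub>R f', a *\<^sub>R g + b *\<^sub>R g') \<in> A"
proof (rule A_closed)
 note X = A_X[OF assms(1)] A_X[OF assms(2)]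
 show "a *\<^sub>R f + b *\<^sub>R f' \<in> X" "a *\<^sub>R g + b *\<^sub>R g' \<in> X" using X by auto
 fix e :: real assume e: "e > 0"
 define d where "d = e / (\<bar>a\<bar> + \<bar>b\<bar> + 1)"
 have d: "d > 0" "\<bar>a\<bar> * d + \<bar>b\<bar> * d < e"
  using e by (auto simp: d_def field_simps add_pos_nonneg add_nonneg_pos)
 obtain x y where xy: "(x, y) \<in> H" "N (f - x) < d" "N (g - y) < d"
  using assms(1) d(1) unfolding A_def by blast
 obtain x' y' where xy': "(x', y') \<in> H" "N (f' - x') < d" "N (g' - y') < d"
  using assms(2) d(1) unfolding A_def by blast
 obtain z where z: "(a *\<^sub>R x + b *\<^sub>R x', z) \<in> H" "N (z - (a *\<^sub>R y + b *\<^sub>R y')) = 0"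
  using H_lin[OF xy(1) xy'(1)] by blast
 have X': "x \<in> X" "y \<in> X" "x' \<in> X" "y' \<in> X" "z \<in> X" using H_X xy xy' z by auto
 have est: "N (a *\<^sub>R p + b *\<^sub>R p' - (a *\<^sub>R q + b *\<^sub>R q')) < e"
  if "p \<in> X" "p' \<in> X" "q \<in> X" "q' \<in> X" "N (p - q) < d" "N (p' - q') < d" for p p' q q'
 proof -
  have "a *\<^sub>R p + b *\<^sub>R p' - (a *\<^sub>R q + b *\<^sub>R q') = a *\<^sub>R (p - q) + b *\<^sub>R (p' - q')"
   by (simp add: algebra_simps)
  hence "N (a *\<^sub>R p + b *\<^sub>R p' - (a *\<^sub>R q + b *\<^sub>R q')) \<le> \<bar>a\<bar> * N (p - q) + \<bar>b\<bar> * N (p' - q')"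
   using N_add[of "a *\<^sub>R (p - q)" "b *\<^sub>R (p' - q')"] N_scale that by simp
  also have "\<dots> \<le> \<bar>a\<bar> * d + \<bar>b\<bar> * d"
   using that by (intro add_mono mult_left_mono) auto
  finally show ?thesis using d by simp
 qed
 have "N (a *\<^sub>R g + b *\<^sub>R g' - z) < e"
  using est[of g g' y y'] N_triangle[of "a *\<^sub>R g + b *\<^sub>R g'" "a *\<^sub>R y + b *\<^sub>R y'" z] z(2)
   N_commute[of z "a *\<^sub>R y + b *\<^sub>R y'"] X X' xy xy' by auto
 thus "\<exists>(x, y)\<in>A. N (a *\<^sub>R f + b *\<^sub>R f' - x) < e \<and> N (a *\<^sub>R g + b *\<^sub>R g' - y) < e"
  using est[of f f' x x'] X X' xy xy' z(1) H_A by (intro bexI[of _ "(a *\<^sub>R x + b *\<^sub>R x', z)"]) auto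
qed

lemma A_add: "(f, g) \<in> A ==> (f', g') \<in> A ==> (f + f', g + g') \<in> A"
 and A_diff: "(f, g) \<in> A ==> (f', g') \<in> A ==> (f - f', g - g') \<in> A"
 and A_scale: "(f, g) \<in> A ==> (a *\<^sub>R f, a *\<^sub>R g) \<in> A"
 using A_comb[of f g f' g' 1 1] A_comb[of f g f' g' 1 "-1"] A_comb[of f g f g a 0] by simp_all

lemma A_accretive:
 assumes "(f, g) \<in> A" "h \<ge> 0" shows "N f \<le> N (f + h *\<^sub>R g)"
proof (cases "h = 0")
 case False
 hence h: "h > 0" using assms by simp
 show ?thesis
 proof (rule field_le_epsilon)
  fix e :: real assume e: "e > 0"
  define d where "d = e / (2 + h)"
  have d: "d > 0" "d * (2 + h) = e" using e h by (auto simp: d_def)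
  obtain x y where xy: "(x, y) \<in> H" "N (f - x) < d" "N (g - y) < d"
   using assms(1) d(1) unfolding A_def by blast
  have X: "f \<in> X" "g \<in> X" "x \<in> X" "y \<in> X" using A_X assms H_X xy by auto
  have "N f \<le> N x + N (f - x)" using N_le X by simp
  also have "N x \<le> N (x + h *\<^sub>R y)" using H_accretive xy h by simp
  also have "\<dots> \<le> N (f + h *\<^sub>R g) + N ((x - f) + h *\<^sub>R (y - g))"
   using N_le[of "x + h *\<^sub>R y" "f + h *\<^sub>R g"] X by (simp add: algebra_simps)
  also have "N ((x - f) + h *\<^sub>R (y - g)) \<le> N (f - x) + h * N (g - y)"
   using N_add[of "x - f" "h *\<^sub>R (y - g)"] N_scale[of "y - g" h] X h N_commute[of x f] N_commute[of y g]
   by simp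
  also have "N (f + h *\<^sub>R g) + (N (f - x) + h * N (g - y)) + N (f - x) \<le> N (f + h *\<^sub>R g) + (d + h * d) + d"
   using xy h by (intro add_mono mult_left_mono) auto
  finally show "N f \<le> N (f + h *\<^sub>R g) + e" using d by (simp add: algebra_simps)
 qed
qed simp

text \<open>Accretivity makes \<open>u + h w \<mapsto> u\<close> contractive, so approximate solutions with dense right-hand sides form
  a Cauchy sequence.\<close>

lemma A_range:
 assumes "f \<in> X" "h > 0"
 shows "\<exists>u w. (u, w) \<in> A \<and> u + h *\<^sub>R w = f"
proof -
 have "\<forall>n. \<exists>q. q \<in> H \<and> N (f - (fst q + h *\<^sub>R snd q)) < inverse (real (Suc n))"
 proof
  fix n show "\<exists>q. q \<in> H \<and> N (f - (fst q + h *\<^sub>R snd q)) < inverse (real (Suc n))"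
   using H_range[OF assms(1), of "inverse (real (Suc n))" h] assms by force
 qed
 then obtain q where q: "\<And>n. q n \<in> H" "\<And>n. N (f - (fst (q n) + h *\<^sub>R snd (q n))) < inverse (real (Suc n))"
  by metis
 define u w where "u n = fst (q n)" and "w n = snd (q n)" for n
 have uw: "(u n, w n) \<in> H" for n using q by (simp add: u_def w_def)
 hence uwA: "(u n, w n) \<in> A" for n using H_A by blast
 have X: "u n \<in> X" "w n \<in> X" for n using H_X uw by auto
 define r where "r n = u n + h *\<^sub>R w n" for n
 have rX: "r n \<in> X" for n using X by (simp add: r_def)
 have r: "N (f - r n) < inverse (real (Suc n))" for n using q by (simp add: r_def u_def w_def)
 have r0: "(\<lambda>n. N (r n - f)) \<longlonglongrightarrow> 0"
  by (rule tendsto_sandwich[OF _ _ tendsto_const LIMSEQ_inverse_real_of_nat])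
    (use r rX N_nonneg N_commute assms in \<open>auto intro!: always_eventually less_imp_le\<close>)
 have le: "N (u m - u n) \<le> N (r m - r n)" for m n
  using A_accretive[OF A_diff[OF uwA[of m] uwA[of n]], of h] assms
  by (simp add: r_def algebra_simps)
 have "\<exists>u'\<in>X. (\<lambda>n. N (u n - u')) \<longlonglongrightarrow> 0"
 proof (rule N_complete)
  fix e :: real assume e: "e > 0"
  obtain M where M: "\<And>n. n \<ge> M ==> N (r n - f) < e/2"
   using order_tendstoD(2)[OF r0, of "e/2"] e by (auto simp: eventually_sequentially)
  show "\<exists>M. \<forall>m\<ge>M. \<forall>n\<ge>M. N (u m - u n) < e"
  proof (intro exI[of _ M] allI impI)
   fix m n assume "m \<ge> M" "n \<ge> M"
   thus "N (u m - u n) < e"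
    using le[of m n] N_triangle[of "r m" f "r n"] M[of m] M[of n] N_commute[of f "r n"] rX assms by simp
  qed
 qed (simp add: X)
 then obtain u' where u': "u' \<in> X" "(\<lambda>n. N (u n - u')) \<longlonglongrightarrow> 0" by blast
 define w' where "w' = (1/h) *\<^sub>R (f - u')"
 have "N (w n - w') \<le> (1/h) * (N (r n - f) + N (u n - u'))" for n
 proof -
  have "w n - w' = (1/h) *\<^sub>R ((r n - f) - (u n - u'))"
   using assms by (simp add: w'_def r_def algebra_simps)
  thus ?thesis
   using N_scale[of "(r n - f) - (u n - u')" "1/h"] N_diff[of "r n - f" "u n - u'"] rX X u' assms
   by (simp add: divide_right_mono)
 qed
 moreover have "(\<lambda>n. (1/h) * (N (r n - f) + N (u n - u'))) \<longlonglongrightarrow> 0"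
  by (intro tendsto_mult_right_zero tendsto_add_zero r0 u'(2))
 ultimately have "(\<lambda>n. N (w n - w')) \<longlonglongrightarrow> 0"
  by - (rule null_le, assumption, use X u' assms N_nonneg in \<open>auto simp: w'_def\<close>)
 hence "(u', w') \<in> A"
  using u' assms by (intro A_lim[OF uwA]) (auto simp: w'_def)
 thus ?thesis using assms by (intro exI[of _ u'] exI[of _ w']) (simp add: w'_def)
qed

text \<open>The resolvent \<open>(1 + h A)\<^sup>-\<^sup>1\<close>. The convention for \<open>h = 0\<close> makes it the identity, so that estimates
  hold uniformly for \<open>h \<ge> 0\<close>.\<close>

definition J :: "real => 'v => 'v" where
 "J h f = (if h > 0 then SOME u. \<exists>w. (u, w) \<in> A \<and> u + h *\<^sub>R w = f else f)"

lemma J_ex: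
 assumes "f \<in> X" "h > 0"
 obtains w where "(J h f, w) \<in> A" "J h f + h *\<^sub>R w = f"
 using someI_ex[OF A_range[OF assms]] assms(2) unfolding J_def by auto

lemma J_X [simp, intro]: "f \<in> X ==> J h f \<in> X"
 by (cases "h > 0") (auto simp: J_def[of h] intro: J_ex[of f h] A_X elim!: J_ex[of f h, unfolded J_def])

lemma J_approx:
 assumes "(u, w) \<in> A" "f \<in> X" "h \<ge> 0"
 shows "N (J h f - u) \<le> N (f - (u + h *\<^sub>R w))"
proof (cases "h = 0")
 case False
 then obtain v where v: "(J h f, v) \<in> A" "J h f + h *\<^sub>R v = f" using J_ex[of f h] assms by auto
 show ?thesis
  using A_accretive[OF A_diff[OF v(1) assms(1)], of h] assms v(2) by (auto simp: algebra_simps)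
qed (simp add: J_def)

lemma J_A:
 assumes "(f, g) \<in> A" "h \<ge> 0"
 shows "(J h f, J h g) \<in> A" "N (f - (J h f + h *\<^sub>R J h g)) = 0"
proof -
 note X = A_X[OF assms(1)]
 have "(J h f, J h g) \<in> A \<and> N (f - (J h f + h *\<^sub>R J h g)) = 0"
 proof (cases "h = 0")
  case False
  hence h: "h > 0" using assms by simp
  obtain w where w: "(J h f, w) \<in> A" "J h f + h *\<^sub>R w = f" using J_ex[of f h] X h by auto
  have wX: "w \<in> X" using w A_X by auto
  have "((1/h) *\<^sub>R (f - J h f), (1/h) *\<^sub>R (g - w)) \<in> A"
   using A_scale[OF A_diff[OF assms(1) w(1)]] .
  moreover have "(1/h) *\<^sub>R (f - J h f) = w" using w(2) h
   by (metis add_diff_cancel_left' divide_self_if less_irrefl scaleR_one scaleR_scaleR times_divide_eq_left mult_1)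
  ultimately have "(w, (1/h) *\<^sub>R (g - w)) \<in> A" by simp
  from J_approx[OF this, of g h] h X have "N (J h g - w) \<le> 0" by simp
  hence e: "N (J h g - w) = 0" using N_nonneg[of "J h g - w"] X wX by simp
  have "f - (J h f + h *\<^sub>R J h g) = (J h f + h *\<^sub>R w) - (J h f + h *\<^sub>R J h g)" using w by simp
  also have "\<dots> = (-h) *\<^sub>R (J h g - w)" by (simp add: algebra_simps)
  finally have "N (f - (J h f + h *\<^sub>R J h g)) = \<bar>-h\<bar> * N (J h g - w)"
   using N_scale[of "J h g - w" "-h"] X wX by simp
  thus ?thesis using e X wX by (auto intro: A_cong[OF w(1)])
 qed (use assms in \<open>simp add: J_def\<close>)
 thus "(J h f, J h g) \<in> A" "N (f - (J h f + h *\<^sub>R J h g)) = 0" by auto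
qed

lemma J_A':
 assumes "f \<in> X" "h > 0"
 shows "(J h f, (1/h) *\<^sub>R (f - J h f)) \<in> A"
proof -
 obtain w where w: "(J h f, w) \<in> A" "J h f + h *\<^sub>R w = f" using J_ex[of f h] assms by auto
 have "(1/h) *\<^sub>R (f - J h f) = w" using w(2) assms
  by (metis add_diff_cancel_left' divide_self_if less_irrefl scaleR_one scaleR_scaleR times_divide_eq_left mult_1)
 thus ?thesis using w by simp
qed

lemma J_contr_diff:
 assumes "f \<in> X" "g \<in> X" "h \<ge> 0"
 shows "N (J h f - J h g) \<le> N (f - g)"
proof (cases "h = 0")
 case False
 then obtain w where w: "(J h g, w) \<in> A" "J h g + h *\<^sub>R w = g" using J_ex[of g h] assms by auto
 show ?thesis using J_approx[OF w(1) assms(1,3)] w(2) by simp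
qed (simp add: J_def)

lemma J_lin: assumes h: "h \<ge> 0" shows "lin (J h)"
proof (cases "h = 0")
 case False
 have "N (J h (x + y) - (J h x + J h y)) = 0" if X: "x \<in> X" "y \<in> X" for x y
 proof -
  obtain w where w: "(J h x, w) \<in> A" "J h x + h *\<^sub>R w = x" using J_ex[of x h] X h False by auto
  obtain v where v: "(J h y, v) \<in> A" "J h y + h *\<^sub>R v = y" using J_ex[of y h] X h False by auto
  have "x + y - (J h x + J h y + h *\<^sub>R (w + v)) = (x - (J h x + h *\<^sub>R w)) + (y - (J h y + h *\<^sub>R v))"
   by (simp add: algebra_simps)
  hence z: "N (x + y - (J h x + J h y + h *\<^sub>R (w + v))) = 0" using w(2) v(2) by simp
  show ?thesis
   using J_approx[OF A_add[OF w(1) v(1)] X_add[OF X] h] X N_nonneg[of "J h (x + y) - (J h x + J h y)"]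
   unfolding z by simp
 qed
 moreover have "N (J h (a *\<^sub>R x) - a *\<^sub>R J h x) = 0" if X: "x \<in> X" for a x
 proof -
  obtain w where w: "(J h x, w) \<in> A" "J h x + h *\<^sub>R w = x" using J_ex[of x h] X h False by auto
  have "a *\<^sub>R x - (a *\<^sub>R J h x + h *\<^sub>R (a *\<^sub>R w)) = a *\<^sub>R (x - (J h x + h *\<^sub>R w))"
   by (simp add: algebra_simps)
  hence z: "N (a *\<^sub>R x - (a *\<^sub>R J h x + h *\<^sub>R (a *\<^sub>R w))) = 0" using w(2) by simp
  show ?thesis
   using J_approx[OF A_scale[OF w(1), of a] X_scale[OF X, of a] h] X N_nonneg[of "J h (a *\<^sub>R x) - a *\<^sub>R J h x"]
   unfolding z by simp
 qed
 ultimately show ?thesis by (simp add: lin_def)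
qed (simp add: lin_def J_def)

lemma J_commute:
 assumes "f \<in> X" "s \<ge> 0" "t \<ge> 0"
 shows "N (J s (J t f) - J t (J s f)) = 0"
proof (cases "t = 0")
 case False
 then obtain w where w: "(J t f, w) \<in> A" "J t f + t *\<^sub>R w = f" using J_ex[of f t] assms by auto
 have X: "w \<in> X" using w A_X by auto
 note L = J_lin[OF assms(2)]
 have "N (J t (J s f) - J s (J t f)) \<le> N (J s f - (J s (J t f) + t *\<^sub>R J s w))"
  using J_approx[OF J_A(1)[OF w(1) assms(2)] _ assms(3)] assms by simp
 also have "\<dots> = N ((J s (J t f + t *\<^sub>R w) - (J s (J t f) + J s (t *\<^sub>R w))) + (J s (t *\<^sub>R w) - t *\<^sub>R J s w))"
  unfolding w(2) by (simp add: algebra_simps)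
 also have "\<dots> \<le> N (J s (J t f + t *\<^sub>R w) - (J s (J t f) + J s (t *\<^sub>R w))) + N (J s (t *\<^sub>R w) - t *\<^sub>R J s w)"
  using assms X by (intro N_add) auto
 also have "\<dots> = 0" using linD(2,3)[OF L] assms X by simp
 finally show ?thesis using N_nonneg[of "J s (J t f) - J t (J s f)"] N_commute[of "J s (J t f)" "J t (J s f)"] assms by simp
qed (simp add: J_def)

text \<open>Vectors in the domain of \<open>A\<^sup>2\<close>, with a quantitative bound. Since the resolvents are contractions
  that commute with \<open>A\<close>, these sets are invariant under all resolvents.\<close>

definition D2 :: "real => 'v set" where
 "D2 \<kappa> = {f. \<exists>g k. (f, g) \<in> A \<and> (g, k) \<in> A \<and> N k \<le> \<kappa>}"

lemma D2_X: "f \<in> D2 \<kappa> ==> f \<in> X" and D2_nonneg: "f \<in> D2 \<kappa> ==> 0 \<le> \<kappa>"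
 unfolding D2_def by (auto intro: A_X) (meson A_X(2) N_nonneg order_trans)

lemma J_contr: "f \<in> X ==> h \<ge> 0 ==> N (J h f) \<le> N f"
 using J_contr_diff[of f 0 h] lin_scale[OF J_lin, of h 0 0] J_X[of 0 h]
  N_abs_diff[of "J h f - J h 0" "J h f"] N_commute[of "J h f - J h 0" "J h f"] by simp

lemma J_D2: "f \<in> D2 \<kappa> ==> h \<ge> 0 ==> J h f \<in> D2 \<kappa>"
 unfolding D2_def using J_A(1) J_contr A_X by clarify (meson order_trans)

text \<open>Two backward Euler steps differ from one step of the total length only in second order.\<close>

lemma J_two_step:
 assumes f: "f \<in> D2 \<kappa>" and st: "s \<ge> 0" "t \<ge> 0"
 shows "N (J s (J t f) - J (s + t) f) \<le> s * t * \<kappa>"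
proof -
 obtain g k where gk: "(f, g) \<in> A" "(g, k) \<in> A" "N k \<le> \<kappa>" using f by (auto simp: D2_def)
 have X: "f \<in> X" "g \<in> X" "k \<in> X" using gk A_X by auto
 define v v1 v2 where "v = J (s + t) f" and "v1 = J (s + t) g" and "v2 = J (s + t) k"
 have v: "(v, v1) \<in> A" "(v1, v2) \<in> A" "N (f - (v + (s + t) *\<^sub>R v1)) = 0"
  unfolding v_def v1_def v2_def using J_A gk st by auto
 have vX: "v \<in> X" "v1 \<in> X" "v2 \<in> X" using X by (auto simp: v_def v1_def v2_def)
 have "N (J s (J t f) - v) \<le> N (J t f - (v + s *\<^sub>R v1))"
  using J_approx[OF v(1)] X st by simp
 also have "\<dots> \<le> N (f - (v + s *\<^sub>R v1 + t *\<^sub>R (v1 + s *\<^sub>R v2)))"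
  using J_approx[OF A_add[OF v(1) A_scale[OF v(2)]] X(1) st(2)] by simp
 also have "\<dots> = N ((f - (v + (s + t) *\<^sub>R v1)) - (s * t) *\<^sub>R v2)" by (simp add: algebra_simps)
 also have "\<dots> \<le> s * t * N v2"
  using N_diff[of "f - (v + (s + t) *\<^sub>R v1)" "(s * t) *\<^sub>R v2"] v(3) vX X st N_scale[of v2 "s * t"] by simp
 also have "\<dots> \<le> s * t * \<kappa>"
  using J_contr[OF X(3), of "s + t"] gk(3) st by (intro mult_left_mono) (auto simp: v2_def)
 finally show ?thesis by (simp add: v_def)
qed

lemma telescope:
 assumes "\<And>x. x \<in> X ==> P x \<in> X" "\<And>x. x \<in> E ==> Q x \<in> E" "E \<subseteq> X"
  "\<And>x y. x \<in> X ==> y \<in> X ==> N (P x - P y) \<le> N (x - y)"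
  "\<And>x. x \<in> E ==> N (P x - Q x) \<le> \<epsilon>" "x \<in> E"
 shows "N ((P ^^ n) x - (Q ^^ n) x) \<le> real n * \<epsilon>"
proof (induction n)
 case (Suc n)
 have P: "(P ^^ n) x \<in> X" for n using assms by (induction n) auto
 have Q: "(Q ^^ n) x \<in> E" for n using assms by (induction n) auto
 have QX: "(Q ^^ n) x \<in> X" for n using Q assms(3) by blast
 have "N (P ((P ^^ n) x) - Q ((Q ^^ n) x)) \<le> N (P ((P ^^ n) x) - P ((Q ^^ n) x)) + N (P ((Q ^^ n) x) - Q ((Q ^^ n) x))"
  using N_triangle[of "P ((P ^^ n) x)" "P ((Q ^^ n) x)" "Q ((Q ^^ n) x)"] P QX assms(1) QX[of "Suc n"] by auto
 also have "\<dots> \<le> real n * \<epsilon> + \<epsilon>"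
  using assms(4)[OF P QX, of n n] Suc assms(5)[OF Q, of n] by simp
 finally show ?case by (simp add: algebra_simps)
qed simp

text \<open>The backward Euler approximation of the semigroup with \<open>2\<^sup>k\<close> steps. Doubling the number of steps
  splits each step in two, so consecutive approximations differ by \<open>2\<^sup>k\<close> errors of size
  \<open>(t / 2\<^sup>k)\<^sup>2\<close>, which is a summable sequence.\<close>

definition T :: "nat => real => 'v => 'v" where
 "T k t = (J (t / 2 ^ k)) ^^ (2 ^ k)"

lemma J_pow_X [simp, intro]: "f \<in> X ==> (J h ^^ n) f \<in> X"
 by (induction n) auto

lemma J_pow_contr: "f \<in> X ==> g \<in> X ==> h \<ge> 0 ==> N ((J h ^^ n) f - (J h ^^ n) g) \<le> N (f - g)"
 by (induction n) (auto intro: order_trans[OF J_contr_diff])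

lemma J_pow_lin: assumes h: "h \<ge> 0" shows "lin (J h ^^ n)"
proof (induction n)
 case (Suc n)
 have "N (J h ((J h ^^ n) (x + y)) - (J h ((J h ^^ n) x) + J h ((J h ^^ n) y))) = 0" if X: "x \<in> X" "y \<in> X" for x y
 proof -
  have "N (J h ((J h ^^ n) (x + y)) - J h ((J h ^^ n) x + (J h ^^ n) y)) \<le> 0"
   using J_contr_diff[of "(J h ^^ n) (x + y)" "(J h ^^ n) x + (J h ^^ n) y" h] linD(2)[OF Suc, of x y] X h by simp
  thus ?thesis
   using N_triangle[of "J h ((J h ^^ n) (x + y))" "J h ((J h ^^ n) x + (J h ^^ n) y)" "J h ((J h ^^ n) x) + J h ((J h ^^ n) y)"]
    linD(2)[OF J_lin[OF h], of "(J h ^^ n) x" "(J h ^^ n) y"] X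
    N_nonneg[of "J h ((J h ^^ n) (x + y)) - (J h ((J h ^^ n) x) + J h ((J h ^^ n) y))"] by simp
 qed
 moreover have "N (J h ((J h ^^ n) (a *\<^sub>R x)) - a *\<^sub>R J h ((J h ^^ n) x)) = 0" if X: "x \<in> X" for a x
 proof -
  have "N (J h ((J h ^^ n) (a *\<^sub>R x)) - J h (a *\<^sub>R (J h ^^ n) x)) \<le> 0"
   using J_contr_diff[of "(J h ^^ n) (a *\<^sub>R x)" "a *\<^sub>R (J h ^^ n) x" h] linD(3)[OF Suc, of x a] X h by simp
  thus ?thesis
   using N_triangle[of "J h ((J h ^^ n) (a *\<^sub>R x))" "J h (a *\<^sub>R (J h ^^ n) x)" "a *\<^sub>R J h ((J h ^^ n) x)"]
    linD(3)[OF J_lin[OF h], of "(J h ^^ n) x" a] X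
    N_nonneg[of "J h ((J h ^^ n) (a *\<^sub>R x)) - a *\<^sub>R J h ((J h ^^ n) x)"] by simp
 qed
 ultimately show ?case by (simp add: lin_def)
qed (simp add: lin_def)

lemma T_X [simp, intro]: "f \<in> X ==> T k t f \<in> X"
 by (simp add: T_def)

lemma T_contr: "f \<in> X ==> g \<in> X ==> t \<ge> 0 ==> N (T k t f - T k t g) \<le> N (f - g)"
 unfolding T_def by (rule J_pow_contr) auto

lemma T_lin: "t \<ge> 0 ==> lin (T k t)"
 unfolding T_def by (rule J_pow_lin) auto

lemma T_step:
 assumes f: "f \<in> D2 \<kappa>" and t: "t \<ge> 0"
 shows "N (T (Suc k) t f - T k t f) \<le> t\<^sup>2 * \<kappa> * (1/2) ^ k / 4"
proof -
 define h where "h = t / 2 ^ k"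
 have h: "h \<ge> 0" "t / 2 ^ Suc k = h / 2" using t by (auto simp: h_def)
 have "T (Suc k) t f = ((J (h/2) \<circ> J (h/2)) ^^ (2 ^ k)) f"
  using funpow_mult[of "2^k" 2 "J (h/2)"] unfolding T_def h(2)
  by (simp add: numeral_2_eq_2 mult.commute comp_def)
 moreover have "N (((J (h/2) \<circ> J (h/2)) ^^ (2 ^ k)) f - (J h ^^ (2 ^ k)) f) \<le> real (2 ^ k) * (h/2 * (h/2) * \<kappa>)"
 proof (rule telescope[where E="D2 \<kappa>"])
  fix x assume x: "x \<in> D2 \<kappa>"
  show "N ((J (h/2) \<circ> J (h/2)) x - J h x) \<le> h/2 * (h/2) * \<kappa>"
   using J_two_step[OF x, of "h/2" "h/2"] h by simp
 next
  fix x y assume "x \<in> X" "y \<in> X"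
  thus "N ((J (h/2) \<circ> J (h/2)) x - (J (h/2) \<circ> J (h/2)) y) \<le> N (x - y)"
   using J_pow_contr[of x y "h/2" 2] h by (simp add: numeral_2_eq_2)
 qed (use f h D2_X J_D2 in auto)
 moreover have "real (2 ^ k) * (h/2 * (h/2) * \<kappa>) = t\<^sup>2 * \<kappa> * (1/2) ^ k / 4"
  by (simp add: h_def power2_eq_square field_simps)
 ultimately show ?thesis unfolding T_def[of k t] h_def[symmetric] by (simp only:)
qed

lemma T_diff:
 assumes f: "f \<in> D2 \<kappa>" and t: "t \<ge> 0" and mn: "m \<le> n"
 shows "N (T n t f - T m t f) \<le> t\<^sup>2 * \<kappa> / 2 * ((1/2) ^ m - (1/2) ^ n)"
 using mn
proof (induction n rule: dec_induct)
 case base thus ?case by simp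
next
 case (step n)
 have "N (T (Suc n) t f - T m t f) \<le> N (T (Suc n) t f - T n t f) + N (T n t f - T m t f)"
  using N_triangle[of "T (Suc n) t f" "T n t f" "T m t f"] D2_X[OF f] by auto
 also have "\<dots> \<le> t\<^sup>2 * \<kappa> * (1/2) ^ n / 4 + t\<^sup>2 * \<kappa> / 2 * ((1/2) ^ m - (1/2) ^ n)"
  using T_step[OF f t, of n] step by simp
 also have "\<dots> = t\<^sup>2 * \<kappa> / 2 * ((1/2) ^ m - (1/2) ^ Suc n)" by (simp add: field_simps)
 finally show ?case .
qed

lemma J_tendsto_id:
 assumes "f \<in> X" "e > 0"
 shows "\<exists>h0>0. \<forall>h. 0 < h \<and> h \<le> h0 \<longrightarrow> N (J h f - f) < e"
proof -
 obtain x y where xy: "(x, y) \<in> H" "N (f - x) < e/4" using H_domain[OF assms(1), of "e/4"] assms(2) by auto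
 have xyA: "(x, y) \<in> A" using xy H_A by auto
 have X: "x \<in> X" "y \<in> X" using A_X xyA by auto
 define h0 where "h0 = e / (4 * (N y + 1))"
 have h0: "h0 > 0" "h0 * N y \<le> e/4"
  using assms N_nonneg[OF X(2)] by (auto simp: h0_def field_simps)
 show ?thesis
 proof (intro exI[of _ h0] conjI h0 allI impI)
  fix h assume h: "0 < h \<and> h \<le> h0"
  have "N (J h x - x) \<le> N (x - (x + h *\<^sub>R y))" using J_approx[OF xyA, of x h] X h by simp
  also have "\<dots> = h * N y" using N_scale[of y "-h"] X h by (simp add: algebra_simps)
  also have "\<dots> \<le> e/4" using h h0 N_nonneg[OF X(2)] by (meson mult_right_mono order_trans)
  finally have a: "N (J h x - x) \<le> e/4" .
  have "N (J h f - f) \<le> N (J h f - J h x) + (N (J h x - x) + N (x - f))"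
   using N_triangle[of "J h f" "J h x" f] N_triangle[of "J h x" x f] X assms by auto
  also have "\<dots> < e" using a J_contr_diff[of f x h] xy N_commute[of x f] X assms h by simp
  finally show "N (J h f - f) < e" .
 qed
qed

text \<open>The closed relation is single-valued up to seminorm zero, because the resolvent of a vector
  that is related to zero is negligible.\<close>

lemma A_single_valued:
 assumes "(0, d) \<in> A" shows "N d = 0"
proof -
 have X: "d \<in> X" using A_X assms by blast
 have "N d \<le> 0 + e" if e: "e > 0" for e
 proof -
  obtain h where h: "h > 0" "N (J h d - d) < e" using J_tendsto_id[OF X e] by blast
  have "N (0 - (J h 0 + h *\<^sub>R J h d)) = 0" using J_A[OF assms, of h] h by auto
  moreover have "N (J h 0) = 0" using lin_scale[OF J_lin, of h 0 0] h by simp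
  moreover have "h *\<^sub>R J h d = - (0 - (J h 0 + h *\<^sub>R J h d)) - J h 0" by simp
  ultimately have "N (h *\<^sub>R J h d) \<le> 0"
   using N_diff[of "- (0 - (J h 0 + h *\<^sub>R J h d))" "J h 0"] N_scale[of "0 - (J h 0 + h *\<^sub>R J h d)" "-1"] X by simp
  hence "N (J h d) \<le> 0" using N_scale[of "J h d" h] X h by (simp add: mult_le_0_iff)
  thus ?thesis using h(2) N_le[OF X J_X[OF X, of h]] N_commute[OF X J_X[OF X, of h]] by linarith
 qed
 hence "N d \<le> 0" by (rule field_le_epsilon)
 thus ?thesis using N_nonneg[OF X] by simp
qed

lemma D2_approx:
 assumes fg: "(f, g) \<in> A" and e: "e > 0"
 obtains f' g' \<kappa> where "(f', g') \<in> A" "f' \<in> D2 \<kappa>" "N (f - f') < e" "N (g - g') < e"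
proof -
 note X = A_X[OF fg]
 obtain h1 where h1: "h1 > 0" "\<And>h. 0 < h ==> h \<le> h1 ==> N (J h f - f) < e"
  using J_tendsto_id[OF X(1) e] by auto
 obtain h2 where h2: "h2 > 0" "\<And>h. 0 < h ==> h \<le> h2 ==> N (J h g - g) < e"
  using J_tendsto_id[OF X(2) e] by auto
 define h where "h = min h1 h2"
 have h: "h > 0" "N (J h f - f) < e" "N (J h g - g) < e" using h1 h2 by (auto simp: h_def)
 have A: "(J h f, J h g) \<in> A" using J_A fg h by simp
 moreover have "J h f \<in> D2 (N ((1/h) *\<^sub>R (g - J h g)))"
  unfolding D2_def using A J_A'[OF X(2) h(1)] by blast
 ultimately show ?thesis using that[of "J h f" "J h g"] h X N_commute by auto
qed

lemma D2_dense:
 assumes "f \<in> X" "e > 0"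
 obtains f' \<kappa> where "f' \<in> D2 \<kappa>" "N (f - f') < e"
proof -
 obtain x y where xy: "(x, y) \<in> H" "N (f - x) < e/2" using H_domain[OF assms(1), of "e/2"] assms(2) by auto
 obtain f' g' \<kappa> where f': "(f', g') \<in> A" "f' \<in> D2 \<kappa>" "N (x - f') < e/2"
  using D2_approx[of x y "e/2"] xy H_A assms by (metis half_gt_zero subsetD)
 show ?thesis using that[OF f'(2)] f' xy N_triangle[of f x f'] assms H_X[OF xy(1)] A_X[OF f'(1)] by simp
qed

lemma T_converges:
 assumes f: "f \<in> X" and t: "t \<ge> 0"
 shows "\<exists>u\<in>X. (\<lambda>k. N (T k t f - u)) \<longlonglongrightarrow> 0"
proof (rule N_complete)
 fix e :: real assume e: "e > 0"
 obtain f' \<kappa> where f': "f' \<in> D2 \<kappa>" "N (f - f') < e/3" using D2_dense[OF f, of "e/3"] e by auto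
 note f'X = D2_X[OF f'(1)]
 have "(\<lambda>m. t\<^sup>2 * \<kappa> / 2 * (1/2) ^ m) \<longlonglongrightarrow> t\<^sup>2 * \<kappa> / 2 * 0"
  by (intro tendsto_intros LIMSEQ_realpow_zero) auto
 hence "eventually (\<lambda>m. t\<^sup>2 * \<kappa> / 2 * (1/2) ^ m < e/3) sequentially"
  using e by (intro order_tendstoD(2)[where y="t\<^sup>2 * \<kappa> / 2 * 0"]) auto
 then obtain M where M: "\<And>m. m \<ge> M ==> t\<^sup>2 * \<kappa> / 2 * (1/2) ^ m < e/3"
  by (auto simp: eventually_sequentially)
 have wlog: "N (T n t f - T m t f) < e" if "M \<le> m" "m \<le> n" for m n
 proof -
  have "t\<^sup>2 * \<kappa> / 2 * ((1/2) ^ m - (1/2) ^ n) \<le> t\<^sup>2 * \<kappa> / 2 * (1/2) ^ m"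
   using D2_nonneg[OF f'(1)] by (intro mult_left_mono) auto
  hence "N (T n t f' - T m t f') < e/3" using T_diff[OF f'(1) t that(2)] M[OF that(1)] by simp
  moreover have "N (T n t f - T m t f) \<le> N (T n t f - T n t f') + (N (T n t f' - T m t f') + N (T m t f' - T m t f))"
   using N_triangle[of "T n t f" "T n t f'" "T m t f"] N_triangle[of "T n t f'" "T m t f'" "T m t f"] f f'X by auto
  ultimately show ?thesis
   using T_contr[OF f f'X t, of n] T_contr[OF f'X f t, of m] f'(2) N_commute[OF f f'X] by simp
 qed
 show "\<exists>M. \<forall>m\<ge>M. \<forall>n\<ge>M. N (T m t f - T n t f) < e"
 proof (intro exI[of _ M] allI impI)
  fix m n assume "m \<ge> M" "n \<ge> M"
  thus "N (T m t f - T n t f) < e"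
   using wlog[of m n] wlog[of n m] N_commute[of "T m t f" "T n t f"] f by (cases "m \<le> n") auto
 qed
qed (use f in auto)

definition S :: "real => 'v => 'v" where
 "S t f = (SOME u. u \<in> X \<and> (\<lambda>k. N (T k t f - u)) \<longlonglongrightarrow> 0)"

lemma S_lim:
 assumes "f \<in> X" "t \<ge> 0"
 shows S_X: "S t f \<in> X" and S_tendsto: "(\<lambda>k. N (T k t f - S t f)) \<longlonglongrightarrow> 0"
proof -
 have "\<exists>u. u \<in> X \<and> (\<lambda>k. N (T k t f - u)) \<longlonglongrightarrow> 0" using T_converges[OF assms] by blast
 from someI_ex[OF this] show "S t f \<in> X" "(\<lambda>k. N (T k t f - S t f)) \<longlonglongrightarrow> 0" by (auto simp: S_def)
qed

lemma S_le:
 assumes "f \<in> X" "t \<ge> 0" "u \<in> X" "\<And>k. N (T k t f - u) \<le> b k" "b \<longlonglongrightarrow> c"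
 shows "N (S t f - u) \<le> c"
proof -
 have "(\<lambda>k. N (S t f - T k t f) + b k) \<longlonglongrightarrow> 0 + c"
  using S_tendsto[OF assms(1,2)] assms S_X[OF assms(1,2)] N_commute by (intro tendsto_add) auto
 moreover have "N (S t f - u) \<le> N (S t f - T k t f) + b k" for k
  using N_triangle[of "S t f" "T k t f" u] assms(1,3) assms(4)[of k] S_X[OF assms(1,2)] by auto
 ultimately show ?thesis by (auto intro: LIMSEQ_le_const)
qed

lemma S_contr: "f \<in> X ==> t \<ge> 0 ==> N (S t f) \<le> N f"
proof -
 assume f: "f \<in> X" and t: "t \<ge> 0"
 have "N (T k t f) \<le> N f" for k
  using T_contr[OF f X_0 t, of k] lin_scale[OF T_lin[OF t, of k], of 0 0] N_le[of "T k t f" "T k t 0"] f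
   by simp
 thus ?thesis using S_le[OF f t X_0, of "\<lambda>_. N f"] by simp
qed

lemma S_lin: assumes t: "t \<ge> 0" shows "lin (S t)"
proof -
 have "N (S t (x + y) - (S t x + S t y)) = 0" if X: "x \<in> X" "y \<in> X" for x y
 proof (rule limit_unique[where u="\<lambda>k. T k t (x + y)"])
  have "(\<lambda>k. N (T k t x - S t x) + N (T k t y - S t y)) \<longlonglongrightarrow> 0"
   using tendsto_add[OF S_tendsto[OF X(1) t] S_tendsto[OF X(2) t]] by simp
  moreover have "N (T k t (x + y) - (S t x + S t y)) \<le> N (T k t x - S t x) + N (T k t y - S t y)" for k
  proof -
   have "N (T k t (x + y) - (S t x + S t y)) \<le> N ((T k t x + T k t y) - (S t x + S t y))"
    using N_triangle[of "T k t (x + y)" "T k t x + T k t y" "S t x + S t y"]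
     linD(2)[OF T_lin[OF t], of x y k] X S_X t by auto
   also have "(T k t x + T k t y) - (S t x + S t y) = (T k t x - S t x) + (T k t y - S t y)" by simp
   finally show ?thesis using N_add[of "T k t x - S t x" "T k t y - S t y"] X S_X t by auto
  qed
  ultimately show "(\<lambda>k. N (T k t (x + y) - (S t x + S t y))) \<longlonglongrightarrow> 0"
   by (rule null_le) (use X S_X t N_nonneg in auto)
 qed (use X t S_X S_tendsto in auto)
 moreover have "N (S t (a *\<^sub>R x) - a *\<^sub>R S t x) = 0" if X: "x \<in> X" for a x
 proof (rule limit_unique[where u="\<lambda>k. T k t (a *\<^sub>R x)"])
  have "(\<lambda>k. \<bar>a\<bar> * N (T k t x - S t x)) \<longlonglongrightarrow> 0"
   by (rule tendsto_mult_right_zero[OF S_tendsto[OF X t]])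
  moreover have "N (T k t (a *\<^sub>R x) - a *\<^sub>R S t x) \<le> \<bar>a\<bar> * N (T k t x - S t x)" for k
  proof -
   have "N (T k t (a *\<^sub>R x) - a *\<^sub>R S t x) \<le> N (a *\<^sub>R T k t x - a *\<^sub>R S t x)"
    using N_triangle[of "T k t (a *\<^sub>R x)" "a *\<^sub>R T k t x" "a *\<^sub>R S t x"]
     linD(3)[OF T_lin[OF t], of x k a] X S_X t by auto
   also have "\<dots> = \<bar>a\<bar> * N (T k t x - S t x)"
    using N_scale[of "T k t x - S t x" a] X S_X t by (simp add: scaleR_diff_right)
   finally show ?thesis .
  qed
  ultimately show "(\<lambda>k. N (T k t (a *\<^sub>R x) - a *\<^sub>R S t x)) \<longlonglongrightarrow> 0"
   by (rule null_le) (use X S_X t N_nonneg in auto)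
 qed (use X t S_X S_tendsto in auto)
 ultimately show ?thesis using S_X t by (simp add: lin_def)
qed

lemma S_contr_diff: "f \<in> X ==> g \<in> X ==> t \<ge> 0 ==> N (S t f - S t g) \<le> N (f - g)"
 using lin_diff[OF S_lin, of t f g] S_contr[of "f - g" t] by simp

lemma S_0: "f \<in> X ==> N (S 0 f - f) = 0"
proof -
 assume f: "f \<in> X"
 have "((J 0) ^^ n) f = f" for n by (induction n) (auto simp: J_def)
 hence "T k 0 f = f" for k by (simp add: T_def)
 thus ?thesis using S_le[OF f order_refl f, of "\<lambda>_. 0" 0] N_nonneg[OF X_diff[OF S_X[OF f order_refl] f]] by simp
qed

lemma J_pow_commute:
 assumes f: "f \<in> X" and st: "s \<ge> 0" "t \<ge> 0"
 shows "N (((J s \<circ> J t) ^^ n) f - (J s ^^ n) ((J t ^^ n) f)) = 0"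
proof -
 have comm: "N (J t ((J s ^^ n) f) - (J s ^^ n) (J t f)) = 0" if f: "f \<in> X" for n f
 proof (induction n)
  case (Suc n)
  have "N (J t (J s ((J s ^^ n) f)) - J s ((J s ^^ n) (J t f)))
    \<le> N (J t (J s ((J s ^^ n) f)) - J s (J t ((J s ^^ n) f))) + N (J s (J t ((J s ^^ n) f)) - J s ((J s ^^ n) (J t f)))"
   using f by (intro N_triangle) auto
  also have "\<dots> \<le> 0 + N (J t ((J s ^^ n) f) - (J s ^^ n) (J t f))"
   using J_commute[of "(J s ^^ n) f" t s] f st by (intro add_mono J_contr_diff) auto
  finally have "N (J t (J s ((J s ^^ n) f)) - J s ((J s ^^ n) (J t f))) \<le> 0" using Suc by simp
  thus ?case using N_nonneg[of "J t (J s ((J s ^^ n) f)) - J s ((J s ^^ n) (J t f))"] f by simp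
 qed simp
 show ?thesis
 proof (induction n)
  case (Suc n)
  have cX: "((J s \<circ> J t) ^^ n) f \<in> X" for n using f by (induction n) auto
  have 1: "N (J s (J t (((J s \<circ> J t) ^^ n) f)) - J s (J t ((J s ^^ n) ((J t ^^ n) f)))) \<le> 0"
   using J_contr_diff[of "J t (((J s \<circ> J t) ^^ n) f)" "J t ((J s ^^ n) ((J t ^^ n) f))" s]
    J_contr_diff[of "((J s \<circ> J t) ^^ n) f" "(J s ^^ n) ((J t ^^ n) f)" t] Suc st f cX by simp
  have 2: "N (J s (J t ((J s ^^ n) ((J t ^^ n) f))) - J s ((J s ^^ n) (J t ((J t ^^ n) f)))) \<le> 0"
   using J_contr_diff[of "J t ((J s ^^ n) ((J t ^^ n) f))" "(J s ^^ n) (J t ((J t ^^ n) f))" s]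
    comm[of "(J t ^^ n) f" n] st f by simp
  have "N (J s (J t (((J s \<circ> J t) ^^ n) f)) - J s ((J s ^^ n) (J t ((J t ^^ n) f)))) \<le> 0"
   using N_triangle[of "J s (J t (((J s \<circ> J t) ^^ n) f))" "J s (J t ((J s ^^ n) ((J t ^^ n) f)))"
     "J s ((J s ^^ n) (J t ((J t ^^ n) f)))"] 1 2 f cX by simp
  hence "N (J s (J t (((J s \<circ> J t) ^^ n) f)) - J s ((J s ^^ n) (J t ((J t ^^ n) f)))) = 0"
   using N_nonneg[of "J s (J t (((J s \<circ> J t) ^^ n) f)) - J s ((J s ^^ n) (J t ((J t ^^ n) f)))"] f cX by simp
  thus ?case unfolding funpow.simps comp_apply .
 qed simp
qed

text \<open>\<open>T k (s + t)\<close> uses steps of length \<open>(s + t) / 2\<^sup>k\<close>, and \<open>T k s\<close> after \<open>T k t\<close> is, by commutation, a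
  product of pairs of steps of lengths \<open>s / 2\<^sup>k\<close> and \<open>t / 2\<^sup>k\<close>; the two-step estimate compares them.\<close>

lemma S_semigroup_D2:
 assumes f: "f \<in> D2 \<kappa>" and st: "s \<ge> 0" "t \<ge> 0"
 shows "N (S (s + t) f - S s (S t f)) = 0"
proof -
 note X = D2_X[OF f]
 have SX: "S t f \<in> X" "S s (S t f) \<in> X" using X S_X st by auto
 have "N (T k (s + t) f - S s (S t f)) \<le> s * t * \<kappa> * (1/2) ^ k + N (T k t f - S t f) + N (T k s (S t f) - S s (S t f))" for k
 proof -
  define a b where "a = s / 2 ^ k" and "b = t / 2 ^ k"
  have ab: "a \<ge> 0" "b \<ge> 0" "a + b = (s + t) / 2 ^ k" using st by (auto simp: a_def b_def add_divide_distrib)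
  have "N ((J (a + b) ^^ (2 ^ k)) f - ((J a \<circ> J b) ^^ (2 ^ k)) f) \<le> real (2 ^ k) * (a * b * \<kappa>)"
  proof (rule telescope[where E="D2 \<kappa>"])
   fix x assume "x \<in> D2 \<kappa>"
   thus "N (J (a + b) x - (J a \<circ> J b) x) \<le> a * b * \<kappa>"
    using J_two_step[of x \<kappa> a b] N_commute[of "J (a + b) x" "J a (J b x)"] D2_X ab by auto
  qed (use f D2_X J_D2 J_contr_diff ab in auto)
  also have "real (2 ^ k) * (a * b * \<kappa>) = s * t * \<kappa> * (1/2) ^ k"
   by (simp add: a_def b_def field_simps)
  finally have 1: "N (T k (s + t) f - ((J a \<circ> J b) ^^ (2 ^ k)) f) \<le> s * t * \<kappa> * (1/2) ^ k"
   by (simp add: T_def ab)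
  have cX: "((J a \<circ> J b) ^^ n) f \<in> X" for n using X by (induction n) auto
  have 2: "N (((J a \<circ> J b) ^^ (2 ^ k)) f - T k s (T k t f)) = 0"
   using J_pow_commute[OF X ab(1,2), of "2 ^ k"] by (simp add: T_def a_def b_def)
  have 3: "N (T k s (T k t f) - T k s (S t f)) \<le> N (T k t f - S t f)"
   using T_contr X SX st by auto
  have "N (T k (s + t) f - S s (S t f)) \<le> N (T k (s + t) f - ((J a \<circ> J b) ^^ (2 ^ k)) f)
    + (N (((J a \<circ> J b) ^^ (2 ^ k)) f - T k s (T k t f)) + (N (T k s (T k t f) - T k s (S t f)) + N (T k s (S t f) - S s (S t f))))"
   using X SX cX
   by (intro order_trans[OF N_triangle[of _ "((J a \<circ> J b) ^^ (2 ^ k)) f"]] add_left_mono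
     order_trans[OF N_triangle[of _ "T k s (T k t f)"]] order_trans[OF N_triangle[of _ "T k s (S t f)"]]) auto
  thus ?thesis using 1 2 3 by simp
 qed
 moreover have "(\<lambda>k. s * t * \<kappa> * (1/2) ^ k + N (T k t f - S t f) + N (T k s (S t f) - S s (S t f))) \<longlonglongrightarrow> s * t * \<kappa> * 0 + 0 + 0"
  using X SX st by (intro tendsto_add tendsto_mult_left LIMSEQ_realpow_zero S_tendsto) auto
 ultimately have "N (S (s + t) f - S s (S t f)) \<le> s * t * \<kappa> * 0 + 0 + 0"
  using X SX st by (intro S_le) auto
 thus ?thesis using N_nonneg[of "S (s + t) f - S s (S t f)"] SX S_X[OF X, of "s + t"] st by simp
qed

lemma S_semigroup:
 assumes f: "f \<in> X" and st: "s \<ge> 0" "t \<ge> 0"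
 shows "N (S (s + t) f - S s (S t f)) = 0"
proof -
 have "N (S (s + t) f - S s (S t f)) \<le> 0"
 proof (rule field_le_epsilon)
  fix e :: real assume "e > 0"
  then obtain f' \<kappa> where f': "f' \<in> D2 \<kappa>" "N (f - f') < e/2" using D2_dense[OF f, of "e/2"] by auto
  note f'X = D2_X[OF f'(1)]
  have 1: "N (S (s + t) f - S (s + t) f') \<le> N (f - f')" using S_contr_diff f f'X st by simp
  have 2: "N (S s (S t f') - S s (S t f)) \<le> N (f - f')"
   using S_contr_diff[of "S t f'" "S t f" s] S_contr_diff[of f' f t] S_X f f'X st N_commute[of f f'] by simp
  have "N (S (s + t) f - S s (S t f)) \<le> N (S (s + t) f - S (s + t) f') + (N (S (s + t) f' - S s (S t f')) + N (S s (S t f') - S s (S t f)))"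
   using f f'X st S_X
   by (intro order_trans[OF N_triangle[of _ "S (s + t) f'"]] add_left_mono N_triangle) auto
  thus "N (S (s + t) f - S s (S t f)) \<le> 0 + e" using 1 2 S_semigroup_D2[OF f'(1) st] f'(2) by simp
 qed
 thus ?thesis using N_nonneg[of "S (s + t) f - S s (S t f)"] S_X f st by simp
qed

lemma S_lipschitz:
 assumes "(x, y) \<in> A" "t \<ge> 0"
 shows "N (S t x - x) \<le> t * N y"
proof (rule S_le)
 note X = A_X[OF assms(1)]
 fix k
 define h where "h = t / 2 ^ k"
 have h: "h \<ge> 0" using assms by (simp add: h_def)
 have 1: "N (J h x - x) \<le> h * N y"
  using J_approx[OF assms(1) X(1) h] N_scale[OF X(2), of "-h"] h by (simp add: algebra_simps)
 have "N ((J h ^^ n) x - (id ^^ n) x) \<le> real n * (h * N y)" for n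
  by (rule telescope[where E="{x}"]) (use X J_contr_diff h 1 in auto)
 from this[of "2 ^ k"] show "N (T k t x - x) \<le> t * N y"
  by (simp add: T_def h_def)
qed (use assms A_X in auto)

text \<open>On the domain of \<open>A\<^sup>2\<close> the first approximation \<open>T 0 t = J t\<close> is already exact to second order in
  \<open>t\<close>. The general case follows by density in the graph norm and the Lipschitz bound for orbits.\<close>

lemma S_generates:
 assumes fg: "(f, g) \<in> A"
 shows "(f, g) \<in> generator S"
proof -
 note X = A_X[OF fg]
 have D2: "N (x - S t x - t *\<^sub>R y) \<le> 2 * t\<^sup>2 * \<kappa>" if x: "(x, y) \<in> A" "(y, z) \<in> A" "N z \<le> \<kappa>" and t: "t \<ge> 0" for x y z \<kappa> t
 proof -
  have xD: "x \<in> D2 \<kappa>" using x by (auto simp: D2_def)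
  have X: "x \<in> X" "y \<in> X" "z \<in> X" using A_X x by auto
  have "N (S t x - T 0 t x) \<le> t\<^sup>2 * \<kappa> / 2"
  proof (rule S_le)
   fix k
   have "t\<^sup>2 * \<kappa> / 2 * ((1/2) ^ 0 - (1/2) ^ k) \<le> t\<^sup>2 * \<kappa> / 2 * 1"
    using D2_nonneg[OF xD] by (intro mult_left_mono) auto
   thus "N (T k t x - T 0 t x) \<le> t\<^sup>2 * \<kappa> / 2" using T_diff[OF xD t, of 0 k] by simp
  qed (use X t in auto)
  hence 1: "N (S t x - J t x) \<le> t\<^sup>2 * \<kappa> / 2" by (simp add: T_def)
  have "N (J t x - (x - t *\<^sub>R y)) \<le> N (x - ((x - t *\<^sub>R y) + t *\<^sub>R (y - t *\<^sub>R z)))"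
   using J_approx[OF A_diff[OF x(1) A_scale[OF x(2)]] X(1) t] .
  also have "\<dots> = t\<^sup>2 * N z"
   using N_scale[OF X(3), of "t\<^sup>2"] by (simp add: algebra_simps power2_eq_square)
  also have "\<dots> \<le> t\<^sup>2 * \<kappa>" using x(3) by (intro mult_left_mono) auto
  finally have 2: "N (J t x - (x - t *\<^sub>R y)) \<le> t\<^sup>2 * \<kappa>" .
  have eq: "x - S t x - t *\<^sub>R y = (x - t *\<^sub>R y) - S t x" by (simp add: algebra_simps)
  have "N (x - S t x - t *\<^sub>R y) \<le> N (S t x - J t x) + N (J t x - (x - t *\<^sub>R y))"
   unfolding eq using N_triangle[of "S t x" "J t x" "x - t *\<^sub>R y"] N_commute[of "S t x" "x - t *\<^sub>R y"] X S_X[OF X(1) t] by simp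
  thus ?thesis using 1 2 mult_nonneg_nonneg[OF zero_le_power2[of t] D2_nonneg[OF xD]]
   by (simp add: mult.assoc)
 qed
 have "((\<lambda>t. N ((1 / t) *\<^sub>R (f - S t f) - g)) \<longlongrightarrow> 0) (at_right 0)"
 proof (rule tendstoI)
  fix e :: real assume e: "e > 0"
  obtain f' g' \<kappa>' where f': "(f', g') \<in> A" "f' \<in> D2 \<kappa>'" "N (f - f') < e/4" "N (g - g') < e/4"
   using D2_approx[OF fg, of "e/4"] e by auto
  note f'X = A_X[OF f'(1)]
  obtain g'' k where gk: "(f', g'') \<in> A" "(g'', k) \<in> A" "N k \<le> \<kappa>'" using f'(2) by (auto simp: D2_def)
  have gX: "g'' \<in> X" using A_X gk by auto
  have gg: "N (g' - g'') = 0"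
   using A_single_valued[of "g' - g''"] A_diff[OF f'(1) gk(1)] by simp
  have gkA: "(g', k) \<in> A" by (rule A_cong[OF gk(2)]) (use gg f'X gk A_X in auto)
  define \<kappa> where "\<kappa> = \<kappa>' + 1"
  have \<kappa>: "\<kappa> > 0" "N k \<le> \<kappa>" using gk(3) D2_nonneg[OF f'(2)] by (auto simp: \<kappa>_def)
  define t0 where "t0 = e / (4 * \<kappa>)"
  have t0: "t0 > 0" using e \<kappa> by (simp add: t0_def)
  have "N ((1 / t) *\<^sub>R (f - S t f) - g) < e" if t: "0 < t" "t < t0" for t
  proof -
   have a: "N ((f - f') - S t (f - f')) \<le> t * N (g - g')"
    using S_lipschitz[OF A_diff[OF fg f'(1)], of t] t X f'X S_X[of "f - f'" t] N_commute[of "f - f'" "S t (f - f')"] by simp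
   have b: "N (f' - S t f' - t *\<^sub>R g') \<le> 2 * t\<^sup>2 * \<kappa>" using D2[OF f'(1) gkA \<kappa>(2)] t by simp
   have c: "N (S t (f - f') - (S t f - S t f')) = 0" using lin_diff0[OF S_lin] X f'X t by simp
   have "f - S t f - t *\<^sub>R g = ((f - f') - S t (f - f')) + ((S t (f - f') - (S t f - S t f')) + ((f' - S t f' - t *\<^sub>R g') - t *\<^sub>R (g - g')))"
    by (simp add: algebra_simps)
   hence "N (f - S t f - t *\<^sub>R g) \<le> N ((f - f') - S t (f - f')) + (N (S t (f - f') - (S t f - S t f')) + (N (f' - S t f' - t *\<^sub>R g') + N (t *\<^sub>R (g - g'))))"
    using X f'X S_X t
    by (simp only:) (intro order_trans[OF N_add] add_left_mono order_trans[OF N_diff] order_refl; simp)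
   also have "\<dots> \<le> t * N (g - g') + (0 + (2 * t\<^sup>2 * \<kappa> + t * N (g - g')))"
    using a b c N_scale[of "g - g'" t] X f'X t by simp
   also have "\<dots> < t * e"
   proof -
    have "2 * t * \<kappa> < e / 2" using t \<kappa> by (simp add: t0_def field_simps)
    hence "2 * N (g - g') + 2 * t * \<kappa> < e" using f'(4) by simp
    hence "t * (2 * N (g - g') + 2 * t * \<kappa>) < t * e" using t by (intro mult_strict_left_mono)
    thus ?thesis by (simp add: algebra_simps power2_eq_square)
   qed
   finally have "N (f - S t f - t *\<^sub>R g) < t * e" .
   moreover have "(1 / t) *\<^sub>R (f - S t f) - g = (1 / t) *\<^sub>R (f - S t f - t *\<^sub>R g)"
    using t by (simp add: algebra_simps)
   moreover have "N ((1 / t) *\<^sub>R (f - S t f - t *\<^sub>R g)) = 1 / t * N (f - S t f - t *\<^sub>R g)"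
    using N_scale[of "f - S t f - t *\<^sub>R g" "1/t"] X S_X[OF X(1)] t by simp
   ultimately show ?thesis using t by (simp add: divide_less_eq mult.commute)
  qed
  moreover have "N ((1 / t) *\<^sub>R (f - S t f) - g) \<ge> 0" if "t > 0" for t
   using N_nonneg[of "(1 / t) *\<^sub>R (f - S t f) - g"] X S_X that by simp
  ultimately show "eventually (\<lambda>t. dist (N ((1 / t) *\<^sub>R (f - S t f) - g)) 0 < e) (at_right 0)"
   using t0 by (auto simp: eventually_at_right dist_real_def intro!: exI[of _ t0])
 qed
 thus ?thesis using X by (simp add: generator_def)
qed

lemma S_at_0:
 assumes f: "f \<in> X" and e: "e > 0"
 shows "\<exists>d>0. \<forall>h. 0 \<le> h \<and> h < d \<longrightarrow> N (S h f - f) < e"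
proof -
 obtain x y where xy: "(x, y) \<in> H" "N (f - x) < e/4" using H_domain[OF f, of "e/4"] e by auto
 have xyA: "(x, y) \<in> A" using xy H_A by auto
 have X: "x \<in> X" "y \<in> X" using A_X xyA by auto
 define d where "d = e / (4 * (N y + 1))"
 have d: "d > 0" "d * N y \<le> e/4"
  using e N_nonneg[OF X(2)] by (auto simp: d_def field_simps)
 show ?thesis
 proof (intro exI[of _ d] conjI d allI impI)
  fix h assume h: "0 \<le> h \<and> h < d"
  have "N (S h x - x) \<le> h * N y" using S_lipschitz[OF xyA] h by simp
  also have "\<dots> \<le> d * N y" using h N_nonneg[OF X(2)] by (intro mult_right_mono) auto
  also have "\<dots> \<le> e/4" by (rule d)
  finally have a: "N (S h x - x) \<le> e/4" .
  have "N (S h f - f) \<le> N (S h f - S h x) + (N (S h x - x) + N (x - f))"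
   using N_triangle[of "S h f" "S h x" f] N_triangle[of "S h x" x f] X f S_X h by auto
  also have "\<dots> < e" using a S_contr_diff[of f x h] xy(2) N_commute[OF X(1) f] N_nonneg[of "f - x"] X f h e by simp
  finally show "N (S h f - f) < e" .
 qed
qed

theorem S_C0_semigroup: "C0_semigroup S"
proof -
 have "((\<lambda>s. N (S s x - S t x)) \<longlongrightarrow> 0) (at t within {0..})" if x: "x \<in> X" and t: "t \<ge> 0" for x t
 proof (rule tendstoI)
  fix e :: real assume "e > 0"
  then obtain d where d: "d > 0" "\<And>h. 0 \<le> h ==> h < d ==> N (S h x - x) < e"
   using S_at_0[OF x] by blast
  have le: "N (S b x - S a x) \<le> N (S (b - a) x - x)" if ab: "0 \<le> a" "a \<le> b" for a b
  proof -
   have "N (S b x - S a x) \<le> N (S b x - S a (S (b - a) x)) + N (S a (S (b - a) x) - S a x)"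
    using x S_X ab by (intro N_triangle) auto
   thus ?thesis using S_semigroup[OF x ab(1), of "b - a"] S_contr_diff[of "S (b - a) x" x a] ab x S_X by simp
  qed
  have "N (S s x - S t x) < e" if "s \<ge> 0" "\<bar>s - t\<bar> < d" for s
   using le[of s t] le[of t s] d(2)[of "t - s"] d(2)[of "s - t"] that t N_commute[of "S s x" "S t x"] x S_X
   by (cases "s \<le> t") auto
  moreover have "N (S s x - S t x) \<ge> 0" if "s \<ge> 0" for s
   using N_nonneg[of "S s x - S t x"] x t S_X that by simp
  ultimately show "eventually (\<lambda>s. dist (N (S s x - S t x)) 0 < e) (at t within {0..})"
   using d(1) by (auto simp: eventually_at dist_real_def intro!: exI[of _ d])
 qed
 thus ?thesis
  unfolding C0_semigroup_def using S_lin S_contr S_0 S_semigroup by (auto intro!: exI[of _ 1])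
qed

text \<open>The Lipschitz bound for orbits passes
  from \<open>H\<close> to its closure and shows that the generator extends \<open>A\<close>. Conversely \<open>1 + A / c\<close> is onto, so
  a pair of the generator outside \<open>A\<close> would yield an eigenvector with \<open>S 1 f = exp c f\<close>, and \<open>exp c\<close>
  exceeds the norm of \<open>S 1\<close> for large \<open>c\<close>. The other semigroup need not be contractive, so its
  generator need not be accretive; that is why the eigenvector argument is used.\<close>

theorem generator_unique:
 assumes S: "C0_semigroup S'" and H: "H \<subseteq> generator S'"
 shows "generator S' = A"
proof -
 obtain M where M: "M \<ge> 0" "\<And>t x. 0 \<le> t ==> t \<le> 1 ==> x \<in> X ==> N (S' t x) \<le> M * N x"
  using C0_semigroup_bounded[OF S] by blast
 have SX: "S' s x \<in> X" if "s \<ge> 0" "x \<in> X" for s x using linD(1)[OF C0_semigroupD(1)[OF S that(1)] that(2)] .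
 have lip: "N (p - S' t p) \<le> M * t * N q" if pq: "(p, q) \<in> A" and t: "0 < t" "t \<le> 1" for p q t
 proof (rule field_le_epsilon)
  fix e :: real assume e: "e > 0"
  note X = A_X[OF pq]
  define d where "d = e / (1 + M + M * t)"
  have d: "d > 0" "d * (1 + M + M * t) = e"
   using e M t mult_nonneg_nonneg[of M t] by (auto simp: d_def add_pos_nonneg add_nonneg_eq_0_iff)
  obtain x y where xy: "(x, y) \<in> H" "N (p - x) < d" "N (q - y) < d" using pq d(1) unfolding A_def by blast
  have X': "x \<in> X" "y \<in> X" using H_X xy by auto
  have eq: "p - S' t p = (x - S' t x) + ((p - x) - (S' t p - S' t x))" by simp
  have "N (p - S' t p) \<le> N (x - S' t x) + (N (p - x) + N (S' t p - S' t x))"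
   unfolding eq using X X' SX t by (intro order_trans[OF N_add] add_left_mono N_diff) auto
  also have "N (S' t p - S' t x) \<le> M * N (p - x)"
   using lin_diff[OF C0_semigroupD(1)[OF S], of t p x] M(2)[of t "p - x"] X X' t by simp
  also have "N (x - S' t x) \<le> M * t * N y"
   using generator_lipschitz[OF S M _ t] xy(1) H by blast
  also have "M * t * N y \<le> M * t * (N q + d)"
   using N_le[of y q] N_commute[of y q] X X' xy M t by (intro mult_left_mono) auto
  also have "M * N (p - x) \<le> M * d" using M xy by (intro mult_left_mono) auto
  also have "N (p - x) \<le> d" using xy by simp
  finally show "N (p - S' t p) \<le> M * t * N q + e" using d by (simp add: algebra_simps)
 qed
 have sub: "A \<subseteq> generator S'"
 proof clarify
  fix f g assume fg: "(f, g) \<in> A"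
  note X = A_X[OF fg]
  have "((\<lambda>t. N ((1 / t) *\<^sub>R (f - S' t f) - g)) \<longlongrightarrow> 0) (at_right 0)"
  proof (rule tendstoI)
   fix e :: real assume e: "e > 0"
   define d where "d = e / (2 * (M + 1))"
   have d: "d > 0" "(M + 1) * d = e / 2" using e M by (auto simp: d_def field_simps)
   obtain x y where xy: "(x, y) \<in> H" "N (f - x) < d" "N (g - y) < d" using fg d(1) unfolding A_def by blast
   have X': "x \<in> X" "y \<in> X" using H_X xy by auto
   have xyA: "(x, y) \<in> A" using xy H_A by auto
   have "((\<lambda>t. N ((1 / t) *\<^sub>R (x - S' t x) - y)) \<longlongrightarrow> 0) (at_right 0)"
    using xy H by (auto simp: generator_def)
   from order_tendstoD(2)[OF this, of "e/2"] e
   have "eventually (\<lambda>t. N ((1 / t) *\<^sub>R (x - S' t x) - y) < e/2) (at_right 0)" by simp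
   moreover have "eventually (\<lambda>t::real. 0 < t \<and> t \<le> 1) (at_right 0)"
    by (intro eventually_at_rightI[of 0 1]) auto
   ultimately show "eventually (\<lambda>t. dist (N ((1 / t) *\<^sub>R (f - S' t f) - g)) 0 < e) (at_right 0)"
   proof eventually_elim
    case (elim t)
    hence t: "0 < t" "t \<le> 1" by auto
    note L = C0_semigroupD(1)[OF S less_imp_le[OF t(1)]]
    have SX': "S' t f \<in> X" "S' t x \<in> X" "S' t (f - x) \<in> X" using SX X X' t by auto
    have eq: "(1 / t) *\<^sub>R (f - S' t f) - g = (1 / t) *\<^sub>R ((f - x) - S' t (f - x)) + ((1 / t) *\<^sub>R (S' t (f - x) - (S' t f - S' t x))
      + (((1 / t) *\<^sub>R (x - S' t x) - y) - (g - y)))" by (simp add: algebra_simps)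
    have "N ((1 / t) *\<^sub>R (f - S' t f) - g) \<le> N ((1 / t) *\<^sub>R ((f - x) - S' t (f - x))) + (N ((1 / t) *\<^sub>R (S' t (f - x) - (S' t f - S' t x)))
      + (N ((1 / t) *\<^sub>R (x - S' t x) - y) + N (g - y)))"
     unfolding eq using X X' SX' by (intro order_trans[OF N_add] add_left_mono N_diff; simp)
    also have "N ((1 / t) *\<^sub>R (S' t (f - x) - (S' t f - S' t x))) = 0"
     using N_scale[of "S' t (f - x) - (S' t f - S' t x)" "1/t"] lin_diff0[OF L, of f x] X X' SX' by simp
    also have "N ((1 / t) *\<^sub>R ((f - x) - S' t (f - x))) \<le> M * N (g - y)"
    proof -
     have "N ((1 / t) *\<^sub>R ((f - x) - S' t (f - x))) = 1 / t * N ((f - x) - S' t (f - x))"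
      using N_scale[of "(f - x) - S' t (f - x)" "1/t"] X X' SX' t by simp
     also have "\<dots> \<le> 1 / t * (M * t * N (g - y))"
      using lip[OF A_diff[OF fg xyA] t] t by (intro mult_left_mono) auto
     finally show ?thesis using t by simp
    qed
    also have "M * N (g - y) + (0 + (N ((1 / t) *\<^sub>R (x - S' t x) - y) + N (g - y))) < (M + 1) * d + e / 2"
     using mult_left_mono[of "N (g - y)" d M] xy(3) M(1) elim by (simp add: algebra_simps)
    finally have "N ((1 / t) *\<^sub>R (f - S' t f) - g) < e" using d by simp
    thus ?case using N_nonneg[of "(1 / t) *\<^sub>R (f - S' t f) - g"] X SX' by (simp add: dist_real_def)
   qed
  qed
  thus "(f, g) \<in> generator S'" using X by (simp add: generator_def)
 qed
 moreover have "(f, g) \<in> A" if fg: "(f, g) \<in> generator S'" for f g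
 proof -
  note X = generator_X[OF fg]
  \<comment> \<open>the exponential of \<open>c\<close> must exceed the bound \<open>M\<close> for the semigroup at time one\<close>
  define c where "c = ln (M + 2)"
  have c: "c > 0" "exp c = M + 2" using M by (auto simp: c_def)
  obtain u w where uw: "(u, w) \<in> A" "u + (1/c) *\<^sub>R w = f + (1/c) *\<^sub>R g"
   using A_range[of "f + (1/c) *\<^sub>R g" "1/c"] X c by auto
  have X': "u \<in> X" "w \<in> X" using A_X uw by auto
  have "(1/c) *\<^sub>R (g - w) = u - f" using uw(2) by (simp add: algebra_simps)
  hence "c *\<^sub>R ((1/c) *\<^sub>R (g - w)) = c *\<^sub>R (u - f)" by simp
  hence gw: "g - w = c *\<^sub>R (u - f)" using c by simp
  have gen: "(f - u, g - w) \<in> generator S'" using generator_diff[OF S fg] uw(1) sub by blast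
  have gw0: "N ((g - w) + c *\<^sub>R (f - u)) = 0" unfolding gw by (simp add: algebra_simps)
  have ev: "N (S' 1 (f - u) - exp c *\<^sub>R (f - u)) = 0"
   by (rule generator_eigenvector[OF S M(1) _ gen gw0]) (use M(2) c in auto)
  hence "(M + 2) * N (f - u) \<le> N (S' 1 (f - u))"
   using N_abs_diff[of "S' 1 (f - u)" "exp c *\<^sub>R (f - u)"] N_scale[of "f - u" "exp c"] X X' SX[of 1 "f - u"] c M(1) by simp
  also have "\<dots> \<le> M * N (f - u)" using M(2)[of 1 "f - u"] X X' by simp
  finally have z: "N (f - u) = 0" using N_nonneg[of "f - u"] X X' by (simp add: algebra_simps)
  hence "N (g - w) = 0" unfolding gw using N_scale[of "u - f" c] N_commute[of f u] X X' by simp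
  thus ?thesis using A_cong[OF uw(1) X] z by simp
 qed
 ultimately show ?thesis by auto
qed

theorem unique_generator: "\<exists>!G. H \<subseteq> G \<and> (\<exists>S. C0_semigroup S \<and> G = generator S)"
proof (rule ex1I[of _ A])
 have "H \<subseteq> generator S" using H_A S_generates by auto
 thus "H \<subseteq> A \<and> (\<exists>S. C0_semigroup S \<and> A = generator S)"
  using H_A S_C0_semigroup generator_unique by metis
qed (use generator_unique in auto)

end

section \<open>The spaces of \<open>p\<close>-integrable functions\<close>

instantiation "fun" :: (type, real_vector) real_vector
begin
definition "scaleR_fun r f = (\<lambda>x. r *\<^sub>R f x)"
instance by standard (auto simp: scaleR_fun_def fun_eq_iff algebra_simps)
end

lemma scaleR_fun_apply [simp]: "(r *\<^sub>R f) x = r *\<^sub>R f x"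
 by (simp add: scaleR_fun_def)

lemma powr_convex_nonneg:
 fixes u v :: real
 assumes p: "1 \<le> p" and uv: "0 \<le> u" "0 \<le> v" and \<theta>: "0 \<le> \<theta>" "\<theta> \<le> 1"
 shows "(\<theta> * u + (1 - \<theta>) * v) powr p \<le> \<theta> * u powr p + (1 - \<theta>) * v powr p"
proof -
 have le: "(t * x) powr p \<le> t * x powr p" if "0 \<le> t" "t \<le> 1" "0 \<le> x" for t x :: real
 proof -
  have "t powr p \<le> t"
   using that p powr_mono'[of 1 p t] by (cases "t = 0") auto
  thus ?thesis using that by (simp add: powr_mult mult_right_mono)
 qed
 consider "u = 0" | "v = 0" | "u > 0" "v > 0" using uv by linarith
 thus ?thesis
 proof cases
  case 1 thus ?thesis using le[of "1 - \<theta>" v] uv \<theta> by simp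
 next
  case 2 thus ?thesis using le[of \<theta> u] uv \<theta> by simp
 next
  case 3
  thus ?thesis using convex_onD[OF powr_convex[OF p], of "1 - \<theta>" u v] \<theta> by simp
 qed
qed

lemma powr_add_le:
 fixes u v :: real
 assumes "1 \<le> p" "0 \<le> u" "0 \<le> v"
 shows "(u + v) powr p \<le> 2 powr p * (u powr p + v powr p)"
proof -
 have "(u + v) powr p = 2 powr p * (1/2 * u + (1 - 1/2) * v) powr p"
  by (subst powr_mult[symmetric]) (use assms in \<open>auto simp: algebra_simps\<close>)
 also have "\<dots> \<le> 2 powr p * (1/2 * u powr p + (1 - 1/2) * v powr p)"
  using powr_convex_nonneg[OF assms, of "1/2"] by (intro mult_left_mono) auto
 also have "\<dots> \<le> 2 powr p * (u powr p + v powr p)" by (intro mult_left_mono add_mono; simp)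
 finally show ?thesis .
qed

definition Lp_norm :: "real => 'a measure => ('a => real) => real" where
 "Lp_norm p M f = (LINT x|M. \<bar>f x\<bar> powr p) powr (1 / p)"

lemma Lp_norm_nonneg [simp]: "0 \<le> Lp_norm p M f"
 by (simp add: Lp_norm_def)

lemma le_suminf: "f k \<le> (\<Sum>k. f k :: ennreal)"
 using sum_le_suminf[of f "{k}"] by simp

lemma eq_ennreal_enn2real: "x \<noteq> \<infinity> ==> x = ennreal (enn2real x)"
 by (simp add: ennreal_enn2real_if)

context
 fixes p :: real and M :: "'a measure"
 assumes p: "1 \<le> p"
begin

lemma Lq_iff: "f \<in> Lq (ennreal p) M \<longleftrightarrow> f \<in> borel_measurable M \<and> integrable M (\<lambda>x. \<bar>f x\<bar> powr p)"
 using p by (auto simp: Lq_def Lq_norm_def Let_def integrable_iff_bounded less_top[symmetric] split: if_splits)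

lemma Lq_norm_eq: "f \<in> Lq (ennreal p) M ==> Lq_norm (ennreal p) M f = ennreal (Lp_norm p M f)"
 using p by (simp add: Lq_iff Lq_norm_def Let_def Lp_norm_def nn_integral_eq_integral)

lemma Lp_norm_powr: "f \<in> Lq (ennreal p) M ==> Lp_norm p M f powr p = (LINT x|M. \<bar>f x\<bar> powr p)"
 using p by (simp add: Lp_norm_def powr_powr)

lemma Lp_norm_le_iff:
 assumes "f \<in> Lq (ennreal p) M" "0 \<le> c"
 shows "Lp_norm p M f \<le> c \<longleftrightarrow> (LINT x|M. \<bar>f x\<bar> powr p) \<le> c powr p"
 unfolding Lp_norm_powr[OF assms(1), symmetric] using assms p powr_le_cancel_iff
 by (metis Lp_norm_nonneg less_eq_real_def linorder_not_le order.strict_trans1 powr_less_mono2 powr_mono2 zero_less_one)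

lemma Lp_norm_eq_0_iff:
 assumes "f \<in> Lq (ennreal p) M"
 shows "Lp_norm p M f = 0 \<longleftrightarrow> (AE x in M. f x = 0)"
proof -
 have "Lp_norm p M f = 0 \<longleftrightarrow> (LINT x|M. \<bar>f x\<bar> powr p) = 0" by (simp add: Lp_norm_def)
 also have "\<dots> \<longleftrightarrow> (AE x in M. \<bar>f x\<bar> powr p = 0)"
  using assms by (subst integral_nonneg_eq_0_iff_AE) (auto simp: Lq_iff)
 finally show ?thesis by simp
qed

lemma Lq_add:
 assumes "f \<in> Lq (ennreal p) M" "g \<in> Lq (ennreal p) M"
 shows "f + g \<in> Lq (ennreal p) M"
proof -
 have [measurable]: "f \<in> borel_measurable M" "g \<in> borel_measurable M" using assms Lq_iff by auto
 have "integrable M (\<lambda>x. \<bar>f x + g x\<bar> powr p)"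
 proof (rule Bochner_Integration.integrable_bound)
  show "integrable M (\<lambda>x. 2 powr p * (\<bar>f x\<bar> powr p + \<bar>g x\<bar> powr p))"
   using assms Lq_iff by (intro integrable_mult_right Bochner_Integration.integrable_add) auto
  show "AE x in M. norm (\<bar>f x + g x\<bar> powr p) \<le> norm (2 powr p * (\<bar>f x\<bar> powr p + \<bar>g x\<bar> powr p))"
  proof (rule AE_I2)
   fix x
   have "\<bar>f x + g x\<bar> powr p \<le> (\<bar>f x\<bar> + \<bar>g x\<bar>) powr p" using p by (intro powr_mono2) auto
   also have "\<dots> \<le> 2 powr p * (\<bar>f x\<bar> powr p + \<bar>g x\<bar> powr p)" using p by (intro powr_add_le) auto
   finally show "norm (\<bar>f x + g x\<bar> powr p) \<le> norm (2 powr p * (\<bar>f x\<bar> powr p + \<bar>g x\<bar> powr p))" by simp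
  qed
 qed simp
 thus ?thesis by (simp add: Lq_iff plus_fun_def)
qed

lemma Lq_scale: "f \<in> Lq (ennreal p) M ==> a *\<^sub>R f \<in> Lq (ennreal p) M"
 and Lp_norm_scale: "f \<in> Lq (ennreal p) M ==> Lp_norm p M (a *\<^sub>R f) = \<bar>a\<bar> * Lp_norm p M f"
proof -
 assume f: "f \<in> Lq (ennreal p) M"
 have eq: "\<bar>(a *\<^sub>R f) x\<bar> powr p = \<bar>a\<bar> powr p * \<bar>f x\<bar> powr p" for x by (simp add: abs_mult powr_mult)
 show "a *\<^sub>R f \<in> Lq (ennreal p) M"
  unfolding Lq_iff eq using f by (auto simp: Lq_iff scaleR_fun_def)
 show "Lp_norm p M (a *\<^sub>R f) = \<bar>a\<bar> * Lp_norm p M f"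
  unfolding Lp_norm_def eq using p by (simp add: powr_mult powr_powr)
qed

lemma Lq_subspace: "subspace (Lq (ennreal p) M)"
 by (rule subspaceI) (use Lq_add Lq_scale p in \<open>auto simp: Lq_iff zero_fun_def\<close>)

text \<open>Minkowski's inequality is the convexity of the power applied to the convex combination of the
  normalised functions \<open>f / \<parallel>f\<parallel>\<close> and \<open>g / \<parallel>g\<parallel>\<close>.\<close>

lemma Lp_norm_add:
 assumes f: "f \<in> Lq (ennreal p) M" and g: "g \<in> Lq (ennreal p) M"
 shows "Lp_norm p M (f + g) \<le> Lp_norm p M f + Lp_norm p M g"
proof -
 define a b where "a = Lp_norm p M f" and "b = Lp_norm p M g"
 have nonneg: "a \<ge> 0" "b \<ge> 0" by (auto simp: a_def b_def)
 have [measurable]: "f \<in> borel_measurable M" "g \<in> borel_measurable M" using f g Lq_iff by auto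
 consider "a = 0" | "b = 0" | "a > 0" "b > 0" using nonneg by linarith
 thus ?thesis
 proof cases
  case 1
  hence "AE x in M. f x = 0" using Lp_norm_eq_0_iff[OF f] by (simp add: a_def)
  hence "(LINT x|M. \<bar>(f + g) x\<bar> powr p) = (LINT x|M. \<bar>g x\<bar> powr p)" by (intro integral_cong_AE) auto
  thus ?thesis by (simp add: Lp_norm_def)
 next
  case 2
  hence "AE x in M. g x = 0" using Lp_norm_eq_0_iff[OF g] by (simp add: b_def)
  hence "(LINT x|M. \<bar>(f + g) x\<bar> powr p) = (LINT x|M. \<bar>f x\<bar> powr p)" by (intro integral_cong_AE) auto
  thus ?thesis by (simp add: Lp_norm_def)
 next
  case 3
  define \<theta> where "\<theta> = a / (a + b)"
  have \<theta>: "0 \<le> \<theta>" "\<theta> \<le> 1" "1 - \<theta> = b / (a + b)" using 3 by (auto simp: \<theta>_def field_simps)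
  have pt: "\<bar>(f + g) x\<bar> powr p \<le> (a + b) powr p * (\<theta> * (\<bar>f x\<bar> powr p / a powr p) + (1 - \<theta>) * (\<bar>g x\<bar> powr p / b powr p))" for x
  proof -
   have "\<bar>(f + g) x\<bar> powr p \<le> ((a + b) * (\<theta> * (\<bar>f x\<bar> / a) + (1 - \<theta>) * (\<bar>g x\<bar> / b))) powr p"
   proof (intro powr_mono2)
    have "a + b \<noteq> 0" using 3 by simp
    hence "(a + b) * (\<theta> * (\<bar>f x\<bar> / a) + (1 - \<theta>) * (\<bar>g x\<bar> / b)) = \<bar>f x\<bar> + \<bar>g x\<bar>"
     unfolding \<theta>(3) unfolding \<theta>_def using 3 by (simp add: distrib_left)
    thus "\<bar>(f + g) x\<bar> \<le> (a + b) * (\<theta> * (\<bar>f x\<bar> / a) + (1 - \<theta>) * (\<bar>g x\<bar> / b))" by simp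
   qed (use p in simp_all)
   also have "\<dots> = (a + b) powr p * (\<theta> * (\<bar>f x\<bar> / a) + (1 - \<theta>) * (\<bar>g x\<bar> / b)) powr p"
    by (rule powr_mult)
   also have "\<dots> \<le> (a + b) powr p * (\<theta> * (\<bar>f x\<bar> / a) powr p + (1 - \<theta>) * (\<bar>g x\<bar> / b) powr p)"
    using 3 \<theta> p by (intro mult_left_mono powr_convex_nonneg) auto
   finally show ?thesis using 3 by (simp add: powr_divide)
  qed
  have int: "integrable M (\<lambda>x. \<bar>f x\<bar> powr p)" "integrable M (\<lambda>x. \<bar>g x\<bar> powr p)" using f g Lq_iff by auto
  have "(LINT x|M. \<bar>(f + g) x\<bar> powr p) \<le>
    (LINT x|M. (a + b) powr p * (\<theta> * (\<bar>f x\<bar> powr p / a powr p) + (1 - \<theta>) * (\<bar>g x\<bar> powr p / b powr p)))"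
   using pt int Lq_add[OF f g] by (intro integral_mono) (auto simp: Lq_iff)
  also have "\<dots> = (a + b) powr p * (\<theta> * ((LINT x|M. \<bar>f x\<bar> powr p) / a powr p) + (1 - \<theta>) * ((LINT x|M. \<bar>g x\<bar> powr p) / b powr p))"
   using int by simp
  also have "\<dots> = (a + b) powr p"
   using 3 unfolding a_def b_def Lp_norm_powr[OF f, symmetric] Lp_norm_powr[OF g, symmetric] by simp
  finally show ?thesis
   using Lp_norm_le_iff[OF Lq_add[OF f g], of "a + b"] nonneg by (simp add: a_def b_def)
 qed
qed

lemma Lq_diff: "f \<in> Lq (ennreal p) M ==> g \<in> Lq (ennreal p) M ==> f - g \<in> Lq (ennreal p) M"
 using Lq_subspace by (rule subspace_diff)

text \<open>Riesz--Fischer: a subsequence with summable increments converges almost everywhere, and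
  Fatou's lemma identifies the pointwise limit as the limit in norm.\<close>

lemma Lp_complete:
 fixes u :: "nat => 'a => real"
 assumes u: "\<And>n. u n \<in> Lq (ennreal p) M"
  and cauchy: "\<And>e. e > 0 ==> \<exists>N. \<forall>m\<ge>N. \<forall>n\<ge>N. Lp_norm p M (u m - u n) < e"
 shows "\<exists>f\<in>Lq (ennreal p) M. (\<lambda>n. Lp_norm p M (u n - f)) \<longlonglongrightarrow> 0"
proof -
 have [measurable]: "u n \<in> borel_measurable M" for n using u Lq_iff by auto
 have int: "integrable M (\<lambda>x. \<bar>u m x - u n x\<bar> powr p)" for m n
  using Lq_diff[OF u[of m] u[of n]] by (simp add: Lq_iff fun_diff_def)
 have "\<exists>N. \<forall>m\<ge>N. \<forall>n\<ge>N. Lp_norm p M (u m - u n) < (1/4) ^ k" for k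
  using cauchy[of "(1/4) ^ k"] by simp
 then obtain N where N: "\<And>k m n. m \<ge> N k ==> n \<ge> N k ==> Lp_norm p M (u m - u n) < (1/4) ^ k" by metis
 define s where "s k = k + (\<Sum>i\<le>k. N i)" for k
 have s: "s k \<ge> N k" "s (Suc k) \<ge> N k" "s k \<ge> k" for k
  using member_le_sum[of k "{..k}" N] by (auto simp: s_def)
 define d where "d k x = u (s (Suc k)) x - u (s k) x" for k x
 have [measurable]: "d k \<in> borel_measurable M" for k unfolding d_def by measurable
 have int_d: "integrable M (\<lambda>x. \<bar>d k x\<bar> powr p)" for k unfolding d_def by (rule int)
 have d_le: "(LINT x|M. \<bar>d k x\<bar> powr p) \<le> ((1/4) ^ k) powr p" for k
  using Lp_norm_le_iff[OF Lq_diff[OF u[of "s (Suc k)"] u[of "s k"]], of "(1/4) ^ k"] N[OF s(2,1), of k] by (simp add: d_def)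
 define c where "c = 1 / 2 powr p"
 have c: "0 < c" "c < 1" using p by (auto simp: c_def intro: gr_one_powr)
 have "(\<integral>\<^sup>+x. (\<Sum>k. ennreal ((2 ^ k) powr p * \<bar>d k x\<bar> powr p)) \<partial>M) = (\<Sum>k. \<integral>\<^sup>+x. ennreal ((2 ^ k) powr p * \<bar>d k x\<bar> powr p) \<partial>M)"
  by (rule nn_integral_suminf) measurable
 also have "\<dots> \<le> (\<Sum>k. ennreal (c ^ k))"
 proof (rule suminf_le)
  fix k
  have "(\<integral>\<^sup>+x. ennreal ((2 ^ k) powr p * \<bar>d k x\<bar> powr p) \<partial>M) = ennreal (LINT x|M. (2 ^ k) powr p * \<bar>d k x\<bar> powr p)"
   using int_d by (intro nn_integral_eq_integral) auto
  also have "\<dots> \<le> ennreal ((2 ^ k) powr p * ((1/4) ^ k) powr p)"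
   using d_le[of k] by (intro ennreal_leI) (simp add: mult_left_mono)
  also have "(2 ^ k) powr p * ((1/4) ^ k) powr p = c ^ k"
  proof -
   have "(2 ^ k) powr p * ((1/4) ^ k) powr p = (2 ^ k * (1/4) ^ k) powr p" by (simp add: powr_mult)
   also have "(2::real) ^ k * (1/4) ^ k = (2 * (1/4)) ^ k" by (rule power_mult_distrib[symmetric])
   also have "\<dots> = 1 / 2 ^ k" by (simp add: power_divide)
   also have "(1 / 2 ^ k) powr p = c ^ k"
    by (simp add: c_def powr_divide power_divide powr_powr powr_realpow[symmetric] mult.commute)
   finally show ?thesis .
  qed
  finally show "(\<integral>\<^sup>+x. ennreal ((2 ^ k) powr p * \<bar>d k x\<bar> powr p) \<partial>M) \<le> ennreal (c ^ k)" .
 qed auto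
 also have "\<dots> = ennreal (\<Sum>k. c ^ k)"
  using c by (intro suminf_ennreal2 summable_geometric) auto
 also have "\<dots> < \<infinity>" by simp
 finally have "(\<integral>\<^sup>+x. (\<Sum>k. ennreal ((2 ^ k) powr p * \<bar>d k x\<bar> powr p)) \<partial>M) \<noteq> \<infinity>"
  by simp
 hence "AE x in M. (\<Sum>k. ennreal ((2 ^ k) powr p * \<bar>d k x\<bar> powr p)) \<noteq> \<infinity>"
  by (intro nn_integral_PInf_AE) measurable
 hence conv: "AE x in M. convergent (\<lambda>k. u (s k) x)"
 proof eventually_elim
  case (elim x)
  define C where "C = enn2real (\<Sum>k. ennreal ((2 ^ k) powr p * \<bar>d k x\<bar> powr p))"
  have bound: "\<bar>d k x\<bar> \<le> C powr (1/p) * (1/2) ^ k" for k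
  proof -
   have "ennreal ((2 ^ k) powr p * \<bar>d k x\<bar> powr p) \<le> (\<Sum>k. ennreal ((2 ^ k) powr p * \<bar>d k x\<bar> powr p))"
    by (rule le_suminf)
   also have "\<dots> = ennreal C" unfolding C_def by (rule eq_ennreal_enn2real[OF elim])
   finally have "(2 ^ k * \<bar>d k x\<bar>) powr p \<le> C"
    unfolding powr_mult by (subst (asm) ennreal_le_iff) (simp_all only: C_def enn2real_nonneg)
   hence "((2 ^ k * \<bar>d k x\<bar>) powr p) powr (1/p) \<le> C powr (1/p)" using p by (intro powr_mono2) auto
   hence "2 ^ k * \<bar>d k x\<bar> \<le> C powr (1/p)" using p by (simp add: powr_powr)
   thus ?thesis by (simp add: power_divide field_simps)
  qed
  have "summable (\<lambda>k. d k x)"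
   by (rule summable_comparison_test'[of "\<lambda>k. C powr (1/p) * (1/2) ^ k"]) (use bound in \<open>auto intro: summable_mult summable_geometric\<close>)
  hence "convergent (\<lambda>n. \<Sum>k<n. d k x)" by (simp add: summable_iff_convergent)
  moreover have "(\<Sum>k<n. d k x) = u (s n) x - u (s 0) x" for n
   unfolding d_def by (rule sum_lessThan_telescope)
  ultimately have "convergent (\<lambda>n. u (s n) x - u (s 0) x)" by simp
  hence "convergent (\<lambda>n. (u (s n) x - u (s 0) x) + u (s 0) x)" by (intro convergent_add convergent_const)
  thus ?case by simp
 qed
 define f where "f x = lim (\<lambda>k. u (s k) x)" for x
 have [measurable]: "f \<in> borel_measurable M" unfolding f_def by (rule borel_measurable_lim_metric) simp
 have f_lim: "AE x in M. (\<lambda>k. u (s k) x) \<longlonglongrightarrow> f x"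
  using conv by eventually_elim (simp add: f_def convergent_LIMSEQ_iff)
 have fatou: "(\<integral>\<^sup>+x. ennreal (\<bar>u n x - f x\<bar> powr p) \<partial>M) \<le> ennreal (e powr p)"
  if e: "e > 0" "\<And>m. m \<ge> K ==> Lp_norm p M (u n - u m) < e" for n e K
 proof -
  have "(\<integral>\<^sup>+x. ennreal (\<bar>u n x - f x\<bar> powr p) \<partial>M) = (\<integral>\<^sup>+x. liminf (\<lambda>k. ennreal (\<bar>u n x - u (s k) x\<bar> powr p)) \<partial>M)"
  proof (rule nn_integral_cong_AE, use f_lim in eventually_elim)
   case (elim x)
   have "(\<lambda>k. ennreal (\<bar>u n x - u (s k) x\<bar> powr p)) \<longlonglongrightarrow> ennreal (\<bar>u n x - f x\<bar> powr p)"
    using p by (intro tendsto_ennrealI tendsto_powr' tendsto_rabs tendsto_diff elim tendsto_const) auto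
   from lim_imp_Liminf[OF sequentially_bot this] show ?case by (rule sym)
  qed
  also have "\<dots> \<le> liminf (\<lambda>k. \<integral>\<^sup>+x. ennreal (\<bar>u n x - u (s k) x\<bar> powr p) \<partial>M)"
   by (rule nn_integral_liminf) measurable
  also have "\<dots> \<le> liminf (\<lambda>k. ennreal (e powr p))"
  proof (rule Liminf_mono)
   show "\<forall>\<^sub>F k in sequentially. (\<integral>\<^sup>+x. ennreal (\<bar>u n x - u (s k) x\<bar> powr p) \<partial>M) \<le> ennreal (e powr p)"
    unfolding eventually_sequentially
   proof (intro exI[of _ K] allI impI)
    fix k assume "k \<ge> K"
    hence "s k \<ge> K" using s(3)[of k] by simp
    hence "(LINT x|M. \<bar>u n x - u (s k) x\<bar> powr p) \<le> e powr p"
     using Lp_norm_le_iff[OF Lq_diff[OF u[of n] u[of "s k"]], of e] e by (simp add: less_imp_le)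
    thus "(\<integral>\<^sup>+x. ennreal (\<bar>u n x - u (s k) x\<bar> powr p) \<partial>M) \<le> ennreal (e powr p)"
     using int by (subst nn_integral_eq_integral) (auto intro: ennreal_leI)
   qed
  qed
  finally show ?thesis by (simp add: Liminf_const)
 qed
 have Lq_un: "u n - f \<in> Lq (ennreal p) M \<and> Lp_norm p M (u n - f) \<le> e"
  if e: "e > 0" "\<And>m. m \<ge> K ==> Lp_norm p M (u n - u m) < e" for n e K
 proof
  have fin: "(\<integral>\<^sup>+x. ennreal (\<bar>u n x - f x\<bar> powr p) \<partial>M) < \<infinity>"
   using fatou[OF that] by (metis ennreal_less_top infinity_ennreal_def order_le_less_trans)
  hence int': "integrable M (\<lambda>x. \<bar>u n x - f x\<bar> powr p)" by (intro integrableI_bounded) auto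
  thus L: "u n - f \<in> Lq (ennreal p) M" by (simp add: Lq_iff fun_diff_def)
  have "ennreal (LINT x|M. \<bar>u n x - f x\<bar> powr p) \<le> ennreal (e powr p)"
   using fatou[OF that] int' by (subst (asm) nn_integral_eq_integral) auto
  thus "Lp_norm p M (u n - f) \<le> e" using Lp_norm_le_iff[OF L, of e] e by (simp add: ennreal_le_iff)
 qed
 obtain K where K: "\<And>m n. m \<ge> K ==> n \<ge> K ==> Lp_norm p M (u m - u n) < 1" using cauchy[of 1] by auto
 have "u K - (u K - f) \<in> Lq (ennreal p) M"
  by (rule Lq_diff[OF u]) (use Lq_un[of 1 K K] K in auto)
 moreover have "u K - (u K - f) = f" by (simp add: fun_eq_iff)
 ultimately have fL: "f \<in> Lq (ennreal p) M" by simp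
 have "(\<lambda>n. Lp_norm p M (u n - f)) \<longlonglongrightarrow> 0"
 proof (rule LIMSEQ_I)
  fix r :: real assume r: "r > 0"
  obtain K where K: "\<And>m n. m \<ge> K ==> n \<ge> K ==> Lp_norm p M (u m - u n) < r / 2"
   using cauchy[of "r/2"] r by auto
  show "\<exists>no. \<forall>n\<ge>no. norm (Lp_norm p M (u n - f) - 0) < r"
  proof (intro exI[of _ K] allI impI)
   fix n assume "n \<ge> K"
   hence "Lp_norm p M (u n - f) \<le> r / 2" using Lq_un[of "r/2" K n] K r by auto
   thus "norm (Lp_norm p M (u n - f) - 0) < r" using r by simp
  qed
 qed
 thus ?thesis using fL by blast
qed

theorem Lp_complete_seminorm: "complete_seminorm (Lq (ennreal p) M) (Lp_norm p M)"
 by unfold_locales (use Lq_subspace Lp_norm_add Lp_norm_scale Lp_complete in auto)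

interpretation Lp: complete_seminorm "Lq (ennreal p) M" "Lp_norm p M"
 by (rule Lp_complete_seminorm)

lemma Lp_norm_diff_0_iff:
 "f \<in> Lq (ennreal p) M ==> g \<in> Lq (ennreal p) M ==> Lp_norm p M (f - g) = 0 \<longleftrightarrow> (AE x in M. f x = g x)"
 using Lp_norm_eq_0_iff[OF Lq_diff] by simp

lemma Lq_bounded_linear_iff:
 "Lq_bounded_linear (ennreal p) M T \<longleftrightarrow>
   Lp.lin T \<and> (\<exists>K. \<forall>f\<in>Lq (ennreal p) M. Lp_norm p M (T f) \<le> K * Lp_norm p M f)"
proof (cases "\<forall>f\<in>Lq (ennreal p) M. T f \<in> Lq (ennreal p) M")
 case True
 have "(\<exists>K::real. \<forall>f\<in>Lq (ennreal p) M. Lq_norm (ennreal p) M (T f) \<le> ennreal K * Lq_norm (ennreal p) M f) \<longleftrightarrow>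
   (\<exists>K. \<forall>f\<in>Lq (ennreal p) M. Lp_norm p M (T f) \<le> K * Lp_norm p M f)" (is "?L \<longleftrightarrow> ?R")
 proof
  assume ?L
  then obtain K :: real where K: "\<And>f. f \<in> Lq (ennreal p) M ==> Lq_norm (ennreal p) M (T f) \<le> ennreal K * Lq_norm (ennreal p) M f" by blast
  have "Lp_norm p M (T f) \<le> max K 0 * Lp_norm p M f" if f: "f \<in> Lq (ennreal p) M" for f
  proof -
   have "ennreal (Lp_norm p M (T f)) \<le> ennreal (max K 0) * ennreal (Lp_norm p M f)"
   proof -
    have "ennreal (max K 0) = ennreal K" by (cases "K \<ge> 0") (auto simp: ennreal_neg)
    thus ?thesis using K[OF f] Lq_norm_eq f True by simp
   qed
   thus ?thesis by (simp add: ennreal_mult[symmetric] ennreal_le_iff)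
  qed
  thus ?R by blast
 next
  assume ?R
  then obtain K where K: "\<And>f. f \<in> Lq (ennreal p) M ==> Lp_norm p M (T f) \<le> K * Lp_norm p M f" by blast
  have "Lq_norm (ennreal p) M (T f) \<le> ennreal \<bar>K\<bar> * Lq_norm (ennreal p) M f" if f: "f \<in> Lq (ennreal p) M" for f
  proof -
   have "Lp_norm p M (T f) \<le> \<bar>K\<bar> * Lp_norm p M f"
    using K[OF f] by (rule order_trans) (intro mult_right_mono, auto)
   thus ?thesis using Lq_norm_eq f True by (simp add: ennreal_mult[symmetric] ennreal_leI)
  qed
  thus ?L by blast
 qed
 moreover have "(AE x in M. T (\<lambda>y. f y + g y) x = T f x + T g x) \<longleftrightarrow> Lp_norm p M (T (f + g) - (T f + T g)) = 0"
  if "f \<in> Lq (ennreal p) M" "g \<in> Lq (ennreal p) M" for f g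
  using that True Lp_norm_diff_0_iff[of "T (f + g)" "T f + T g"] Lq_add by (simp add: plus_fun_def)
 moreover have "(AE x in M. T (\<lambda>y. a * f y) x = a * T f x) \<longleftrightarrow> Lp_norm p M (T (a *\<^sub>R f) - a *\<^sub>R T f) = 0"
  if "f \<in> Lq (ennreal p) M" for f a
  using that True Lp_norm_diff_0_iff[of "T (a *\<^sub>R f)" "a *\<^sub>R T f"] Lq_scale by (simp add: scaleR_fun_def)
 ultimately show ?thesis using True unfolding Lq_bounded_linear_def Lp.lin_def by simp
qed (auto simp: Lq_bounded_linear_def Lp.lin_def)

lemma tendsto_Lq_norm_iff:
 assumes "eventually (\<lambda>t. f t \<in> Lq (ennreal p) M) F"
 shows "((\<lambda>t. Lq_norm (ennreal p) M (f t)) \<longlongrightarrow> 0) F \<longleftrightarrow> ((\<lambda>t. Lp_norm p M (f t)) \<longlongrightarrow> 0) F"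
proof -
 have "((\<lambda>t. Lq_norm (ennreal p) M (f t)) \<longlongrightarrow> 0) F \<longleftrightarrow> ((\<lambda>t. ennreal (Lp_norm p M (f t))) \<longlongrightarrow> ennreal 0) F"
  by (rule filterlim_cong) (use assms in \<open>auto elim!: eventually_mono simp: Lq_norm_eq\<close>)
 also have "\<dots> \<longleftrightarrow> ((\<lambda>t. Lp_norm p M (f t)) \<longlongrightarrow> 0) F"
  by (subst tendsto_ennreal_iff) auto
 finally show ?thesis .
qed

lemma Lq_C0_semigroup_iff: "Lq_C0_semigroup (ennreal p) M S \<longleftrightarrow> Lp.C0_semigroup S"
proof (cases "\<forall>t\<ge>0. \<forall>f\<in>Lq (ennreal p) M. S t f \<in> Lq (ennreal p) M")
 case True
 have "((\<lambda>s. Lq_norm (ennreal p) M (\<lambda>x. S s f x - S t f x)) \<longlongrightarrow> 0) (at t within {0..}) \<longleftrightarrow>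
   ((\<lambda>s. Lp_norm p M (S s f - S t f)) \<longlongrightarrow> 0) (at t within {0..})"
  if "f \<in> Lq (ennreal p) M" "t \<ge> 0" for f t
 proof -
  have "eventually (\<lambda>s. S s f - S t f \<in> Lq (ennreal p) M) (at t within {0..})"
   using that True Lq_diff by (auto simp: eventually_at intro!: exI[of _ 1])
  from tendsto_Lq_norm_iff[OF this] show ?thesis by (simp add: fun_diff_def)
 qed
 moreover have "(AE x in M. S (s + t) f x = S s (S t f) x) \<longleftrightarrow> Lp_norm p M (S (s + t) f - S s (S t f)) = 0"
  if "f \<in> Lq (ennreal p) M" "s \<ge> 0" "t \<ge> 0" for f s t
  using that True by (simp add: Lp_norm_diff_0_iff)
 moreover have "(AE x in M. S 0 f x = f x) \<longleftrightarrow> Lp_norm p M (S 0 f - f) = 0"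
  if "f \<in> Lq (ennreal p) M" for f using that True by (simp add: Lp_norm_diff_0_iff)
 ultimately show ?thesis unfolding Lq_C0_semigroup_def Lp.C0_semigroup_def Lq_bounded_linear_iff by auto
qed (auto simp: Lq_C0_semigroup_def Lp.C0_semigroup_def Lq_bounded_linear_iff Lp.lin_def)

lemma Lq_generator_eq:
 assumes "Lq_C0_semigroup (ennreal p) M S"
 shows "Lq_generator (ennreal p) M S = Lp.generator S"
proof -
 have S: "S t f \<in> Lq (ennreal p) M" if "t \<ge> 0" "f \<in> Lq (ennreal p) M" for t f
  using assms that unfolding Lq_C0_semigroup_iff Lp.C0_semigroup_def Lp.lin_def by blast
 have "((\<lambda>t. Lq_norm (ennreal p) M (\<lambda>x. (f x - S t f x) / t - g x)) \<longlongrightarrow> 0) (at_right 0) \<longleftrightarrow>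
   ((\<lambda>t. Lp_norm p M ((1 / t) *\<^sub>R (f - S t f) - g)) \<longlongrightarrow> 0) (at_right 0)"
  if fg: "f \<in> Lq (ennreal p) M" "g \<in> Lq (ennreal p) M" for f g
 proof -
  have "eventually (\<lambda>t. (1 / t) *\<^sub>R (f - S t f) - g \<in> Lq (ennreal p) M) (at_right 0)"
   using fg S by (intro eventually_at_rightI[of 0 1]) auto
  from tendsto_Lq_norm_iff[OF this] show ?thesis by (simp add: fun_diff_def scaleR_fun_def)
 qed
 thus ?thesis unfolding Lq_generator_def Lp.generator_def by blast
qed

text \<open>On \<open>L\<^sub>p\<close> the concrete notions of semigroup and generator are the abstract ones, because seminorm zero
  means equality almost everywhere.\<close>

theorem Lq_unique_iff:
 "Lq_unique (ennreal p) M H \<longleftrightarrow> (\<exists>!G. H \<subseteq> G \<and> (\<exists>S. Lp.C0_semigroup S \<and> G = Lp.generator S))"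
proof -
 have "(\<exists>S. Lq_C0_semigroup (ennreal p) M S \<and> G = Lq_generator (ennreal p) M S) \<longleftrightarrow>
   (\<exists>S. Lp.C0_semigroup S \<and> G = Lp.generator S)" for G
  using Lq_generator_eq Lq_C0_semigroup_iff by metis
 thus ?thesis unfolding Lq_unique_def by simp
qed

end

lemma Lp_norm_2_sq:
 assumes "f \<in> Lq 2 M"
 shows "(Lp_norm 2 M f)\<^sup>2 = (LINT x|M. (f x)\<^sup>2)"
 using Lp_norm_powr[of 2 f M] assms by simp

lemma Lq_2_iff: "f \<in> Lq 2 M \<longleftrightarrow> f \<in> borel_measurable M \<and> integrable M (\<lambda>x. (f x)\<^sup>2)"
 using Lq_iff[of 2 f M] by simp

lemma Lq_2_integrable_mult:
 assumes f: "f \<in> Lq 2 M" and g: "g \<in> Lq 2 M"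
 shows "integrable M (\<lambda>x. f x * g x)"
proof (rule Bochner_Integration.integrable_bound)
 have [measurable]: "f \<in> borel_measurable M" "g \<in> borel_measurable M" using f g Lq_2_iff by auto
 show "integrable M (\<lambda>x. (f x)\<^sup>2 + (g x)\<^sup>2)" using f g by (auto simp: Lq_2_iff)
 show "(\<lambda>x. f x * g x) \<in> borel_measurable M" by measurable
 show "AE x in M. norm (f x * g x) \<le> norm ((f x)\<^sup>2 + (g x)\<^sup>2)"
 proof (rule AE_I2)
  fix x
  have "0 \<le> (\<bar>f x\<bar> - \<bar>g x\<bar>)\<^sup>2" "0 \<le> \<bar>f x\<bar> * \<bar>g x\<bar>" by simp_all
  hence "\<bar>f x\<bar> * \<bar>g x\<bar> \<le> (f x)\<^sup>2 + (g x)\<^sup>2" unfolding power2_diff power2_abs by linarith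
  thus "norm (f x * g x) \<le> norm ((f x)\<^sup>2 + (g x)\<^sup>2)" by (simp add: abs_mult)
 qed
qed

text \<open>Orthogonal projection in \<open>L\<^sub>2\<close>: a minimising sequence for the distance to a subspace is a
  Cauchy sequence by the parallelogram law, and the residual of its limit is orthogonal to the
  subspace.\<close>

lemma L2_dense_if_orthogonal_trivial:
 assumes V: "subspace V" "V \<subseteq> Lq 2 M"
  and orth: "\<And>h. h \<in> Lq 2 M ==> (\<And>v. v \<in> V ==> (LINT x|M. h x * v x) = 0) ==> AE x in M. h x = 0"
  and f: "f \<in> Lq 2 M" and e: "e > 0"
 shows "\<exists>v\<in>V. Lp_norm 2 M (f - v) < e"
proof -
 interpret L2: complete_seminorm "Lq 2 M" "Lp_norm 2 M"
  using Lp_complete_seminorm[of 2 M] by simp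
 have V': "v \<in> Lq 2 M" if "v \<in> V" for v using V that by blast
 have V0: "0 \<in> V" and Vadd: "v \<in> V ==> w \<in> V ==> v + w \<in> V" and Vsc: "v \<in> V ==> a *\<^sub>R v \<in> V" for v w a
  using V(1) by (auto intro: subspace_0 subspace_add subspace_scale)
 define d where "d = (INF v\<in>V. Lp_norm 2 M (f - v))"
 have bdd: "bdd_below ((\<lambda>v. Lp_norm 2 M (f - v)) ` V)" by (rule bdd_belowI2[of _ 0]) simp
 have d_le: "d \<le> Lp_norm 2 M (f - v)" if "v \<in> V" for v unfolding d_def using bdd that by (rule cINF_lower)
 have d0: "0 \<le> d" unfolding d_def using V0 by (intro cINF_greatest) auto
 have "\<exists>v\<in>V. Lp_norm 2 M (f - v) < d + 1 / real (Suc n)" for n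
  using cInf_lessD[of "(\<lambda>v. Lp_norm 2 M (f - v)) ` V" "d + 1 / real (Suc n)"] V0 unfolding d_def by fastforce
 then obtain v where v: "\<And>n. v n \<in> V" "\<And>n. Lp_norm 2 M (f - v n) < d + 1 / real (Suc n)" by metis
 have par: "(Lp_norm 2 M (v m - v n))\<^sup>2 = 2 * (Lp_norm 2 M (f - v n))\<^sup>2 + 2 * (Lp_norm 2 M (f - v m))\<^sup>2
   - 4 * (Lp_norm 2 M (f - (1/2) *\<^sub>R (v m + v n)))\<^sup>2" for m n
 proof -
  define F G where "F = f - v n" and "G = f - v m"
  have FG: "F \<in> Lq 2 M" "G \<in> Lq 2 M" using f V' v by (auto simp: F_def G_def)
  note int = Lq_2_integrable_mult[OF FG] FG[unfolded Lq_2_iff]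
  have "v m - v n = F - G" "f - (1/2) *\<^sub>R (v m + v n) = (1/2) *\<^sub>R (F + G)"
   by (auto simp: F_def G_def fun_eq_iff field_simps)
  moreover have "(Lp_norm 2 M (F - G))\<^sup>2 = (LINT x|M. (F x)\<^sup>2) + (LINT x|M. (G x)\<^sup>2) - 2 * (LINT x|M. F x * G x)"
   using Lp_norm_2_sq[OF L2.X_diff[OF FG]] int by (simp add: power2_diff mult.assoc)
  moreover have "(Lp_norm 2 M ((1/2) *\<^sub>R (F + G)))\<^sup>2 = ((LINT x|M. (F x)\<^sup>2) + (LINT x|M. (G x)\<^sup>2) + 2 * (LINT x|M. F x * G x)) / 4"
   unfolding L2.N_scale[OF L2.X_add[OF FG]] power_mult_distrib
   using Lp_norm_2_sq[OF L2.X_add[OF FG]] int by (simp add: power2_sum mult.assoc power_divide)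
  ultimately show ?thesis
   unfolding F_def[symmetric] G_def[symmetric] using Lp_norm_2_sq[OF FG(1)] Lp_norm_2_sq[OF FG(2)] by simp
 qed
 define r where "r n = (d + 1 / real (Suc n))\<^sup>2 - d\<^sup>2" for n
 have r_nonneg: "0 \<le> r n" and r_mono: "K \<le> n ==> r n \<le> r K" for n K
  using d0 by (auto simp: r_def intro!: power_mono add_left_mono divide_left_mono)
 have r0: "r \<longlonglongrightarrow> 0"
 proof -
  have "(\<lambda>n. (d + 1 / real (Suc n))\<^sup>2 - d\<^sup>2) \<longlonglongrightarrow> (d + 0)\<^sup>2 - d\<^sup>2"
   by (intro tendsto_intros LIMSEQ_Suc[OF lim_1_over_n])
  thus ?thesis by (simp add: r_def[abs_def])
 qed
 have sq: "(Lp_norm 2 M (f - v n))\<^sup>2 \<le> r n + d\<^sup>2" for n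
  unfolding r_def using v(2)[of n] by (simp add: power_mono less_imp_le)
 have cauchy: "(Lp_norm 2 M (v m - v n))\<^sup>2 \<le> 2 * r m + 2 * r n" for m n
 proof -
  have "d\<^sup>2 \<le> (Lp_norm 2 M (f - (1/2) *\<^sub>R (v m + v n)))\<^sup>2"
   using d_le[OF Vsc[OF Vadd[OF v(1) v(1)]], of "1/2" m n] d0 by (intro power_mono)
  thus ?thesis using par[of m n] sq[of m] sq[of n] by linarith
 qed
 have "\<exists>w\<in>Lq 2 M. (\<lambda>n. Lp_norm 2 M (v n - w)) \<longlonglongrightarrow> 0"
 proof (rule L2.N_complete)
  fix e :: real assume e: "e > 0"
  hence "eventually (\<lambda>n. r n < e\<^sup>2 / 4) sequentially" by (intro order_tendstoD(2)[OF r0]) auto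
  then obtain K where K: "\<And>n. n \<ge> K ==> r n < e\<^sup>2 / 4" by (auto simp: eventually_sequentially)
  show "\<exists>K. \<forall>m\<ge>K. \<forall>n\<ge>K. Lp_norm 2 M (v m - v n) < e"
  proof (intro exI[of _ K] allI impI)
   fix m n assume "m \<ge> K" "n \<ge> K"
   hence "(Lp_norm 2 M (v m - v n))\<^sup>2 < e\<^sup>2" using cauchy[of m n] K[of m] K[of n] by linarith
   thus "Lp_norm 2 M (v m - v n) < e" using e by (simp add: power2_less_imp_less)
  qed
 qed (use v V' in auto)
 then obtain w where w: "w \<in> Lq 2 M" "(\<lambda>n. Lp_norm 2 M (v n - w)) \<longlonglongrightarrow> 0" by blast
 define h where "h = f - w"
 have hL: "h \<in> Lq 2 M" using f w by (simp add: h_def)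
 have dist: "d \<le> Lp_norm 2 M (h - u)" if u: "u \<in> V" for u
 proof -
  have "(\<lambda>n. Lp_norm 2 M ((f - (v n + u)) - (h - u))) \<longlonglongrightarrow> 0"
  proof -
   have "Lp_norm 2 M ((f - (v n + u)) - (h - u)) = Lp_norm 2 M (v n - w)" for n
   proof -
    have eq: "(f - (v n + u)) - (h - u) = w - v n" by (simp add: h_def fun_eq_iff)
    show ?thesis unfolding eq using L2.N_commute[OF w(1) V'[OF v(1)]] .
   qed
   thus ?thesis using w by simp
  qed
  hence "(\<lambda>n. Lp_norm 2 M (f - (v n + u))) \<longlonglongrightarrow> Lp_norm 2 M (h - u)"
   by (rule L2.limit_norm[rotated 2]) (use f hL v V' u in auto)
  thus ?thesis by (rule LIMSEQ_le_const) (use d_le Vadd v u in auto)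
 qed
 have h_d: "Lp_norm 2 M h = d"
 proof (rule antisym)
  have "(\<lambda>n. Lp_norm 2 M ((f - v n) - h)) \<longlonglongrightarrow> 0"
  proof -
   have eq: "(f - v n) - h = w - v n" for n by (simp add: h_def fun_eq_iff)
   show ?thesis unfolding eq using w(2) L2.N_commute[OF V'[OF v(1)] w(1)] by simp
  qed
  hence "(\<lambda>n. Lp_norm 2 M (f - v n)) \<longlonglongrightarrow> Lp_norm 2 M h"
   by (rule L2.limit_norm[rotated 2]) (use f hL v V' in auto)
  moreover have "(\<lambda>n. d + 1 / real (Suc n)) \<longlonglongrightarrow> d + 0"
   by (intro tendsto_intros LIMSEQ_Suc[OF lim_1_over_n])
  ultimately have "Lp_norm 2 M h \<le> d + 0"
   by (rule LIMSEQ_le) (intro exI[of _ 0] allI impI less_imp_le v(2))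
  thus "Lp_norm 2 M h \<le> d" by simp
 qed (use dist[OF V0] in simp)
 have "(LINT x|M. h x * u x) = 0" if u: "u \<in> V" for u
 proof -
  define I Q where "I = (LINT x|M. h x * u x)" and "Q = (LINT x|M. (u x)\<^sup>2)"
  have ineq: "0 \<le> t\<^sup>2 * Q - 2 * t * I" for t
  proof -
   have tu: "t *\<^sub>R u \<in> Lq 2 M" using V' u by auto
   have "(Lp_norm 2 M h)\<^sup>2 \<le> (Lp_norm 2 M (h - t *\<^sub>R u))\<^sup>2"
    unfolding h_d using dist[OF Vsc[OF u]] d0 by (intro power_mono)
   also have "(Lp_norm 2 M (h - t *\<^sub>R u))\<^sup>2 = (LINT x|M. (h x)\<^sup>2 + (t\<^sup>2 * (u x)\<^sup>2 - 2 * t * (h x * u x)))"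
    using Lp_norm_2_sq[OF L2.X_diff[OF hL tu]] by (simp add: power2_diff power_mult_distrib algebra_simps)
   also have "\<dots> = (Lp_norm 2 M h)\<^sup>2 + (t\<^sup>2 * Q - 2 * t * I)"
    using Lp_norm_2_sq[OF hL] hL V'[OF u] Lq_2_integrable_mult[OF hL V'[OF u]]
    by (simp add: Lq_2_iff I_def Q_def)
   finally show ?thesis by simp
  qed
  have Q0: "0 \<le> Q" by (simp add: Q_def)
  define t where "t = I / (Q + 1)"
  have "t * (Q + 1) = I" using Q0 by (simp add: t_def)
  hence "t\<^sup>2 * Q - 2 * t * I = - (t\<^sup>2 * (Q + 2))" by (simp add: power2_eq_square algebra_simps flip: \<open>t * (Q + 1) = I\<close>)
  hence "t\<^sup>2 * (Q + 2) \<le> 0" using ineq[of t] by simp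
  hence "t\<^sup>2 \<le> 0" using Q0 by (simp add: mult_le_0_iff)
  hence "t = 0" by simp
  thus ?thesis using \<open>t * (Q + 1) = I\<close> by (simp add: I_def)
 qed
 hence "AE x in M. h x = 0" using orth[OF hL] by blast
 hence "d = 0" using Lp_norm_eq_0_iff[of 2 h M] hL h_d by simp
 moreover obtain n where "1 / real (Suc n) < e" using nat_approx_posE[OF e] by blast
 ultimately show ?thesis using v(1)[of n] v(2)[of n] by (intro bexI[of _ "v n"]) auto
qed

section \<open>Functions of class \<open>C\<^sup>k\<close> and their convolutions\<close>

lemma has_derivative_imp_pd: "(f has_derivative f') (at x) ==> pd i f x = f' (axis i 1)"
 by (simp add: pd_def frechet_derivative_at[symmetric])

lemma has_derivative_pd:
 fixes f :: "real^'n => real"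
 assumes "f differentiable (at x)"
 shows "(f has_derivative (\<lambda>h. \<Sum>i\<in>UNIV. h $ i * pd i f x)) (at x)"
proof -
 define f' where "f' = frechet_derivative f (at x)"
 have f': "(f has_derivative f') (at x)" using assms by (simp add: f'_def frechet_derivative_works)
 have lin: "linear f'" using f' has_derivative_linear by blast
 have "f' h = (\<Sum>i\<in>UNIV. h $ i * pd i f x)" for h
 proof -
  have "f' h = f' (\<Sum>i\<in>UNIV. (h $ i) *\<^sub>R axis i 1)" by (simp add: basis_expansion scalar_mult_eq_scaleR flip: scalar_mult_eq_scaleR)
  also have "\<dots> = (\<Sum>i\<in>UNIV. h $ i * pd i f x)"
   using lin by (simp add: linear_sum linear_scale has_derivative_imp_pd[OF f'])
  finally show ?thesis .
 qed
 thus ?thesis using f' by presburger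
qed

lemma Ck_continuous: "Ck k f ==> continuous_on UNIV f"
 by (cases k) (auto simp: continuous_on_eq_continuous_within differentiable_imp_continuous_within)

lemma Ck_Suc_imp: "Ck (Suc k) f ==> Ck k f"
proof (induction k arbitrary: f)
 case 0
 thus ?case using Ck_continuous[OF 0] by simp
next
 case (Suc k)
 thus ?case by (metis Ck.simps(2))
qed

lemma Ck_le: "Ck k f ==> j \<le> k ==> Ck j f"
proof (induction k)
 case (Suc k)
 thus ?case using Ck_Suc_imp[of k f] by (cases "j = Suc k") auto
qed simp

lemma Ck_differentiable: "Ck (Suc k) f ==> f differentiable (at x)"
 by simp

lemma pd_add: "f differentiable (at x) ==> g differentiable (at x) ==> pd i (\<lambda>x. f x + g x) x = pd i f x + pd i g x"
 by (rule has_derivative_imp_pd[THEN trans, OF has_derivative_add])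
   (auto simp: frechet_derivative_works[symmetric] pd_def)

lemma pd_mult: "f differentiable (at x) ==> g differentiable (at x) ==>
  pd i (\<lambda>x. f x * g x) x = f x * pd i g x + pd i f x * g x"
 by (rule has_derivative_imp_pd[THEN trans, OF has_derivative_mult])
   (auto simp: frechet_derivative_works[symmetric] pd_def)

lemma pd_cmult: "f differentiable (at x) ==> pd i (\<lambda>x. c * f x) x = c * pd i f x"
 by (rule has_derivative_imp_pd[THEN trans, OF has_derivative_mult_right])
   (auto simp: frechet_derivative_works[symmetric] pd_def)

lemma pd_compose:
 fixes f :: "real^'n => real"
 assumes "f differentiable (at x)" "(F has_real_derivative F') (at (f x))"
 shows "((\<lambda>x. F (f x)) has_derivative (\<lambda>h. F' * frechet_derivative f (at x) h)) (at x)"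
  and "pd i (\<lambda>x. F (f x)) x = F' * pd i f x"
proof -
 show d: "((\<lambda>x. F (f x)) has_derivative (\<lambda>h. F' * frechet_derivative f (at x) h)) (at x)"
  using has_derivative_compose[OF assms(1)[unfolded frechet_derivative_works] assms(2)[unfolded has_field_derivative_def]] .
 show "pd i (\<lambda>x. F (f x)) x = F' * pd i f x" using has_derivative_imp_pd[OF d] by (simp add: pd_def)
qed

lemma pd_affine:
 fixes f :: "real^'n => real"
 assumes "f differentiable (at (a + c *\<^sub>R x))"
 shows "(\<lambda>x. f (a + c *\<^sub>R x)) differentiable (at x)" "pd i (\<lambda>x. f (a + c *\<^sub>R x)) x = c * pd i f (a + c *\<^sub>R x)"
proof -
 have "((\<lambda>x. a + c *\<^sub>R x) has_derivative (\<lambda>h. c *\<^sub>R h)) (at x)" by (auto intro!: derivative_eq_intros)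
 from has_derivative_compose[OF this assms[unfolded frechet_derivative_works]]
 have d: "((\<lambda>x. f (a + c *\<^sub>R x)) has_derivative (\<lambda>h. frechet_derivative f (at (a + c *\<^sub>R x)) (c *\<^sub>R h))) (at x)" .
 show "(\<lambda>x. f (a + c *\<^sub>R x)) differentiable (at x)" using d by (rule differentiableI)
 have "linear (frechet_derivative f (at (a + c *\<^sub>R x)))"
  using assms[unfolded frechet_derivative_works] has_derivative_linear by blast
 thus "pd i (\<lambda>x. f (a + c *\<^sub>R x)) x = c * pd i f (a + c *\<^sub>R x)"
  using has_derivative_imp_pd[OF d] by (simp add: pd_def linear_scale)
qed

lemma Ck_add: "Ck k f ==> Ck k g ==> Ck k (\<lambda>x. f x + g x)"
proof (induction k arbitrary: f g)
 case (Suc k)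
 have "pd i (\<lambda>x. f x + g x) = (\<lambda>x. pd i f x + pd i g x)" for i using Suc.prems by (auto simp: pd_add)
 thus ?case using Suc by (auto intro: differentiable_add)
qed (auto intro: continuous_intros)

lemma Ck_mult: "Ck k f ==> Ck k g ==> Ck k (\<lambda>x. f x * g x)"
proof (induction k arbitrary: f g)
 case (Suc k)
 have "pd i (\<lambda>x. f x * g x) = (\<lambda>x. f x * pd i g x + pd i f x * g x)" for i using Suc.prems by (auto simp: pd_mult)
 moreover have "Ck k (\<lambda>x. f x * pd i g x + pd i f x * g x)" for i
  using Suc.prems Ck_Suc_imp[OF Suc.prems(1)] Ck_Suc_imp[OF Suc.prems(2)] by (intro Ck_add Suc.IH) auto
 ultimately show ?case using Suc.prems by (auto intro: differentiable_mult)
qed (auto intro: continuous_intros)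

lemma pd_const: "pd i (\<lambda>_. c) = (\<lambda>_. 0)"
 by (simp add: pd_def fun_eq_iff)

lemma Ck_const: "Ck k (\<lambda>_. c)"
 by (induction k arbitrary: c) (auto simp: pd_const intro: differentiable_const)

lemma Ck_affine: "Ck k f ==> Ck k (\<lambda>x. f (a + c *\<^sub>R x))"
proof (induction k arbitrary: f)
 case (Suc k)
 have "pd i (\<lambda>x. f (a + c *\<^sub>R x)) = (\<lambda>x. c * pd i f (a + c *\<^sub>R x))" for i using Suc.prems by (auto simp: pd_affine)
 moreover have "Ck k (\<lambda>x. c * pd i f (a + c *\<^sub>R x))" for i
  using Suc by (intro Ck_mult Ck_const Suc.IH) auto
 ultimately show ?case using Suc.prems by (auto intro: pd_affine(1))
next
 case 0
 thus ?case by (auto intro!: continuous_intros continuous_on_compose2[of UNIV f])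
qed

text \<open>The compactly supported functions of class \<open>C\<^sup>k\<close>, with the support condition in the form in
  which it is used: vanishing off some compact subset.\<close>

definition Cc :: "nat => (real^'n::finite) set => (real^'n => real) set" where
 "Cc k \<Omega> = {f. Ck k f \<and> (\<exists>K. compact K \<and> K \<subseteq> \<Omega> \<and> (\<forall>x. x \<notin> K \<longrightarrow> f x = 0))}"

lemma CcI: "Ck k f ==> compact K ==> K \<subseteq> \<Omega> ==> (\<And>x. x \<notin> K ==> f x = 0) ==> f \<in> Cc k \<Omega>"
 by (auto simp: Cc_def)

lemma Cc_support: "f \<in> Cc k \<Omega> ==> \<exists>K. compact K \<and> K \<subseteq> \<Omega> \<and> (\<forall>x. x \<notin> K \<longrightarrow> f x = 0)"
 by (simp add: Cc_def)

lemma Cc_Ck: "f \<in> Cc k \<Omega> ==> Ck k f"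
 by (simp add: Cc_def)

lemma Cc_mono: "f \<in> Cc k \<Omega> ==> \<Omega> \<subseteq> \<Omega>' ==> f \<in> Cc k \<Omega>'"
 unfolding Cc_def by blast

lemma Cc_le: "f \<in> Cc k \<Omega> ==> j \<le> k ==> f \<in> Cc j \<Omega>"
 unfolding Cc_def using Ck_le by blast

lemma Cc_outside: "f \<in> Cc k \<Omega> ==> x \<notin> \<Omega> ==> f x = 0"
 by (auto simp: Cc_def)

lemma test_functions_iff: "\<phi> \<in> test_functions \<Omega> \<longleftrightarrow> (\<forall>k. \<phi> \<in> Cc k \<Omega>)"
proof
 assume \<phi>: "\<phi> \<in> test_functions \<Omega>"
 define K where "K = closure {x. \<phi> x \<noteq> 0}"
 have z: "\<phi> x = 0" if "x \<notin> K" for x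
  using that closure_subset[of "{x. \<phi> x \<noteq> 0}"] unfolding K_def by blast
 have K: "compact K" "K \<subseteq> \<Omega>" "\<And>k. Ck k \<phi>" using \<phi> by (auto simp: test_functions_def K_def)
 show "\<forall>k. \<phi> \<in> Cc k \<Omega>" using CcI[OF K(3,1,2) z] by blast
next
 assume \<phi>: "\<forall>k. \<phi> \<in> Cc k \<Omega>"
 then obtain K where K: "compact K" "K \<subseteq> \<Omega>" "\<And>x. x \<notin> K ==> \<phi> x = 0" using Cc_support[of \<phi> 0] by blast
 have "closure {x. \<phi> x \<noteq> 0} \<subseteq> K"
  using K by (intro closure_minimal) (auto simp: compact_imp_closed)
 moreover from this K(1) have "compact (closure {x. \<phi> x \<noteq> 0})"
  by (metis closed_closure compact_Int_closed inf.absorb_iff2)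
 ultimately show "\<phi> \<in> test_functions \<Omega>" using \<phi> K by (auto simp: test_functions_def Cc_def)
qed

lemma pd_zero_off:
 assumes "compact K" "\<And>x. x \<notin> K ==> f x = 0" "x \<notin> K"
 shows "pd i f x = (0::real)"
proof -
 have "(f has_derivative (\<lambda>h. 0)) (at x)"
  by (rule has_derivative_transform_within_open[of "\<lambda>_. 0" _ _ _ "- K"])
    (use assms in \<open>auto simp: compact_imp_closed\<close>)
 thus ?thesis using has_derivative_imp_pd by fastforce
qed

lemma Cc_pd: "f \<in> Cc (Suc k) \<Omega> ==> pd i f \<in> Cc k \<Omega>"
 using pd_zero_off[of _ f _ i] by (force simp: Cc_def)

lemma Cc_add: "f \<in> Cc k \<Omega> ==> g \<in> Cc k \<Omega> ==> (\<lambda>x. f x + g x) \<in> Cc k \<Omega>"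
proof -
 assume fg: "f \<in> Cc k \<Omega>" "g \<in> Cc k \<Omega>"
 have "Ck k (\<lambda>x. f x + g x)" using fg Cc_Ck Ck_add by blast
 obtain K where K: "compact K" "K \<subseteq> \<Omega>" "\<And>x. x \<notin> K ==> f x = 0" using Cc_support[OF fg(1)] by blast
 obtain L where L: "compact L" "L \<subseteq> \<Omega>" "\<And>x. x \<notin> L ==> g x = 0" using Cc_support[OF fg(2)] by blast
 show ?thesis by (rule CcI[of _ _ "K \<union> L"]) (use K L \<open>Ck k _\<close> in auto)
qed

lemma Cc_mult: "f \<in> Cc k \<Omega> ==> Ck k g ==> (\<lambda>x. f x * g x) \<in> Cc k \<Omega>"
 using Ck_mult[of k f g] by (force simp: Cc_def)

lemma Cc_cmult: "f \<in> Cc k \<Omega> ==> (\<lambda>x. c * f x) \<in> Cc k \<Omega>"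
 using Cc_mult[OF _ Ck_const, of f k \<Omega> c] by (simp add: mult.commute)

lemma Cc_continuous: "f \<in> Cc k \<Omega> ==> continuous_on UNIV f"
 using Cc_Ck Ck_continuous by blast

lemma Cc_measurable [measurable_dest]: "f \<in> Cc k \<Omega> ==> f \<in> borel_measurable borel"
 using Cc_continuous borel_measurable_continuous_onI by blast

lemma Cc_integrable: "f \<in> Cc k \<Omega> ==> integrable lborel f"
proof -
 assume f: "f \<in> Cc k \<Omega>"
 then obtain K where K: "compact K" "\<And>x. x \<notin> K ==> f x = 0" using Cc_support[OF f] by blast
 have "(\<lambda>x. indicator K x *\<^sub>R f x) = f" using K by (auto simp: fun_eq_iff indicator_def)
 thus ?thesis using borel_integrable_compact[OF K(1) continuous_on_subset[OF Cc_continuous[OF f] subset_UNIV]] by simp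
qed

lemma Cc_bounded:
 assumes "f \<in> Cc k \<Omega>"
 obtains B where "B \<ge> 0" "\<And>x. \<bar>f x\<bar> \<le> B"
proof -
 obtain K where K: "compact K" "\<And>x. x \<notin> K ==> f x = 0" using Cc_support[OF assms] by blast
 have "continuous_on K f" by (rule continuous_on_subset[OF Cc_continuous[OF assms] subset_UNIV])
 hence "bounded (f ` K)" using K compact_continuous_image compact_imp_bounded by blast
 then obtain B where B: "\<And>x. x \<in> K ==> \<bar>f x\<bar> \<le> B" by (auto simp: bounded_iff)
 show ?thesis
 proof (rule that[of "max B 0"])
  fix x
  show "\<bar>f x\<bar> \<le> max B 0" using B[of x] K(2)[of x] by (cases "x \<in> K") auto
 qed simp
qed

lemma integrable_mult_bounded:
 assumes "integrable M F" "f \<in> borel_measurable M" "\<And>x. \<bar>f x\<bar> \<le> (B::real)"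
 shows "integrable M (\<lambda>x. F x * f x)"
proof (rule Bochner_Integration.integrable_bound[of _ "\<lambda>x. B * F x"])
 show "AE x in M. norm (F x * f x) \<le> norm (B * F x)"
 proof (rule AE_I2)
  fix x
  have "\<bar>f x\<bar> \<le> \<bar>B\<bar>" using assms(3)[of x] by simp
  from mult_left_mono[OF this, of "\<bar>F x\<bar>"] show "norm (F x * f x) \<le> norm (B * F x)"
   by (simp add: abs_mult mult.commute)
 qed
qed (use assms in \<open>auto intro: borel_measurable_times\<close>)

lemma compact_neighbourhood:
 assumes "compact (K :: 'a::euclidean_space set)"
 shows "compact {x + y | x y. x \<in> K \<and> y \<in> cball 0 r}"
 using compact_sums[OF assms compact_cball] .

lemma Cc_uniformly_continuous:
 assumes f: "f \<in> Cc k \<Omega>" and e: "e > 0"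
 obtains d where "d > 0" "\<And>x h. norm h < d ==> \<bar>f (x + h) - f x\<bar> < e"
proof -
 obtain K where K: "compact K" "\<And>x. x \<notin> K ==> f x = 0" using Cc_support[OF f] by blast
 define K' where "K' = {x + y | x y. x \<in> K \<and> y \<in> cball 0 1}"
 have "uniformly_continuous_on K' f"
  unfolding K'_def
  by (rule compact_uniformly_continuous[OF continuous_on_subset[OF Cc_continuous[OF f] subset_UNIV] compact_neighbourhood[OF K(1)]])
 then obtain d where d: "d > 0" "\<And>x y. x \<in> K' ==> y \<in> K' ==> dist y x < d ==> dist (f y) (f x) < e"
  unfolding uniformly_continuous_on_def using e by metis
 have "\<bar>f (x + h) - f x\<bar> < e" if h: "norm h < min d 1" for x h
 proof (cases "x \<in> K \<or> x + h \<in> K")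
  case True
  have "x \<in> K'" "x + h \<in> K'"
  proof -
   have "x = x + 0" "x = (x + h) + (- h)" "x + h = (x + h) + 0" by auto
   thus "x \<in> K'" "x + h \<in> K'"
    using True h unfolding K'_def mem_Collect_eq by (metis mem_cball_0 norm_minus_cancel norm_zero zero_le_one less_imp_le min_less_iff_conj)+
  qed
  thus ?thesis using d(2)[of x "x + h"] h by (simp add: dist_norm)
 qed (use K(2) e in auto)
 thus ?thesis using that[of "min d 1"] d(1) by auto
qed

lemma sum_axis: "(\<Sum>j\<in>UNIV. axis i 1 $ j * c j) = (c i :: real)"
proof -
 have "axis i 1 $ j * c j = (if j = i then c j else 0)" for j by (simp add: axis_def)
 thus ?thesis by simp
qed

text \<open>The remainder of a compactly supported \<open>C\<^sup>1\<close> function is small uniformly in the base point. This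
  is what allows differentiation under the integral sign.\<close>

lemma Cc_uniformly_differentiable:
 fixes f :: "real^'n => real"
 assumes f: "f \<in> Cc (Suc k) \<Omega>" and e: "e > 0"
 obtains d where "d > 0" "\<And>x h. norm h < d ==> \<bar>f (x + h) - f x - (\<Sum>i\<in>UNIV. h $ i * pd i f x)\<bar> \<le> e * norm h"
proof -
 define N where "N = real CARD('n)"
 have N: "N > 0" by (simp add: N_def)
 have "\<exists>d>0. \<forall>x h. norm h < d \<longrightarrow> \<bar>pd i f (x + h) - pd i f x\<bar> < e / N" for i
  using Cc_uniformly_continuous[OF Cc_pd[OF f], of "e / N" i] e N by (metis divide_pos_pos)
 then obtain \<delta> where \<delta>: "\<And>i. \<delta> i > 0" "\<And>i x h. norm h < \<delta> i ==> \<bar>pd i f (x + h) - pd i f x\<bar> < e / N" by metis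
 define d where "d = Min (range \<delta>)"
 have d: "d > 0" "d \<le> \<delta> i" for i using \<delta> by (auto simp: d_def)
 have "\<bar>f (x + h) - f x - (\<Sum>i\<in>UNIV. h $ i * pd i f x)\<bar> \<le> e * norm h" if h: "norm h < d" for x h
 proof -
  have "((\<lambda>t. f (x + t *\<^sub>R h)) has_derivative (\<lambda>s. \<Sum>i\<in>UNIV. (s *\<^sub>R h) $ i * pd i f (x + t *\<^sub>R h))) (at t within {0..1})" for t
  proof (rule has_derivative_compose[of "\<lambda>t. x + t *\<^sub>R h" "\<lambda>s. s *\<^sub>R h" t "{0..1}" f])
   show "((\<lambda>t. x + t *\<^sub>R h) has_derivative (\<lambda>s. s *\<^sub>R h)) (at t within {0..1})" by (auto intro!: derivative_eq_intros)
  qed (use has_derivative_pd Ck_differentiable Cc_Ck[OF f] in blast)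
  from mvt_very_simple[OF zero_le_one this] obtain t where t: "t \<in> {0..1}"
   "f (x + h) - f x = (\<Sum>i\<in>UNIV. h $ i * pd i f (x + t *\<^sub>R h))" by auto
  have "norm (t *\<^sub>R h) \<le> 1 * norm h" using t(1) by (simp add: mult_left_le_one_le)
  hence th: "norm (t *\<^sub>R h) < \<delta> i" for i using h d(2)[of i] by simp
  have "\<bar>f (x + h) - f x - (\<Sum>i\<in>UNIV. h $ i * pd i f x)\<bar> = \<bar>\<Sum>i\<in>UNIV. h $ i * (pd i f (x + t *\<^sub>R h) - pd i f x)\<bar>"
   by (simp add: t(2) sum_subtractf right_diff_distrib)
  also have "\<dots> \<le> (\<Sum>i\<in>UNIV. \<bar>h $ i * (pd i f (x + t *\<^sub>R h) - pd i f x)\<bar>)" by (rule sum_abs)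
  also have "\<dots> \<le> (\<Sum>i\<in>(UNIV :: 'n set). norm h * (e / N))"
  proof (rule sum_mono)
   fix i
   show "\<bar>h $ i * (pd i f (x + t *\<^sub>R h) - pd i f x)\<bar> \<le> norm h * (e / N)"
    using mult_mono[OF component_le_norm_cart[of h i] less_imp_le[OF \<delta>(2)[OF th[of i], of x]]]
    by (simp add: abs_mult)
  qed
  also have "\<dots> = e * norm h" using N by (simp add: N_def)
  finally show ?thesis .
 qed
 thus ?thesis using that d(1) by blast
qed

lemma lborel_distr_minus: "distr lborel borel (\<lambda>y. x - y) = (lborel :: 'a::euclidean_space measure)"
 using lborel_affine[of "-1" x] by (simp add: density_1)

lemma
 fixes f :: "'a::euclidean_space => real"
 assumes [measurable]: "f \<in> borel_measurable borel"
 shows lborel_integral_translate: "(LINT x|lborel. f (x + a)) = (LINT x|lborel. f x)"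
  and lborel_integral_reflect: "(LINT y|lborel. f (x - y)) = (LINT y|lborel. f y)"
  and lborel_integrable_translate: "integrable lborel (\<lambda>x. f (x + a)) \<longleftrightarrow> integrable lborel f"
  and lborel_integrable_reflect: "integrable lborel (\<lambda>y. f (x - y)) \<longleftrightarrow> integrable lborel f"
proof -
 have 1: "(\<lambda>x. x + a) = (+) a" by (auto simp: fun_eq_iff add.commute)
 show "(LINT x|lborel. f (x + a)) = (LINT x|lborel. f x)"
  by (subst lborel_distr_plus[of a, symmetric], subst integral_distr) (auto simp: add.commute)
 show "(LINT y|lborel. f (x - y)) = (LINT y|lborel. f y)"
  by (subst (2) lborel_distr_minus[of x, symmetric], subst integral_distr) auto
 show "integrable lborel (\<lambda>x. f (x + a)) \<longleftrightarrow> integrable lborel f"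
  by (subst (2) lborel_distr_plus[of a, symmetric], subst integrable_distr_eq) (auto simp: add.commute)
 show "integrable lborel (\<lambda>y. f (x - y)) \<longleftrightarrow> integrable lborel f"
  by (subst (2) lborel_distr_minus[of x, symmetric], subst integrable_distr_eq) auto
qed

lemma integral_abs_le_compact:
 fixes f :: "real^'n => real"
 assumes K: "compact K" and f: "f \<in> borel_measurable borel" "\<And>x. x \<notin> K ==> f x = 0" "\<And>x. \<bar>f x\<bar> \<le> e"
 shows "integrable lborel f" "\<bar>LINT x|lborel. f x\<bar> \<le> e * measure lborel K"
proof -
 have K': "K \<in> sets lborel" "emeasure lborel K < \<infinity>"
  using K emeasure_lborel_cbox_finite emeasure_compact_finite by (auto simp: compact_imp_closed borel_closed)
 show int: "integrable lborel f"
  by (rule integrableI_bounded_set[of K _ _ e]) (use K' f in auto)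
 have "\<bar>LINT x|lborel. f x\<bar> \<le> (LINT x|lborel. \<bar>f x\<bar>)"
  using integral_norm_bound[of lborel f] by simp
 also have "\<dots> \<le> (LINT x|lborel. indicator K x * e)"
 proof (rule integral_mono)
  show "integrable lborel (\<lambda>x. indicator K x * e)"
   using K' by (intro integrable_mult_left integrable_real_indicator) auto
  fix x show "\<bar>f x\<bar> \<le> indicator K x * e" using f(2,3)[of x] by (cases "x \<in> K") auto
 qed (use int in auto)
 finally show "\<bar>LINT x|lborel. f x\<bar> \<le> e * measure lborel K" using K' by (simp add: mult.commute)
qed

text \<open>The integral of a partial derivative vanishes: the difference quotients have integral zero by
  translation invariance and converge uniformly within a fixed compact set.\<close>

lemma integral_pd_eq_0:
 fixes f :: "real^'n => real"
 assumes f: "f \<in> Cc (Suc k) \<Omega>"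
 shows "(LINT x|lborel. pd i f x) = 0"
proof -
 obtain K where K: "compact K" "\<And>x. x \<notin> K ==> f x = 0" using Cc_support[OF f] by blast
 define K' where "K' = {x + y | x y. x \<in> K \<and> y \<in> cball 0 (1::real)}"
 have K': "compact K'" unfolding K'_def using compact_neighbourhood[OF K(1)] .
 have KK: "x \<in> K'" if "x + h \<in> K" "norm h \<le> 1" for x h
  unfolding K'_def by (rule CollectI, rule exI[of _ "x + h"], rule exI[of _ "- h"]) (use that in auto)
 have "\<bar>LINT x|lborel. pd i f x\<bar> \<le> 0 + e" if e: "e > 0" for e
 proof -
  define e' where "e' = e / (measure lborel K' + 1)"
  have m: "0 < measure lborel K' + 1" using measure_nonneg[of lborel K'] by linarith
  hence e': "e' > 0" "e' * (measure lborel K' + 1) = e" using e by (auto simp: e'_def)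
  hence e'_le: "e' * measure lborel K' \<le> e" by (simp add: distrib_left)
  obtain d where d: "d > 0" "\<And>x h. norm h < d ==> \<bar>f (x + h) - f x - (\<Sum>i\<in>UNIV. h $ i * pd i f x)\<bar> \<le> e' * norm h"
   using Cc_uniformly_differentiable[OF f e'(1)] by blast
  define t where "t = min 1 (d / 2)"
  define h :: "real^'n" where "h = t *\<^sub>R axis i 1"
  have t: "t > 0" "t \<le> 1" "t < d" using d by (auto simp: t_def)
  have h: "norm h = t" "norm h < d" using t by (auto simp: h_def)
  have hs: "(\<Sum>j\<in>UNIV. h $ j * pd j f x) = t * pd i f x" for x
   using sum_axis[of i "\<lambda>j. pd j f x"] by (simp add: h_def mult.assoc flip: sum_distrib_left)
  define q where "q x = (f (x + h) - f x) / t - pd i f x" for x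
  have [measurable]: "f \<in> borel_measurable borel" "pd i f \<in> borel_measurable borel"
   using Cc_measurable[OF f] Cc_measurable[OF Cc_pd[OF f]] by auto
  have q_le: "\<bar>q x\<bar> \<le> e'" for x
  proof -
   have "q x = (f (x + h) - f x - t * pd i f x) / t" using t by (simp add: q_def diff_divide_distrib)
   thus ?thesis using d(2)[OF h(2), of x] t unfolding hs h by (simp add: divide_le_eq)
  qed
  have q_out: "q x = 0" if x: "x \<notin> K'" for x
  proof -
   have nk: "x \<notin> K" "x + h \<notin> K" using x KK[of x h] KK[of x 0] h t by auto
   show ?thesis using K(2)[OF nk(1)] K(2)[OF nk(2)] pd_zero_off[OF K(1) _ nk(1), of f i] K(2) by (simp add: q_def)
  qed
  have qm: "q \<in> borel_measurable borel" unfolding q_def by measurable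
  have q_int: "integrable lborel q" "\<bar>LINT x|lborel. q x\<bar> \<le> e' * measure lborel K'"
   by (rule integral_abs_le_compact[OF K' qm q_out q_le], assumption)+
  have fi: "integrable lborel f" "integrable lborel (\<lambda>x. f (x + h))" "integrable lborel (pd i f)"
   using Cc_integrable[OF f] Cc_integrable[OF Cc_pd[OF f]] lborel_integrable_translate[of f h] by auto
  have "(LINT x|lborel. q x) = ((LINT x|lborel. f (x + h)) - (LINT x|lborel. f x)) / t - (LINT x|lborel. pd i f x)"
   unfolding q_def using fi by simp
  hence "(LINT x|lborel. q x) = - (LINT x|lborel. pd i f x)" by (simp add: lborel_integral_translate)
  thus ?thesis using q_int e'_le by simp
 qed
 hence "\<bar>LINT x|lborel. pd i f x\<bar> \<le> 0" by (rule field_le_epsilon)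
 thus ?thesis by simp
qed

lemma integration_by_parts:
 fixes f g :: "real^'n => real"
 assumes f: "f \<in> Cc (Suc k) \<Omega>" and g: "Ck (Suc k) g"
 shows "(LINT x|lborel. f x * pd i g x) = - (LINT x|lborel. pd i f x * g x)"
proof -
 have eq: "pd i (\<lambda>x. f x * g x) = (\<lambda>x. f x * pd i g x + pd i f x * g x)"
  using Cc_Ck[OF f] g by (auto simp: pd_mult)
 have "integrable lborel (\<lambda>x. f x * pd i g x)" "integrable lborel (\<lambda>x. pd i f x * g x)"
  using Cc_integrable[OF Cc_mult[OF Cc_le[OF f le_SucI[OF order_refl]]]] Cc_integrable[OF Cc_mult[OF Cc_pd[OF f] Ck_Suc_imp[OF g]]] g by auto
 thus ?thesis using integral_pd_eq_0[OF Cc_mult[OF f g], of i] unfolding eq by simp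
qed

definition conv :: "(real^'n::finite => real) => (real^'n => real) => real^'n => real" where
 "conv F f x = (LINT y|lborel. F y * f (x - y))"

lemma conv_integrable:
 assumes F: "integrable lborel F" and f: "f \<in> Cc k \<Omega>"
 shows "integrable lborel (\<lambda>y. F y * f (x - y))"
proof -
 obtain B where B: "\<And>x. \<bar>f x\<bar> \<le> B" using Cc_bounded[OF f] by blast
 have [measurable]: "f \<in> borel_measurable borel" by (rule Cc_measurable[OF f])
 show ?thesis by (rule integrable_mult_bounded[OF F, of _ B]) (use B in auto)
qed

lemma conv_bounded_diff:
 fixes F u :: "real^'n => real"
 assumes F: "integrable lborel F" and u: "\<And>y. integrable lborel (\<lambda>y. F y * u y)" "\<And>y. \<bar>u y\<bar> \<le> e"
 shows "\<bar>LINT y|lborel. F y * u y\<bar> \<le> e * (LINT y|lborel. \<bar>F y\<bar>)"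
proof -
 have "\<bar>LINT y|lborel. F y * u y\<bar> \<le> (LINT y|lborel. \<bar>F y * u y\<bar>)"
  using integral_norm_bound[of lborel "\<lambda>y. F y * u y"] by simp
 also have "\<dots> \<le> (LINT y|lborel. e * \<bar>F y\<bar>)"
 proof (rule integral_mono)
  fix y
  show "\<bar>F y * u y\<bar> \<le> e * \<bar>F y\<bar>"
   using mult_left_mono[OF u(2)[of y], of "\<bar>F y\<bar>"] by (simp add: abs_mult mult.commute)
 qed (use F u in auto)
 finally show ?thesis using F by simp
qed

lemma conv_continuous:
 fixes f :: "real^'n => real"
 assumes F: "integrable lborel F" and f: "f \<in> Cc k \<Omega>"
 shows "continuous_on UNIV (conv F f)"
proof -
 define I where "I = (LINT y|lborel. \<bar>F y\<bar>) + 1"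
 have I: "I > 0" "(LINT y|lborel. \<bar>F y\<bar>) \<le> I" by (auto simp: I_def add_nonneg_pos)
 show ?thesis
  unfolding continuous_on_iff
 proof (intro ballI allI impI)
  fix x :: "real^'n" and e :: real assume e: "e > 0"
  obtain d where d: "d > 0" "\<And>x h. norm h < d ==> \<bar>f (x + h) - f x\<bar> < e / (2 * I)"
   using Cc_uniformly_continuous[OF f, of "e / (2 * I)"] e I by auto
  show "\<exists>d>0. \<forall>x'\<in>UNIV. dist x' x < d \<longrightarrow> dist (conv F f x') (conv F f x) < e"
  proof (intro exI[of _ d] conjI d ballI impI)
   fix x' assume "dist x' x < d"
   hence h: "norm (x' - x) < d" by (simp add: dist_norm)
   have "conv F f x' - conv F f x = (LINT y|lborel. F y * (f (x' - y) - f (x - y)))"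
    unfolding conv_def using conv_integrable[OF F f] by (simp add: right_diff_distrib)
   also have "\<bar>\<dots>\<bar> \<le> e / (2 * I) * (LINT y|lborel. \<bar>F y\<bar>)"
   proof (rule conv_bounded_diff[OF F])
    fix y
    show "\<bar>f (x' - y) - f (x - y)\<bar> \<le> e / (2 * I)" using d(2)[OF h, of "x - y"] by simp
    show "integrable lborel (\<lambda>y. F y * (f (x' - y) - f (x - y)))"
     using conv_integrable[OF F f] by (simp add: right_diff_distrib)
   qed
   also have "\<dots> \<le> e / (2 * I) * I" using I e by (intro mult_left_mono) auto
   also have "\<dots> < e" using I e by simp
   finally show "dist (conv F f x') (conv F f x) < e" by (simp add: dist_real_def)
  qed
 qed
qed

lemma conv_has_derivative:
 fixes f :: "real^'n => real"
 assumes F: "integrable lborel F" and f: "f \<in> Cc (Suc k) \<Omega>"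
 shows "(conv F f has_derivative (\<lambda>h. \<Sum>i\<in>UNIV. h $ i * conv F (pd i f) x)) (at x)"
 unfolding has_derivative_at_alt
proof (intro conjI allI impI)
 show "bounded_linear (\<lambda>h::real^'n. \<Sum>i\<in>UNIV. h $ i * conv F (pd i f) x)"
  by (intro bounded_linear_sum bounded_linear_mult_const bounded_linear_vec_nth)
 define I where "I = (LINT y|lborel. \<bar>F y\<bar>) + 1"
 have I: "I > 0" "(LINT y|lborel. \<bar>F y\<bar>) \<le> I" by (auto simp: I_def add_nonneg_pos)
 fix e :: real assume e: "e > 0"
 obtain d where d: "d > 0" "\<And>x h. norm h < d ==> \<bar>f (x + h) - f x - (\<Sum>i\<in>UNIV. h $ i * pd i f x)\<bar> \<le> e / I * norm h"
  using Cc_uniformly_differentiable[OF f, of "e / I"] e I by auto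
 show "\<exists>d>0. \<forall>y. norm (y - x) < d \<longrightarrow> norm (conv F f y - conv F f x - (\<Sum>i\<in>UNIV. (y - x) $ i * conv F (pd i f) x)) \<le> e * norm (y - x)"
 proof (intro exI[of _ d] conjI d allI impI)
  fix x' assume h: "norm (x' - x) < d"
  define h where "h = x' - x"
  note int = conv_integrable[OF F f] conv_integrable[OF F Cc_pd[OF f]]
  have int': "integrable lborel (\<lambda>y. F y * (f (x' - y) - f (x - y) - (\<Sum>i\<in>UNIV. h $ i * pd i f (x - y))))"
  proof -
   have "integrable lborel (\<lambda>y. F y * f (x' - y) - F y * f (x - y) - (\<Sum>i\<in>UNIV. h $ i * (F y * pd i f (x - y))))"
    using int by (intro Bochner_Integration.integrable_diff Bochner_Integration.integrable_sum integrable_mult_right) auto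
   thus ?thesis by (simp add: right_diff_distrib sum_distrib_left mult_ac)
  qed
  have "conv F f x' - conv F f x - (\<Sum>i\<in>UNIV. h $ i * conv F (pd i f) x)
    = (LINT y|lborel. F y * f (x' - y) - F y * f (x - y) - (\<Sum>i\<in>UNIV. h $ i * (F y * pd i f (x - y))))"
   unfolding conv_def using int by (simp add: integral_sum)
  also have "\<dots> = (LINT y|lborel. F y * (f (x' - y) - f (x - y) - (\<Sum>i\<in>UNIV. h $ i * pd i f (x - y))))"
   by (simp add: right_diff_distrib sum_distrib_left mult_ac)
  also have "\<bar>\<dots>\<bar> \<le> e / I * norm h * (LINT y|lborel. \<bar>F y\<bar>)"
  proof (rule conv_bounded_diff[OF F int'])
   fix y
   show "\<bar>f (x' - y) - f (x - y) - (\<Sum>i\<in>UNIV. h $ i * pd i f (x - y))\<bar> \<le> e / I * norm h"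
    using d(2)[of h "x - y"] h by (simp add: h_def)
  qed
  also have "\<dots> \<le> e / I * norm h * I" using I e by (intro mult_left_mono) auto
  also have "\<dots> = e * norm h" using I by simp
  finally show "norm (conv F f x' - conv F f x - (\<Sum>i\<in>UNIV. (x' - x) $ i * conv F (pd i f) x)) \<le> e * norm (x' - x)"
   by (simp add: h_def)
 qed
qed

lemma pd_conv:
 fixes f :: "real^'n => real"
 assumes F: "integrable lborel F" and f: "f \<in> Cc (Suc k) \<Omega>"
 shows "pd i (conv F f) = conv F (pd i f)"
proof
 fix x
 show "pd i (conv F f) x = conv F (pd i f) x"
  using has_derivative_imp_pd[OF conv_has_derivative[OF F f], of i x] by (simp add: sum_axis)
qed

lemma Ck_conv:
 assumes F: "integrable lborel F"
 shows "f \<in> Cc k \<Omega> ==> Ck k (conv F f)"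
proof (induction k arbitrary: f)
 case 0
 thus ?case using conv_continuous[OF F] by simp
next
 case (Suc k)
 show ?case
  using conv_has_derivative[OF F Suc.prems] Suc.IH[OF Cc_pd[OF Suc.prems]] pd_conv[OF F Suc.prems]
  by (auto simp: differentiable_def)
qed

lemma conv_commute:
 assumes [measurable]: "F \<in> borel_measurable borel" "f \<in> borel_measurable borel"
 shows "conv F f x = conv f F x"
 unfolding conv_def using lborel_integral_reflect[of "\<lambda>y. F y * f (x - y)" x] by (simp add: mult.commute)

lemma conv_zero_off:
 assumes "\<And>y. y \<notin> K ==> F y = 0" "\<And>z. norm z > r ==> f z = 0" "x \<notin> {x + y | x y. x \<in> K \<and> y \<in> cball 0 r}"
 shows "conv F f x = 0"
proof -
 have "F y * f (x - y) = 0" for y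
 proof (cases "y \<in> K")
  case True
  have "x = y + (x - y)" by simp
  hence "x - y \<notin> cball 0 r" using assms(3) True by blast
  thus ?thesis using assms(2) by simp
 qed (use assms(1) in simp)
 hence "(\<lambda>y. F y * f (x - y)) = (\<lambda>_. 0)" by blast
 thus ?thesis by (simp add: conv_def)
qed

section \<open>Continuity of translations\<close>

lemma lborel_integral_minus:
 fixes f :: "real^'n => real"
 assumes "f \<in> borel_measurable borel"
 shows "(LINT x|lborel. f (x - a)) = (LINT x|lborel. f x)"
  and "integrable lborel (\<lambda>x. f (x - a)) \<longleftrightarrow> integrable lborel f"
 using lborel_integral_translate[OF assms, of "- a"] lborel_integrable_translate[OF assms, of "- a"] by simp_all

lemma quarters: "a \<le> r / 4 ==> b < r / 4 ==> 0 < r ==> a + (b + a) < (r :: real)"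
 by simp

definition L1_translation_continuous :: "(real^'n::finite => real) => bool" where
 "L1_translation_continuous f \<longleftrightarrow> integrable lborel f \<and>
   (\<forall>z. z \<longlonglongrightarrow> 0 \<longrightarrow> (\<lambda>n. LINT x|lborel. \<bar>f (x - z n) - f x\<bar>) \<longlonglongrightarrow> 0)"

lemma L1_translation_continuous_approx:
 fixes f :: "real^'n => real"
 assumes f: "integrable lborel f"
  and approx: "\<And>e. e > 0 ==> \<exists>g. L1_translation_continuous g \<and> (LINT x|lborel. \<bar>f x - g x\<bar>) \<le> e"
 shows "L1_translation_continuous f"
 unfolding L1_translation_continuous_def
proof (intro conjI f allI impI)
 fix z :: "nat => real^'n" assume z: "z \<longlonglongrightarrow> 0"
 show "(\<lambda>n. LINT x|lborel. \<bar>f (x - z n) - f x\<bar>) \<longlonglongrightarrow> 0"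
 proof (rule LIMSEQ_I)
  fix r :: real assume r: "r > 0"
  obtain g where g: "L1_translation_continuous g" "(LINT x|lborel. \<bar>f x - g x\<bar>) \<le> r / 4"
   using approx[of "r / 4"] r by auto
  have gi: "integrable lborel g" using g by (simp add: L1_translation_continuous_def)
  have [measurable]: "f \<in> borel_measurable borel" "g \<in> borel_measurable borel" using f gi by auto
  have "(\<lambda>n. LINT x|lborel. \<bar>g (x - z n) - g x\<bar>) \<longlonglongrightarrow> 0" using g z by (simp add: L1_translation_continuous_def)
  then obtain n0 where n0: "\<And>n. n \<ge> n0 ==> (LINT x|lborel. \<bar>g (x - z n) - g x\<bar>) < r / 4"
   using order_tendstoD(2)[of _ 0 sequentially "r / 4"] r by (auto simp: eventually_sequentially)
  show "\<exists>no. \<forall>n\<ge>no. norm ((LINT x|lborel. \<bar>f (x - z n) - f x\<bar>) - 0) < r"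
  proof (intro exI[of _ n0] allI impI)
   fix n assume n: "n \<ge> n0"
   have int: "integrable lborel (\<lambda>x. f (x - z n))" "integrable lborel (\<lambda>x. g (x - z n))"
    using f gi by (simp_all add: lborel_integral_minus)
   have "(LINT x|lborel. \<bar>f (x - z n) - f x\<bar>) \<le> (LINT x|lborel. \<bar>f (x - z n) - g (x - z n)\<bar> + (\<bar>g (x - z n) - g x\<bar> + \<bar>f x - g x\<bar>))"
    using int f gi by (intro integral_mono Bochner_Integration.integrable_add integrable_abs Bochner_Integration.integrable_diff) auto
   also have "\<dots> = (LINT x|lborel. \<bar>f (x - z n) - g (x - z n)\<bar>) + ((LINT x|lborel. \<bar>g (x - z n) - g x\<bar>) + (LINT x|lborel. \<bar>f x - g x\<bar>))"
    using int f gi by simp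
   also have "(LINT x|lborel. \<bar>f (x - z n) - g (x - z n)\<bar>) = (LINT x|lborel. \<bar>f x - g x\<bar>)"
    using lborel_integral_minus(1)[of "\<lambda>x. \<bar>f x - g x\<bar>" "z n"] by simp
   also have "(LINT x|lborel. \<bar>f x - g x\<bar>) + ((LINT x|lborel. \<bar>g (x - z n) - g x\<bar>) + (LINT x|lborel. \<bar>f x - g x\<bar>)) < r"
    by (rule quarters[OF g(2) n0[OF n] r])
   finally show "norm ((LINT x|lborel. \<bar>f (x - z n) - f x\<bar>) - 0) < r" by simp
  qed
 qed
qed

text \<open>The positive part of \<open>1\<^sub>U - 1\<^sub>U(\<cdot> - z)\<close> tends to zero pointwise, because \<open>U\<close> is open, and is dominated
  by \<open>1\<^sub>U\<close>. Its integral controls that of the absolute value since the difference has integral zero.\<close>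

lemma L1_translation_continuous_open:
 fixes U :: "(real^'n) set"
 assumes U: "open U" "emeasure lborel U < \<infinity>"
 shows "L1_translation_continuous (\<lambda>x. indicator U x * c)"
 unfolding L1_translation_continuous_def
proof (intro conjI allI impI)
 have Ub [measurable]: "U \<in> sets borel" using U by simp
 have i: "integrable lborel (indicator U :: _ => real)" using U Ub by (simp add: integrable_real_indicator)
 thus "integrable lborel (\<lambda>x. indicator U x * c)" by simp
 fix z :: "nat => real^'n" assume z: "z \<longlonglongrightarrow> 0"
 define f :: "_ => real" where "f = indicator U"
 have f: "integrable lborel f" and [measurable]: "f \<in> borel_measurable borel" using i by (auto simp: f_def)
 have fz: "integrable lborel (\<lambda>x. f (x - z n))" for n using f by (simp add: lborel_integral_minus)
 have pos: "(\<lambda>n. LINT x|lborel. max (f x - f (x - z n)) 0) \<longlonglongrightarrow> (LINT x|(lborel :: (real^'n) measure). 0)"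
 proof (rule integral_dominated_convergence[where w=f])
  show "AE x in lborel. (\<lambda>n. max (f x - f (x - z n)) 0) \<longlonglongrightarrow> 0"
  proof (rule AE_I2)
   fix x
   show "(\<lambda>n. max (f x - f (x - z n)) 0) \<longlonglongrightarrow> 0"
   proof (cases "x \<in> U")
    case True
    have "(\<lambda>n. x - z n) \<longlonglongrightarrow> x - 0" by (intro tendsto_intros z)
    hence "eventually (\<lambda>n. x - z n \<in> U) sequentially" using U True by (auto dest: topological_tendstoD)
    hence "eventually (\<lambda>n. max (f x - f (x - z n)) 0 = 0) sequentially"
     by eventually_elim (simp add: f_def True)
    thus ?thesis by (rule tendsto_eventually)
   qed (simp add: f_def)
  qed
  show "AE x in lborel. norm (max (f x - f (x - z n)) 0) \<le> f x" for n
   by (rule AE_I2) (simp add: f_def indicator_def)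
 qed (use f in auto)
 have "(LINT x|lborel. \<bar>f (x - z n) * c - f x * c\<bar>) = 2 * \<bar>c\<bar> * (LINT x|lborel. max (f x - f (x - z n)) 0)" for n
 proof -
  have "(LINT x|lborel. \<bar>f (x - z n) * c - f x * c\<bar>) = (LINT x|lborel. \<bar>c\<bar> * (2 * max (f x - f (x - z n)) 0 + (f (x - z n) - f x)))"
  proof (rule Bochner_Integration.integral_cong[OF refl])
   fix x
   have "\<bar>f (x - z n) * c - f x * c\<bar> = \<bar>c\<bar> * \<bar>f (x - z n) - f x\<bar>"
    unfolding left_diff_distrib[symmetric] abs_mult by (rule mult.commute)
   also have "\<bar>f (x - z n) - f x\<bar> = 2 * max (f x - f (x - z n)) 0 + (f (x - z n) - f x)"
    by (simp add: max_def abs_if)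
   finally show "\<bar>f (x - z n) * c - f x * c\<bar> = \<bar>c\<bar> * (2 * max (f x - f (x - z n)) 0 + (f (x - z n) - f x))" .
  qed
  also have "\<dots> = \<bar>c\<bar> * (2 * (LINT x|lborel. max (f x - f (x - z n)) 0) + ((LINT x|lborel. f (x - z n)) - (LINT x|lborel. f x)))"
   using f fz by (simp add: integrable_max)
  finally show ?thesis by (simp add: lborel_integral_minus)
 qed
 thus "(\<lambda>n. LINT x|lborel. \<bar>indicator U (x - z n) * c - indicator U x * c\<bar>) \<longlonglongrightarrow> 0"
  using tendsto_mult_right_zero[OF pos[simplified], of "2 * \<bar>c\<bar>"] by (simp add: f_def)
qed

text \<open>By regularity of Lebesgue measure, indicators of sets of finite measure are \<open>L\<^sub>1\<close> limits of indicators
  of open sets; simple functions and limits follow.\<close>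

lemma L1_translation_continuous:
 fixes f :: "real^'n => real"
 assumes "integrable lborel f"
 shows "L1_translation_continuous f"
 using assms
proof (induction f rule: integrable_induct)
 case (base A c)
 have A: "A \<in> sets borel" using base by simp
 have i: "integrable lborel (\<lambda>x. indicator A x * c)" using base by (intro integrable_mult_left integrable_real_indicator) auto
 have "L1_translation_continuous (\<lambda>x. indicator A x * c)"
 proof (rule L1_translation_continuous_approx[OF i])
  fix e :: real assume e: "e > 0"
  define e' where "e' = e / (\<bar>c\<bar> + 1)"
  have e': "e' > 0" "e' * (\<bar>c\<bar> + 1) = e" using e by (auto simp: e'_def add_nonneg_eq_0_iff intro!: divide_pos_pos)
  obtain U where U: "open U" "A \<subseteq> U" "(U - A) \<in> lmeasurable" "emeasure lebesgue (U - A) < ennreal e'"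
   using sets_lebesgue_outer_open[of A e'] A e' by auto
  have UA: "emeasure lborel (U - A) < ennreal e'" using U A by simp
  have "emeasure lborel U = emeasure lborel A + emeasure lborel (U - A)"
   using U A by (subst plus_emeasure) (auto simp: Un_absorb1)
  also have "\<dots> < \<infinity>" using base UA by (auto simp: ennreal_add_eq_top less_top[symmetric] dest: less_trans)
  finally have Uf: "emeasure lborel U < \<infinity>" .
  have "(LINT x|lborel. \<bar>indicator A x * c - indicator U x * c\<bar>) = (LINT x|lborel. indicator (U - A) x * \<bar>c\<bar>)"
   using U(2) by (intro Bochner_Integration.integral_cong) (auto simp: indicator_def)
  also have "\<dots> = measure lborel (U - A) * \<bar>c\<bar>" using U A by simp
  also have "\<dots> \<le> e' * \<bar>c\<bar>"
   using UA e' by (intro mult_right_mono) (auto simp: measure_def enn2real_leI)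
  also have "\<dots> \<le> e" using e' by (simp add: distrib_left)
  finally show "\<exists>g. L1_translation_continuous g \<and> (LINT x|lborel. \<bar>indicator A x * c - g x\<bar>) \<le> e"
   using L1_translation_continuous_open[OF U(1) Uf] by blast
 qed
 thus ?case by simp
next
 case (add f g)
 show ?case
  unfolding L1_translation_continuous_def
 proof (intro conjI allI impI)
  show "integrable lborel (\<lambda>x. f x + g x)" using add by simp
  fix z :: "nat => real^'n" assume z: "z \<longlonglongrightarrow> 0"
  have int: "integrable lborel (\<lambda>x. f (x - z n))" "integrable lborel (\<lambda>x. g (x - z n))" for n
   using add.hyps by (auto simp: lborel_integral_minus)
  show "(\<lambda>n. LINT x|lborel. \<bar>f (x - z n) + g (x - z n) - (f x + g x)\<bar>) \<longlonglongrightarrow> 0"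
  proof (rule null_le)
   show "(\<lambda>n. (LINT x|lborel. \<bar>f (x - z n) - f x\<bar>) + (LINT x|lborel. \<bar>g (x - z n) - g x\<bar>)) \<longlonglongrightarrow> 0"
    using add.IH z by (auto simp: L1_translation_continuous_def intro!: tendsto_add_zero)
   fix n
   have "(LINT x|lborel. \<bar>f (x - z n) + g (x - z n) - (f x + g x)\<bar>) \<le> (LINT x|lborel. \<bar>f (x - z n) - f x\<bar> + \<bar>g (x - z n) - g x\<bar>)"
    using int add.hyps by (intro integral_mono Bochner_Integration.integrable_add integrable_abs Bochner_Integration.integrable_diff) auto
   thus "(LINT x|lborel. \<bar>f (x - z n) + g (x - z n) - (f x + g x)\<bar>) \<le> (LINT x|lborel. \<bar>f (x - z n) - f x\<bar>) + (LINT x|lborel. \<bar>g (x - z n) - g x\<bar>)"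
    using int add.hyps by simp
  qed simp
 qed
next
 case (lim f s)
 show ?case
 proof (rule L1_translation_continuous_approx[OF lim.hyps(4)])
  fix e :: real assume e: "e > 0"
  have [measurable]: "f \<in> borel_measurable lborel" "s i \<in> borel_measurable lborel" for i using lim.hyps by auto
  have "(\<lambda>i. LINT x|lborel. \<bar>f x - s i x\<bar>) \<longlonglongrightarrow> (LINT x|(lborel :: (real^'n) measure). 0)"
  proof (rule integral_dominated_convergence[where w="\<lambda>x. 3 * \<bar>f x\<bar>"])
   show "AE x in lborel. (\<lambda>i. \<bar>f x - s i x\<bar>) \<longlonglongrightarrow> 0"
   proof (rule AE_I2)
    fix x
    have "(\<lambda>i. \<bar>f x - s i x\<bar>) \<longlonglongrightarrow> \<bar>f x - f x\<bar>" using lim.hyps(2)[of x] by (intro tendsto_intros) auto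
    thus "(\<lambda>i. \<bar>f x - s i x\<bar>) \<longlonglongrightarrow> 0" by simp
   qed
   show "AE x in lborel. norm \<bar>f x - s i x\<bar> \<le> 3 * \<bar>f x\<bar>" for i
   proof (rule AE_I2)
    fix x show "norm \<bar>f x - s i x\<bar> \<le> 3 * \<bar>f x\<bar>" using lim.hyps(3)[of x i] by (simp add: abs_real_def split: if_splits)
   qed
  qed (use lim.hyps in auto)
  hence "eventually (\<lambda>i. (LINT x|lborel. \<bar>f x - s i x\<bar>) < e) sequentially" using e by (intro order_tendstoD(2)) auto
  then obtain i where "(LINT x|lborel. \<bar>f x - s i x\<bar>) < e" by (auto simp: eventually_sequentially)
  thus "\<exists>g. L1_translation_continuous g \<and> (LINT x|lborel. \<bar>f x - g x\<bar>) \<le> e" using lim.IH less_imp_le by blast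
 qed
qed

text \<open>Continuity of translations in \<open>L\<^sub>2\<close> follows from the case of \<open>L\<^sub>1\<close> applied to \<open>g \<bar>g\<bar>\<close>.\<close>

lemma sq_diff_le: "(a - b)\<^sup>2 \<le> 2 * \<bar>a * \<bar>a\<bar> - b * \<bar>b\<bar>\<bar>" for a b :: real
proof -
 have pos: "(a - b)\<^sup>2 \<le> 2 * \<bar>a * \<bar>a\<bar> - b * \<bar>b\<bar>\<bar>" if "0 \<le> b" "b \<le> a" for a b :: real
 proof -
  have "(a - b) * (a - b) \<le> (a - b) * (2 * (a + b))" using that by (intro mult_left_mono) auto
  moreover have "0 \<le> a * a - b * b" using that by (simp add: mult_mono)
  ultimately show ?thesis using that by (simp add: power2_eq_square algebra_simps)
 qed
 have neg: "(a - b)\<^sup>2 \<le> 2 * \<bar>a * \<bar>a\<bar> - b * \<bar>b\<bar>\<bar>" if "0 \<le> a" "b \<le> 0" for a b :: real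
 proof -
  have "0 \<le> (a + b)\<^sup>2" "0 \<le> a * a" "0 \<le> b * b" by auto
  thus ?thesis using that by (simp add: power2_eq_square algebra_simps)
 qed
 have e1: "(a - b)\<^sup>2 = (- a - - b)\<^sup>2" and e1': "(b - a)\<^sup>2 = (- b - - a)\<^sup>2"
  by (simp_all add: power2_eq_square algebra_simps)
 have e2: "\<bar>a * \<bar>a\<bar> - b * \<bar>b\<bar>\<bar> = \<bar>- a * \<bar>- a\<bar> - - b * \<bar>- b\<bar>\<bar>"
  and e2': "\<bar>b * \<bar>b\<bar> - a * \<bar>a\<bar>\<bar> = \<bar>- b * \<bar>- b\<bar> - - a * \<bar>- a\<bar>\<bar>"
  by (simp_all add: abs_if)
 consider "0 \<le> b" "b \<le> a" | "0 \<le> a" "a \<le> b" | "b \<le> 0" "0 \<le> a" | "a \<le> 0" "0 \<le> b"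
  | "a \<le> b" "b \<le> 0" | "b \<le> a" "a \<le> 0" by linarith
 thus ?thesis
 proof cases
  case 1 thus ?thesis by (intro pos)
 next
  case 2 thus ?thesis unfolding power2_commute[of a b] abs_minus_commute[of "a * \<bar>a\<bar>"] by (intro pos)
 next
  case 3 thus ?thesis by (intro neg)
 next
  case 4 thus ?thesis unfolding power2_commute[of a b] abs_minus_commute[of "a * \<bar>a\<bar>"] by (intro neg)
 next
  case 5 thus ?thesis unfolding e1 e2 by (intro pos) auto
 next
  case 6 thus ?thesis
   unfolding power2_commute[of a b] abs_minus_commute[of "a * \<bar>a\<bar>"] e1' e2' by (intro pos) auto
 qed
qed

lemma translation_continuous_eps:
 fixes f :: "real^'n => real"
 assumes f: "integrable lborel f" and e: "e > 0"
 obtains d where "d > 0" "\<And>z. norm z \<le> d ==> (LINT x|lborel. \<bar>f (x - z) - f x\<bar>) \<le> e"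
proof -
 have "\<exists>d>0. \<forall>z. norm z \<le> d \<longrightarrow> (LINT x|lborel. \<bar>f (x - z) - f x\<bar>) \<le> e"
 proof (rule ccontr)
  assume neg: "\<not> ?thesis"
  have "\<exists>z. norm z \<le> 1 / real (Suc n) \<and> \<not> (LINT x|lborel. \<bar>f (x - z) - f x\<bar>) \<le> e" for n
   using neg by (metis of_nat_0_less_iff zero_less_Suc zero_less_divide_1_iff)
  then obtain z where z: "\<And>n. norm (z n) \<le> 1 / real (Suc n)" "\<And>n. \<not> (LINT x|lborel. \<bar>f (x - z n) - f x\<bar>) \<le> e" by metis
  have "z \<longlonglongrightarrow> 0"
   by (rule Lim_null_comparison[OF _ LIMSEQ_Suc[OF lim_1_over_n]]) (use z in auto)
  hence "(\<lambda>n. LINT x|lborel. \<bar>f (x - z n) - f x\<bar>) \<longlonglongrightarrow> 0"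
   using L1_translation_continuous[OF f] by (simp add: L1_translation_continuous_def)
  from order_tendstoD(2)[OF this e] obtain N where "\<forall>n\<ge>N. (LINT x|lborel. \<bar>f (x - z n) - f x\<bar>) < e"
   unfolding eventually_sequentially by blast
  with z(2)[of N] show False by (meson less_imp_le order_refl)
 qed
 thus ?thesis using that by blast
qed

lemma nn_translation_L1:
 fixes f :: "real^'n => real"
 assumes f: "integrable lborel f" and e: "e > 0"
 obtains d where "d > 0" "\<And>z. norm z \<le> d ==> (\<integral>\<^sup>+x. ennreal \<bar>f (x - z) - f x\<bar> \<partial>lborel) \<le> ennreal e"
proof -
 obtain d where d: "d > 0" "\<And>z. norm z \<le> d ==> (LINT x|lborel. \<bar>f (x - z) - f x\<bar>) \<le> e"
  using translation_continuous_eps[OF f e] by blast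
 have [measurable]: "f \<in> borel_measurable borel" using f by simp
 have "(\<integral>\<^sup>+x. ennreal \<bar>f (x - z) - f x\<bar> \<partial>lborel) = ennreal (LINT x|lborel. \<bar>f (x - z) - f x\<bar>)" for z
  using f by (intro nn_integral_eq_integral) (auto simp: lborel_integral_minus)
 thus ?thesis using that[OF d(1)] d(2) by (simp add: ennreal_leI)
qed

lemma nn_translation_L2:
 fixes g :: "real^'n => real"
 assumes [measurable]: "g \<in> borel_measurable borel" and g: "integrable lborel (\<lambda>x. (g x)\<^sup>2)" and e: "e > 0"
 obtains d where "d > 0" "\<And>z. norm z \<le> d ==> (\<integral>\<^sup>+x. ennreal ((g (x - z) - g x)\<^sup>2) \<partial>lborel) \<le> ennreal e"
proof -
 have "integrable lborel (\<lambda>x. g x * \<bar>g x\<bar>)"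
  by (rule Bochner_Integration.integrable_bound[OF g]) (auto simp: abs_mult power2_eq_square)
 from nn_translation_L1[OF this, of "e / 2"] e obtain d where d: "d > 0"
  "\<And>z. norm z \<le> d ==> (\<integral>\<^sup>+x. ennreal \<bar>g (x - z) * \<bar>g (x - z)\<bar> - g x * \<bar>g x\<bar>\<bar> \<partial>lborel) \<le> ennreal (e / 2)" by auto
 have "(\<integral>\<^sup>+x. ennreal ((g (x - z) - g x)\<^sup>2) \<partial>lborel) \<le> ennreal e" if z: "norm z \<le> d" for z
 proof -
  have "(\<integral>\<^sup>+x. ennreal ((g (x - z) - g x)\<^sup>2) \<partial>lborel) \<le> (\<integral>\<^sup>+x. 2 * ennreal \<bar>g (x - z) * \<bar>g (x - z)\<bar> - g x * \<bar>g x\<bar>\<bar> \<partial>lborel)"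
  proof (rule nn_integral_mono)
   fix x
   have "ennreal ((g (x - z) - g x)\<^sup>2) \<le> ennreal (2 * \<bar>g (x - z) * \<bar>g (x - z)\<bar> - g x * \<bar>g x\<bar>\<bar>)"
    by (intro ennreal_leI sq_diff_le)
   thus "ennreal ((g (x - z) - g x)\<^sup>2) \<le> 2 * ennreal \<bar>g (x - z) * \<bar>g (x - z)\<bar> - g x * \<bar>g x\<bar>\<bar>"
    by (simp add: ennreal_mult)
  qed
  also have "\<dots> = 2 * (\<integral>\<^sup>+x. ennreal \<bar>g (x - z) * \<bar>g (x - z)\<bar> - g x * \<bar>g x\<bar>\<bar> \<partial>lborel)"
   by (rule nn_integral_cmult) measurable
  also have "\<dots> \<le> 2 * ennreal (e / 2)" using d(2)[OF z] by (intro mult_left_mono) auto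
  also have "\<dots> = ennreal e" using e by (simp add: ennreal_mult[symmetric] flip: ennreal_numeral)
  finally show ?thesis .
 qed
 thus ?thesis using that d(1) by blast
qed

text \<open>Averages of increments are small in the mean: Tonelli's theorem reduces the bound to the
  continuity of translations.\<close>

lemma tonelli_bound:
 fixes k :: "real^'n => real" and u :: "real^'n => real^'n => ennreal"
 assumes [measurable]: "k \<in> borel_measurable borel" "case_prod u \<in> borel_measurable (lborel \<Otimes>\<^sub>M lborel)"
  and k: "(\<integral>\<^sup>+z. ennreal (k z) \<partial>lborel) \<le> K"
  and u: "\<And>z. k z \<noteq> 0 ==> (\<integral>\<^sup>+x. u x z \<partial>lborel) \<le> E"
 shows "(\<integral>\<^sup>+x. \<integral>\<^sup>+z. ennreal (k z) * u x z \<partial>lborel \<partial>lborel) \<le> K * E"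
proof -
 have "(\<integral>\<^sup>+x. \<integral>\<^sup>+z. ennreal (k z) * u x z \<partial>lborel \<partial>lborel) = (\<integral>\<^sup>+z. \<integral>\<^sup>+x. ennreal (k z) * u x z \<partial>lborel \<partial>lborel)"
  by (rule lborel_pair.Fubini'[symmetric]) measurable
 also have "\<dots> = (\<integral>\<^sup>+z. ennreal (k z) * (\<integral>\<^sup>+x. u x z \<partial>lborel) \<partial>lborel)"
  by (intro nn_integral_cong nn_integral_cmult) measurable
 also have "\<dots> \<le> (\<integral>\<^sup>+z. ennreal (k z) * E \<partial>lborel)"
 proof (rule nn_integral_mono)
  fix z show "ennreal (k z) * (\<integral>\<^sup>+x. u x z \<partial>lborel) \<le> ennreal (k z) * E"
   using u[of z] by (cases "k z = 0") (auto intro: mult_left_mono)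
 qed
 also have "\<dots> = (\<integral>\<^sup>+z. ennreal (k z) \<partial>lborel) * E" by (rule nn_integral_multc) measurable
 also have "\<dots> \<le> K * E" using k by (rule mult_right_mono) simp
 finally show ?thesis .
qed

text \<open>The variance of \<open>w\<close> with respect to the density \<open>k\<close> is nonnegative.\<close>

lemma weighted_Cauchy_Schwarz:
 fixes k w :: "'a => real"
 assumes [measurable]: "k \<in> borel_measurable M" "w \<in> borel_measurable M"
  and k: "\<And>z. 0 \<le> k z" "integrable M k" "(LINT z|M. k z) \<le> \<kappa>" and w: "\<And>z. 0 \<le> w z"
  and R: "ennreal \<bar>R\<bar> \<le> (\<integral>\<^sup>+z. ennreal (k z * w z) \<partial>M)"
 shows "ennreal (R\<^sup>2) \<le> ennreal \<kappa> * (\<integral>\<^sup>+z. ennreal (k z * (w z)\<^sup>2) \<partial>M)"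
proof -
 define I where "I = (LINT z|M. k z)"
 have I: "0 \<le> I" "I \<le> \<kappa>" using k by (auto simp: I_def)
 show ?thesis
 proof (cases "I = 0")
  case True
  hence "AE z in M. k z = 0" using k integral_nonneg_eq_0_iff_AE[OF k(2)] by (simp add: I_def)
  hence "(\<integral>\<^sup>+z. ennreal (k z * w z) \<partial>M) = (\<integral>\<^sup>+z. 0 \<partial>M)" by (intro nn_integral_cong_AE) auto
  hence "R = 0" using R by simp
  thus ?thesis by simp
 next
  case False
  hence Ipos: "I > 0" "\<kappa> > 0" using I by auto
  show ?thesis
  proof (cases "(\<integral>\<^sup>+z. ennreal (k z * (w z)\<^sup>2) \<partial>M) = \<infinity>")
   case True
   thus ?thesis using Ipos by (simp add: ennreal_mult_top)
  next
   case False
   hence i2: "integrable M (\<lambda>z. k z * (w z)\<^sup>2)"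
    using k w by (intro integrableI_nonneg) (auto simp: less_top[symmetric])
   have i1: "integrable M (\<lambda>z. k z * w z)"
   proof (rule Bochner_Integration.integrable_bound)
    show "integrable M (\<lambda>z. k z + k z * (w z)\<^sup>2)" using k i2 by simp
    show "AE z in M. norm (k z * w z) \<le> norm (k z + k z * (w z)\<^sup>2)"
    proof (rule AE_I2)
     fix z
     have "0 \<le> (w z - 1)\<^sup>2" "0 \<le> w z" using w by auto
     hence "w z \<le> 1 + (w z)\<^sup>2" unfolding power2_diff by simp
     from mult_left_mono[OF this k(1)[of z]] show "norm (k z * w z) \<le> norm (k z + k z * (w z)\<^sup>2)"
      using k(1)[of z] w[of z] by (simp add: distrib_left)
    qed
   qed simp
   define A B where "A = (LINT z|M. k z * w z)" and "B = (LINT z|M. k z * (w z)\<^sup>2)"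
   have A0: "0 \<le> A" and B0: "0 \<le> B" using k w by (auto simp: A_def B_def)
   have RA: "\<bar>R\<bar> \<le> A" using R A0 i1 k w by (subst (asm) nn_integral_eq_integral) (auto simp: A_def)
   define m where "m = A / I"
   have "0 \<le> (LINT z|M. k z * (w z - m)\<^sup>2)" using k by simp
   also have "\<dots> = (LINT z|M. k z * (w z)\<^sup>2 - 2 * m * (k z * w z) + m\<^sup>2 * k z)"
    by (intro Bochner_Integration.integral_cong) (auto simp: power2_diff algebra_simps)
   also have "\<dots> = B - 2 * m * A + m\<^sup>2 * I" using i1 i2 k by (simp add: A_def B_def I_def)
   finally have "0 \<le> (B - 2 * m * A + m\<^sup>2 * I) * I" using Ipos by simp
   also have "\<dots> = B * I - A\<^sup>2" using Ipos by (simp add: m_def power2_eq_square algebra_simps)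
   finally have "A\<^sup>2 \<le> B * I" by simp
   also have "\<dots> \<le> B * \<kappa>" using B0 I by (intro mult_left_mono) auto
   finally have "R\<^sup>2 \<le> \<kappa> * B" using power_mono[OF RA, of 2] by (simp add: mult.commute)
   hence "ennreal (R\<^sup>2) \<le> ennreal \<kappa> * ennreal B" using B0 Ipos by (simp add: ennreal_mult[symmetric] ennreal_leI)
   thus ?thesis using i2 k by (subst nn_integral_eq_integral) (auto simp: B_def)
  qed
 qed
qed

text \<open>A function dominated by averages of increments of \<open>g\<close> against a kernel \<open>k\<close> of bounded mass is small in
  \<open>L\<^sub>2\<close> as soon as the translates of \<open>g\<close> by vectors in the support of \<open>k\<close> are close to \<open>g\<close>. The
  intended kernels are \<open>norm z * \<bar>pd j (\<rho> m) z\<bar>\<close>, which do not shrink but keep bounded mass.\<close>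

lemma kernel_L2:
 fixes k g R :: "real^'n => real"
 assumes [measurable]: "k \<in> borel_measurable borel" "g \<in> borel_measurable borel"
  and k: "\<And>z. 0 \<le> k z" "integrable lborel k" "(LINT z|lborel. k z) \<le> \<kappa>" and "0 \<le> e"
  and R: "\<And>x. x \<in> A ==> ennreal \<bar>R x\<bar> \<le> (\<integral>\<^sup>+z. ennreal (k z * \<bar>g (x - z) - g x\<bar>) \<partial>lborel)"
  and g: "\<And>z. k z \<noteq> 0 ==> (\<integral>\<^sup>+x. ennreal ((g (x - z) - g x)\<^sup>2) \<partial>lborel) \<le> ennreal e"
 shows "(\<integral>\<^sup>+x. indicator A x * ennreal ((R x)\<^sup>2) \<partial>lborel) \<le> ennreal (\<kappa>\<^sup>2 * e)"
proof -
 have "0 \<le> (LINT z|lborel. k z)" by (intro Bochner_Integration.integral_nonneg k)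
 hence \<kappa>: "0 \<le> \<kappa>" using k(3) by simp
 have "(\<integral>\<^sup>+x. indicator A x * ennreal ((R x)\<^sup>2) \<partial>lborel) \<le> (\<integral>\<^sup>+x. ennreal \<kappa> * (\<integral>\<^sup>+z. ennreal (k z) * ennreal ((g (x - z) - g x)\<^sup>2) \<partial>lborel) \<partial>lborel)"
 proof (rule nn_integral_mono)
  fix x
  show "indicator A x * ennreal ((R x)\<^sup>2) \<le> ennreal \<kappa> * (\<integral>\<^sup>+z. ennreal (k z) * ennreal ((g (x - z) - g x)\<^sup>2) \<partial>lborel)"
  proof (cases "x \<in> A")
   case True
   have "ennreal ((R x)\<^sup>2) \<le> ennreal \<kappa> * (\<integral>\<^sup>+z. ennreal (k z * \<bar>g (x - z) - g x\<bar>\<^sup>2) \<partial>lborel)"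
    using k R[OF True] by (intro weighted_Cauchy_Schwarz) auto
   thus ?thesis using True k by (simp add: ennreal_mult)
  qed simp
 qed
 also have "\<dots> = ennreal \<kappa> * (\<integral>\<^sup>+x. \<integral>\<^sup>+z. ennreal (k z) * ennreal ((g (x - z) - g x)\<^sup>2) \<partial>lborel \<partial>lborel)"
  by (rule nn_integral_cmult) measurable
 also have "\<dots> \<le> ennreal \<kappa> * (ennreal \<kappa> * ennreal e)"
 proof (intro mult_left_mono tonelli_bound g)
  have "(\<integral>\<^sup>+z. ennreal (k z) \<partial>lborel) = ennreal (LINT z|lborel. k z)" using k by (intro nn_integral_eq_integral) auto
  thus "(\<integral>\<^sup>+z. ennreal (k z) \<partial>lborel) \<le> ennreal \<kappa>" using k by (simp add: ennreal_leI)
 qed auto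
 also have "\<dots> = ennreal (\<kappa>\<^sup>2 * e)"
  using \<kappa> \<open>0 \<le> e\<close> by (simp add: ennreal_mult[symmetric] power2_eq_square mult.assoc)
 finally show ?thesis .
qed

lemma
 fixes f :: "'a::euclidean_space => real"
 assumes [measurable]: "f \<in> borel_measurable borel" and s: "s > 0"
 shows lborel_integral_scale: "s ^ DIM('a) * (LINT x|lborel. f (s *\<^sub>R x)) = (LINT x|lborel. f x)"
proof -
 have "(LINT x|lborel. f x) = (LINT x|density (distr lborel borel (\<lambda>x. 0 + s *\<^sub>R x)) (\<lambda>_. ennreal (\<bar>s\<bar> ^ DIM('a))). f x)"
  using lborel_affine[of s "0::'a"] s by simp
 also have "\<dots> = (LINT x|distr lborel borel (\<lambda>x::'a. s *\<^sub>R x). s ^ DIM('a) *\<^sub>R f x)"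
  using s by (subst integral_density) auto
 also have "\<dots> = (LINT x|lborel. s ^ DIM('a) *\<^sub>R f (s *\<^sub>R x))"
  by (subst integral_distr) auto
 finally show ?thesis by simp
qed

section \<open>Mollifiers and weak derivatives\<close>

lemma compact_neighbourhood_subset:
 assumes "(\<Union>x\<in>K. cball x r) \<subseteq> \<Omega>"
 shows "{x + y | x y. x \<in> K \<and> y \<in> cball 0 (r :: real)} \<subseteq> (\<Omega> :: 'a::real_normed_vector set)"
proof clarify
 fix x y assume "x \<in> K" "y \<in> cball (0 :: 'a) r"
 hence "x + y \<in> (\<Union>x\<in>K. cball x r)" by (auto simp: dist_norm intro!: bexI[of _ x])
 thus "x + y \<in> \<Omega>" using assms by blast
qed

lemma abs_sum_le: "\<bar>a\<bar> \<le> x ==> \<bar>b\<bar> \<le> y ==> c = a + b ==> \<bar>c\<bar> \<le> x + (y :: real)"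
 by simp

text \<open>The last condition is scale invariant: differentiation costs one power of the radius of the
  support, and the weight \<open>norm z\<close> regains it.\<close>

locale mollifier =
 fixes \<rho> :: "nat => real^'n::finite => real" and \<kappa> :: real
 assumes \<rho>_Cc: "\<rho> m \<in> Cc k UNIV"
  and \<rho>_nonneg: "0 \<le> \<rho> m z"
  and \<rho>_support: "norm z > 1 / real (Suc m) ==> \<rho> m z = 0"
  and \<rho>_integral: "(LINT z|lborel. \<rho> m z) = 1"
  and \<rho>_moment: "(LINT z|lborel. norm z * \<bar>pd j (\<rho> m) z\<bar>) \<le> \<kappa>"

text \<open>Any nonnegative test function that is not identically zero can be normalised and rescaled.\<close>

lemma mollifier_exists:
 fixes \<eta> :: "real^'n::finite => real"
 assumes \<eta>: "\<eta> \<in> test_functions \<Omega>" "\<And>x. 0 \<le> \<eta> x" "\<eta> x0 \<noteq> 0"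
 shows "\<exists>\<rho> :: nat => real^'n => real. \<exists>\<kappa>. mollifier \<rho> \<kappa>"
proof -
 have C: "\<eta> \<in> Cc k UNIV" for k using \<eta>(1) Cc_mono unfolding test_functions_iff by blast
 have [measurable]: "\<eta> \<in> borel_measurable borel" "pd j \<eta> \<in> borel_measurable borel" for j
  using Cc_measurable[OF C[of 0]] Cc_measurable[OF Cc_pd[OF C[of 1, unfolded One_nat_def]]] by auto
 obtain K where K: "compact K" "\<And>x. x \<notin> K ==> \<eta> x = 0" using Cc_support[OF C[of 0]] by blast
 obtain R where R: "R > 0" "\<And>x. x \<in> K ==> norm x \<le> R"
  using compact_imp_bounded[OF K(1)] unfolding bounded_pos by blast
 define I where "I = (LINT x|lborel. \<eta> x)"
 have "I \<noteq> 0"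
 proof
  assume "I = 0"
  hence ae: "AE x in lborel. \<eta> x = 0"
   using integral_nonneg_eq_0_iff_AE[OF Cc_integrable[OF C[of 0]]] \<eta>(2) by (simp add: I_def)
  have "open {x. \<eta> x \<noteq> 0}"
   using Cc_continuous[OF C[of 0]] open_vimage[of "- {0}" \<eta>] by (auto simp: vimage_def)
  then obtain r where r: "r > 0" "ball x0 r \<subseteq> {x. \<eta> x \<noteq> 0}" using \<eta>(3) openE by blast
  have "AE x in lborel. x \<notin> ball x0 r" using ae by eventually_elim (use r in auto)
  hence "emeasure lborel (ball x0 r) = 0" by (subst (asm) AE_iff_measurable[of "ball x0 r"]) auto
  thus False using content_ball_pos[OF r(1), of x0] by (simp add: measure_def)
 qed
 moreover have "0 \<le> I" using \<eta>(2) by (simp add: I_def)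
 ultimately have I: "I > 0" by simp
 define d where "d = DIM(real^'n)"
 define s where "s m = R * real (Suc m)" for m
 have s: "s m > 0" for m using R by (simp add: s_def)
 define \<rho> where "\<rho> m z = s m ^ d / I * \<eta> (0 + s m *\<^sub>R z)" for m z
 define \<kappa> where "\<kappa> = (\<Sum>j\<in>UNIV. (LINT z|lborel. norm z * \<bar>pd j \<eta> z\<bar>) / I)"
 have mom0: "0 \<le> (LINT z|lborel. norm z * \<bar>pd j \<eta> z\<bar>)" for j by simp
 have far: "\<rho> m z = 0" if "norm z > 1 / real (Suc m)" for m z
 proof -
  have "norm (s m *\<^sub>R z) = R * (real (Suc m) * norm z)" using R by (simp add: s_def del: of_nat_Suc)
  moreover have "1 < real (Suc m) * norm z" using that by (simp add: divide_less_eq mult.commute del: of_nat_Suc)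
  ultimately have "R < norm (s m *\<^sub>R z)" using R by (simp del: of_nat_Suc norm_scaleR)
  thus ?thesis using R(2)[of "s m *\<^sub>R z"] K(2)[of "s m *\<^sub>R z"] by (auto simp: \<rho>_def)
 qed
 have "mollifier \<rho> \<kappa>"
 proof
  show "\<rho> m \<in> Cc k UNIV" for m k
  proof (rule CcI[of _ _ "cball 0 (1 / real (Suc m))"])
   show "Ck k (\<rho> m)" unfolding \<rho>_def by (intro Ck_mult Ck_const Ck_affine Cc_Ck[OF C])
   fix z :: "real^'n" assume "z \<notin> cball 0 (1 / real (Suc m))"
   thus "\<rho> m z = 0" using far[of m z] by (simp add: not_le)
  qed auto
  show "0 \<le> \<rho> m z" for m z using I s[of m] \<eta>(2) by (simp add: \<rho>_def)
  show "\<rho> m z = 0" if "norm z > 1 / real (Suc m)" for m z using far[OF that] .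
  show "(LINT z|lborel. \<rho> m z) = 1" for m
   using lborel_integral_scale[of \<eta> "s m"] s I by (simp add: \<rho>_def d_def I_def)
  show "(LINT z|lborel. norm z * \<bar>pd j (\<rho> m) z\<bar>) \<le> \<kappa>" for j m
  proof -
   have "pd j (\<rho> m) z = s m ^ d / I * (s m * pd j \<eta> (0 + s m *\<^sub>R z))" for z
    unfolding \<rho>_def
    using pd_affine(1)[of \<eta> 0 "s m" z] pd_affine(2)[of \<eta> 0 "s m" z j] Cc_Ck[OF C[of 1]] by (subst pd_cmult) auto
   hence "norm z * \<bar>pd j (\<rho> m) z\<bar> = s m ^ d / I * (norm (s m *\<^sub>R z) * \<bar>pd j \<eta> (s m *\<^sub>R z)\<bar>)" for z
    using s[of m] I by (simp add: abs_mult)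
   hence "(LINT z|lborel. norm z * \<bar>pd j (\<rho> m) z\<bar>) = s m ^ d * (LINT z|lborel. norm (s m *\<^sub>R z) * \<bar>pd j \<eta> (s m *\<^sub>R z)\<bar>) / I"
    by simp
   also have "\<dots> = (LINT z|lborel. norm z * \<bar>pd j \<eta> z\<bar>) / I"
    using lborel_integral_scale[of "\<lambda>z. norm z * \<bar>pd j \<eta> z\<bar>" "s m"] s by (simp add: d_def)
   also have "\<dots> \<le> \<kappa>"
    unfolding \<kappa>_def using mom0 I by (intro member_le_sum[where f="\<lambda>j. (LINT z|lborel. norm z * \<bar>pd j \<eta> z\<bar>) / I"]) auto
   finally show ?thesis .
  qed
 qed
 thus ?thesis by blast
qed

text \<open>Weak derivatives of Borel functions on the whole space, so that convolutions and product measures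
  can be used.\<close>

definition wpd :: "(real^'n::finite) set => 'n => (real^'n => real) => (real^'n => real) => bool" where
 "wpd \<Omega> i f g \<longleftrightarrow> f \<in> borel_measurable borel \<and> g \<in> borel_measurable borel \<and>
   (\<forall>K. compact K \<and> K \<subseteq> \<Omega> \<longrightarrow> integrable lborel (\<lambda>x. indicator K x * f x) \<and> integrable lborel (\<lambda>x. indicator K x * g x)) \<and>
   (\<forall>\<phi>\<in>test_functions \<Omega>. (LINT x|lborel. f x * pd i \<phi> x) = - (LINT x|lborel. g x * \<phi> x))"

lemma locally_integrable_mult:
 assumes f: "f \<in> borel_measurable borel" "integrable lborel (\<lambda>x. indicator K x * f x)"
  and \<phi>: "\<phi> \<in> Cc k UNIV" "\<And>x. x \<notin> K ==> \<phi> x = 0"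
 shows "integrable lborel (\<lambda>x. f x * \<phi> x)"
proof -
 obtain B where B: "\<And>x. \<bar>\<phi> x\<bar> \<le> B" using Cc_bounded[OF \<phi>(1)] by blast
 have "integrable lborel (\<lambda>x. (indicator K x * f x) * \<phi> x)"
  using integrable_mult_bounded[OF f(2) _ B] Cc_measurable[OF \<phi>(1)] by simp
 moreover have "(indicator K x * f x) * \<phi> x = f x * \<phi> x" for x using \<phi>(2)[of x] by (cases "x \<in> K") auto
 ultimately show ?thesis by simp
qed

lemma integrable_mult_Cc:
 assumes f: "f \<in> borel_measurable borel" "\<And>K. compact K ==> K \<subseteq> \<Omega> ==> integrable lborel (\<lambda>x. indicator K x * f x)"
  and \<phi>: "\<phi> \<in> Cc k \<Omega>"
 shows "integrable lborel (\<lambda>x. f x * \<phi> x)"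
proof -
 obtain K where K: "compact K" "K \<subseteq> \<Omega>" "\<And>x. x \<notin> K ==> \<phi> x = 0" using Cc_support[OF \<phi>] by blast
 show ?thesis by (rule locally_integrable_mult[OF f(1) f(2)[OF K(1,2)] Cc_mono[OF \<phi>] K(3)]) auto
qed

context mollifier
begin

lemma \<rho>_measurable [measurable]: "\<rho> m \<in> borel_measurable borel"
 using Cc_measurable[OF \<rho>_Cc[of m 0]] .

lemma pd_\<rho>_measurable [measurable]: "pd j (\<rho> m) \<in> borel_measurable borel"
 using Cc_measurable[OF Cc_pd[OF \<rho>_Cc[of m "Suc 0"]]] .

lemma \<rho>_integrable: "integrable lborel (\<rho> m)"
 using Cc_integrable[OF \<rho>_Cc[of m 0]] .

lemma pd_\<rho>_support: "norm z > 1 / real (Suc m) ==> pd j (\<rho> m) z = 0"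
 using pd_zero_off[of "cball 0 (1 / real (Suc m))" "\<rho> m" z j] \<rho>_support by auto

lemma eventually_radius: "r > 0 ==> \<exists>M. \<forall>m\<ge>M. 1 / real (Suc m) \<le> r"
proof -
 assume "r > 0"
 hence "eventually (\<lambda>m. 1 / real (Suc m) < r) sequentially"
  using order_tendstoD(2)[OF LIMSEQ_Suc[OF lim_1_over_n]] by blast
 thus ?thesis unfolding eventually_sequentially using less_imp_le by blast
qed

lemma conv_test:
 assumes F: "integrable lborel F" "\<And>x. x \<notin> K ==> F x = 0" and K: "compact K"
  and r: "1 / real (Suc m) \<le> r" "{x + y | x y. x \<in> K \<and> y \<in> cball 0 r} \<subseteq> \<Omega>"
 shows "conv F (\<rho> m) \<in> test_functions \<Omega>"
 unfolding test_functions_iff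
proof
 fix k
 show "conv F (\<rho> m) \<in> Cc k \<Omega>"
 proof (rule CcI[OF Ck_conv[OF F(1) \<rho>_Cc] compact_neighbourhood[OF K, of r] r(2)])
  fix x assume x: "x \<notin> {x + y | x y. x \<in> K \<and> y \<in> cball 0 r}"
  show "conv F (\<rho> m) x = 0" by (rule conv_zero_off[OF F(2) _ x]) (use \<rho>_support r(1) in auto)
 qed
qed

lemma translate_test:
 assumes "cball x r \<subseteq> \<Omega>" "1 / real (Suc m) \<le> r"
 shows "(\<lambda>y. \<rho> m (x - y)) \<in> test_functions \<Omega>" "pd i (\<lambda>y. \<rho> m (x - y)) y = - pd i (\<rho> m) (x - y)"
  and "pd j (pd i (\<lambda>y. \<rho> m (x - y))) y = pd j (pd i (\<rho> m)) (x - y)"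
proof -
 have pd: "pd i (\<lambda>y. f (x - y)) y = - pd i f (x - y)" if "Ck (Suc 0) f" for f i y
  using pd_affine(2)[of f x "-1" y i] Ck_differentiable[OF that] by simp
 have eq: "pd i (\<lambda>y. \<rho> m (x - y)) = (\<lambda>y. - pd i (\<rho> m) (x - y))" for i
  using pd Cc_Ck[OF \<rho>_Cc] by blast
 have "Ck k (\<lambda>y. \<rho> m (x - y))" for k using Ck_affine[OF Cc_Ck[OF \<rho>_Cc], of k m x "-1"] by simp
 thus "(\<lambda>y. \<rho> m (x - y)) \<in> test_functions \<Omega>"
  unfolding test_functions_iff using assms
  by (intro allI CcI[where K="cball x r"]) (auto simp: dist_norm intro!: \<rho>_support)
 show "pd i (\<lambda>y. \<rho> m (x - y)) y = - pd i (\<rho> m) (x - y)" by (simp add: eq)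
 have C1: "Ck (Suc 0) (pd i (\<rho> m))" using Cc_Ck[OF Cc_pd[OF \<rho>_Cc[of m "Suc (Suc 0)"]]] .
 have "pd j (\<lambda>y. (-1) * pd i (\<rho> m) (x + (-1) *\<^sub>R y)) y = (-1) * pd j (\<lambda>y. pd i (\<rho> m) (x + (-1) *\<^sub>R y)) y"
  by (intro pd_cmult pd_affine(1) Ck_differentiable[OF C1])
 thus "pd j (pd i (\<lambda>y. \<rho> m (x - y))) y = pd j (pd i (\<rho> m)) (x - y)"
  unfolding eq using pd[OF C1] by simp
qed

lemma average_le:
 assumes w: "\<And>y. norm y \<le> 1 / real (Suc m) ==> \<bar>w y\<bar> \<le> e" and int: "integrable lborel (\<lambda>y. \<rho> m y * w y)"
 shows "\<bar>LINT y|lborel. \<rho> m y * w y\<bar> \<le> e"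
proof -
 have "\<bar>LINT y|lborel. \<rho> m y * w y\<bar> \<le> (LINT y|lborel. \<bar>\<rho> m y * w y\<bar>)"
  using integral_norm_bound[of lborel "\<lambda>y. \<rho> m y * w y"] by simp
 also have "\<dots> \<le> (LINT y|lborel. \<rho> m y * e)"
 proof (rule integral_mono)
  fix y
  show "\<bar>\<rho> m y * w y\<bar> \<le> \<rho> m y * e"
  proof (cases "norm y \<le> 1 / real (Suc m)")
   case True
   thus ?thesis using w[OF True] \<rho>_nonneg[of m y] by (simp add: abs_mult mult_left_mono)
  qed (use \<rho>_support[of m y] in simp)
 qed (use int \<rho>_integrable in auto)
 finally show ?thesis using \<rho>_integral by simp
qed

lemma average_diff:
 assumes "integrable lborel F"
 shows "conv F (\<rho> m) x - F x = (LINT z|lborel. \<rho> m z * (F (x - z) - F x))"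
  and "integrable lborel (\<lambda>z. \<rho> m z * (F (x - z) - F x))"
proof -
 have [measurable]: "F \<in> borel_measurable borel" using assms by simp
 have "integrable lborel (\<lambda>y. F y * \<rho> m (x - y))" using conv_integrable[OF assms \<rho>_Cc] .
 hence i: "integrable lborel (\<lambda>z. \<rho> m z * F (x - z))"
  using lborel_integrable_reflect[of "\<lambda>y. F y * \<rho> m (x - y)" x] by (simp add: mult.commute)
 thus "integrable lborel (\<lambda>z. \<rho> m z * (F (x - z) - F x))" using \<rho>_integrable by (simp add: right_diff_distrib)
 show "conv F (\<rho> m) x - F x = (LINT z|lborel. \<rho> m z * (F (x - z) - F x))"
  using i \<rho>_integrable \<rho>_integral conv_commute[of F "\<rho> m" x] by (simp add: right_diff_distrib conv_def)
qed

lemma conv_uniform: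
 assumes \<psi>: "\<psi> \<in> Cc k \<Omega>" and e: "e > 0"
 shows "\<exists>M. \<forall>m\<ge>M. \<forall>x. \<bar>conv \<psi> (\<rho> m) x - \<psi> x\<bar> \<le> e"
proof -
 obtain d where d: "d > 0" "\<And>x h. norm h < d ==> \<bar>\<psi> (x + h) - \<psi> x\<bar> < e" using Cc_uniformly_continuous[OF \<psi> e] by blast
 obtain M where M: "\<And>m. m \<ge> M ==> 1 / real (Suc m) \<le> d / 2" using eventually_radius[of "d / 2"] d by auto
 have "\<bar>conv \<psi> (\<rho> m) x - \<psi> x\<bar> \<le> e" if "m \<ge> M" for m x
  unfolding average_diff(1)[OF Cc_integrable[OF \<psi>]]
 proof (rule average_le[OF _ average_diff(2)[OF Cc_integrable[OF \<psi>]]])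
  fix y :: "real^'n" assume "norm y \<le> 1 / real (Suc m)"
  hence "norm (- y) < d" using M[OF that] d(1) by (simp add: order_le_less_trans)
  from d(2)[OF this, of x] show "\<bar>\<psi> (x - y) - \<psi> x\<bar> \<le> e" by simp
 qed
 thus ?thesis by blast
qed

lemma conv_L2:
 assumes g: "integrable lborel g" "integrable lborel (\<lambda>x. (g x)\<^sup>2)" and e: "e > 0"
 shows "\<exists>M. \<forall>m\<ge>M. (\<integral>\<^sup>+x. ennreal ((conv g (\<rho> m) x - g x)\<^sup>2) \<partial>lborel) \<le> ennreal e"
proof -
 have [measurable]: "g \<in> borel_measurable borel" using g by simp
 obtain d where d: "d > 0" "\<And>z. norm z \<le> d ==> (\<integral>\<^sup>+x. ennreal ((g (x - z) - g x)\<^sup>2) \<partial>lborel) \<le> ennreal e"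
  using nn_translation_L2[OF _ g(2) e] by auto
 obtain M where M: "\<And>m. m \<ge> M ==> 1 / real (Suc m) \<le> d" using eventually_radius[OF d(1)] by blast
 have "(\<integral>\<^sup>+x. ennreal ((conv g (\<rho> m) x - g x)\<^sup>2) \<partial>lborel) \<le> ennreal e" if m: "m \<ge> M" for m
 proof -
  have "(\<integral>\<^sup>+x. indicator UNIV x * ennreal ((conv g (\<rho> m) x - g x)\<^sup>2) \<partial>lborel) \<le> ennreal (1\<^sup>2 * e)"
  proof (rule kernel_L2[of "\<rho> m" g])
   fix x
   have "ennreal \<bar>conv g (\<rho> m) x - g x\<bar> \<le> (\<integral>\<^sup>+z. ennreal \<bar>\<rho> m z * (g (x - z) - g x)\<bar> \<partial>lborel)"
    unfolding average_diff(1)[OF g(1)]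
    using integral_norm_bound_ennreal[OF average_diff(2)[OF g(1), of m x]] by simp
   thus "ennreal \<bar>conv g (\<rho> m) x - g x\<bar> \<le> (\<integral>\<^sup>+z. ennreal (\<rho> m z * \<bar>g (x - z) - g x\<bar>) \<partial>lborel)"
    using \<rho>_nonneg by (simp add: abs_mult)
  next
   fix z assume "\<rho> m z \<noteq> 0"
   hence "norm z \<le> d" using \<rho>_support[of m z] M[OF m] by linarith
   thus "(\<integral>\<^sup>+x. ennreal ((g (x - z) - g x)\<^sup>2) \<partial>lborel) \<le> ennreal e" by (rule d)
  qed (use \<rho>_nonneg \<rho>_integrable \<rho>_integral e in auto)
  thus ?thesis by simp
 qed
 thus ?thesis by blast
qed

text \<open>Testing with smooth functions implies testing with \<open>C\<^sup>1\<close> functions: mollification of a \<open>C\<^sup>1\<close>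
  function converges uniformly together with the first derivatives, within a fixed compact set.\<close>

lemma wpd_C1:
 fixes \<Omega> :: "(real^'n) set"
 assumes w: "wpd \<Omega> i f g" and \<Omega>: "open \<Omega>" and \<xi>: "\<xi> \<in> Cc (Suc 0) \<Omega>"
 shows "(LINT x|lborel. f x * pd i \<xi> x) = - (LINT x|lborel. g x * \<xi> x)"
proof -
 obtain K where K: "compact K" "K \<subseteq> \<Omega>" "\<And>x. x \<notin> K ==> \<xi> x = 0" using Cc_support[OF \<xi>] by blast
 obtain r where r: "r > 0" "(\<Union>x\<in>K. cball x r) \<subseteq> \<Omega>"
  using compact_subset_open_imp_cball_epsilon_subset[OF K(1) \<Omega> K(2)] by blast
 define K' where "K' = {x + y | x y. x \<in> K \<and> y \<in> cball 0 r}"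
 have K': "compact K'" "K' \<subseteq> \<Omega>"
  using compact_neighbourhood[OF K(1)] compact_neighbourhood_subset[OF r(2)] by (auto simp only: K'_def)
 have KK: "x \<in> K'" if "x \<in> K" for x unfolding K'_def using that r(1) by (intro CollectI exI[of _ x] exI[of _ 0]) auto
 have [measurable]: "f \<in> borel_measurable borel" "g \<in> borel_measurable borel" using w by (auto simp: wpd_def)
 have fgi: "integrable lborel (\<lambda>x. indicator K' x * f x)" "integrable lborel (\<lambda>x. indicator K' x * g x)"
  using w K' by (auto simp: wpd_def)
 note int = integrable_mult_Cc[of _ \<Omega>]
 have loc: "\<And>K. compact K ==> K \<subseteq> \<Omega> ==> integrable lborel (\<lambda>x. indicator K x * f x)"
  "\<And>K. compact K ==> K \<subseteq> \<Omega> ==> integrable lborel (\<lambda>x. indicator K x * g x)" using w by (auto simp: wpd_def)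
 define A where "A = (LINT x|lborel. \<bar>indicator K' x * f x\<bar>) + (LINT x|lborel. \<bar>indicator K' x * g x\<bar>)"
 have A: "A \<ge> 0" by (simp add: A_def)
 define D where "D = (LINT x|lborel. f x * pd i \<xi> x) + (LINT x|lborel. g x * \<xi> x)"
 have "\<bar>D\<bar> \<le> 0 + e" if e: "e > 0" for e
 proof -
  define e' where "e' = e / (A + 1)"
  have e': "e' > 0" "e' * A \<le> e" using e A by (auto simp: e'_def field_simps)
  obtain M1 where M1: "\<And>m x. m \<ge> M1 ==> \<bar>conv \<xi> (\<rho> m) x - \<xi> x\<bar> \<le> e'" using conv_uniform[OF \<xi> e'(1)] by blast
  obtain M2 where M2: "\<And>m x. m \<ge> M2 ==> \<bar>conv (pd i \<xi>) (\<rho> m) x - pd i \<xi> x\<bar> \<le> e'"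
   using conv_uniform[OF Cc_pd[OF \<xi>] e'(1)] by blast
  obtain M3 where M3: "\<And>m. m \<ge> M3 ==> 1 / real (Suc m) \<le> r" using eventually_radius[OF r(1)] by blast
  define m where "m = max M1 (max M2 M3)"
  have m: "m \<ge> M1" "m \<ge> M2" "m \<ge> M3" by (auto simp: m_def)
  have [measurable]: "\<xi> \<in> borel_measurable borel" "pd i \<xi> \<in> borel_measurable borel"
   using Cc_measurable[OF \<xi>] Cc_measurable[OF Cc_pd[OF \<xi>]] by auto
  define \<phi> where "\<phi> = conv \<xi> (\<rho> m)"
  have \<phi>: "\<phi> \<in> test_functions \<Omega>"
   unfolding \<phi>_def by (rule conv_test[OF Cc_integrable[OF \<xi>] K(3) K(1) M3[OF m(3)] K'(2)[unfolded K'_def]])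
  have \<phi>K: "\<phi> x = 0" if "x \<notin> K'" for x
   unfolding \<phi>_def by (rule conv_zero_off[OF K(3) _ that[unfolded K'_def]]) (use \<rho>_support M3[OF m(3)] in auto)
  have \<phi>C: "\<phi> \<in> Cc k \<Omega>" for k using \<phi> by (simp add: test_functions_iff)
  have "\<phi> = conv (\<rho> m) \<xi>" unfolding \<phi>_def by (rule ext, rule conv_commute) measurable
  hence "pd i \<phi> = conv (\<rho> m) (pd i \<xi>)" using pd_conv[OF \<rho>_integrable \<xi>] by simp
  also have "\<dots> = conv (pd i \<xi>) (\<rho> m)" by (rule ext, rule conv_commute) measurable
  finally have pd\<phi>: "pd i \<phi> = conv (pd i \<xi>) (\<rho> m)" .
  have pd\<xi>K: "pd i \<xi> x = 0" if "x \<notin> K'" for x using pd_zero_off[of K \<xi> x i] K(1,3) KK that by blast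
  have pd\<phi>K: "pd i \<phi> x = 0" if "x \<notin> K'" for x using pd_zero_off[of K' \<phi> x i] K'(1) \<phi>K that by blast
  have est: "\<bar>(LINT x|lborel. u x * \<alpha> x) - (LINT x|lborel. u x * \<beta> x)\<bar> \<le> e' * (LINT x|lborel. \<bar>indicator K' x * u x\<bar>)"
   if u: "integrable lborel (\<lambda>x. indicator K' x * u x)" "integrable lborel (\<lambda>x. u x * \<alpha> x)" "integrable lborel (\<lambda>x. u x * \<beta> x)"
    and ab: "\<And>x. \<bar>\<beta> x - \<alpha> x\<bar> \<le> e'" "\<And>x. x \<notin> K' ==> \<alpha> x = 0" "\<And>x. x \<notin> K' ==> \<beta> x = 0" for u \<alpha> \<beta>
  proof -
   have eq: "(indicator K' x * u x) * (\<alpha> x - \<beta> x) = u x * \<alpha> x - u x * \<beta> x" for x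
    using ab(2,3)[of x] by (cases "x \<in> K'") (auto simp: right_diff_distrib)
   have "\<bar>LINT x|lborel. (indicator K' x * u x) * (\<alpha> x - \<beta> x)\<bar> \<le> e' * (LINT x|lborel. \<bar>indicator K' x * u x\<bar>)"
    by (rule conv_bounded_diff[OF u(1)]) (use u ab(1) in \<open>auto simp: eq abs_minus_commute\<close>)
   thus ?thesis unfolding eq using u by simp
  qed
  have M1': "\<bar>\<phi> x - \<xi> x\<bar> \<le> e'" for x unfolding \<phi>_def by (rule M1[OF m(1)])
  have M2': "\<bar>pd i \<phi> x - pd i \<xi> x\<bar> \<le> e'" for x unfolding pd\<phi> by (rule M2[OF m(2)])
  have \<xi>K: "\<xi> x = 0" if "x \<notin> K'" for x using K(3) KK that by blast
  have fm: "f \<in> borel_measurable borel" "g \<in> borel_measurable borel" by measurable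
  have 1: "\<bar>(LINT x|lborel. f x * pd i \<xi> x) - (LINT x|lborel. f x * pd i \<phi> x)\<bar> \<le> e' * (LINT x|lborel. \<bar>indicator K' x * f x\<bar>)"
   by (rule est[OF fgi(1) int[OF fm(1) loc(1) Cc_pd[OF \<xi>]] int[OF fm(1) loc(1) Cc_pd[OF \<phi>C]] _ pd\<xi>K pd\<phi>K])
    (assumption | rule M2')+
  have 2: "\<bar>(LINT x|lborel. g x * \<xi> x) - (LINT x|lborel. g x * \<phi> x)\<bar> \<le> e' * (LINT x|lborel. \<bar>indicator K' x * g x\<bar>)"
   by (rule est[OF fgi(2) int[OF fm(2) loc(2) \<xi>] int[OF fm(2) loc(2) \<phi>C] _ \<xi>K \<phi>K])
    (assumption | rule M1')+
  have "(LINT x|lborel. f x * pd i \<phi> x) + (LINT x|lborel. g x * \<phi> x) = 0" using w \<phi> by (simp add: wpd_def)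
  hence "D = ((LINT x|lborel. f x * pd i \<xi> x) - (LINT x|lborel. f x * pd i \<phi> x)) + ((LINT x|lborel. g x * \<xi> x) - (LINT x|lborel. g x * \<phi> x))"
   by (simp add: D_def)
  hence "\<bar>D\<bar> \<le> e' * A" unfolding A_def distrib_left by (rule abs_sum_le[OF 1 2])
  thus ?thesis using e'(2) by simp
 qed
 hence "\<bar>D\<bar> \<le> 0" by (rule field_le_epsilon)
 thus ?thesis by (simp add: D_def)
qed

text \<open>Testing with translates of the mollifier shows that the mollifications of \<open>u\<close> vanish locally, and they
  converge to \<open>u\<close> in the mean.\<close>

lemma fundamental_lemma:
 fixes \<Omega> :: "(real^'n) set"
 assumes \<Omega>: "open \<Omega>" and [measurable]: "u \<in> borel_measurable borel"
  and loc: "\<And>K. compact K ==> K \<subseteq> \<Omega> ==> integrable lborel (\<lambda>x. indicator K x * u x)"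
  and z: "\<And>\<phi>. \<phi> \<in> test_functions \<Omega> ==> (LINT x|lborel. u x * \<phi> x) = 0"
 shows "AE x in lborel. x \<in> \<Omega> \<longrightarrow> u x = 0"
proof -
 have AE_K: "AE x in lborel. x \<in> K \<longrightarrow> u x = 0" if K: "compact K" "K \<subseteq> \<Omega>" for K
 proof -
  obtain r where r: "r > 0" "(\<Union>x\<in>K. cball x r) \<subseteq> \<Omega>"
   using compact_subset_open_imp_cball_epsilon_subset[OF K(1) \<Omega> K(2)] by blast
  define K' where "K' = {x + y | x y. x \<in> K \<and> y \<in> cball 0 r}"
  have K': "compact K'" "K' \<subseteq> \<Omega>"
   using compact_neighbourhood[OF K(1)] compact_neighbourhood_subset[OF r(2)] by (auto simp only: K'_def)
  have ball: "y \<in> K'" if "x \<in> K" "norm (x - y) \<le> r" for x y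
   unfolding K'_def using that by (intro CollectI exI[of _ x] exI[of _ "y - x"]) (auto simp: norm_minus_commute)
  have Km [measurable]: "K \<in> sets borel" using K by (simp add: compact_imp_closed borel_closed)
  have K'm [measurable]: "K' \<in> sets borel" using K' by (simp add: compact_imp_closed borel_closed)
  define U where "U x = indicator K' x * u x" for x
  have U: "integrable lborel U" unfolding U_def[abs_def] by (rule loc[OF K'])
  have [measurable]: "U \<in> borel_measurable borel" unfolding U_def by measurable
  have small: "(\<integral>\<^sup>+x. indicator K x * ennreal \<bar>U x\<bar> \<partial>lborel) \<le> 0 + ennreal e" if e: "e > 0" for e
  proof -
   obtain d where d: "d > 0" "\<And>z. norm z \<le> d ==> (\<integral>\<^sup>+x. ennreal \<bar>U (x - z) - U x\<bar> \<partial>lborel) \<le> ennreal e"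
    using nn_translation_L1[OF U e] by blast
   obtain M where M: "\<And>m. m \<ge> M ==> 1 / real (Suc m) \<le> min d r" using eventually_radius[of "min d r"] d r by auto
   note M = M[OF order_refl]
   have pt: "indicator K x * ennreal \<bar>U x\<bar> \<le> (\<integral>\<^sup>+z. ennreal (\<rho> M z) * ennreal \<bar>U (x - z) - U x\<bar> \<partial>lborel)" for x
   proof (cases "x \<in> K")
    case True
    have t: "(\<lambda>y. \<rho> M (x - y)) \<in> test_functions \<Omega>"
     by (rule translate_test(1)[of x r]) (use True r M in auto)
    have eq: "U y * \<rho> M (x - y) = u y * \<rho> M (x - y)" for y
     using ball[OF True, of y] \<rho>_support[of M "x - y"] M by (cases "norm (x - y) \<le> r") (auto simp: U_def)
    have "conv U (\<rho> M) x = 0" using z[OF t] unfolding conv_def eq .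
    hence "\<bar>U x\<bar> = \<bar>LINT z|lborel. \<rho> M z * (U (x - z) - U x)\<bar>" using average_diff(1)[OF U, of M x] by simp
    hence "ennreal \<bar>U x\<bar> \<le> (\<integral>\<^sup>+z. ennreal \<bar>\<rho> M z * (U (x - z) - U x)\<bar> \<partial>lborel)"
     using integral_norm_bound_ennreal[OF average_diff(2)[OF U, of M x]] by simp
    thus ?thesis using True \<rho>_nonneg by (simp add: abs_mult ennreal_mult)
   qed simp
   have "(\<integral>\<^sup>+x. indicator K x * ennreal \<bar>U x\<bar> \<partial>lborel) \<le> (\<integral>\<^sup>+x. \<integral>\<^sup>+z. ennreal (\<rho> M z) * ennreal \<bar>U (x - z) - U x\<bar> \<partial>lborel \<partial>lborel)"
    by (rule nn_integral_mono) (rule pt)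
   also have "\<dots> \<le> 1 * ennreal e"
   proof (rule tonelli_bound)
    show "(\<integral>\<^sup>+z. ennreal (\<rho> M z) \<partial>lborel) \<le> 1"
     using nn_integral_eq_integral[OF \<rho>_integrable[of M]] \<rho>_nonneg \<rho>_integral by simp
    fix z assume "\<rho> M z \<noteq> 0"
    hence "norm z \<le> d" using \<rho>_support[of M z] M by linarith
    thus "(\<integral>\<^sup>+x. ennreal \<bar>U (x - z) - U x\<bar> \<partial>lborel) \<le> ennreal e" by (rule d)
   qed measurable
   finally show ?thesis by simp
  qed
  have "(\<integral>\<^sup>+x. indicator K x * ennreal \<bar>U x\<bar> \<partial>lborel) \<le> 0"
   by (rule ennreal_le_epsilon, rule small)
  hence "(\<integral>\<^sup>+x. indicator K x * ennreal \<bar>U x\<bar> \<partial>lborel) = 0" by simp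
  hence "AE x in lborel. indicator K x * ennreal \<bar>U x\<bar> = 0" by (subst (asm) nn_integral_0_iff_AE) auto
  thus ?thesis
  proof eventually_elim
   case (elim x)
   have "x \<in> K'" if "x \<in> K" using ball[OF that, of x] r(1) by simp
   thus ?case using elim by (auto simp: U_def indicator_def split: if_splits)
  qed
 qed
 obtain C where C: "\<And>n::nat. compact (C n)" "\<And>n. C n \<subseteq> \<Omega>" "\<Union> (range C) = \<Omega>"
  using open_Union_compact_subsets[OF \<Omega>] by metis
 have "AE x in lborel. \<forall>n. x \<in> C n \<longrightarrow> u x = 0" unfolding AE_all_countable using AE_K[OF C(1,2)] by blast
 thus ?thesis by eventually_elim (use C(3) in auto)
qed

lemma wpd_unique:
 fixes \<Omega> :: "(real^'n) set"
 assumes "open \<Omega>" "wpd \<Omega> i f g1" "wpd \<Omega> i f g2"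
 shows "AE x in lborel. x \<in> \<Omega> \<longrightarrow> g1 x = g2 x"
proof -
 have [measurable]: "g1 \<in> borel_measurable borel" "g2 \<in> borel_measurable borel" using assms by (auto simp: wpd_def)
 have i: "integrable lborel (\<lambda>x. indicator K x * g1 x)" "integrable lborel (\<lambda>x. indicator K x * g2 x)" if "compact K" "K \<subseteq> \<Omega>" for K
  using assms that by (auto simp: wpd_def)
 have "AE x in lborel. x \<in> \<Omega> \<longrightarrow> g1 x - g2 x = 0"
 proof (rule fundamental_lemma[OF assms(1)])
  fix \<phi> assume \<phi>: "\<phi> \<in> test_functions \<Omega>"
  hence "integrable lborel (\<lambda>x. g1 x * \<phi> x)" "integrable lborel (\<lambda>x. g2 x * \<phi> x)"
   using integrable_mult_Cc[of _ \<Omega> \<phi> 0] i by (auto simp: test_functions_iff)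
  moreover have "(LINT x|lborel. g1 x * \<phi> x) = (LINT x|lborel. g2 x * \<phi> x)" using assms \<phi> by (simp add: wpd_def)
  ultimately show "(LINT x|lborel. (g1 x - g2 x) * \<phi> x) = 0" by (simp add: left_diff_distrib)
 qed (use i in \<open>auto simp: right_diff_distrib\<close>)
 thus ?thesis by simp
qed

lemma wpd_mult:
 fixes \<Omega> :: "(real^'n) set"
 assumes w: "wpd \<Omega> i f g" and \<Omega>: "open \<Omega>" and \<psi>: "\<psi> \<in> Cc (Suc 0) UNIV"
 shows "wpd \<Omega> i (\<lambda>x. f x * \<psi> x) (\<lambda>x. g x * \<psi> x + f x * pd i \<psi> x)"
 unfolding wpd_def
proof (intro conjI allI impI ballI)
 have [measurable]: "f \<in> borel_measurable borel" "g \<in> borel_measurable borel" using w by (auto simp: wpd_def)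
 have [measurable]: "\<psi> \<in> borel_measurable borel" "pd i \<psi> \<in> borel_measurable borel"
  using Cc_measurable[OF \<psi>] Cc_measurable[OF Cc_pd[OF \<psi>]] by auto
 show "(\<lambda>x. f x * \<psi> x) \<in> borel_measurable borel" "(\<lambda>x. g x * \<psi> x + f x * pd i \<psi> x) \<in> borel_measurable borel" by measurable
 have loc: "\<And>K. compact K ==> K \<subseteq> \<Omega> ==> integrable lborel (\<lambda>x. indicator K x * f x)"
  "\<And>K. compact K ==> K \<subseteq> \<Omega> ==> integrable lborel (\<lambda>x. indicator K x * g x)" using w by (auto simp: wpd_def)
 obtain B where B: "\<And>x. \<bar>\<psi> x\<bar> \<le> B" using Cc_bounded[OF \<psi>] by blast
 obtain B' where B': "\<And>x. \<bar>pd i \<psi> x\<bar> \<le> B'" using Cc_bounded[OF Cc_pd[OF \<psi>]] by blast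
 fix K assume K: "compact K \<and> K \<subseteq> \<Omega>"
 have "integrable lborel (\<lambda>x. (indicator K x * f x) * \<psi> x)" "integrable lborel (\<lambda>x. (indicator K x * g x) * \<psi> x)"
  "integrable lborel (\<lambda>x. (indicator K x * f x) * pd i \<psi> x)"
  using integrable_mult_bounded[OF loc(1) _ B] integrable_mult_bounded[OF loc(2) _ B] integrable_mult_bounded[OF loc(1) _ B'] K by auto
 thus "integrable lborel (\<lambda>x. indicator K x * (f x * \<psi> x))" "integrable lborel (\<lambda>x. indicator K x * (g x * \<psi> x + f x * pd i \<psi> x))"
  by (simp_all add: distrib_left mult.assoc)
next
 fix \<phi> assume "\<phi> \<in> test_functions \<Omega>"
 hence \<phi>: "\<phi> \<in> Cc k \<Omega>" for k by (simp add: test_functions_iff)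
 have loc: "\<And>K. compact K ==> K \<subseteq> \<Omega> ==> integrable lborel (\<lambda>x. indicator K x * f x)"
  "\<And>K. compact K ==> K \<subseteq> \<Omega> ==> integrable lborel (\<lambda>x. indicator K x * g x)" using w by (auto simp: wpd_def)
 have fm: "f \<in> borel_measurable borel" "g \<in> borel_measurable borel" using w by (auto simp: wpd_def)
 have p: "(\<lambda>x. \<phi> x * \<psi> x) \<in> Cc (Suc 0) \<Omega>" using Cc_mult[OF \<phi> Cc_Ck[OF \<psi>]] .
 have eq: "pd i (\<lambda>x. \<phi> x * \<psi> x) = (\<lambda>x. \<phi> x * pd i \<psi> x + pd i \<phi> x * \<psi> x)"
  using Ck_differentiable[OF Cc_Ck[OF \<phi>]] Ck_differentiable[OF Cc_Ck[OF \<psi>]] by (auto simp: pd_mult)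
 have C1: "(\<lambda>x. \<phi> x * pd i \<psi> x) \<in> Cc 0 \<Omega>" "(\<lambda>x. pd i \<phi> x * \<psi> x) \<in> Cc 0 \<Omega>" "(\<lambda>x. \<phi> x * \<psi> x) \<in> Cc 0 \<Omega>"
  using Cc_mult[OF \<phi> Cc_Ck[OF Cc_pd[OF \<psi>]]] Cc_mult[OF Cc_pd[OF \<phi>] Ck_le[OF Cc_Ck[OF \<psi>]]] Cc_le[OF p] by auto
 note I = integrable_mult_Cc[OF fm(1) loc(1) C1(1)] integrable_mult_Cc[OF fm(1) loc(1) C1(2)] integrable_mult_Cc[OF fm(2) loc(2) C1(3)]
 have "(LINT x|lborel. f x * (\<phi> x * pd i \<psi> x)) + (LINT x|lborel. f x * (pd i \<phi> x * \<psi> x)) = - (LINT x|lborel. g x * (\<phi> x * \<psi> x))"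
  using wpd_C1[OF w \<Omega> p] I unfolding eq by (simp add: distrib_left)
 moreover have "(LINT x|lborel. (g x * \<psi> x + f x * pd i \<psi> x) * \<phi> x) = (LINT x|lborel. g x * (\<phi> x * \<psi> x)) + (LINT x|lborel. f x * (\<phi> x * pd i \<psi> x))"
  using I by (subst Bochner_Integration.integral_add[symmetric]) (auto simp: algebra_simps)
 moreover have "(LINT x|lborel. f x * \<psi> x * pd i \<phi> x) = (LINT x|lborel. f x * (pd i \<phi> x * \<psi> x))" by (simp add: mult_ac)
 ultimately show "(LINT x|lborel. f x * \<psi> x * pd i \<phi> x) = - (LINT x|lborel. (g x * \<psi> x + f x * pd i \<psi> x) * \<phi> x)" by simp
qed

text \<open>Bounded weak derivatives give a local Lipschitz bound: the mollified functions satisfy it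
  classically and converge pointwise.\<close>

lemma wpd_lipschitz:
 fixes f :: "real^'n => real"
 assumes w: "\<And>i. wpd \<Omega> i f (D i)" and B: "\<And>i x. \<bar>D i x\<bar> \<le> B" and f: "continuous_on \<Omega> f"
  and r: "r > 0" "cball x0 (2 * r) \<subseteq> \<Omega>" and xy: "x \<in> cball x0 r" "y \<in> cball x0 r"
 shows "\<bar>f x - f y\<bar> \<le> real CARD('n) * B * norm (x - y)"
proof -
 define F where "F x = indicator (cball x0 (2 * r)) x * f x" for x
 have F: "integrable lborel F" unfolding F_def[abs_def] using w r(2) by (auto simp: wpd_def)
 have [measurable]: "D i \<in> borel_measurable borel" for i using w by (auto simp: wpd_def)
 have conv: "(\<lambda>m. conv F (\<rho> m) x) \<longlonglongrightarrow> f x" if x: "x \<in> cball x0 r" for x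
 proof (rule LIMSEQ_I)
  fix e :: real assume e: "e > 0"
  have inside: "x - z \<in> cball x0 (2 * r)" if "norm z \<le> r" for z
  proof -
   have eq: "x0 - (x - z) = (x0 - x) + z" by simp
   have "norm (x0 - (x - z)) \<le> norm (x0 - x) + norm z" unfolding eq by (rule norm_triangle_ineq)
   thus ?thesis using x that by (simp add: dist_norm)
  qed
  have "x \<in> \<Omega>" using inside[of 0] r by auto
  then obtain d where d: "d > 0" "\<And>x'. x' \<in> \<Omega> ==> dist x' x < d ==> dist (f x') (f x) < e / 2"
   using f e unfolding continuous_on_iff by (meson half_gt_zero)
  obtain M where M: "\<And>m. m \<ge> M ==> 1 / real (Suc m) \<le> min r (d / 2)" using eventually_radius[of "min r (d/2)"] r d by auto
  show "\<exists>no. \<forall>m\<ge>no. norm (conv F (\<rho> m) x - f x) < e"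
  proof (intro exI[of _ M] allI impI)
   fix m assume m: "m \<ge> M"
   have Fx: "F x = f x" using inside[of 0] r(1) by (simp add: F_def)
   have "\<bar>LINT z|lborel. \<rho> m z * (F (x - z) - F x)\<bar> \<le> e / 2"
   proof (rule average_le[OF _ average_diff(2)[OF F]])
    fix z :: "real^'n" assume "norm z \<le> 1 / real (Suc m)"
    hence z: "norm z \<le> r" "norm z < d" using M[OF m] d(1) by auto
    have "dist (f (x - z)) (f x) < e / 2" using inside[OF z(1)] r(2) z(2) by (intro d(2)) (auto simp: dist_norm)
    thus "\<bar>F (x - z) - F x\<bar> \<le> e / 2" using inside[OF z(1)] by (simp add: Fx dist_real_def) (simp add: F_def)
   qed
   hence "\<bar>conv F (\<rho> m) x - f x\<bar> \<le> e / 2" using average_diff(1)[OF F, of m x] Fx by simp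
   thus "norm (conv F (\<rho> m) x - f x) < e" using e by simp
  qed
 qed
 obtain M where M: "\<And>m. m \<ge> M ==> 1 / real (Suc m) \<le> r" using eventually_radius[OF r(1)] by blast
 have lip: "\<bar>conv F (\<rho> m) x - conv F (\<rho> m) y\<bar> \<le> real CARD('n) * B * norm (x - y)" if m: "m \<ge> M" for m
 proof -
  have pd: "\<bar>conv F (pd j (\<rho> m)) u\<bar> \<le> B" if u: "u \<in> cball x0 r" for u j
  proof -
   have inside: "y \<in> cball x0 (2 * r)" if "norm (u - y) \<le> r" for y
    using u that dist_triangle[of x0 y u] by (simp add: dist_norm)
   have sub: "cball u r \<subseteq> \<Omega>" using inside r(2) by (auto simp: dist_norm)
   note t = translate_test[OF sub M[OF m]]
   have eq: "F y * pd j (\<rho> m) (u - y) = f y * pd j (\<rho> m) (u - y)" for y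
    using inside[of y] pd_\<rho>_support[of m "u - y" j] M[OF m] by (cases "norm (u - y) \<le> r") (auto simp: F_def)
   have "conv F (pd j (\<rho> m)) u = - (LINT y|lborel. f y * pd j (\<lambda>y. \<rho> m (u - y)) y)"
    unfolding conv_def t(2) eq by simp
   also have "\<dots> = (LINT y|lborel. D j y * \<rho> m (u - y))" using w[of j] t(1) by (simp add: wpd_def)
   also have "\<dots> = (LINT y|lborel. \<rho> m y * D j (u - y))"
    using lborel_integral_reflect[of "\<lambda>y. D j y * \<rho> m (u - y)" u] by (simp add: mult.commute)
   finally have eq: "conv F (pd j (\<rho> m)) u = (LINT y|lborel. \<rho> m y * D j (u - y))" .
   show ?thesis unfolding eq using B
    by (intro average_le integrable_mult_bounded[OF \<rho>_integrable, of _ B]) auto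
  qed
  define c where "c = closed_segment x y"
  have seg: "x + t *\<^sub>R (y - x) \<in> cball x0 r" if "t \<in> {0..1}" for t
  proof -
   have "x + t *\<^sub>R (y - x) = (1 - t) *\<^sub>R x + t *\<^sub>R y" by (simp add: algebra_simps)
   thus ?thesis using convex_cball[of x0 r] xy that unfolding convex_alt by auto
  qed
  have "((\<lambda>t. conv F (\<rho> m) (x + t *\<^sub>R (y - x))) has_derivative (\<lambda>s. \<Sum>j\<in>UNIV. (s *\<^sub>R (y - x)) $ j * conv F (pd j (\<rho> m)) (x + t *\<^sub>R (y - x)))) (at t within {0..1})" for t
  proof (rule has_derivative_compose[of "\<lambda>t. x + t *\<^sub>R (y - x)" "\<lambda>s. s *\<^sub>R (y - x)" t "{0..1}" "conv F (\<rho> m)"])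
   show "((\<lambda>t. x + t *\<^sub>R (y - x)) has_derivative (\<lambda>s. s *\<^sub>R (y - x))) (at t within {0..1})" by (auto intro!: derivative_eq_intros)
  qed (rule conv_has_derivative[OF F \<rho>_Cc])
  from mvt_very_simple[OF zero_le_one this] obtain t where t: "t \<in> {0..1}"
   "conv F (\<rho> m) y - conv F (\<rho> m) x = (\<Sum>j\<in>UNIV. (y - x) $ j * conv F (pd j (\<rho> m)) (x + t *\<^sub>R (y - x)))" by auto
  have "\<bar>conv F (\<rho> m) y - conv F (\<rho> m) x\<bar> \<le> (\<Sum>j\<in>UNIV. \<bar>(y - x) $ j * conv F (pd j (\<rho> m)) (x + t *\<^sub>R (y - x))\<bar>)"
   unfolding t(2) by (rule sum_abs)
  also have "\<dots> \<le> (\<Sum>j\<in>(UNIV::'n set). norm (y - x) * B)"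
  proof (rule sum_mono)
   fix j
   show "\<bar>(y - x) $ j * conv F (pd j (\<rho> m)) (x + t *\<^sub>R (y - x))\<bar> \<le> norm (y - x) * B"
    unfolding abs_mult by (intro mult_mono component_le_norm_cart pd[OF seg[OF t(1)]]) auto
  qed
  finally show ?thesis by (simp add: norm_minus_commute abs_minus_commute mult_ac)
 qed
 have "(\<lambda>m. \<bar>conv F (\<rho> m) x - conv F (\<rho> m) y\<bar>) \<longlonglongrightarrow> \<bar>f x - f y\<bar>"
  by (intro tendsto_intros conv xy)
 thus ?thesis by (rule LIMSEQ_le_const2) (use lip in blast)
qed

end

section \<open>The elliptic operator and its accretivity\<close>

text \<open>The coefficients with Borel representatives of their weak derivatives, bounded at every point.\<close>

locale elliptic = mollifier \<rho> \<kappa> for \<rho> :: "nat => real^'n::finite => real" and \<kappa> +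
 fixes \<Omega> :: "(real^'n) set" and c :: "'n => 'n => real^'n => real"
  and D :: "'n => 'n => 'n => real^'n => real" and B :: real
 assumes \<Omega>: "open \<Omega>"
  and c_wpd: "wpd \<Omega> k (c i j) (D i j k)"
  and D_bound: "\<bar>D i j k x\<bar> \<le> B"
  and c_continuous: "continuous_on \<Omega> (c i j)"
  and c_sym: "c i j x = c j i x"
  and c_pos: "x \<in> \<Omega> ==> \<xi> \<noteq> 0 ==> 0 < (\<Sum>i\<in>UNIV. \<Sum>j\<in>UNIV. c i j x * \<xi> $ i * \<xi> $ j)"
begin

lemma c_measurable [measurable]: "c i j \<in> borel_measurable borel"
 and D_measurable [measurable]: "D i j k \<in> borel_measurable borel"
 using c_wpd by (auto simp: wpd_def)

lemma B_nonneg: "0 \<le> B"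
 using D_bound[of undefined undefined undefined undefined] by simp

text \<open>The operator in nondivergence form, where the derivatives of the coefficients appear explicitly.\<close>

definition Lop :: "(real^'n => real) => real^'n => real" where
 "Lop \<phi> x = - (\<Sum>i\<in>UNIV. \<Sum>j\<in>UNIV. D i j i x * pd j \<phi> x + c i j x * pd i (pd j \<phi>) x)"

definition Gam :: "(real^'n => real) => real^'n => real" where
 "Gam \<phi> x = (\<Sum>i\<in>UNIV. \<Sum>j\<in>UNIV. c i j x * pd i \<phi> x * pd j \<phi> x)"

lemma c_bounded_on_compact:
 assumes "compact K" "K \<subseteq> \<Omega>"
 obtains b where "b \<ge> 0" "\<And>i j x. x \<in> K ==> \<bar>c i j x\<bar> \<le> b"
proof -
 have "\<exists>b. \<forall>x\<in>K. \<bar>c i j x\<bar> \<le> b" for i j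
 proof -
  have "compact (c i j ` K)"
   using assms by (intro compact_continuous_image continuous_on_subset[OF c_continuous])
  thus ?thesis using compact_imp_bounded by (fastforce simp: bounded_iff)
 qed
 then obtain b where b: "\<And>i j x. x \<in> K ==> \<bar>c i j x\<bar> \<le> b i j" by metis
 define b' where "b' = (\<Sum>i\<in>UNIV. \<Sum>j\<in>UNIV. \<bar>b i j\<bar>)"
 have b': "\<bar>b i j\<bar> \<le> b'" for i j
 proof -
  have "\<bar>b i j\<bar> \<le> (\<Sum>j\<in>UNIV. \<bar>b i j\<bar>)" by (rule member_le_sum) auto
  also have "\<dots> \<le> b'" unfolding b'_def by (rule member_le_sum) (auto intro: sum_nonneg)
  finally show ?thesis .
 qed
 show ?thesis
 proof (rule that[of b'])
  show "b' \<ge> 0" unfolding b'_def by (intro sum_nonneg) auto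
  fix i j x assume "x \<in> K"
  thus "\<bar>c i j x\<bar> \<le> b'" using b[of x i j] b'[of i j] by linarith
 qed
qed

lemma c_mult_bounded:
 assumes f: "f \<in> Cc k \<Omega>"
 obtains b where "\<And>x. \<bar>c i j x * f x\<bar> \<le> b"
proof -
 obtain K where K: "compact K" "K \<subseteq> \<Omega>" "\<And>x. x \<notin> K ==> f x = 0" using Cc_support[OF f] by blast
 obtain b where b: "b \<ge> 0" "\<And>i j x. x \<in> K ==> \<bar>c i j x\<bar> \<le> b" using c_bounded_on_compact[OF K(1,2)] by blast
 obtain b' where b': "b' \<ge> 0" "\<And>x. \<bar>f x\<bar> \<le> b'" using Cc_bounded[OF f] by blast
 have "\<bar>c i j x * f x\<bar> \<le> b * b'" for x
 proof (cases "x \<in> K")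
  case True
  thus ?thesis unfolding abs_mult using b b' by (intro mult_mono) auto
 qed (use b b' K(3) in auto)
 thus ?thesis using that by blast
qed

lemma Lop_measurable:
 assumes \<phi>: "\<phi> \<in> test_functions \<Omega>"
 shows "Lop \<phi> \<in> borel_measurable borel"
proof -
 have \<phi>C: "\<phi> \<in> Cc k \<Omega>" for k using \<phi> by (simp add: test_functions_iff)
 have [measurable]: "pd j \<phi> \<in> borel_measurable borel" "pd i (pd j \<phi>) \<in> borel_measurable borel" for i j
  using Cc_measurable[OF Cc_pd[OF \<phi>C]] Cc_measurable[OF Cc_pd[OF Cc_pd[OF \<phi>C]]] by auto
 show ?thesis unfolding Lop_def[abs_def] by measurable
qed

lemma Lop_bounded:
 assumes \<phi>: "\<phi> \<in> test_functions \<Omega>"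
 obtains b where "b \<ge> 0" "\<And>x. \<bar>Lop \<phi> x\<bar> \<le> b"
proof -
 have \<phi>C: "\<phi> \<in> Cc k \<Omega>" for k using \<phi> by (simp add: test_functions_iff)
 have "\<exists>b. \<forall>x. \<bar>D i j i x * pd j \<phi> x + c i j x * pd i (pd j \<phi>) x\<bar> \<le> b" for i j
 proof -
  obtain b1 where b1: "b1 \<ge> 0" "\<And>x. \<bar>pd j \<phi> x\<bar> \<le> b1" using Cc_bounded[OF Cc_pd[OF \<phi>C[of "Suc 0"]]] by blast
  obtain b2 where b2: "\<And>x. \<bar>c i j x * pd i (pd j \<phi>) x\<bar> \<le> b2"
   using c_mult_bounded[OF Cc_pd[OF Cc_pd[OF \<phi>C[of "Suc (Suc 0)"]]]] by blast
  have "\<bar>D i j i x * pd j \<phi> x + c i j x * pd i (pd j \<phi>) x\<bar> \<le> B * b1 + b2" for x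
  proof -
   have "\<bar>D i j i x * pd j \<phi> x\<bar> \<le> B * b1" unfolding abs_mult using D_bound b1 B_nonneg by (intro mult_mono) auto
   thus ?thesis using b2[of x] by linarith
  qed
  thus ?thesis by blast
 qed
 then obtain b where b: "\<And>i j x. \<bar>D i j i x * pd j \<phi> x + c i j x * pd i (pd j \<phi>) x\<bar> \<le> b i j" by metis
 have "\<bar>Lop \<phi> x\<bar> \<le> (\<Sum>i\<in>UNIV. \<Sum>j\<in>UNIV. b i j)" for x
  unfolding Lop_def abs_minus_cancel
  by (intro order_trans[OF sum_abs] sum_mono b)
 thus ?thesis using that[of "\<bar>\<Sum>i\<in>UNIV. \<Sum>j\<in>UNIV. b i j\<bar>"] by (meson abs_ge_self abs_ge_zero order_trans)
qed

lemma Lop_zero_off: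
 assumes "compact K" "\<And>x. x \<notin> K ==> \<phi> x = 0" "x \<notin> K"
 shows "Lop \<phi> x = 0"
proof -
 have pd0: "pd j \<phi> x = 0" if "x \<notin> K" for j x using pd_zero_off[of K \<phi> x j] assms(1,2) that by blast
 have "pd i (pd j \<phi>) x = 0" for i j using pd_zero_off[of K "pd j \<phi>" x i] assms(1,3) pd0 by blast
 thus ?thesis using pd0[OF assms(3)] by (simp add: Lop_def)
qed

lemma Lop_integrable_mult:
 assumes \<phi>: "\<phi> \<in> test_functions \<Omega>" and \<psi>: "\<psi> \<in> Cc k \<Omega>"
 shows "integrable lborel (\<lambda>x. Lop \<phi> x * \<psi> x)"
proof -
 obtain b where b: "\<And>x. \<bar>Lop \<phi> x\<bar> \<le> b" using Lop_bounded[OF \<phi>] by blast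
 show ?thesis
  using integrable_mult_bounded[OF Cc_integrable[OF \<psi>] _ b] Lop_measurable[OF \<phi>]
  by (simp add: mult.commute)
qed

lemma wpd_flux:
 assumes \<phi>: "\<phi> \<in> test_functions \<Omega>"
 shows "wpd \<Omega> i (\<lambda>x. c i j x * pd j \<phi> x) (\<lambda>x. D i j i x * pd j \<phi> x + c i j x * pd i (pd j \<phi>) x)"
proof -
 have "pd j \<phi> \<in> Cc (Suc 0) UNIV"
  using Cc_mono[OF Cc_pd[of \<phi> "Suc 0" \<Omega> j]] \<phi> by (simp add: test_functions_iff)
 thus ?thesis by (rule wpd_mult[OF c_wpd \<Omega>])
qed

lemma green:
 assumes \<phi>: "\<phi> \<in> test_functions \<Omega>" and \<psi>: "\<psi> \<in> Cc (Suc 0) \<Omega>"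
 shows "(LINT x|lborel. Lop \<phi> x * \<psi> x) = (LINT x|lborel. (\<Sum>i\<in>UNIV. \<Sum>j\<in>UNIV. c i j x * pd j \<phi> x * pd i \<psi> x))"
  and "integrable lborel (\<lambda>x. (\<Sum>i\<in>UNIV. \<Sum>j\<in>UNIV. c i j x * pd j \<phi> x * pd i \<psi> x))"
proof -
 note w = wpd_flux[OF \<phi>]
 have i1: "integrable lborel (\<lambda>x. c i j x * pd j \<phi> x * pd i \<psi> x)" for i j
  using integrable_mult_Cc[of _ \<Omega>, OF _ _ Cc_pd[OF \<psi>]] w[of i j] unfolding wpd_def by blast
 have i2: "integrable lborel (\<lambda>x. (D i j i x * pd j \<phi> x + c i j x * pd i (pd j \<phi>) x) * \<psi> x)" for i j
  using integrable_mult_Cc[of _ \<Omega>, OF _ _ \<psi>] w[of i j] unfolding wpd_def by blast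
 show "integrable lborel (\<lambda>x. (\<Sum>i\<in>UNIV. \<Sum>j\<in>UNIV. c i j x * pd j \<phi> x * pd i \<psi> x))"
  using i1 by (intro Bochner_Integration.integrable_sum)
 have "(LINT x|lborel. Lop \<phi> x * \<psi> x) = (LINT x|lborel. - (\<Sum>i\<in>UNIV. \<Sum>j\<in>UNIV. (D i j i x * pd j \<phi> x + c i j x * pd i (pd j \<phi>) x) * \<psi> x))"
  by (simp add: Lop_def sum_distrib_right)
 also have "\<dots> = - (\<Sum>i\<in>UNIV. \<Sum>j\<in>UNIV. LINT x|lborel. (D i j i x * pd j \<phi> x + c i j x * pd i (pd j \<phi>) x) * \<psi> x)"
  using i2 by (simp add: integral_sum)
 also have "\<dots> = (\<Sum>i\<in>UNIV. \<Sum>j\<in>UNIV. LINT x|lborel. c i j x * pd j \<phi> x * pd i \<psi> x)"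
  using wpd_C1[OF w \<Omega> \<psi>] by (simp add: sum_negf)
 also have "\<dots> = (LINT x|lborel. (\<Sum>i\<in>UNIV. \<Sum>j\<in>UNIV. c i j x * pd j \<phi> x * pd i \<psi> x))"
  using i1 by (simp add: integral_sum)
 finally show "(LINT x|lborel. Lop \<phi> x * \<psi> x) = (LINT x|lborel. (\<Sum>i\<in>UNIV. \<Sum>j\<in>UNIV. c i j x * pd j \<phi> x * pd i \<psi> x))" .
qed

lemma quadratic_nonneg:
 assumes "x \<in> \<Omega>" shows "0 \<le> (\<Sum>i\<in>UNIV. \<Sum>j\<in>UNIV. c i j x * v i * v j)"
proof (cases "(\<chi> i. v i) = 0")
 case True
 hence "v i = 0" for i by (simp add: vec_eq_iff)
 thus ?thesis by simp
next
 case False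
 from c_pos[OF assms this] show ?thesis by simp
qed

end

text \<open>The smooth convex functions \<open>(s\<^sup>2 + \<delta>)\<^bsup>p/2\<^esup>\<close> approximate \<open>\<bar>s\<bar>\<^sup>p\<close>.\<close>

lemma smooth_power:
 fixes p \<delta> s :: real
 assumes p: "1 \<le> p" and \<delta>: "\<delta> > 0"
 defines "j \<equiv> \<lambda>s::real. (s\<^sup>2 + \<delta>) powr (p / 2)"
  and "F \<equiv> \<lambda>s::real. s * (s\<^sup>2 + \<delta>) powr (p / 2 - 1)"
  and "F' \<equiv> \<lambda>s::real. (s\<^sup>2 + \<delta>) powr (p / 2 - 1) + s * ((p / 2 - 1) * (s\<^sup>2 + \<delta>) powr (p / 2 - 1 - 1) * (2 * s))"
 shows "(j has_real_derivative p * F s) (at s)"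
  and "(F has_real_derivative F' s) (at s)"
  and "0 \<le> F' s"
  and "continuous_on UNIV F'"
  and "j s + p * F s * (t - s) \<le> j t"
proof -
 have pos: "s\<^sup>2 + \<delta> > 0" for s :: real using \<delta> by (simp add: add_nonneg_pos)
 have jd: "(j has_real_derivative p * F s) (at s)" for s
  unfolding j_def F_def using pos[of s] by (auto intro!: derivative_eq_intros)
 show "(j has_real_derivative p * F s) (at s)" by (rule jd)
 have Fd: "(F has_real_derivative F' s) (at s)" for s
  unfolding F_def F'_def using pos[of s] by (auto intro!: derivative_eq_intros)
 show "(F has_real_derivative F' s) (at s)" by (rule Fd)
 have F'0: "0 \<le> F' s" for s
 proof -
  have "(s\<^sup>2 + \<delta>) powr (p / 2 - 1) = (s\<^sup>2 + \<delta>) powr (p / 2 - 1 - 1) * (s\<^sup>2 + \<delta>)"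
   using pos[of s] powr_add[of "s\<^sup>2 + \<delta>" "p / 2 - 1 - 1" 1] by simp
  hence "F' s = (s\<^sup>2 + \<delta>) powr (p / 2 - 1 - 1) * (\<delta> + (p - 1) * s\<^sup>2)"
   by (simp add: F'_def algebra_simps power2_eq_square)
  thus ?thesis using p \<delta> by simp
 qed
 show "0 \<le> F' s" by (rule F'0)
 show "continuous_on UNIV F'"
  unfolding F'_def using pos by (intro continuous_intros) (auto simp: less_imp_neq[symmetric] intro: less_imp_neq[THEN not_sym])
 have "convex_on UNIV j"
  by (rule f''_ge0_imp_convex[of UNIV j "\<lambda>s. p * F s" "\<lambda>s. p * F' s"])
    (use jd Fd F'0 p in \<open>auto intro!: DERIV_cmult\<close>)
 from convex_on_imp_above_tangent[OF this connected_UNIV _ UNIV_I has_field_derivative_at_within[OF jd], of s t]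
 show "j s + p * F s * (t - s) \<le> j t" by simp
qed

context elliptic
begin

text \<open>Accretivity: testing \<open>L \<phi>\<close> with an increasing function of \<open>\<phi>\<close> gives a nonnegative number by
  Green's formula, and convexity turns this into monotonicity of the \<open>p\<close>-norm.\<close>

lemma Lop_accretive:
 assumes \<phi>: "\<phi> \<in> test_functions \<Omega>" and p: "1 \<le> p" and h: "h > 0"
 shows "(LINT x|lborel. \<bar>\<phi> x\<bar> powr p) \<le> (LINT x|lborel. \<bar>\<phi> x + h * Lop \<phi> x\<bar> powr p)"
  and "integrable lborel (\<lambda>x. \<bar>\<phi> x\<bar> powr p)" "integrable lborel (\<lambda>x. \<bar>\<phi> x + h * Lop \<phi> x\<bar> powr p)"
proof -
 have \<phi>C: "\<phi> \<in> Cc k \<Omega>" for k using \<phi> by (simp add: test_functions_iff)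
 obtain K where K: "compact K" "K \<subseteq> \<Omega>" "\<And>x. x \<notin> K ==> \<phi> x = 0" using Cc_support[OF \<phi>C[of 0]] by blast
 have L0: "Lop \<phi> x = 0" if "x \<notin> K" for x using Lop_zero_off[of K \<phi> x] K that by blast
 define f where "f x = \<phi> x + h * Lop \<phi> x" for x
 have f0: "f x = 0" if "x \<notin> K" for x using K(3) L0 that by (simp add: f_def)
 have [measurable]: "\<phi> \<in> borel_measurable borel" "Lop \<phi> \<in> borel_measurable borel"
  using Cc_measurable[OF \<phi>C[of 0]] Lop_measurable[OF \<phi>] by auto
 have [measurable]: "f \<in> borel_measurable borel" unfolding f_def by measurable
 obtain b1 where b1: "b1 \<ge> 0" "\<And>x. \<bar>\<phi> x\<bar> \<le> b1" using Cc_bounded[OF \<phi>C[of 0]] by blast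
 obtain b2 where b2: "b2 \<ge> 0" "\<And>x. \<bar>Lop \<phi> x\<bar> \<le> b2" using Lop_bounded[OF \<phi>] by blast
 define b where "b = b1 + h * b2"
 have b: "b \<ge> 0" "\<bar>\<phi> x\<bar> \<le> b" "\<bar>f x\<bar> \<le> b" for x
 proof -
  have "0 \<le> h * b2" "\<bar>h * Lop \<phi> x\<bar> \<le> h * b2" using h b2 by (auto simp: abs_mult intro: mult_left_mono)
  thus "b \<ge> 0" "\<bar>\<phi> x\<bar> \<le> b" "\<bar>f x\<bar> \<le> b" using b1(1) b1(2)[of x] unfolding b_def f_def by linarith+
 qed
 have pw: "\<bar>\<bar>u\<bar> powr p\<bar> \<le> b powr p" if "\<bar>u\<bar> \<le> b" for u using that p by (auto intro: powr_mono2)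
 show i1: "integrable lborel (\<lambda>x. \<bar>\<phi> x\<bar> powr p)"
  by (rule integral_abs_le_compact(1)[OF K(1)]) (use K(3) p pw b in auto)
 have i2: "integrable lborel (\<lambda>x. \<bar>f x\<bar> powr p)"
  by (rule integral_abs_le_compact(1)[OF K(1)]) (use f0 p pw b in auto)
 thus "integrable lborel (\<lambda>x. \<bar>\<phi> x + h * Lop \<phi> x\<bar> powr p)" by (simp add: f_def)
 define j where "j \<delta> s = (s\<^sup>2 + \<delta>) powr (p / 2)" for \<delta> s :: real
 define w where "w n x = j (1 / real (Suc n)) (f x) - j (1 / real (Suc n)) (\<phi> x)" for n x
 have pos: "0 \<le> (LINT x|lborel. w n x)" for n
 proof -
  define \<delta> where "\<delta> = 1 / real (Suc n)"
  have \<delta>: "\<delta> > 0" by (simp add: \<delta>_def)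
  define G where "G s = s * (s\<^sup>2 + \<delta>) powr (p / 2 - 1)" for s :: real
  define G' where "G' s = (s\<^sup>2 + \<delta>) powr (p / 2 - 1) + s * ((p / 2 - 1) * (s\<^sup>2 + \<delta>) powr (p / 2 - 1 - 1) * (2 * s))" for s :: real
  note S = smooth_power[OF p \<delta>, folded G_def[abs_def] G'_def[abs_def] G_def G'_def j_def]
  have diff: "\<phi> differentiable (at x)" for x using Ck_differentiable[OF Cc_Ck[OF \<phi>C]] .
  have pdG: "pd i (\<lambda>x. G (\<phi> x)) = (\<lambda>x. G' (\<phi> x) * pd i \<phi> x)" for i
   using pd_compose(2)[OF diff S(2)] by blast
  have \<psi>: "(\<lambda>x. G (\<phi> x)) \<in> Cc (Suc 0) \<Omega>"
  proof (rule CcI[OF _ K(1,2)])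
   show "Ck (Suc 0) (\<lambda>x. G (\<phi> x))"
    unfolding Ck.simps pdG
   proof (intro conjI allI)
    show "(\<lambda>x. G (\<phi> x)) differentiable (at x)" for x using pd_compose(1)[OF diff S(2)] by (rule differentiableI)
    show "continuous_on UNIV (\<lambda>x. G' (\<phi> x) * pd i \<phi> x)" for i
     using Cc_continuous[OF \<phi>C[of 0]] Cc_continuous[OF Cc_pd[OF \<phi>C[of "Suc 0"]]]
     by (intro continuous_on_mult continuous_on_compose2[OF S(4)]) auto
   qed
  qed (use K(3) in \<open>simp add: G_def\<close>)
  have "0 \<le> (LINT x|lborel. Lop \<phi> x * G (\<phi> x))"
   unfolding green(1)[OF \<phi> \<psi>]
  proof (rule Bochner_Integration.integral_nonneg)
   fix x
   show "0 \<le> (\<Sum>i\<in>UNIV. \<Sum>j\<in>UNIV. c i j x * pd j \<phi> x * pd i (\<lambda>x. G (\<phi> x)) x)"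
   proof (cases "x \<in> \<Omega>")
    case True
    have "0 \<le> G' (\<phi> x) * (\<Sum>i\<in>UNIV. \<Sum>j\<in>UNIV. c i j x * pd i \<phi> x * pd j \<phi> x)"
     using quadratic_nonneg[OF True, of "\<lambda>i. pd i \<phi> x"] S(3) by simp
    thus ?thesis unfolding pdG by (simp add: sum_distrib_left mult_ac)
   next
    case False
    hence "pd j \<phi> x = 0" for j using Cc_outside[OF Cc_pd[OF \<phi>C[of "Suc 0"]]] by blast
    thus ?thesis by simp
   qed
  qed
  hence "0 \<le> p * h * (LINT x|lborel. Lop \<phi> x * G (\<phi> x))" using p h by simp
  also have "\<dots> = (LINT x|lborel. p * h * (Lop \<phi> x * G (\<phi> x)))" by simp
  also have "\<dots> \<le> (LINT x|lborel. w n x)"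
  proof (rule integral_mono)
   show "integrable lborel (\<lambda>x. p * h * (Lop \<phi> x * G (\<phi> x)))" using Lop_integrable_mult[OF \<phi> \<psi>] by simp
   show "integrable lborel (w n)"
   proof (rule integral_abs_le_compact(1)[OF K(1)])
    show "w n \<in> borel_measurable borel" unfolding w_def j_def by measurable
    show "w n x = 0" if "x \<notin> K" for x using K(3)[OF that] f0[OF that] by (simp add: w_def)
    fix x
    have "j \<delta> s \<le> (b\<^sup>2 + \<delta>) powr (p / 2)" if "\<bar>s\<bar> \<le> b" for s
     unfolding j_def using that p \<delta> abs_le_square_iff[of s b] b(1) by (intro powr_mono2) auto
    hence "j \<delta> (f x) \<le> (b\<^sup>2 + \<delta>) powr (p / 2)" "j \<delta> (\<phi> x) \<le> (b\<^sup>2 + \<delta>) powr (p / 2)" using b by auto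
    moreover have "0 \<le> j \<delta> (f x)" "0 \<le> j \<delta> (\<phi> x)" by (auto simp: j_def)
    ultimately show "\<bar>w n x\<bar> \<le> (b\<^sup>2 + \<delta>) powr (p / 2)" unfolding w_def \<delta>_def[symmetric] by linarith
   qed
   fix x
   have "j \<delta> (\<phi> x) + p * G (\<phi> x) * (f x - \<phi> x) \<le> j \<delta> (f x)" by (rule S(5))
   thus "p * h * (Lop \<phi> x * G (\<phi> x)) \<le> w n x"
    unfolding w_def \<delta>_def[symmetric] by (simp add: f_def mult_ac)
  qed
  finally show ?thesis .
 qed
 have lim: "(\<lambda>n. LINT x|lborel. w n x) \<longlonglongrightarrow> (LINT x|lborel. \<bar>f x\<bar> powr p - \<bar>\<phi> x\<bar> powr p)"
 proof (rule integral_dominated_convergence[where w="\<lambda>x. indicator K x * (2 * (b\<^sup>2 + 1) powr (p / 2))"])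
  have Kf: "K \<in> sets lborel" "emeasure lborel K < \<infinity>"
   using K(1) emeasure_compact_finite by (auto simp: compact_imp_closed borel_closed)
  show "integrable lborel (\<lambda>x. indicator K x * (2 * (b\<^sup>2 + 1) powr (p / 2)))"
   using Kf by (intro integrable_mult_left integrable_real_indicator) auto
  have jl: "(\<lambda>n. j (1 / real (Suc n)) s) \<longlonglongrightarrow> \<bar>s\<bar> powr p" for s
  proof -
   have "(\<lambda>n. (s\<^sup>2 + 1 / real (Suc n)) powr (p / 2)) \<longlonglongrightarrow> (s\<^sup>2 + 0) powr (p / 2)"
    using p by (intro tendsto_powr' tendsto_add tendsto_const LIMSEQ_Suc[OF lim_1_over_n]) (auto intro!: always_eventually)
   moreover have "(s\<^sup>2) powr (p / 2) = \<bar>s\<bar> powr p"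
   proof -
    have "s\<^sup>2 = \<bar>s\<bar> powr 2" by simp
    thus ?thesis by (simp only: powr_powr) simp
   qed
   ultimately show ?thesis by (simp add: j_def)
  qed
  show "AE x in lborel. (\<lambda>n. w n x) \<longlonglongrightarrow> \<bar>f x\<bar> powr p - \<bar>\<phi> x\<bar> powr p"
   unfolding w_def by (intro AE_I2 tendsto_diff jl)
  show "AE x in lborel. norm (w n x) \<le> indicator K x * (2 * (b\<^sup>2 + 1) powr (p / 2))" for n
  proof (rule AE_I2)
   fix x
   have jb: "0 \<le> j (1 / real (Suc n)) s" "j (1 / real (Suc n)) s \<le> (b\<^sup>2 + 1) powr (p / 2)" if "\<bar>s\<bar> \<le> b" for s
    unfolding j_def using that p abs_le_square_iff[of s b] b(1) by (auto intro!: powr_mono2 add_mono)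
   show "norm (w n x) \<le> indicator K x * (2 * (b\<^sup>2 + 1) powr (p / 2))"
   proof (cases "x \<in> K")
    case True
    thus ?thesis using jb[OF b(2)[of x]] jb[OF b(3)[of x]] by (simp add: w_def)
   qed (use K(3) f0 in \<open>simp add: w_def\<close>)
  qed
 qed (auto simp: w_def j_def)
 have "0 \<le> (LINT x|lborel. \<bar>f x\<bar> powr p - \<bar>\<phi> x\<bar> powr p)"
  by (rule LIMSEQ_le_const[OF lim]) (use pos in auto)
 thus "(LINT x|lborel. \<bar>\<phi> x\<bar> powr p) \<le> (LINT x|lborel. \<bar>\<phi> x + h * Lop \<phi> x\<bar> powr p)"
  using i1 i2 by (simp add: f_def)
qed

end

section \<open>The energy inequality\<close>

lemma nn_integral_imp_integrable:
 assumes "f \<in> borel_measurable M" "\<And>x. 0 \<le> f x" "(\<integral>\<^sup>+x. ennreal (f x) \<partial>M) \<le> ennreal e"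
 shows "integrable M f" "0 \<le> e ==> (LINT x|M. f x) \<le> e"
proof -
 have fin: "(\<integral>\<^sup>+x. ennreal (f x) \<partial>M) < \<infinity>" using assms(3) ennreal_less_top order_le_less_trans by (metis infinity_ennreal_def)
 show i: "integrable M f" by (rule integrableI_nonneg) (use assms fin in auto)
 show "(LINT x|M. f x) \<le> e" if "0 \<le> e"
  using assms(3) nn_integral_eq_integral[OF i] assms(2) that by (simp add: ennreal_le_iff)
qed

text \<open>A bounded weight defines a continuous quadratic form on \<open>L\<^sub>2\<close>.\<close>

lemma L2_limit_weighted:
 fixes u :: "nat => 'a => real"
 assumes [measurable]: "w \<in> borel_measurable M" "g \<in> borel_measurable M" "\<And>m. u m \<in> borel_measurable M"
  and w: "\<And>x. \<bar>w x\<bar> \<le> b" and g: "integrable M (\<lambda>x. (g x)\<^sup>2)"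
  and u: "\<And>e. e > 0 ==> \<exists>N. \<forall>m\<ge>N. (\<integral>\<^sup>+x. ennreal ((u m x - g x)\<^sup>2) \<partial>M) \<le> ennreal e"
 shows "(\<lambda>m. LINT x|M. w x * (u m x)\<^sup>2) \<longlonglongrightarrow> (LINT x|M. w x * (g x)\<^sup>2)"
proof (rule LIMSEQ_I)
 fix r :: real assume r: "r > 0"
 define G where "G = (LINT x|M. (g x)\<^sup>2)"
 have G: "G \<ge> 0" by (simp add: G_def)
 define b' where "b' = \<bar>b\<bar> + 1"
 have b': "b' > 0" "\<bar>w x\<bar> \<le> b'" for x using w[of x] by (auto simp: b'_def)
 define \<tau> where "\<tau> = r / (4 * b' * (G + 1))"
 have \<tau>: "\<tau> > 0" using r b' G by (simp add: \<tau>_def)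
 have \<tau>G: "b' * (\<tau> * G) < r / 2"
 proof -
  have "b' * (\<tau> * G) \<le> b' * (\<tau> * (G + 1))" using b' \<tau> G by (intro mult_left_mono) auto
  also have "\<dots> = r / 4" using b' G by (simp add: \<tau>_def)
  finally show ?thesis using r by simp
 qed
 define e where "e = r / (4 * b' * (1 + 1 / \<tau>))"
 have e: "e > 0" "b' * ((1 + 1 / \<tau>) * e) < r / 2"
 proof -
  have p: "1 + 1 / \<tau> > 0" using \<tau> by (simp add: add_pos_pos)
  show "e > 0" using r b' p by (simp add: e_def)
  have "b' * ((1 + 1 / \<tau>) * e) = r / 4" using p b' unfolding e_def by (simp add: divide_simps)
  thus "b' * ((1 + 1 / \<tau>) * e) < r / 2" using r by simp
 qed
 obtain N where N: "\<And>m. m \<ge> N ==> (\<integral>\<^sup>+x. ennreal ((u m x - g x)\<^sup>2) \<partial>M) \<le> ennreal e" using u[OF e(1)] by blast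
 show "\<exists>no. \<forall>m\<ge>no. norm ((LINT x|M. w x * (u m x)\<^sup>2) - (LINT x|M. w x * (g x)\<^sup>2)) < r"
 proof (intro exI[of _ N] allI impI)
  fix m assume m: "m \<ge> N"
  define d where "d x = u m x - g x" for x
  have [measurable]: "d \<in> borel_measurable M" unfolding d_def by measurable
  have d: "integrable M (\<lambda>x. (d x)\<^sup>2)" "(LINT x|M. (d x)\<^sup>2) \<le> e"
   using nn_integral_imp_integrable[of "\<lambda>x. (d x)\<^sup>2" M e] N[OF m] e(1) by (auto simp: d_def)
  have pt: "\<bar>2 * g x * d x\<bar> \<le> \<tau> * (g x)\<^sup>2 + (1 / \<tau>) * (d x)\<^sup>2" for x
  proof -
   have "0 \<le> (\<tau> * \<bar>g x\<bar> - \<bar>d x\<bar>)\<^sup>2" by simp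
   hence "\<tau> * (2 * \<bar>g x\<bar> * \<bar>d x\<bar>) \<le> \<tau> * (\<tau> * (g x)\<^sup>2 + (1 / \<tau>) * (d x)\<^sup>2)"
    using \<tau> by (simp add: power2_diff power_mult_distrib algebra_simps power2_eq_square)
   thus ?thesis using \<tau> by (simp add: abs_mult)
  qed
  have u2: "(u m x)\<^sup>2 = (g x)\<^sup>2 + ((d x)\<^sup>2 + 2 * g x * d x)" for x by (simp add: d_def power2_eq_square algebra_simps)
  have gd: "integrable M (\<lambda>x. 2 * g x * d x)"
  proof (rule Bochner_Integration.integrable_bound)
   show "integrable M (\<lambda>x. \<tau> * (g x)\<^sup>2 + (1 / \<tau>) * (d x)\<^sup>2)" using g d by simp
   show "AE x in M. norm (2 * g x * d x) \<le> norm (\<tau> * (g x)\<^sup>2 + (1 / \<tau>) * (d x)\<^sup>2)"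
    by (intro AE_I2) (use pt abs_ge_self order_trans in \<open>fastforce simp: real_norm_def\<close>)
  qed measurable
  have i1: "integrable M (\<lambda>x. w x * (g x)\<^sup>2)" using integrable_mult_bounded[OF g _ b'(2)] by (simp add: mult.commute)
  have i2: "integrable M (\<lambda>x. w x * ((d x)\<^sup>2 + 2 * g x * d x))"
   using integrable_mult_bounded[OF Bochner_Integration.integrable_add[OF d(1) gd] _ b'(2)] by (simp add: mult.commute)
  have "(LINT x|M. w x * (u m x)\<^sup>2) - (LINT x|M. w x * (g x)\<^sup>2) = (LINT x|M. w x * ((d x)\<^sup>2 + 2 * g x * d x))"
   unfolding u2 using i1 i2 by (simp add: distrib_left[of _ "(g _)\<^sup>2"])
  also have "norm \<dots> \<le> (LINT x|M. norm (w x * ((d x)\<^sup>2 + 2 * g x * d x)))" by (rule integral_norm_bound)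
  also have "\<dots> \<le> (LINT x|M. b' * (\<tau> * (g x)\<^sup>2 + (1 + 1 / \<tau>) * (d x)\<^sup>2))"
  proof (rule integral_mono)
   fix x
   have "norm ((d x)\<^sup>2 + 2 * g x * d x) \<le> \<tau> * (g x)\<^sup>2 + (1 + 1 / \<tau>) * (d x)\<^sup>2"
    using pt[of x] zero_le_power2[of "d x"] unfolding distrib_right real_norm_def by linarith
   thus "norm (w x * ((d x)\<^sup>2 + 2 * g x * d x)) \<le> b' * (\<tau> * (g x)\<^sup>2 + (1 + 1 / \<tau>) * (d x)\<^sup>2)"
    unfolding norm_mult using b' by (intro mult_mono) auto
  qed (use i2 g d in auto)
  also have "\<dots> = b' * (\<tau> * G) + b' * ((1 + 1 / \<tau>) * (LINT x|M. (d x)\<^sup>2))"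
   using g d by (simp add: G_def distrib_left)
  also have "\<dots> \<le> b' * (\<tau> * G) + b' * ((1 + 1 / \<tau>) * e)"
   using d b' \<tau> by (intro add_left_mono mult_left_mono) auto
  also have "\<dots> < r / 2 + r / 2" by (rule add_strict_mono[OF \<tau>G e(2)])
  also have "\<dots> = r" by simp
  finally show "norm ((LINT x|M. w x * (u m x)\<^sup>2) - (LINT x|M. w x * (g x)\<^sup>2)) < r" .
 qed
qed

text \<open>The algebra behind the energy inequality; the numbers stand for the values at one point of the
  cutoff function, the mollified solution, their partial derivatives, the coefficients and the
  error of the flux.\<close>

lemma energy_algebra:
 fixes c :: "'i::finite => 'i => real"
 assumes sym: "\<And>i j. c i j = c j i" and \<mu>: "\<mu> > 0" and \<tau>: "\<tau> > 0"
  and coercive: "\<And>v. \<mu> * (\<Sum>i\<in>UNIV. (v i)\<^sup>2) \<le> (\<Sum>i\<in>UNIV. \<Sum>j\<in>UNIV. c i j * v i * v j)"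
  and A: "\<And>i. \<bar>\<eta> * \<eta>' i\<bar> \<le> A" and E: "\<eta>\<^sup>2 \<le> E"
  and P: "\<And>i. P i = (\<Sum>j\<in>UNIV. c i j * u' j) + Q i"
 shows "- (\<Sum>i\<in>UNIV. P i * (2 * \<eta> * \<eta>' i * u + \<eta>\<^sup>2 * u' i))
  \<le> u\<^sup>2 * (\<Sum>i\<in>UNIV. \<Sum>j\<in>UNIV. c i j * \<eta>' i * \<eta>' j) + (\<Sum>i\<in>UNIV. (E / (4 * \<mu>) + 1 / (2 * \<tau>)) * (Q i)\<^sup>2 + \<tau> / 2 * A\<^sup>2 * u\<^sup>2)"
proof -
 define v where "v i = \<eta> * u' i + u * \<eta>' i" for i
 define e where "e i = 2 * \<eta> * \<eta>' i * u + \<eta>\<^sup>2 * u' i" for i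
 have e: "e i = \<eta> * v i + u * (\<eta> * \<eta>' i)" for i by (simp add: e_def v_def power2_eq_square algebra_simps)
 have swap: "(\<Sum>i\<in>UNIV. \<Sum>j\<in>UNIV. c i j * v j * \<eta>' i) = (\<Sum>i\<in>UNIV. \<Sum>j\<in>UNIV. c i j * \<eta>' j * v i)"
  by (subst sum.swap) (simp add: sym mult_ac)
 have pt: "c i j * u' j * e i = c i j * v i * v j + u * (c i j * v j * \<eta>' i) - u * (c i j * \<eta>' j * v i) - u\<^sup>2 * (c i j * \<eta>' i * \<eta>' j)" for i j
  by (simp add: e_def v_def power2_eq_square algebra_simps)
 have main: "(\<Sum>i\<in>UNIV. \<Sum>j\<in>UNIV. c i j * u' j * e i) = (\<Sum>i\<in>UNIV. \<Sum>j\<in>UNIV. c i j * v i * v j) - u\<^sup>2 * (\<Sum>i\<in>UNIV. \<Sum>j\<in>UNIV. c i j * \<eta>' i * \<eta>' j)"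
  unfolding pt sum_subtractf sum.distrib using swap by (simp flip: sum_distrib_left)
 have Q: "- (Q i * e i) \<le> (E / (4 * \<mu>) + 1 / (2 * \<tau>)) * (Q i)\<^sup>2 + \<tau> / 2 * A\<^sup>2 * u\<^sup>2 + \<mu> * (v i)\<^sup>2" for i
 proof -
  have 1: "- (Q i * (\<eta> * v i)) \<le> E / (4 * \<mu>) * (Q i)\<^sup>2 + \<mu> * (v i)\<^sup>2"
  proof -
   have "0 \<le> (Q i * \<eta> + 2 * \<mu> * v i)\<^sup>2" by simp
   hence "- (4 * \<mu> * (Q i * (\<eta> * v i))) \<le> \<eta>\<^sup>2 * (Q i)\<^sup>2 + 4 * \<mu> * (\<mu> * (v i)\<^sup>2)"
    by (simp add: power2_eq_square algebra_simps)
   also have "\<dots> \<le> E * (Q i)\<^sup>2 + 4 * \<mu> * (\<mu> * (v i)\<^sup>2)" using E by (intro add_right_mono mult_right_mono) auto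
   also have "\<dots> = 4 * \<mu> * (E / (4 * \<mu>) * (Q i)\<^sup>2 + \<mu> * (v i)\<^sup>2)" using \<mu> by (simp add: distrib_left)
   finally have "4 * \<mu> * - (Q i * (\<eta> * v i)) \<le> 4 * \<mu> * (E / (4 * \<mu>) * (Q i)\<^sup>2 + \<mu> * (v i)\<^sup>2)" by simp
   thus ?thesis using \<mu> by (subst (asm) mult_le_cancel_left_pos) auto
  qed
  have 2: "- (Q i * (u * (\<eta> * \<eta>' i))) \<le> 1 / (2 * \<tau>) * (Q i)\<^sup>2 + \<tau> / 2 * A\<^sup>2 * u\<^sup>2"
  proof -
   have "0 \<le> (Q i + \<tau> * (u * (\<eta> * \<eta>' i)))\<^sup>2" by simp
   hence "2 * \<tau> * - (Q i * (u * (\<eta> * \<eta>' i))) \<le> (Q i)\<^sup>2 + \<tau>\<^sup>2 * (u\<^sup>2 * (\<eta> * \<eta>' i)\<^sup>2)"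
    by (simp add: power2_eq_square algebra_simps)
   also have "\<dots> \<le> (Q i)\<^sup>2 + \<tau>\<^sup>2 * (u\<^sup>2 * A\<^sup>2)"
    using power_mono[OF A[of i], of 2] by (intro add_left_mono mult_left_mono) auto
   also have "\<dots> = 2 * \<tau> * (1 / (2 * \<tau>) * (Q i)\<^sup>2 + \<tau> / 2 * A\<^sup>2 * u\<^sup>2)"
    using \<tau> by (simp add: distrib_left power2_eq_square)
   finally show ?thesis using \<tau> by (subst (asm) mult_le_cancel_left_pos) auto
  qed
  have "Q i * e i = Q i * (\<eta> * v i) + Q i * (u * (\<eta> * \<eta>' i))" unfolding e by (simp add: distrib_left)
  moreover have "(E / (4 * \<mu>) + 1 / (2 * \<tau>)) * (Q i)\<^sup>2 = E / (4 * \<mu>) * (Q i)\<^sup>2 + 1 / (2 * \<tau>) * (Q i)\<^sup>2" by (rule distrib_right)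
  ultimately show ?thesis using 1 2 by linarith
 qed
 have "- (\<Sum>i\<in>UNIV. P i * e i) = - (\<Sum>i\<in>UNIV. \<Sum>j\<in>UNIV. c i j * u' j * e i) + (\<Sum>i\<in>UNIV. - (Q i * e i))"
  unfolding P by (simp add: distrib_right sum.distrib sum_distrib_right sum_negf)
 also have "(\<Sum>i\<in>UNIV. - (Q i * e i)) \<le> (\<Sum>i\<in>UNIV. (E / (4 * \<mu>) + 1 / (2 * \<tau>)) * (Q i)\<^sup>2 + \<tau> / 2 * A\<^sup>2 * u\<^sup>2 + \<mu> * (v i)\<^sup>2)"
  by (rule sum_mono) (rule Q)
 also have "\<dots> = (\<Sum>i\<in>UNIV. (E / (4 * \<mu>) + 1 / (2 * \<tau>)) * (Q i)\<^sup>2 + \<tau> / 2 * A\<^sup>2 * u\<^sup>2) + \<mu> * (\<Sum>i\<in>UNIV. (v i)\<^sup>2)"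
  by (simp add: sum.distrib sum_distrib_left)
 finally show ?thesis unfolding e_def[symmetric] main using coercive[of v] by linarith
qed

context elliptic
begin

text \<open>The quadratic form attains a positive minimum on \<open>K\<close> times the unit sphere.\<close>

lemma coercive_on_compact:
 assumes K: "compact K" "K \<subseteq> \<Omega>"
 obtains \<mu> where "\<mu> > 0" "\<And>x v. x \<in> K ==> \<mu> * (\<Sum>i\<in>UNIV. (v i)\<^sup>2) \<le> (\<Sum>i\<in>UNIV. \<Sum>j\<in>UNIV. c i j x * v i * v j)"
proof (cases "K = {}")
 case True
 thus ?thesis using that[of 1] by simp
next
 case False
 define q where "q y = (\<Sum>i\<in>UNIV. \<Sum>j\<in>UNIV. c i j (fst y) * snd y $ i * snd y $ j)" for y :: "(real^'n) \<times> (real^'n)"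
 define T where "T = K \<times> sphere (0::real^'n) 1"
 have "sphere (0::real^'n) 1 \<noteq> {}" by simp
 hence T: "compact T" "T \<noteq> {}" using K False by (auto simp: T_def intro: compact_Times)
 have cc: "continuous_on T (\<lambda>y. c i j (fst y))" for i j
  by (rule continuous_on_compose2[OF c_continuous[of i j]]) (use K in \<open>auto simp: T_def intro: continuous_on_fst\<close>)
 have "continuous_on T q" unfolding q_def
  by (intro continuous_on_sum continuous_on_mult cc continuous_on_component continuous_on_snd continuous_on_id)
 then obtain y where y: "y \<in> T" "\<And>z. z \<in> T ==> q y \<le> q z" using continuous_attains_inf[OF T] by blast
 have "snd y \<noteq> 0" "fst y \<in> \<Omega>" using y(1) K by (auto simp: T_def)
 hence \<mu>: "q y > 0" unfolding q_def using c_pos by blast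
 have "q y * (\<Sum>i\<in>UNIV. (v i)\<^sup>2) \<le> (\<Sum>i\<in>UNIV. \<Sum>j\<in>UNIV. c i j x * v i * v j)" if x: "x \<in> K" for x v
 proof -
  define V :: "real^'n" where "V = (\<chi> i. v i)"
  have n2: "(norm V)\<^sup>2 = (\<Sum>i\<in>UNIV. (v i)\<^sup>2)" unfolding power2_norm_eq_inner by (simp add: V_def inner_vec_def power2_eq_square)
  show ?thesis
  proof (cases "V = 0")
   case True
   hence "v i = 0" for i by (simp add: V_def vec_eq_iff)
   thus ?thesis by simp
  next
   case False
   define W where "W = (1 / norm V) *\<^sub>R V"
   have "(x, W) \<in> T" using x False by (simp add: T_def W_def)
   hence "q y * (norm V)\<^sup>2 \<le> q (x, W) * (norm V)\<^sup>2" using y(2) by (intro mult_right_mono) auto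
   also have "\<dots> = (\<Sum>i\<in>UNIV. \<Sum>j\<in>UNIV. c i j x * v i * v j)"
   proof -
    have eq: "c i j x * W $ i * W $ j * (norm V)\<^sup>2 = c i j x * v i * v j" for i j
     using False by (simp add: W_def V_def power2_eq_square)
    show ?thesis by (simp only: q_def fst_conv snd_conv sum_distrib_right eq)
   qed
   finally show ?thesis by (simp add: n2)
  qed
 qed
 thus ?thesis using that[OF \<mu>] by blast
qed

text \<open>The mollification of the distributional flux \<open>\<Sum>\<^sub>j c\<^sub>i\<^sub>j \<partial>\<^sub>j g\<close>, with the derivative moved to the mollifier
  and the coefficient by the product rule.\<close>

definition flux :: "(real^'n => real) => nat => 'n => real^'n => real" where
 "flux g m i x = (\<Sum>j\<in>UNIV. conv (\<lambda>y. g y * c i j y) (pd j (\<rho> m)) x - conv (\<lambda>y. g y * D j i j y) (\<rho> m) x)"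

text \<open>Functions that can be mollified globally: a solution multiplied by the indicator of a compact set.\<close>

definition cut :: "(real^'n) set => (real^'n => real) => bool" where
 "cut K g \<longleftrightarrow> compact K \<and> K \<subseteq> \<Omega> \<and> (\<forall>x. x \<notin> K \<longrightarrow> g x = 0) \<and> integrable lborel g \<and> integrable lborel (\<lambda>x. (g x)\<^sup>2)"

lemma cut_integrable:
 assumes g: "cut K g"
 shows "integrable lborel (\<lambda>y. g y * c i j y)" "integrable lborel (\<lambda>y. g y * D i j k y)"
proof -
 have gi: "integrable lborel g" and K: "compact K" "K \<subseteq> \<Omega>" and g0: "\<And>x. x \<notin> K ==> g x = 0" using g by (auto simp: cut_def)
 have Km [measurable]: "K \<in> sets borel" using K by (simp add: compact_imp_closed borel_closed)
 show "integrable lborel (\<lambda>y. g y * D i j k y)" by (rule integrable_mult_bounded[OF gi _ D_bound]) measurable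
 obtain b where b: "b \<ge> 0" "\<And>i j x. x \<in> K ==> \<bar>c i j x\<bar> \<le> b" using c_bounded_on_compact[OF K] by blast
 have "integrable lborel (\<lambda>y. g y * (indicator K y * c i j y))"
 proof (rule integrable_mult_bounded[OF gi, of _ b])
  fix y show "\<bar>indicator K y * c i j y\<bar> \<le> b" using b by (cases "y \<in> K") auto
 qed measurable
 moreover have "g y * (indicator K y * c i j y) = g y * c i j y" for y using g0 by (cases "y \<in> K") auto
 ultimately show "integrable lborel (\<lambda>y. g y * c i j y)" by simp
qed

lemma flux_smooth:
 assumes g: "cut K g"
 shows "Ck k (flux g m i)"
  and "pd l (flux g m i) x = (\<Sum>j\<in>UNIV. conv (\<lambda>y. g y * c i j y) (pd l (pd j (\<rho> m))) x - conv (\<lambda>y. g y * D j i j y) (pd l (\<rho> m)) x)"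
proof -
 note int = cut_integrable[OF g]
 define a b where "a j = conv (\<lambda>y. g y * c i j y) (pd j (\<rho> m))" and "b j = conv (\<lambda>y. g y * D j i j y) (\<rho> m)" for j
 have ab: "Ck k (a j)" "Ck k (b j)" for j k
  unfolding a_def b_def using Ck_conv[OF int(1) Cc_pd[OF \<rho>_Cc]] Ck_conv[OF int(2) \<rho>_Cc] by auto
 have pda: "pd l (a j) = conv (\<lambda>y. g y * c i j y) (pd l (pd j (\<rho> m)))" for j
  unfolding a_def by (rule pd_conv[OF int(1) Cc_pd[OF \<rho>_Cc[of m "Suc (Suc 0)"]]])
 have pdb: "pd l (b j) = conv (\<lambda>y. g y * D j i j y) (pd l (\<rho> m))" for j
  unfolding b_def by (rule pd_conv[OF int(2) \<rho>_Cc[of m "Suc 0"]])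
 have eq: "flux g m i = (\<lambda>x. \<Sum>j\<in>UNIV. a j x + (-1) * b j x)" by (simp add: fun_eq_iff flux_def a_def b_def)
 have t: "Ck k (\<lambda>x. a j x + (-1) * b j x)" for j k by (intro Ck_add Ck_mult Ck_const ab)
 have sumC: "finite S ==> Ck k (\<lambda>x. \<Sum>j\<in>S. a j x + (-1) * b j x)" for S k
  by (induction S rule: finite_induct) (auto intro: Ck_const Ck_add[OF t[simplified]])
 show "Ck k (flux g m i)" unfolding eq by (rule sumC) simp
 have d: "a j differentiable (at x)" "b j differentiable (at x)" for j x
  using Ck_differentiable[OF ab(1)[of "Suc 0"]] Ck_differentiable[OF ab(2)[of "Suc 0"]] by auto
 have td: "(\<lambda>x. a j x + (-1) * b j x) differentiable (at x)" "pd l (\<lambda>x. a j x + (-1) * b j x) x = pd l (a j) x + (-1) * pd l (b j) x" for j x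
 proof -
  have n: "(\<lambda>x. (-1) * b j x) differentiable (at x)" using d by (intro differentiable_mult) auto
  show "(\<lambda>x. a j x + (-1) * b j x) differentiable (at x)" using d n by (intro differentiable_add) auto
  show "pd l (\<lambda>x. a j x + (-1) * b j x) x = pd l (a j) x + (-1) * pd l (b j) x"
   by (simp only: pd_add[OF d(1) n] pd_cmult[OF d(2)])
 qed
 have "finite S ==> (\<lambda>x. \<Sum>j\<in>S. a j x + (-1) * b j x) differentiable (at x) \<and> pd l (\<lambda>x. \<Sum>j\<in>S. a j x + (-1) * b j x) x = (\<Sum>j\<in>S. pd l (a j) x + (-1) * pd l (b j) x)" for S
 proof (induction S rule: finite_induct)
  case empty
  thus ?case by (simp add: pd_const)
 next
  case (insert s S)
  have e: "(\<lambda>x. \<Sum>j\<in>insert s S. a j x + (-1) * b j x) = (\<lambda>x. (a s x + (-1) * b s x) + (\<Sum>j\<in>S. a j x + (-1) * b j x))"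
   using insert by (simp add: fun_eq_iff)
  show ?case unfolding e using insert td[of s x] pd_add[OF td(1)[of s x]] differentiable_add[OF td(1)[of s x]] by simp
 qed
 from this[of UNIV] show "pd l (flux g m i) x = (\<Sum>j\<in>UNIV. conv (\<lambda>y. g y * c i j y) (pd l (pd j (\<rho> m))) x - conv (\<lambda>y. g y * D j i j y) (pd l (\<rho> m)) x)"
  unfolding eq pda pdb by simp
qed

text \<open>Testing the equation with translates of the mollifier shows that the mollified solution solves
  the equation in divergence form, with a flux that is a mollification.\<close>

lemma mollified_equation:
 assumes g: "cut K (\<lambda>x. indicator K x * g0 x)"
  and eq: "\<And>\<phi>. \<phi> \<in> test_functions \<Omega> ==> (LINT x|lborel. g0 x * (\<phi> x + h * Lop \<phi> x)) = 0"
  and x: "cball x r \<subseteq> K" and m: "1 / real (Suc m) \<le> r"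
 shows "conv (\<lambda>x. indicator K x * g0 x) (\<rho> m) x = h * (\<Sum>i\<in>UNIV. pd i (flux (\<lambda>x. indicator K x * g0 x) m i) x)"
proof -
 define g where "g x = indicator K x * g0 x" for x
 have g: "cut K g" using g by (simp add: g_def[abs_def])
 have K: "compact K" "K \<subseteq> \<Omega>" and gi: "integrable lborel g" using g by (auto simp: cut_def)
 note int = cut_integrable[OF g]
 have sub: "cball x r \<subseteq> \<Omega>" using x K by blast
 define \<phi> where "\<phi> y = \<rho> m (x - y)" for y
 have \<phi>: "\<phi> \<in> test_functions \<Omega>" using translate_test(1)[OF sub m] by (simp add: \<phi>_def[abs_def])
 have pd1: "pd j \<phi> y = - pd j (\<rho> m) (x - y)" for j y using translate_test(2)[OF sub m] by (simp add: \<phi>_def[abs_def])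
 have pd2: "pd i (pd j \<phi>) y = pd i (pd j (\<rho> m)) (x - y)" for i j y using translate_test(3)[OF sub m] by (simp add: \<phi>_def[abs_def])
 have \<phi>0: "\<phi> y = 0" if "y \<notin> cball x r" for y using that m by (auto simp: \<phi>_def dist_norm intro!: \<rho>_support)
 have L0: "Lop \<phi> y = 0" if "y \<notin> cball x r" for y using Lop_zero_off[of "cball x r" \<phi> y] \<phi>0 that by auto
 have gg: "g0 y * (\<phi> y + h * Lop \<phi> y) = g y * (\<phi> y + h * Lop \<phi> y)" for y
  using \<phi>0[of y] L0[of y] x by (cases "y \<in> cball x r") (auto simp: g_def)
 note ci = conv_integrable[OF int(1) Cc_pd[OF Cc_pd[OF \<rho>_Cc[of m "Suc (Suc 0)"]]]] conv_integrable[OF int(2) Cc_pd[OF \<rho>_Cc[of m "Suc 0"]]]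
 define A where "A i j = conv (\<lambda>y. g y * c i j y) (pd i (pd j (\<rho> m))) x" for i j
 define B' where "B' i j = conv (\<lambda>y. g y * D i j i y) (pd j (\<rho> m)) x" for i j
 have gL: "g y * Lop \<phi> y = (\<Sum>i\<in>UNIV. \<Sum>j\<in>UNIV. (g y * D i j i y) * pd j (\<rho> m) (x - y) - (g y * c i j y) * pd i (pd j (\<rho> m)) (x - y))" for y
  unfolding Lop_def pd1 pd2 by (simp add: sum_distrib_left sum_negf[symmetric] algebra_simps)
 have gLi: "integrable lborel (\<lambda>y. g y * Lop \<phi> y)"
  unfolding gL by (intro Bochner_Integration.integrable_sum Bochner_Integration.integrable_diff ci)
 have gLI: "(LINT y|lborel. g y * Lop \<phi> y) = (\<Sum>i\<in>UNIV. \<Sum>j\<in>UNIV. B' i j - A i j)"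
  unfolding gL A_def B'_def conv_def using ci by (simp add: integral_sum)
 have "0 = (LINT y|lborel. g y * \<phi> y + h * (g y * Lop \<phi> y))"
  using eq[OF \<phi>] unfolding gg by (simp add: distrib_left mult_ac)
 also have "\<dots> = conv g (\<rho> m) x + h * (\<Sum>i\<in>UNIV. \<Sum>j\<in>UNIV. B' i j - A i j)"
  using conv_integrable[OF gi \<rho>_Cc[of m 0], of x] gLi unfolding gLI[symmetric] by (simp add: conv_def \<phi>_def)
 finally have "conv g (\<rho> m) x = h * (\<Sum>i\<in>UNIV. \<Sum>j\<in>UNIV. A i j - B' i j)"
  by (simp add: sum_subtractf algebra_simps)
 also have "(\<Sum>i\<in>UNIV. \<Sum>j\<in>UNIV. A i j - B' i j) = (\<Sum>i\<in>UNIV. \<Sum>j\<in>UNIV. A i j - B' j i)"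
  unfolding sum_subtractf by (simp add: sum.swap[of B'])
 also have "\<dots> = (\<Sum>i\<in>UNIV. pd i (flux g m i) x)"
  unfolding flux_smooth(2)[OF g] A_def B'_def ..
 finally show ?thesis by (simp add: g_def[abs_def])
qed

text \<open>Friedrichs' lemma: the mollified flux differs from the flux of the mollified function by an
  average of increments. The Lipschitz bound for the coefficients compensates the singularity of
  the differentiated mollifier, and the averaging kernel annihilates constants by the definition
  of the weak derivative.\<close>

lemma flux_error:
 assumes g: "cut K g" and x: "cball x r \<subseteq> K" "cball x (2 * r) \<subseteq> \<Omega>" and r: "r > 0" and m: "1 / real (Suc m) \<le> r"
 shows "ennreal \<bar>flux g m i x - (\<Sum>j\<in>UNIV. c i j x * pd j (conv g (\<rho> m)) x)\<bar>
  \<le> (\<integral>\<^sup>+z. ennreal ((\<Sum>j\<in>UNIV. real CARD('n) * B * (norm z * \<bar>pd j (\<rho> m) z\<bar>) + B * \<rho> m z) * \<bar>g (x - z) - g x\<bar>) \<partial>lborel)"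
proof -
 have K: "compact K" "K \<subseteq> \<Omega>" and gi: "integrable lborel g" using g by (auto simp: cut_def)
 have [measurable]: "g \<in> borel_measurable borel" using gi by simp
 note int = cut_integrable[OF g]
 have sub: "cball x r \<subseteq> \<Omega>" using x K by blast
 note t = translate_test[OF sub m]
 define N where "N y = (\<Sum>j\<in>UNIV. (c i j y - c i j x) * pd j (\<rho> m) (x - y) - D j i j y * \<rho> m (x - y))" for y
 have pdu: "pd j (conv g (\<rho> m)) x = conv g (pd j (\<rho> m)) x" for j using pd_conv[OF gi \<rho>_Cc[of m "Suc 0"]] by simp
 have tC: "(\<lambda>y. \<rho> m (x - y)) \<in> Cc k \<Omega>" for k using t(1) by (simp add: test_functions_iff)
 have pt: "(\<lambda>y. pd j (\<rho> m) (x - y)) = (\<lambda>y. (-1) * pd j (\<lambda>y. \<rho> m (x - y)) y)" for j using t(2) by simp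
 have ptC: "(\<lambda>y. pd j (\<rho> m) (x - y)) \<in> Cc 0 \<Omega>" for j
  unfolding pt by (intro Cc_cmult Cc_pd tC)
 have ic: "integrable lborel (\<lambda>y. c k j y * pd j (\<rho> m) (x - y))" for j k
  by (rule integrable_mult_Cc[OF _ _ ptC]) (use c_wpd[of j k j] in \<open>auto simp: wpd_def\<close>)
 have iD: "integrable lborel (\<lambda>y. D j i j y * \<rho> m (x - y))" for j
  by (rule integrable_mult_Cc[OF _ _ tC[of 0]]) (use c_wpd[of j j i] in \<open>auto simp: wpd_def\<close>)
 have ip: "integrable lborel (\<lambda>y. pd j (\<rho> m) (x - y))" for j using Cc_integrable[OF ptC] .
 have iN: "integrable lborel N"
  unfolding N_def[abs_def] left_diff_distrib using ic iD ip
  by (intro Bochner_Integration.integrable_sum Bochner_Integration.integrable_diff integrable_mult_right)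
 have [measurable]: "N \<in> borel_measurable borel" using iN by simp
 have "(LINT y|lborel. N y) = (\<Sum>j\<in>UNIV. (LINT y|lborel. c i j y * pd j (\<rho> m) (x - y)) - c i j x * (LINT y|lborel. pd j (\<rho> m) (x - y)) - (LINT y|lborel. D j i j y * \<rho> m (x - y)))"
  unfolding N_def left_diff_distrib using ic iD ip by (simp add: integral_sum)
 also have "\<dots> = 0"
 proof (intro sum.neutral ballI)
  fix j
  have "(LINT y|lborel. c i j y * pd j (\<rho> m) (x - y)) = - (LINT y|lborel. c j i y * pd j (\<lambda>y. \<rho> m (x - y)) y)"
   unfolding t(2) by (simp add: c_sym[of i j])
  also have "\<dots> = (LINT y|lborel. D j i j y * \<rho> m (x - y))" using c_wpd[of j j i] t(1) by (simp add: wpd_def)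
  finally have 1: "(LINT y|lborel. c i j y * pd j (\<rho> m) (x - y)) = (LINT y|lborel. D j i j y * \<rho> m (x - y))" .
  have "(LINT y|lborel. pd j (\<rho> m) (x - y)) = (LINT y|lborel. pd j (\<rho> m) y)" by (rule lborel_integral_reflect) measurable
  also have "\<dots> = 0" by (rule integral_pd_eq_0[OF \<rho>_Cc[of m "Suc 0"]])
  finally show "(LINT y|lborel. c i j y * pd j (\<rho> m) (x - y)) - c i j x * (LINT y|lborel. pd j (\<rho> m) (x - y)) - (LINT y|lborel. D j i j y * \<rho> m (x - y)) = 0"
   using 1 by simp
 qed
 finally have N0: "(LINT y|lborel. N y) = 0" .
 note ci = conv_integrable[OF int(1) Cc_pd[OF \<rho>_Cc[of m "Suc 0"]]] conv_integrable[OF int(2) \<rho>_Cc[of m 0]] conv_integrable[OF gi Cc_pd[OF \<rho>_Cc[of m "Suc 0"]]]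
 have gN: "g y * N y = (\<Sum>j\<in>UNIV. (g y * c i j y) * pd j (\<rho> m) (x - y) - (g y * D j i j y) * \<rho> m (x - y) - c i j x * (g y * pd j (\<rho> m) (x - y)))" for y
  by (simp add: N_def sum_distrib_left algebra_simps)
 have igN: "integrable lborel (\<lambda>y. g y * N y)"
  unfolding gN using ci by (intro Bochner_Integration.integrable_sum Bochner_Integration.integrable_diff integrable_mult_right)
 have "flux g m i x - (\<Sum>j\<in>UNIV. c i j x * pd j (conv g (\<rho> m)) x) = (LINT y|lborel. g y * N y)"
  unfolding gN flux_def pdu conv_def using ci by (simp add: integral_sum sum_subtractf)
 also have "\<dots> = (LINT y|lborel. (g y - g x) * N y)"
  using igN iN N0 by (simp add: left_diff_distrib)
 also have "\<dots> = (LINT z|lborel. (g (x - z) - g x) * N (x - z))"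
  by (subst lborel_integral_reflect[symmetric, of _ x]) (auto simp: N_def)
 finally have eq: "flux g m i x - (\<Sum>j\<in>UNIV. c i j x * pd j (conv g (\<rho> m)) x) = (LINT z|lborel. (g (x - z) - g x) * N (x - z))" .
 have i: "integrable lborel (\<lambda>z. (g (x - z) - g x) * N (x - z))"
  using igN iN by (subst lborel_integrable_reflect[of "\<lambda>y. (g y - g x) * N y"]) (auto simp: left_diff_distrib)
 have Nb: "\<bar>N (x - z)\<bar> \<le> (\<Sum>j\<in>UNIV. real CARD('n) * B * (norm z * \<bar>pd j (\<rho> m) z\<bar>) + B * \<rho> m z)" for z
 proof -
  have "\<bar>(c i j (x - z) - c i j x) * pd j (\<rho> m) z - D j i j (x - z) * \<rho> m z\<bar> \<le> real CARD('n) * B * (norm z * \<bar>pd j (\<rho> m) z\<bar>) + B * \<rho> m z" for j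
  proof (cases "norm z \<le> r")
   case True
   have "\<bar>c i j (x - z) - c i j x\<bar> \<le> real CARD('n) * B * norm ((x - z) - x)"
    by (rule wpd_lipschitz[OF c_wpd D_bound c_continuous r x(2)]) (use True r in \<open>auto simp: dist_norm\<close>)
   hence "\<bar>(c i j (x - z) - c i j x) * pd j (\<rho> m) z\<bar> \<le> real CARD('n) * B * norm z * \<bar>pd j (\<rho> m) z\<bar>"
    unfolding abs_mult by (intro mult_right_mono) auto
   moreover have "\<bar>D j i j (x - z) * \<rho> m z\<bar> \<le> B * \<rho> m z"
    unfolding abs_mult using D_bound \<rho>_nonneg by (simp add: mult_right_mono)
   ultimately show ?thesis by (simp add: mult.assoc)
  next
   case False
   hence "norm z > 1 / real (Suc m)" using m by simp
   thus ?thesis using \<rho>_support pd_\<rho>_support by simp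
  qed
  thus ?thesis unfolding N_def by (intro order_trans[OF sum_abs] sum_mono) simp
 qed
 have "ennreal \<bar>flux g m i x - (\<Sum>j\<in>UNIV. c i j x * pd j (conv g (\<rho> m)) x)\<bar> \<le> (\<integral>\<^sup>+z. ennreal \<bar>(g (x - z) - g x) * N (x - z)\<bar> \<partial>lborel)"
  unfolding eq using integral_norm_bound_ennreal[OF i] by simp
 also have "\<dots> \<le> (\<integral>\<^sup>+z. ennreal ((\<Sum>j\<in>UNIV. real CARD('n) * B * (norm z * \<bar>pd j (\<rho> m) z\<bar>) + B * \<rho> m z) * \<bar>g (x - z) - g x\<bar>) \<partial>lborel)"
  proof (intro nn_integral_mono ennreal_leI)
  fix z
  show "\<bar>(g (x - z) - g x) * N (x - z)\<bar> \<le> (\<Sum>j\<in>UNIV. real CARD('n) * B * (norm z * \<bar>pd j (\<rho> m) z\<bar>) + B * \<rho> m z) * \<bar>g (x - z) - g x\<bar>"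
   unfolding abs_mult mult.commute[of "\<bar>g (x - z) - g x\<bar>" "\<bar>N (x - z)\<bar>"] by (rule mult_right_mono[OF Nb abs_ge_zero])
 qed
 finally show ?thesis .
qed

text \<open>The kernels in the pointwise bound have uniformly bounded mass and shrinking supports, so continuity of
  translations in \<open>L\<^sub>2\<close> makes the error small.\<close>

lemma flux_error_L2:
 assumes g: "cut K g" and A: "\<And>x. x \<in> A ==> cball x r \<subseteq> K" "\<And>x. x \<in> A ==> cball x (2 * r) \<subseteq> \<Omega>" and r: "r > 0" and e: "e > 0"
 shows "\<exists>M. \<forall>m\<ge>M. (\<integral>\<^sup>+x. indicator A x * ennreal ((flux g m i x - (\<Sum>j\<in>UNIV. c i j x * pd j (conv g (\<rho> m)) x))\<^sup>2) \<partial>lborel) \<le> ennreal e"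
proof -
 have gi: "integrable lborel g" "integrable lborel (\<lambda>x. (g x)\<^sup>2)" using g by (auto simp: cut_def)
 have [measurable]: "g \<in> borel_measurable borel" using gi by simp
 define k where "k m z = (\<Sum>j\<in>UNIV. real CARD('n) * B * (norm z * \<bar>pd j (\<rho> m) z\<bar>) + B * \<rho> m z)" for m z
 define \<kappa>' where "\<kappa>' = real CARD('n) * (real CARD('n) * B * \<kappa> + B)"
 have km: "k m \<in> borel_measurable borel" for m unfolding k_def by measurable
 have k0: "0 \<le> k m z" for m z unfolding k_def using B_nonneg \<rho>_nonneg by (intro sum_nonneg add_nonneg_nonneg mult_nonneg_nonneg) auto
 have mi: "integrable lborel (\<lambda>z. norm z * \<bar>pd j (\<rho> m) z\<bar>)" for j m
 proof -
  obtain b where b: "\<And>z. \<bar>pd j (\<rho> m) z\<bar> \<le> b" using Cc_bounded[OF Cc_pd[OF \<rho>_Cc[of m "Suc 0"]]] by blast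
  have far: "pd j (\<rho> m) z = 0" if "z \<notin> cball 0 1" for z
  proof (rule pd_\<rho>_support)
   have "1 / real (Suc m) \<le> 1" "1 < norm z" using that by simp_all
   thus "1 / real (Suc m) < norm z" by (rule le_less_trans)
  qed
  show ?thesis
  proof (rule integral_abs_le_compact(1)[of "cball 0 1" _ b])
   fix z
   show "\<bar>norm z * \<bar>pd j (\<rho> m) z\<bar>\<bar> \<le> b"
   proof (cases "norm z \<le> 1")
    case True
    have "norm z * \<bar>pd j (\<rho> m) z\<bar> \<le> 1 * \<bar>pd j (\<rho> m) z\<bar>" using True by (intro mult_right_mono) auto
    thus ?thesis using b[of z] by simp
   qed (use far[of z] b[of z] in simp)
  qed (use far in auto)
 qed
 have ki: "integrable lborel (k m)" for m
  unfolding k_def[abs_def] using mi \<rho>_integrable by (intro Bochner_Integration.integrable_sum Bochner_Integration.integrable_add integrable_mult_right)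
 have k\<kappa>: "(LINT z|lborel. k m z) \<le> \<kappa>'" for m
 proof -
  have "(LINT z|lborel. k m z) = (\<Sum>j\<in>UNIV. real CARD('n) * B * (LINT z|lborel. norm z * \<bar>pd j (\<rho> m) z\<bar>) + B)"
   unfolding k_def using mi \<rho>_integrable \<rho>_integral by (simp add: integral_sum)
  also have "\<dots> \<le> (\<Sum>j\<in>(UNIV::'n set). real CARD('n) * B * \<kappa> + B)"
   using \<rho>_moment B_nonneg by (intro sum_mono add_right_mono mult_left_mono) auto
  finally show ?thesis by (simp add: \<kappa>'_def)
 qed
 define e' where "e' = e / (\<kappa>'\<^sup>2 + 1)"
 have e': "e' > 0" "\<kappa>'\<^sup>2 * e' \<le> e"
 proof -
  have p: "\<kappa>'\<^sup>2 + 1 > 0" using zero_le_power2[of \<kappa>'] by linarith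
  thus pos: "e' > 0" using e by (simp add: e'_def)
  have "(\<kappa>'\<^sup>2 + 1) * e' = e" using p by (simp add: e'_def)
  thus "\<kappa>'\<^sup>2 * e' \<le> e" using pos by (simp add: distrib_right)
 qed
 obtain d where d: "d > 0" "\<And>z. norm z \<le> d ==> (\<integral>\<^sup>+x. ennreal ((g (x - z) - g x)\<^sup>2) \<partial>lborel) \<le> ennreal e'"
  using nn_translation_L2[OF _ gi(2) e'(1)] by auto
 obtain M where M: "\<And>m. m \<ge> M ==> 1 / real (Suc m) \<le> min d r" using eventually_radius[of "min d r"] d r by auto
 have "(\<integral>\<^sup>+x. indicator A x * ennreal ((flux g m i x - (\<Sum>j\<in>UNIV. c i j x * pd j (conv g (\<rho> m)) x))\<^sup>2) \<partial>lborel) \<le> ennreal e" if m: "m \<ge> M" for m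
 proof -
  have "(\<integral>\<^sup>+x. indicator A x * ennreal ((flux g m i x - (\<Sum>j\<in>UNIV. c i j x * pd j (conv g (\<rho> m)) x))\<^sup>2) \<partial>lborel) \<le> ennreal (\<kappa>'\<^sup>2 * e')"
  proof (rule kernel_L2[OF km _ k0 ki k\<kappa> less_imp_le[OF e'(1)]])
   fix x assume "x \<in> A"
   thus "ennreal \<bar>flux g m i x - (\<Sum>j\<in>UNIV. c i j x * pd j (conv g (\<rho> m)) x)\<bar> \<le> (\<integral>\<^sup>+z. ennreal (k m z * \<bar>g (x - z) - g x\<bar>) \<partial>lborel)"
    unfolding k_def using flux_error[OF g A(1,2) r] M[OF m] by simp
  next
   fix z assume "k m z \<noteq> 0"
   hence "norm z \<le> d" using \<rho>_support[of m z] pd_\<rho>_support[of m z] M[OF m] by (cases "norm z > 1 / real (Suc m)") (auto simp: k_def)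
   thus "(\<integral>\<^sup>+x. ennreal ((g (x - z) - g x)\<^sup>2) \<partial>lborel) \<le> ennreal e'" by (rule d)
  qed measurable
  also have "\<dots> \<le> ennreal e" using e'(2) by (rule ennreal_leI)
  finally show ?thesis .
 qed
 thus ?thesis by blast
qed

end

context elliptic
begin

lemma Gam_nonneg: "x \<in> \<Omega> ==> 0 \<le> Gam \<eta> x"
 unfolding Gam_def by (rule quadratic_nonneg)

lemma Gam_zero_off: "compact K ==> (\<And>x. x \<notin> K ==> \<eta> x = 0) ==> x \<notin> K ==> Gam \<eta> x = 0"
 using pd_zero_off[of K \<eta> x] by (simp add: Gam_def)

lemma Gam_measurable:
 assumes \<eta>: "\<eta> \<in> test_functions \<Omega>"
 shows "Gam \<eta> \<in> borel_measurable borel"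
proof -
 have \<eta>C: "\<eta> \<in> Cc k \<Omega>" for k using \<eta> by (simp add: test_functions_iff)
 have [measurable]: "pd i \<eta> \<in> borel_measurable borel" for i by (rule Cc_measurable[OF Cc_pd[OF \<eta>C]])
 show ?thesis unfolding Gam_def[abs_def] by measurable
qed

lemma Gam_bounded:
 assumes \<eta>: "\<eta> \<in> test_functions \<Omega>"
 obtains b where "\<And>x. \<bar>Gam \<eta> x\<bar> \<le> b"
proof -
 have \<eta>C: "\<eta> \<in> Cc k \<Omega>" for k using \<eta> by (simp add: test_functions_iff)
 have p: "(\<lambda>x. pd i \<eta> x * pd j \<eta> x) \<in> Cc 0 \<Omega>" for i j
  by (rule Cc_mult[OF Cc_pd[OF \<eta>C] Cc_Ck[OF Cc_pd[OF \<eta>C]]])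
 have "\<exists>b. \<forall>x. \<bar>c i j x * (pd i \<eta> x * pd j \<eta> x)\<bar> \<le> b" for i j
  using c_mult_bounded[OF p] by metis
 then obtain b where b: "\<And>i j x. \<bar>c i j x * (pd i \<eta> x * pd j \<eta> x)\<bar> \<le> b i j" by metis
 have "\<bar>Gam \<eta> x\<bar> \<le> (\<Sum>i\<in>UNIV. \<Sum>j\<in>UNIV. b i j)" for x
  unfolding Gam_def mult.assoc by (intro order_trans[OF sum_abs] sum_mono b)
 thus ?thesis using that by blast
qed

text \<open>The energy inequality: formally, testing \<open>g + h L g = 0\<close> with \<open>\<eta>\<^sup>2 g\<close> and completing the
  square. Since nothing is known about derivatives of \<open>g\<close>, the computation is carried out for its
  mollification; the error of the flux tends to zero in \<open>L\<^sub>2\<close> near the support of \<open>\<eta>\<close> and is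
  absorbed by the local coercivity of the coefficients at an arbitrarily small cost \<open>\<tau>\<close>.\<close>

theorem energy:
 fixes \<eta> :: "real^'n => real"
 assumes g0 [measurable]: "g0 \<in> borel_measurable borel"
  and loc: "\<And>K. compact K ==> K \<subseteq> \<Omega> ==> integrable lborel (\<lambda>x. indicator K x * (g0 x)\<^sup>2)"
  and h: "h > 0"
  and eq: "\<And>\<phi>. \<phi> \<in> test_functions \<Omega> ==> (LINT x|lborel. g0 x * (\<phi> x + h * Lop \<phi> x)) = 0"
  and \<eta>: "\<eta> \<in> test_functions \<Omega>"
 shows "(LINT x|lborel. (\<eta> x)\<^sup>2 * (g0 x)\<^sup>2) \<le> h * (LINT x|lborel. Gam \<eta> x * (g0 x)\<^sup>2)"
  and "integrable lborel (\<lambda>x. (\<eta> x)\<^sup>2 * (g0 x)\<^sup>2)" and "integrable lborel (\<lambda>x. Gam \<eta> x * (g0 x)\<^sup>2)"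
proof -
 have \<eta>C: "\<eta> \<in> Cc k \<Omega>" for k using \<eta> by (simp add: test_functions_iff)
 obtain K where K: "compact K" "K \<subseteq> \<Omega>" "\<And>x. x \<notin> K ==> \<eta> x = 0" using Cc_support[OF \<eta>C[of 0]] by blast
 have pd0: "pd i \<eta> x = 0" if "x \<notin> K" for i x using pd_zero_off[of K \<eta> x i] K that by blast
 have Gam0: "Gam \<eta> x = 0" if "x \<notin> K" for x using Gam_zero_off[of K \<eta> x] K that by blast
 have [measurable]: "K \<in> sets borel" using K by (simp add: compact_imp_closed borel_closed)
 have \<eta>m [measurable]: "\<eta> \<in> borel_measurable borel" by (rule Cc_measurable[OF \<eta>C])
 note Gm [measurable] = Gam_measurable[OF \<eta>]
 obtain r0 where r0: "r0 > 0" "(\<Union>x\<in>K. cball x r0) \<subseteq> \<Omega>"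
  using compact_subset_open_imp_cball_epsilon_subset[OF K(1) \<Omega> K(2)] by blast
 define r where "r = r0 / 2"
 have r: "r > 0" "2 * r = r0" using r0 by (auto simp: r_def)
 \<comment> \<open>balls of radius \<open>r\<close> about \<open>K\<close> stay in \<open>K1\<close> for mollifying; those of radius \<open>2 r\<close> stay in \<open>\<Omega>\<close> for the Lipschitz bound\<close>
 define K1 where "K1 = {x + y | x y. x \<in> K \<and> y \<in> cball 0 r}"
 have K1c: "compact K1" unfolding K1_def by (rule compact_neighbourhood[OF K(1)])
 have ball_le: "cball x r \<subseteq> cball x r0" for x :: "real^'n" using r by (intro subset_cball) simp
 have K1s: "K1 \<subseteq> \<Omega>" unfolding K1_def
  by (rule compact_neighbourhood_subset) (use r0 ball_le in blast)
 have KK1: "cball x r \<subseteq> K1" if "x \<in> K" for x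
 proof
  fix y assume "y \<in> cball x r"
  hence "y = x + (y - x)" "y - x \<in> cball 0 r" by (auto simp: dist_norm norm_minus_commute)
  thus "y \<in> K1" using that unfolding K1_def by blast
 qed
 have K2: "cball x (2 * r) \<subseteq> \<Omega>" if "x \<in> K" for x using r r0 that by blast
 have [measurable]: "K1 \<in> sets borel" using K1c by (simp add: compact_imp_closed borel_closed)
 define g where "g x = indicator K1 x * g0 x" for x
 have gm [measurable]: "g \<in> borel_measurable borel" unfolding g_def by measurable
 have g2: "integrable lborel (\<lambda>x. (g x)\<^sup>2)"
 proof -
  have "(g x)\<^sup>2 = indicator K1 x * (g0 x)\<^sup>2" for x by (simp add: g_def indicator_def)
  thus ?thesis using loc[OF K1c K1s] by simp
 qed
 have g1: "integrable lborel g"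
 proof (rule Bochner_Integration.integrable_bound)
  show "integrable lborel (\<lambda>x. indicator K1 x + (g x)\<^sup>2)"
   using borel_integrable_compact[OF K1c, of "\<lambda>_. 1 :: real"] g2 by (intro Bochner_Integration.integrable_add) simp_all
  show "AE x in lborel. norm (g x) \<le> norm (indicator K1 x + (g x)\<^sup>2)"
  proof (rule AE_I2)
   fix x
   have "\<bar>g x\<bar> \<le> indicator K1 x + (g x)\<^sup>2"
   proof (cases "x \<in> K1")
    case True
    have "0 \<le> (\<bar>g x\<bar> - 1)\<^sup>2" by simp
    hence "2 * \<bar>g x\<bar> \<le> 1 + (g x)\<^sup>2" by (simp add: power2_diff)
    thus ?thesis using True abs_ge_zero[of "g x"] by simp
   qed (simp add: g_def)
   thus "norm (g x) \<le> norm (indicator K1 x + (g x)\<^sup>2)" by simp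
  qed
 qed simp
 have cutg: "cut K1 g" using g1 g2 K1c K1s by (auto simp: cut_def g_def)
 define u where "u m = conv g (\<rho> m)" for m
 have uC: "Ck k (u m)" for k m unfolding u_def by (rule Ck_conv[OF g1 \<rho>_Cc])
 have uc: "continuous_on UNIV (u m)" for m using uC[of 0] by simp
 have um [measurable]: "u m \<in> borel_measurable borel" for m using uc by (rule borel_measurable_continuous_onI)
 define P where "P m i = flux g m i" for m i
 have PC: "Ck k (P m i)" for k m i unfolding P_def by (rule flux_smooth(1)[OF cutg])
 define Q where "Q m i x = P m i x - (\<Sum>j\<in>UNIV. c i j x * pd j (u m) x)" for m i x
 have [measurable]: "pd j (u m) \<in> borel_measurable borel" for j m
  using uC[of "Suc 0"] by (intro borel_measurable_continuous_onI) simp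
 have [measurable]: "P m i \<in> borel_measurable borel" for i m
  using PC[of 0] by (intro borel_measurable_continuous_onI) simp
 have Qm [measurable]: "Q m i \<in> borel_measurable borel" for m i unfolding Q_def by measurable
 have uL2: "\<exists>M. \<forall>m\<ge>M. (\<integral>\<^sup>+x. ennreal ((u m x - g x)\<^sup>2) \<partial>lborel) \<le> ennreal e" if "e > 0" for e
  unfolding u_def by (rule conv_L2[OF g1 g2 that])
 obtain b\<eta> where b\<eta>: "b\<eta> \<ge> 0" "\<And>x. \<bar>\<eta> x\<bar> \<le> b\<eta>" using Cc_bounded[OF \<eta>C[of 0]] by blast
 have "\<exists>b. \<forall>x. \<bar>\<eta> x * pd i \<eta> x\<bar> \<le> b" for i
  using Cc_bounded[OF Cc_mult[OF \<eta>C Cc_Ck[OF Cc_pd[OF \<eta>C]]]] by metis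
 then obtain A' where A': "\<And>i x. \<bar>\<eta> x * pd i \<eta> x\<bar> \<le> A' i" by metis
 define A where "A = (\<Sum>i\<in>UNIV. A' i)"
 have A: "\<bar>\<eta> x * pd i \<eta> x\<bar> \<le> A" for i x
 proof -
  have "0 \<le> A' i" for i using A'[of undefined i] by linarith
  hence "A' i \<le> A" unfolding A_def by (intro member_le_sum) auto
  thus ?thesis using A'[of x i] by linarith
 qed
 obtain bG where bG: "\<And>x. \<bar>Gam \<eta> x\<bar> \<le> bG" using Gam_bounded[OF \<eta>] by blast
 obtain \<mu> where \<mu>: "\<mu> > 0" "\<And>x v. x \<in> K ==> \<mu> * (\<Sum>i\<in>UNIV. (v i)\<^sup>2) \<le> (\<Sum>i\<in>UNIV. \<Sum>j\<in>UNIV. c i j x * v i * v j)"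
  using coercive_on_compact[OF K(1,2)] by blast
 have b2: "\<bar>(\<eta> x)\<^sup>2\<bar> \<le> b\<eta>\<^sup>2" for x using power_mono[OF b\<eta>(2)[of x], of 2] by simp
 have bK: "\<bar>indicator K x\<bar> \<le> (1::real)" for x :: "real^'n" by (simp add: indicator_def)
 have \<eta>2m: "(\<lambda>x. (\<eta> x)\<^sup>2) \<in> borel_measurable lborel" and Km: "(indicator K :: _ => real) \<in> borel_measurable lborel" by measurable
 have lim\<eta>: "(\<lambda>m. LINT x|lborel. (\<eta> x)\<^sup>2 * (u m x)\<^sup>2) \<longlonglongrightarrow> (LINT x|lborel. (\<eta> x)\<^sup>2 * (g x)\<^sup>2)"
  by (rule L2_limit_weighted[OF \<eta>2m _ _ b2 g2 uL2]) simp_all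
 have limG: "(\<lambda>m. LINT x|lborel. Gam \<eta> x * (u m x)\<^sup>2) \<longlonglongrightarrow> (LINT x|lborel. Gam \<eta> x * (g x)\<^sup>2)"
  by (rule L2_limit_weighted[OF _ _ _ bG g2 uL2]) simp_all
 have limK: "(\<lambda>m. LINT x|lborel. indicator K x * (u m x)\<^sup>2) \<longlonglongrightarrow> (LINT x|lborel. indicator K x * (g x)\<^sup>2)"
  by (rule L2_limit_weighted[OF Km _ _ bK g2 uL2]) simp_all
 have nnQ: "(\<integral>\<^sup>+x. ennreal (indicator K x * (Q m i x)\<^sup>2) \<partial>lborel) = (\<integral>\<^sup>+x. indicator K x * ennreal ((flux g m i x - (\<Sum>j\<in>UNIV. c i j x * pd j (conv g (\<rho> m)) x))\<^sup>2) \<partial>lborel)" for m i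
  by (rule nn_integral_cong) (simp add: Q_def P_def u_def indicator_def)
 have QL2: "\<exists>M. \<forall>m\<ge>M. integrable lborel (\<lambda>x. indicator K x * (Q m i x)\<^sup>2) \<and> (LINT x|lborel. indicator K x * (Q m i x)\<^sup>2) \<le> e" if e: "e > 0" for i e
 proof -
  obtain M where M: "\<And>m. m \<ge> M ==> (\<integral>\<^sup>+x. ennreal (indicator K x * (Q m i x)\<^sup>2) \<partial>lborel) \<le> ennreal e"
   unfolding nnQ using flux_error_L2[OF cutg KK1 K2 r(1) e] by blast
  have "integrable lborel (\<lambda>x. indicator K x * (Q m i x)\<^sup>2) \<and> (LINT x|lborel. indicator K x * (Q m i x)\<^sup>2) \<le> e" if "m \<ge> M" for m
   using nn_integral_imp_integrable[OF _ _ M[OF that]] e by simp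
  thus ?thesis by blast
 qed
 have "\<forall>i. \<exists>M. \<forall>m\<ge>M. integrable lborel (\<lambda>x. indicator K x * (Q m i x)\<^sup>2)" using QL2[OF zero_less_one] by blast
 then obtain M0 where M0: "\<And>i m. m \<ge> M0 i ==> integrable lborel (\<lambda>x. indicator K x * (Q m i x)\<^sup>2)" by metis
 obtain M1 where M1: "\<And>m. m \<ge> M1 ==> 1 / real (Suc m) \<le> r" using eventually_radius[OF r(1)] by blast
 define M where "M = max M1 (Max (range M0))"
 have M: "1 / real (Suc m) \<le> r" "integrable lborel (\<lambda>x. indicator K x * (Q m i x)\<^sup>2)" if "m \<ge> M" for m i
 proof -
  have "M0 i \<le> Max (range M0)" by (rule Max_ge) auto
  hence "m \<ge> M1" "m \<ge> M0 i" using that unfolding M_def by linarith+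
  thus "1 / real (Suc m) \<le> r" "integrable lborel (\<lambda>x. indicator K x * (Q m i x)\<^sup>2)" using M1 M0 by blast+
 qed
 have limQ: "(\<lambda>m. LINT x|lborel. indicator K x * (Q m i x)\<^sup>2) \<longlonglongrightarrow> 0" for i
 proof (rule LIMSEQ_I)
  fix e :: real assume "e > 0"
  then obtain N where N: "\<And>m. m \<ge> N ==> (LINT x|lborel. indicator K x * (Q m i x)\<^sup>2) \<le> e / 2" using QL2[of "e / 2" i] by auto
  have "norm ((LINT x|lborel. indicator K x * (Q m i x)\<^sup>2) - 0) < e" if "m \<ge> N" for m
  proof -
   have "0 \<le> (LINT x|lborel. indicator K x * (Q m i x)\<^sup>2)" by (rule Bochner_Integration.integral_nonneg) simp
   thus ?thesis using N[OF that] \<open>e > 0\<close> by simp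
  qed
  thus "\<exists>no. \<forall>m\<ge>no. norm ((LINT x|lborel. indicator K x * (Q m i x)\<^sup>2) - 0) < e" by blast
 qed
 have iG: "integrable lborel (\<lambda>x. Gam \<eta> x * (u m x)\<^sup>2)" for m
 proof -
  have "(\<lambda>x. pd i \<eta> x * (pd j \<eta> x * (u m x * u m x))) \<in> Cc 0 \<Omega>" for i j
   by (rule Cc_mult[OF Cc_pd[OF \<eta>C] Ck_mult[OF Cc_Ck[OF Cc_pd[OF \<eta>C]] Ck_mult[OF uC uC]]])
  hence "integrable lborel (\<lambda>x. c i j x * (pd i \<eta> x * (pd j \<eta> x * (u m x * u m x))))" for i j
   by (intro integrable_mult_Cc[of "c i j" \<Omega>]) (use c_wpd[of undefined i j] in \<open>auto simp: wpd_def\<close>)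
  thus ?thesis unfolding Gam_def by (simp add: sum_distrib_right power2_eq_square mult.assoc)
 qed
 have iK: "integrable lborel (\<lambda>x. indicator K x * (u m x)\<^sup>2)" for m
  using borel_integrable_compact[OF K(1), of "\<lambda>x. (u m x)\<^sup>2"] continuous_on_subset[OF uc[of m]]
  by (auto intro!: continuous_intros)
 have i\<eta>: "integrable lborel (\<lambda>x. (\<eta> x)\<^sup>2 * (u m x)\<^sup>2)" for m
  proof -
  have "integrable lborel (\<lambda>x. indicator K x * (u m x)\<^sup>2 * (\<eta> x)\<^sup>2)"
   by (rule integrable_mult_bounded[OF iK \<eta>2m b2])
  moreover have "indicator K x * (u m x)\<^sup>2 * (\<eta> x)\<^sup>2 = (\<eta> x)\<^sup>2 * (u m x)\<^sup>2" for x
   using K(3)[of x] by (cases "x \<in> K") simp_all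
  ultimately show ?thesis by simp
 qed
 define a b Z where "a = (LINT x|lborel. (\<eta> x)\<^sup>2 * (g x)\<^sup>2)" and "b = (LINT x|lborel. Gam \<eta> x * (g x)\<^sup>2)"
  and "Z = (\<Sum>i\<in>(UNIV::'n set). A\<^sup>2 * (LINT x|lborel. indicator K x * (g x)\<^sup>2))"
 have Z: "Z \<ge> 0" unfolding Z_def by (intro sum_nonneg mult_nonneg_nonneg Bochner_Integration.integral_nonneg) auto
 have main: "a \<le> h * (b + \<tau> / 2 * Z)" if \<tau>: "\<tau> > 0" for \<tau>
 proof -
  \<comment> \<open>this constant may depend on \<open>\<tau>\<close>: the flux error tends to zero for fixed \<open>\<tau>\<close>\<close>
  define C where "C = b\<eta>\<^sup>2 / (4 * \<mu>) + 1 / (2 * \<tau>)"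
  define R where "R m x = Gam \<eta> x * (u m x)\<^sup>2 + (\<Sum>i\<in>UNIV. C * (indicator K x * (Q m i x)\<^sup>2) + \<tau> / 2 * (A\<^sup>2 * (indicator K x * (u m x)\<^sup>2)))" for m x
  define f where "f m x = \<eta> x * (\<eta> x * u m x)" for m x
  have fC: "f m \<in> Cc (Suc 0) \<Omega>" for m unfolding f_def[abs_def] by (rule Cc_mult[OF \<eta>C Ck_mult[OF Cc_Ck[OF \<eta>C] uC]])
  have pf: "pd i (f m) x = 2 * \<eta> x * pd i \<eta> x * u m x + (\<eta> x)\<^sup>2 * pd i (u m) x" for i m x
  proof -
   note d = Ck_differentiable[OF Cc_Ck[OF \<eta>C[of "Suc 0"]], of x] Ck_differentiable[OF uC[of "Suc 0" m], of x]
   show ?thesis unfolding f_def[abs_def] using d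
    by (simp add: pd_mult differentiable_mult power2_eq_square algebra_simps)
  qed
  have R: "(LINT x|lborel. R m x) = (LINT x|lborel. Gam \<eta> x * (u m x)\<^sup>2) +
    (\<Sum>i\<in>UNIV. C * (LINT x|lborel. indicator K x * (Q m i x)\<^sup>2) + \<tau> / 2 * (A\<^sup>2 * (LINT x|lborel. indicator K x * (u m x)\<^sup>2)))"
   and Ri: "integrable lborel (R m)" if "m \<ge> M" for m
  proof -
   have i: "integrable lborel (\<lambda>x. C * (indicator K x * (Q m i x)\<^sup>2) + \<tau> / 2 * (A\<^sup>2 * (indicator K x * (u m x)\<^sup>2)))" for i
    using M(2)[OF that] iK by (intro Bochner_Integration.integrable_add integrable_mult_right)
   have I: "(LINT x|lborel. C * (indicator K x * (Q m i x)\<^sup>2) + \<tau> / 2 * (A\<^sup>2 * (indicator K x * (u m x)\<^sup>2)))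
    = C * (LINT x|lborel. indicator K x * (Q m i x)\<^sup>2) + \<tau> / 2 * (A\<^sup>2 * (LINT x|lborel. indicator K x * (u m x)\<^sup>2))" for i
    using M(2)[OF that, of i] iK[of m] by simp
   have s: "integrable lborel (\<lambda>x. \<Sum>i\<in>UNIV. C * (indicator K x * (Q m i x)\<^sup>2) + \<tau> / 2 * (A\<^sup>2 * (indicator K x * (u m x)\<^sup>2)))"
    using i by (rule Bochner_Integration.integrable_sum)
   show "integrable lborel (R m)" unfolding R_def[abs_def] by (rule Bochner_Integration.integrable_add[OF iG s])
   show "(LINT x|lborel. R m x) = (LINT x|lborel. Gam \<eta> x * (u m x)\<^sup>2) +
    (\<Sum>i\<in>UNIV. C * (LINT x|lborel. indicator K x * (Q m i x)\<^sup>2) + \<tau> / 2 * (A\<^sup>2 * (LINT x|lborel. indicator K x * (u m x)\<^sup>2)))"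
    unfolding R_def Bochner_Integration.integral_add[OF iG s] Bochner_Integration.integral_sum[OF i] I ..
  qed
  have step: "(LINT x|lborel. (\<eta> x)\<^sup>2 * (u m x)\<^sup>2) \<le> h * (LINT x|lborel. R m x)" if m: "m \<ge> M" for m
  proof -
   have pt: "(\<eta> x)\<^sup>2 * (u m x)\<^sup>2 = h * (\<Sum>i\<in>UNIV. f m x * pd i (P m i) x)" for x
   proof (cases "x \<in> K")
    case True
    have "u m x = h * (\<Sum>i\<in>UNIV. pd i (P m i) x)"
     using mollified_equation[OF cutg[unfolded g_def[abs_def]] eq KK1[OF True] M(1)[OF m]]
     by (simp add: u_def P_def g_def[abs_def])
    hence "f m x * u m x = h * (\<Sum>i\<in>UNIV. f m x * pd i (P m i) x)" by (metis mult.left_commute sum_distrib_left)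
    thus ?thesis by (simp add: f_def power2_eq_square mult_ac)
   qed (use K(3) in \<open>simp add: f_def\<close>)
   have i1: "integrable lborel (\<lambda>x. f m x * pd i (P m i) x)" for i
    using PC[of "Suc 0" m i] Cc_integrable[OF Cc_mult[OF Cc_le[OF fC[of m], of 0], of "pd i (P m i)"]] by simp
   have i2: "integrable lborel (\<lambda>x. pd i (f m) x * P m i x)" for i
    by (rule Cc_integrable[OF Cc_mult[OF Cc_pd[OF fC] PC]])
   have "(LINT x|lborel. (\<eta> x)\<^sup>2 * (u m x)\<^sup>2) = h * (\<Sum>i\<in>UNIV. LINT x|lborel. f m x * pd i (P m i) x)"
    unfolding pt using i1 by (simp add: integral_sum)
   also have "(\<Sum>i\<in>UNIV. LINT x|lborel. f m x * pd i (P m i) x) = (\<Sum>i\<in>UNIV. - (LINT x|lborel. pd i (f m) x * P m i x))"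
    using integration_by_parts[OF fC PC] by simp
   also have "\<dots> = (LINT x|lborel. - (\<Sum>i\<in>UNIV. pd i (f m) x * P m i x))"
    using i2 by (simp add: integral_sum sum_negf)
   also have "\<dots> \<le> (LINT x|lborel. R m x)"
   proof (rule integral_mono[OF _ Ri[OF m]])
    show "integrable lborel (\<lambda>x. - (\<Sum>i\<in>UNIV. pd i (f m) x * P m i x))" using i2 by simp
    fix x
    show "- (\<Sum>i\<in>UNIV. pd i (f m) x * P m i x) \<le> R m x"
    proof (cases "x \<in> K")
     case False
     hence "\<eta> x = 0" "\<And>i. pd i \<eta> x = 0" "Gam \<eta> x = 0" using K(3) pd0 Gam0 by blast+
     thus ?thesis using False by (simp add: R_def pf)
    next
     case True
     have "- (\<Sum>i\<in>UNIV. P m i x * (2 * \<eta> x * pd i \<eta> x * u m x + (\<eta> x)\<^sup>2 * pd i (u m) x))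
      \<le> (u m x)\<^sup>2 * (\<Sum>i\<in>UNIV. \<Sum>j\<in>UNIV. c i j x * pd i \<eta> x * pd j \<eta> x) + (\<Sum>i\<in>UNIV. (b\<eta>\<^sup>2 / (4 * \<mu>) + 1 / (2 * \<tau>)) * (Q m i x)\<^sup>2 + \<tau> / 2 * A\<^sup>2 * (u m x)\<^sup>2)"
      by (rule energy_algebra[OF c_sym \<mu>(1) \<tau> \<mu>(2)[OF True] A]) (use b2[of x] in \<open>simp_all add: Q_def\<close>)
     thus ?thesis using True by (simp add: R_def pf Gam_def C_def mult_ac)
    qed
   qed
   finally show ?thesis using h by (simp add: mult_left_mono)
  qed
  have "(\<lambda>m. LINT x|lborel. R m x) \<longlonglongrightarrow> b + (\<Sum>i\<in>(UNIV::'n set). C * 0 + \<tau> / 2 * (A\<^sup>2 * (LINT x|lborel. indicator K x * (g x)\<^sup>2)))"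
  proof (rule Lim_transform_eventually)
   show "\<forall>\<^sub>F m in sequentially. (LINT x|lborel. Gam \<eta> x * (u m x)\<^sup>2) +
    (\<Sum>i\<in>UNIV. C * (LINT x|lborel. indicator K x * (Q m i x)\<^sup>2) + \<tau> / 2 * (A\<^sup>2 * (LINT x|lborel. indicator K x * (u m x)\<^sup>2))) = (LINT x|lborel. R m x)"
    unfolding eventually_sequentially using R by (intro exI[of _ M]) simp
   show "(\<lambda>m. (LINT x|lborel. Gam \<eta> x * (u m x)\<^sup>2) +
    (\<Sum>i\<in>UNIV. C * (LINT x|lborel. indicator K x * (Q m i x)\<^sup>2) + \<tau> / 2 * (A\<^sup>2 * (LINT x|lborel. indicator K x * (u m x)\<^sup>2)))) \<longlonglongrightarrow>
    b + (\<Sum>i\<in>(UNIV::'n set). C * 0 + \<tau> / 2 * (A\<^sup>2 * (LINT x|lborel. indicator K x * (g x)\<^sup>2)))"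
    unfolding b_def by (intro tendsto_add tendsto_sum tendsto_mult tendsto_const limG limQ limK)
  qed
  hence "(\<lambda>m. h * (LINT x|lborel. R m x)) \<longlonglongrightarrow> h * (b + (\<Sum>i\<in>(UNIV::'n set). C * 0 + \<tau> / 2 * (A\<^sup>2 * (LINT x|lborel. indicator K x * (g x)\<^sup>2))))"
   by (rule tendsto_mult_left)
  from LIMSEQ_le[OF lim\<eta> this] step
  have "a \<le> h * (b + (\<Sum>i\<in>(UNIV::'n set). C * 0 + \<tau> / 2 * (A\<^sup>2 * (LINT x|lborel. indicator K x * (g x)\<^sup>2))))"
   unfolding a_def by blast
  thus ?thesis by (simp add: Z_def mult_ac)
 qed
 have "a \<le> h * b"
 proof (rule field_le_epsilon)
  fix e :: real assume e: "e > 0"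
  define \<tau> where "\<tau> = e / (h * (Z + 1))"
  have \<tau>: "\<tau> > 0" using e h Z by (simp add: \<tau>_def)
  have "h * (\<tau> / 2 * Z) \<le> h * (\<tau> * (Z + 1))" using h Z \<tau> by (intro mult_left_mono) (auto simp: algebra_simps intro: add_nonneg_nonneg)
  also have "\<dots> = e" using h Z by (simp add: \<tau>_def)
  finally show "a \<le> h * b + e" using main[OF \<tau>] by (simp add: distrib_left)
 qed
 moreover have e1: "(\<eta> x)\<^sup>2 * (g x)\<^sup>2 = (\<eta> x)\<^sup>2 * (g0 x)\<^sup>2" "Gam \<eta> x * (g x)\<^sup>2 = Gam \<eta> x * (g0 x)\<^sup>2" for x
 proof -
  have "x \<in> K1" if "x \<in> K" using KK1[OF that] r by auto
  hence "g x = g0 x \<or> (\<eta> x = 0 \<and> Gam \<eta> x = 0)" using K(3) Gam0 by (cases "x \<in> K") (auto simp: g_def)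
  thus "(\<eta> x)\<^sup>2 * (g x)\<^sup>2 = (\<eta> x)\<^sup>2 * (g0 x)\<^sup>2" "Gam \<eta> x * (g x)\<^sup>2 = Gam \<eta> x * (g0 x)\<^sup>2" by auto
 qed
 ultimately show "(LINT x|lborel. (\<eta> x)\<^sup>2 * (g0 x)\<^sup>2) \<le> h * (LINT x|lborel. Gam \<eta> x * (g0 x)\<^sup>2)"
  by (simp add: a_def b_def)
 show "integrable lborel (\<lambda>x. (\<eta> x)\<^sup>2 * (g0 x)\<^sup>2)" "integrable lborel (\<lambda>x. Gam \<eta> x * (g0 x)\<^sup>2)"
  unfolding e1[symmetric] using integrable_mult_bounded[OF g2 \<eta>2m b2] integrable_mult_bounded[OF g2 _ bG] Gm by (simp_all add: mult.commute)
qed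

end

section \<open>Density of the range\<close>

text \<open>Compare \<open>\<bar>y\<bar>\<close> with \<open>\<tau> W\<^bsup>q/2\<^esup>\<close>, where \<open>q = p / (2 - p)\<close>: below this threshold the first term on the right
  dominates, above it the second.\<close>

lemma young_weighted:
 fixes y W \<tau> p :: real
 assumes p: "1 \<le> p" "p < 2" and W: "W \<ge> 0" and \<tau>: "\<tau> > 0"
 shows "\<bar>y\<bar> powr p * W powr (p / 2) \<le> \<tau> powr p * W powr (p / (2 - p)) + \<tau> powr (p - 2) * y\<^sup>2"
proof -
 define V where "V = W powr (p / (2 * (2 - p)))"
 have V: "V \<ge> 0" by (simp add: V_def)
 have V1: "V powr (2 - p) = W powr (p / 2)"
 proof -
  have "p / (2 * (2 - p)) * (2 - p) = p / 2" using p by (simp add: field_simps)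
  thus ?thesis by (simp only: V_def powr_powr)
 qed
 have V2: "V powr p * V powr (2 - p) = W powr (p / (2 - p))"
 proof -
  have "p / (2 * (2 - p)) * p + p / (2 * (2 - p)) * (2 - p) = p / (2 - p)"
   unfolding distrib_left[symmetric] using p by (simp add: field_simps)
  thus ?thesis by (simp only: V_def powr_powr powr_add[symmetric])
 qed
 show ?thesis
 proof (cases "\<bar>y\<bar> \<le> \<tau> * V")
  case True
  have "\<bar>y\<bar> powr p * W powr (p / 2) \<le> (\<tau> * V) powr p * V powr (2 - p)"
   unfolding V1 using True p by (intro mult_right_mono powr_mono2) auto
  also have "\<dots> = \<tau> powr p * W powr (p / (2 - p))"
   using \<tau> V by (simp add: powr_mult V2[symmetric] mult.assoc)
  finally show ?thesis by (simp add: add_increasing2)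
 next
  case False
  hence y: "\<bar>y\<bar> > 0" using \<tau> V by (meson linorder_not_less mult_nonneg_nonneg not_le order_less_imp_le order_le_less_trans)
  have "V \<le> \<bar>y\<bar> / \<tau>" using False \<tau> by (simp add: field_simps)
  hence "\<bar>y\<bar> powr p * W powr (p / 2) \<le> \<bar>y\<bar> powr p * (\<bar>y\<bar> / \<tau>) powr (2 - p)"
   unfolding V1[symmetric] using V p by (intro mult_left_mono powr_mono2) auto
  also have "\<dots> = (\<bar>y\<bar> powr p * \<bar>y\<bar> powr (2 - p)) * \<tau> powr (p - 2)"
  proof -
   have "(\<bar>y\<bar> / \<tau>) powr (2 - p) = \<bar>y\<bar> powr (2 - p) / \<tau> powr (2 - p)" using \<tau> by (intro powr_divide)
   moreover have "\<tau> powr (p - 2) = inverse (\<tau> powr (2 - p))" using powr_minus[of \<tau> "2 - p"] by simp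
   ultimately show ?thesis by (simp only: divide_inverse mult.assoc)
  qed
  also have "\<bar>y\<bar> powr p * \<bar>y\<bar> powr (2 - p) = y\<^sup>2" using y by (simp flip: powr_add)
  finally show ?thesis using W by (simp add: mult.commute add_increasing)
 qed
qed

lemma young:
 fixes y \<tau> p :: real
 assumes p: "1 \<le> p" "p \<le> 2" and \<tau>: "\<tau> > 0"
 shows "\<bar>y\<bar> powr p \<le> \<tau> powr p + \<tau> powr (p - 2) * y\<^sup>2"
proof (cases "p = 2")
 case True
 thus ?thesis using \<tau> by (cases "y = 0") simp_all
next
 case False
 thus ?thesis using young_weighted[of p 1 \<tau> y] p \<tau> by simp
qed

lemma truncate_Lp:
 fixes f :: "real^'n::finite => real"
 assumes \<Omega>: "open \<Omega>" and f [measurable]: "f \<in> borel_measurable borel" and f0: "\<And>x. x \<notin> \<Omega> ==> f x = 0"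
  and int: "integrable lborel (\<lambda>x. \<bar>f x\<bar> powr p)" and p: "1 \<le> p" and e: "e > 0"
 shows "\<exists>f1 K b. f1 \<in> borel_measurable borel \<and> compact K \<and> K \<subseteq> \<Omega> \<and> (\<forall>x. x \<notin> K \<longrightarrow> f1 x = 0) \<and>
  (\<forall>x. \<bar>f1 x\<bar> \<le> b) \<and> integrable lborel (\<lambda>x. \<bar>f x - f1 x\<bar> powr p) \<and> (LINT x|lborel. \<bar>f x - f1 x\<bar> powr p) < e"
proof -
 obtain C where C: "\<And>n::nat. compact (C n)" "\<And>n. C n \<subseteq> \<Omega>" "\<Union> (range C) = \<Omega>" "\<And>K. compact K ==> K \<subseteq> \<Omega> ==> \<exists>N. \<forall>n\<ge>N. K \<subseteq> C n"
  using open_Union_compact_subsets[OF \<Omega>] by metis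
 define t where "t n x = (if x \<in> C n \<and> \<bar>f x\<bar> \<le> real n then f x else 0)" for n x
 have [measurable]: "C n \<in> sets borel" for n using C(1) by (simp add: compact_imp_closed borel_closed)
 have tm [measurable]: "t n \<in> borel_measurable borel" for n unfolding t_def by measurable
 have le: "\<bar>f x - t n x\<bar> powr p \<le> \<bar>f x\<bar> powr p" for n x by (simp add: t_def)
 have ev: "eventually (\<lambda>n. \<bar>f x - t n x\<bar> powr p = 0) sequentially" for x
 proof (cases "x \<in> \<Omega>")
  case True
  then obtain N where N: "\<And>n. n \<ge> N ==> x \<in> C n" using C(4)[of "{x}"] by auto
  obtain N' where N': "\<bar>f x\<bar> \<le> real N'" using real_arch_simple by blast
  have "\<bar>f x - t n x\<bar> powr p = 0" if "n \<ge> max N N'" for n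
  proof -
   have "real N' \<le> real n" using that by simp
   thus ?thesis using N[of n] N' that by (simp add: t_def)
  qed
  thus ?thesis unfolding eventually_sequentially by blast
 qed (use f0 in \<open>simp add: t_def\<close>)
 have lim: "(\<lambda>n. LINT x|lborel. \<bar>f x - t n x\<bar> powr p) \<longlonglongrightarrow> (LINT x::real^'n|lborel. (0::real))"
 proof (rule Bochner_Integration.integral_dominated_convergence[of "\<lambda>_. 0 :: real" lborel "\<lambda>n x. \<bar>f x - t n x\<bar> powr p" "\<lambda>x. \<bar>f x\<bar> powr p"])
  show "AE x in lborel. (\<lambda>n. \<bar>f x - t n x\<bar> powr p) \<longlonglongrightarrow> 0" using ev by (intro AE_I2 tendsto_eventually)
  show "AE x in lborel. norm (\<bar>f x - t n x\<bar> powr p) \<le> \<bar>f x\<bar> powr p" for n using le by simp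
 qed (use int in simp_all)
 then obtain n where n: "(LINT x|lborel. \<bar>f x - t n x\<bar> powr p) < e"
  using order_tendstoD(2)[OF lim, of e] e unfolding eventually_sequentially by auto
 have i: "integrable lborel (\<lambda>x. \<bar>f x - t n x\<bar> powr p)"
  by (rule Bochner_Integration.integrable_bound[OF int]) (use le in simp_all)
 show ?thesis by (intro exI[of _ "t n"] exI[of _ "C n"] exI[of _ "real n"] conjI allI tm C i n) (auto simp: t_def)
qed

lemma Lp_triangle_small:
 fixes f :: "'a => real"
 assumes p: "1 \<le> p" and m: "f \<in> borel_measurable M" "f1 \<in> borel_measurable M" "f2 \<in> borel_measurable M"
  and i: "integrable M (\<lambda>x. \<bar>f x - f1 x\<bar> powr p)" "integrable M (\<lambda>x. \<bar>f1 x - f2 x\<bar> powr p)"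
  and l: "(LINT x|M. \<bar>f x - f1 x\<bar> powr p) < e / (2 * 2 powr p)" "(LINT x|M. \<bar>f1 x - f2 x\<bar> powr p) < e / (2 * 2 powr p)"
 shows "(LINT x|M. \<bar>f x - f2 x\<bar> powr p) < e"
proof -
 have pt: "\<bar>f x - f2 x\<bar> powr p \<le> 2 powr p * (\<bar>f x - f1 x\<bar> powr p + \<bar>f1 x - f2 x\<bar> powr p)" for x
 proof -
  have "\<bar>f x - f2 x\<bar> powr p \<le> (\<bar>f x - f1 x\<bar> + \<bar>f1 x - f2 x\<bar>) powr p" using p by (intro powr_mono2) auto
  also have "\<dots> \<le> 2 powr p * (\<bar>f x - f1 x\<bar> powr p + \<bar>f1 x - f2 x\<bar> powr p)" using p by (intro powr_add_le) auto
  finally show ?thesis .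
 qed
 have "(LINT x|M. \<bar>f x - f2 x\<bar> powr p) \<le> (LINT x|M. 2 powr p * (\<bar>f x - f1 x\<bar> powr p + \<bar>f1 x - f2 x\<bar> powr p))"
  using i by (intro integral_mono_AE' AE_I2 pt) auto
 also have "\<dots> = 2 powr p * ((LINT x|M. \<bar>f x - f1 x\<bar> powr p) + (LINT x|M. \<bar>f1 x - f2 x\<bar> powr p))"
  using i by simp
 also have "\<dots> < 2 powr p * (e / (2 * 2 powr p) + e / (2 * 2 powr p))"
  using l by (intro mult_strict_left_mono add_strict_mono) auto
 also have "\<dots> = e" by simp
 finally show ?thesis .
qed

context mollifier
begin

text \<open>Truncation reduces the problem to bounded functions with compact support. For these, mollification
  converges in \<open>L\<^sub>2\<close>, and Young's inequality transfers this to \<open>L\<^sub>p\<close> because all supports lie in one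
  set of finite measure.\<close>

lemma test_functions_dense:
 fixes f :: "real^'n => real"
 assumes \<Omega>: "open \<Omega>" and f [measurable]: "f \<in> borel_measurable borel" and f0: "\<And>x. x \<notin> \<Omega> ==> f x = 0"
  and int: "integrable lborel (\<lambda>x. \<bar>f x\<bar> powr p)" and p: "1 \<le> p" "p \<le> 2" and e: "e > 0"
 shows "\<exists>\<phi>\<in>test_functions \<Omega>. (LINT x|lborel. \<bar>f x - \<phi> x\<bar> powr p) < e"
proof -
 define e' where "e' = e / (2 * 2 powr p)"
 have e': "e' > 0" using e by (simp add: e'_def)
 obtain f1 K b where f1 [measurable]: "f1 \<in> borel_measurable borel" and K: "compact K" "K \<subseteq> \<Omega>" and f10: "\<And>x. x \<notin> K ==> f1 x = 0"
  and b: "\<And>x. \<bar>f1 x\<bar> \<le> b" and d1: "integrable lborel (\<lambda>x. \<bar>f x - f1 x\<bar> powr p)" "(LINT x|lborel. \<bar>f x - f1 x\<bar> powr p) < e'"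
  using truncate_Lp[of \<Omega> f p e', OF \<Omega> f f0 int p(1) e'] by blast
 obtain r where r: "r > 0" "(\<Union>x\<in>K. cball x r) \<subseteq> \<Omega>"
  using compact_subset_open_imp_cball_epsilon_subset[OF K(1) \<Omega> K(2)] by blast
 define K' where "K' = {x + y | x y. x \<in> K \<and> y \<in> cball 0 r}"
 have K': "compact K'" unfolding K'_def by (rule compact_neighbourhood[OF K(1)])
 have K's: "K' \<subseteq> \<Omega>" unfolding K'_def by (rule compact_neighbourhood_subset[OF r(2)])
 have KK': "K \<subseteq> K'" unfolding K'_def using r(1) by force
 have K'm [measurable]: "K' \<in> sets borel" using K' by (simp add: compact_imp_closed borel_closed)
 have iK': "integrable lborel (indicator K' :: _ => real)"
  using borel_integrable_compact[OF K', of "\<lambda>_. 1 :: real"] by simp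
 define \<nu> where "\<nu> = (LINT x|lborel. indicator K' x :: real)"
 have \<nu>: "\<nu> \<ge> 0" unfolding \<nu>_def by simp
 define \<tau> where "\<tau> = (e' / (2 * (\<nu> + 1))) powr (1 / p)"
 have \<tau>: "\<tau> > 0" "\<tau> powr p = e' / (2 * (\<nu> + 1))" using e' \<nu> p by (auto simp: \<tau>_def powr_powr)
 define \<tau>' where "\<tau>' = \<tau> powr (p - 2)"
 have \<tau>': "\<tau>' > 0" using \<tau> by (simp add: \<tau>'_def)
 have g: "integrable lborel f1" "integrable lborel (\<lambda>x. (f1 x)\<^sup>2)"
 proof -
  show "integrable lborel f1" by (rule integral_abs_le_compact(1)[OF K(1) f1 f10 b])
  have "\<bar>(f1 x)\<^sup>2\<bar> \<le> b\<^sup>2" for x using power_mono[OF b[of x], of 2] by simp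
  thus "integrable lborel (\<lambda>x. (f1 x)\<^sup>2)" using f10 by (intro integral_abs_le_compact(1)[OF K(1)]) auto
 qed
 define s where "s = e' / (4 * \<tau>')"
 have s: "s > 0" using e' \<tau>' by (simp add: s_def)
 obtain M where M: "\<And>m. m \<ge> M ==> (\<integral>\<^sup>+x. ennreal ((conv f1 (\<rho> m) x - f1 x)\<^sup>2) \<partial>lborel) \<le> ennreal s"
  using conv_L2[OF g s] by blast
 obtain M' where M': "\<And>m. m \<ge> M' ==> 1 / real (Suc m) \<le> r" using eventually_radius[OF r(1)] by blast
 define m where "m = max M M'"
 define \<phi> where "\<phi> = conv f1 (\<rho> m)"
 have m: "(\<integral>\<^sup>+x. ennreal ((\<phi> x - f1 x)\<^sup>2) \<partial>lborel) \<le> ennreal s" "1 / real (Suc m) \<le> r"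
  using M[of m] M'[of m] by (auto simp: m_def \<phi>_def)
 have \<phi>: "\<phi> \<in> test_functions \<Omega>" unfolding \<phi>_def
  by (rule conv_test[OF g(1) f10 K(1) m(2)]) (assumption, rule K's[unfolded K'_def])
 have [measurable]: "\<phi> \<in> borel_measurable borel" using \<phi> Cc_measurable unfolding test_functions_iff by blast
 have \<phi>0: "\<phi> x = 0" if "x \<notin> K'" for x
  unfolding \<phi>_def
 proof (rule conv_zero_off[of K f1])
  show "x \<notin> {x + y | x y. x \<in> K \<and> y \<in> cball 0 r}" using that by (simp add: K'_def)
 qed (use f10 \<rho>_support m(2) in \<open>auto intro!: \<rho>_support\<close>)
 have d: "integrable lborel (\<lambda>x. (\<phi> x - f1 x)\<^sup>2)" "(LINT x|lborel. (\<phi> x - f1 x)\<^sup>2) \<le> s"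
  using nn_integral_imp_integrable[OF _ _ m(1)] s by auto
 have pt: "\<bar>f1 x - \<phi> x\<bar> powr p \<le> \<tau> powr p * indicator K' x + \<tau>' * (\<phi> x - f1 x)\<^sup>2" for x
 proof (cases "x \<in> K'")
  case True
  thus ?thesis using young[OF p \<tau>(1), of "f1 x - \<phi> x"] by (simp add: \<tau>'_def power2_commute)
 next
  case False
  hence "\<phi> x = 0" "f1 x = 0" using \<phi>0 f10 KK' by blast+
  thus ?thesis using \<tau>' by simp
 qed
 have i: "integrable lborel (\<lambda>x. \<tau> powr p * indicator K' x + \<tau>' * (\<phi> x - f1 x)\<^sup>2)" using iK' d by simp
 have d2: "integrable lborel (\<lambda>x. \<bar>f1 x - \<phi> x\<bar> powr p)"
  by (rule Bochner_Integration.integrable_bound[OF i]) (use pt in \<open>auto intro!: AE_I2 intro: order_trans[OF _ abs_ge_self]\<close>)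
 have "(LINT x|lborel. \<bar>f1 x - \<phi> x\<bar> powr p) \<le> (LINT x|lborel. \<tau> powr p * indicator K' x + \<tau>' * (\<phi> x - f1 x)\<^sup>2)"
  by (rule integral_mono[OF d2 i pt])
 also have "\<dots> = \<tau> powr p * \<nu> + \<tau>' * (LINT x|lborel. (\<phi> x - f1 x)\<^sup>2)" using iK' d by (simp add: \<nu>_def)
 also have "\<dots> \<le> \<tau> powr p * (\<nu> + 1) + \<tau>' * s" using d \<tau>' by (intro add_mono mult_left_mono) auto
 also have "\<tau> powr p * (\<nu> + 1) = e' / 2" unfolding \<tau>(2) using \<nu> by (simp add: field_simps)
 also have "e' / 2 + \<tau>' * s = e' / 2 + e' / 4" using \<tau>' by (simp add: s_def)
 also have "\<dots> < e'" using e' by simp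
 finally have "(LINT x|lborel. \<bar>f1 x - \<phi> x\<bar> powr p) < e'" .
 thus ?thesis using Lp_triangle_small[OF p(1) _ _ _ d1(1) d2, of e] d1(2) \<phi> by (auto simp: e'_def)
qed

end

lemma test_functions_measurable: "\<phi> \<in> test_functions \<Omega> ==> \<phi> \<in> borel_measurable borel"
 using Cc_measurable unfolding test_functions_iff by blast

text \<open>Strong convergence of the multiplication operators to the identity on \<open>L\<^sub>2(\<Omega>)\<close>, with functions on \<open>\<Omega>\<close>
  extended by zero.\<close>

definition tends_to_1 :: "(real^'n::finite) set => (nat => real^'n => real) => bool" where
 "tends_to_1 \<Omega> \<eta> \<longleftrightarrow> (\<forall>n. \<eta> n \<in> test_functions \<Omega>) \<and>
   (\<forall>\<psi>. \<psi> \<in> borel_measurable borel \<longrightarrow> integrable lborel (\<lambda>x. (\<psi> x)\<^sup>2) \<longrightarrow> (\<forall>x. x \<notin> \<Omega> \<longrightarrow> \<psi> x = 0) \<longrightarrow>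
    (\<lambda>n. LINT x|lborel. ((\<eta> n x - 1) * \<psi> x)\<^sup>2) \<longlonglongrightarrow> 0)"

context elliptic
begin

lemma Lop_linear:
 assumes \<phi>: "\<phi> \<in> test_functions \<Omega>" and \<psi>: "\<psi> \<in> test_functions \<Omega>"
 shows "(\<lambda>x. a * \<phi> x + b * \<psi> x) \<in> test_functions \<Omega>"
  and "Lop (\<lambda>x. a * \<phi> x + b * \<psi> x) x = a * Lop \<phi> x + b * Lop \<psi> x"
proof -
 have \<phi>C: "\<phi> \<in> Cc k \<Omega>" "\<psi> \<in> Cc k \<Omega>" for k using \<phi> \<psi> by (auto simp: test_functions_iff)
 show "(\<lambda>x. a * \<phi> x + b * \<psi> x) \<in> test_functions \<Omega>"
  unfolding test_functions_iff by (intro allI Cc_add Cc_cmult \<phi>C)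
 have lin: "pd i (\<lambda>x. a * f x + b * g x) = (\<lambda>x. a * pd i f x + b * pd i g x)" if fg: "Ck (Suc 0) f" "Ck (Suc 0) g" for f g i
 proof
  fix x
  have d: "f differentiable (at x)" "g differentiable (at x)" using fg by (auto intro: Ck_differentiable)
  have d': "(\<lambda>x. a * f x) differentiable (at x)" "(\<lambda>x. b * g x) differentiable (at x)" using d by (auto intro!: differentiable_mult)
  show "pd i (\<lambda>x. a * f x + b * g x) x = a * pd i f x + b * pd i g x"
   by (simp only: pd_add[OF d'] pd_cmult[OF d(1)] pd_cmult[OF d(2)])
 qed
 have 1: "pd j (\<lambda>x. a * \<phi> x + b * \<psi> x) = (\<lambda>x. a * pd j \<phi> x + b * pd j \<psi> x)" for j
  by (rule lin[OF Cc_Ck[OF \<phi>C(1)] Cc_Ck[OF \<phi>C(2)]])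
 have 2: "pd i (\<lambda>x. a * pd j \<phi> x + b * pd j \<psi> x) = (\<lambda>x. a * pd i (pd j \<phi>) x + b * pd i (pd j \<psi>) x)" for i j
  by (rule lin[OF Cc_Ck[OF Cc_pd[OF \<phi>C(1)]] Cc_Ck[OF Cc_pd[OF \<phi>C(2)]]])
 have 3: "D i j i x * (a * pd j \<phi> x + b * pd j \<psi> x) + c i j x * (a * pd i (pd j \<phi>) x + b * pd i (pd j \<psi>) x)
  = a * (D i j i x * pd j \<phi> x + c i j x * pd i (pd j \<phi>) x) + b * (D i j i x * pd j \<psi> x + c i j x * pd i (pd j \<psi>) x)" for i j
  by (simp add: algebra_simps)
 show "Lop (\<lambda>x. a * \<phi> x + b * \<psi> x) x = a * Lop \<phi> x + b * Lop \<psi> x"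
  unfolding Lop_def 1 2 3 sum.distrib sum_distrib_left[symmetric] by (simp add: sum.distrib algebra_simps)
qed

text \<open>The weighted \<open>L\<^sub>2\<close> space turns the bound for \<open>\<Gamma>(\<eta>\<^sub>n)\<close> into a uniform one: the energy
  inequality for an annihilator \<open>g\<close> of the range gives
  \<open>\<integral> \<eta>\<^sub>n\<^sup>2 g\<^sup>2 \<le> h \<integral> \<Gamma>(\<eta>\<^sub>n) g\<^sup>2 \<le> h \<epsilon>\<^sub>n \<integral> W g\<^sup>2\<close>, which tends to zero.\<close>

lemma annihilator_trivial:
 assumes \<eta>: "tends_to_1 \<Omega> \<eta>" and \<epsilon>: "\<epsilon> \<longlonglongrightarrow> 0" and h: "h > 0"
  and W [measurable]: "W \<in> borel_measurable borel"
  and g [measurable]: "g \<in> borel_measurable borel"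
  and loc: "\<And>K. compact K ==> K \<subseteq> \<Omega> ==> integrable lborel (\<lambda>x. indicator K x * (g x)\<^sup>2)"
  and g2: "integrable lborel (\<lambda>x. W x * (g x)\<^sup>2)"
  and Gam: "\<And>n. AE x in lborel. Gam (\<eta> n) x * (g x)\<^sup>2 \<le> \<epsilon> n * (W x * (g x)\<^sup>2)"
  and ann: "\<And>\<phi>. \<phi> \<in> test_functions \<Omega> ==> (LINT x|lborel. g x * (\<phi> x + h * Lop \<phi> x)) = 0"
 shows "AE x in lborel. x \<in> \<Omega> \<longrightarrow> g x = 0"
proof -
 have \<eta>t: "\<eta> n \<in> test_functions \<Omega>" for n using \<eta> by (simp add: tends_to_1_def)
 have \<eta>C: "\<eta> n \<in> Cc 0 \<Omega>" for n using \<eta>t by (simp add: test_functions_iff)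
 have [measurable]: "\<eta> n \<in> borel_measurable borel" for n by (rule Cc_measurable[OF \<eta>C])
 note en = energy[OF g loc h ann \<eta>t]
 have en0: "(\<lambda>n. LINT x|lborel. (\<eta> n x)\<^sup>2 * (g x)\<^sup>2) \<longlonglongrightarrow> 0"
 proof (rule tendsto_sandwich[of "\<lambda>_. 0" _ _ "\<lambda>n. h * (\<epsilon> n * (LINT x|lborel. W x * (g x)\<^sup>2))"])
  show "\<forall>\<^sub>F n in sequentially. 0 \<le> (LINT x|lborel. (\<eta> n x)\<^sup>2 * (g x)\<^sup>2)"
   by (intro always_eventually allI Bochner_Integration.integral_nonneg) simp
  have "(LINT x|lborel. (\<eta> n x)\<^sup>2 * (g x)\<^sup>2) \<le> h * (\<epsilon> n * (LINT x|lborel. W x * (g x)\<^sup>2))" for n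
  proof -
   have "(LINT x|lborel. Gam (\<eta> n) x * (g x)\<^sup>2) \<le> (LINT x|lborel. \<epsilon> n * (W x * (g x)\<^sup>2))"
    by (intro integral_mono_AE[OF en(3) _ Gam] integrable_mult_right g2)
   also have "\<dots> = \<epsilon> n * (LINT x|lborel. W x * (g x)\<^sup>2)" using g2 by simp
   finally have "h * (LINT x|lborel. Gam (\<eta> n) x * (g x)\<^sup>2) \<le> h * (\<epsilon> n * (LINT x|lborel. W x * (g x)\<^sup>2))"
    using h by (intro mult_left_mono) auto
   thus ?thesis using en(1)[of n] by linarith
  qed
  thus "\<forall>\<^sub>F n in sequentially. (LINT x|lborel. (\<eta> n x)\<^sup>2 * (g x)\<^sup>2) \<le> h * (\<epsilon> n * (LINT x|lborel. W x * (g x)\<^sup>2))" by simp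
  have "(\<lambda>n. h * (\<epsilon> n * (LINT x|lborel. W x * (g x)\<^sup>2))) \<longlonglongrightarrow> h * (0 * (LINT x|lborel. W x * (g x)\<^sup>2))"
   by (intro tendsto_mult tendsto_const \<epsilon>)
  thus "(\<lambda>n. h * (\<epsilon> n * (LINT x|lborel. W x * (g x)\<^sup>2))) \<longlonglongrightarrow> 0" by simp
 qed simp
 have AE_K: "AE x in lborel. x \<in> K \<longrightarrow> g x = 0" if K: "compact K" "K \<subseteq> \<Omega>" for K
 proof -
  have [measurable]: "K \<in> sets borel" using K by (simp add: compact_imp_closed borel_closed)
  define \<psi> where "\<psi> x = indicator K x * g x" for x
  have \<psi>sq: "(\<psi> x)\<^sup>2 = indicator K x * (g x)\<^sup>2" for x by (simp add: \<psi>_def indicator_def)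
  have [measurable]: "\<psi> \<in> borel_measurable borel" unfolding \<psi>_def by measurable
  have \<psi>i: "integrable lborel (\<lambda>x. (\<psi> x)\<^sup>2)" unfolding \<psi>sq by (rule loc[OF K])
  have lim: "(\<lambda>n. LINT x|lborel. ((\<eta> n x - 1) * \<psi> x)\<^sup>2) \<longlonglongrightarrow> 0"
  proof -
   have "\<forall>x. x \<notin> \<Omega> \<longrightarrow> \<psi> x = 0" using K(2) by (auto simp: \<psi>_def indicator_def)
   thus ?thesis using \<eta> \<psi>i unfolding tends_to_1_def by simp
  qed
  have le: "(LINT x|lborel. (\<psi> x)\<^sup>2) \<le> 2 * (LINT x|lborel. ((\<eta> n x - 1) * \<psi> x)\<^sup>2) + 2 * (LINT x|lborel. (\<eta> n x)\<^sup>2 * (g x)\<^sup>2)" for n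
  proof -
   obtain b where b: "\<And>x. \<bar>\<eta> n x\<bar> \<le> b" using Cc_bounded[OF \<eta>C] by blast
   have b2: "\<bar>(\<eta> n x - 1)\<^sup>2\<bar> \<le> (b + 1)\<^sup>2" for x
   proof -
    have "\<bar>\<eta> n x - 1\<bar> \<le> b + 1" using b[of x] by linarith
    from power_mono[OF this, of 2] show ?thesis by simp
   qed
   have "integrable lborel (\<lambda>x. (\<psi> x)\<^sup>2 * (\<eta> n x - 1)\<^sup>2)"
    by (rule integrable_mult_bounded[OF \<psi>i _ b2]) measurable
   hence i: "integrable lborel (\<lambda>x. ((\<eta> n x - 1) * \<psi> x)\<^sup>2)" by (simp add: power_mult_distrib mult.commute)
   have "(LINT x|lborel. (\<psi> x)\<^sup>2) \<le> (LINT x|lborel. 2 * ((\<eta> n x - 1) * \<psi> x)\<^sup>2 + 2 * ((\<eta> n x)\<^sup>2 * (g x)\<^sup>2))"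
   proof (rule integral_mono[OF \<psi>i])
    show "integrable lborel (\<lambda>x. 2 * ((\<eta> n x - 1) * \<psi> x)\<^sup>2 + 2 * ((\<eta> n x)\<^sup>2 * (g x)\<^sup>2))" using i en(2)[of n] by simp
    fix x
    show "(\<psi> x)\<^sup>2 \<le> 2 * ((\<eta> n x - 1) * \<psi> x)\<^sup>2 + 2 * ((\<eta> n x)\<^sup>2 * (g x)\<^sup>2)"
    proof (cases "x \<in> K")
     case True
     have "0 \<le> ((2 * \<eta> n x - 1) * g x)\<^sup>2" by simp
     thus ?thesis using True by (simp add: \<psi>_def power2_eq_square algebra_simps)
    qed (simp add: \<psi>_def)
   qed
   thus ?thesis using i en(2)[of n] by simp
  qed
  have "(\<lambda>n. 2 * (LINT x|lborel. ((\<eta> n x - 1) * \<psi> x)\<^sup>2) + 2 * (LINT x|lborel. (\<eta> n x)\<^sup>2 * (g x)\<^sup>2)) \<longlonglongrightarrow> 2 * 0 + 2 * 0"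
   by (intro tendsto_add tendsto_mult tendsto_const lim en0)
  hence "(LINT x|lborel. (\<psi> x)\<^sup>2) \<le> 2 * 0 + 2 * 0" by (rule LIMSEQ_le_const) (use le in blast)
  moreover have "(LINT x|lborel. (\<psi> x)\<^sup>2) \<ge> 0" by (rule Bochner_Integration.integral_nonneg) simp
  ultimately have "(LINT x|lborel. (\<psi> x)\<^sup>2) = 0" by linarith
  hence "AE x in lborel. (\<psi> x)\<^sup>2 = 0" using integral_nonneg_eq_0_iff_AE[OF \<psi>i] by simp
  thus ?thesis by eventually_elim (auto simp: \<psi>_def)
 qed
 obtain C where C: "\<And>n::nat. compact (C n)" "\<And>n. C n \<subseteq> \<Omega>" "\<Union> (range C) = \<Omega>"
  using open_Union_compact_subsets[OF \<Omega>] by metis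
 have "AE x in lborel. \<forall>n. x \<in> C n \<longrightarrow> g x = 0" unfolding AE_all_countable using AE_K[OF C(1,2)] by blast
 thus ?thesis by eventually_elim (use C(3) in auto)
qed

text \<open>The range of \<open>1 + h L\<close> is dense in the weighted space \<open>L\<^sub>2(W\<^sup>-\<^sup>1)\<close>: an element \<open>h\<^sub>0\<close> orthogonal to all
  \<open>(\<phi> + h L \<phi>) / \<surd>W\<close> corresponds to an annihilator \<open>h\<^sub>0 / \<surd>W\<close>.\<close>

lemma weighted_range_dense:
 assumes \<eta>: "tends_to_1 \<Omega> \<eta>" and \<epsilon>: "\<epsilon> \<longlonglongrightarrow> 0" and h: "h > 0"
  and W [measurable]: "W \<in> borel_measurable borel" and W0: "\<And>x. W x > 0"
  and Wloc: "\<And>K. compact K ==> K \<subseteq> \<Omega> ==> \<exists>\<delta>>0. \<forall>x\<in>K. \<delta> \<le> W x"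
  and Gam: "\<And>n. AE x in lborel. Gam (\<eta> n) x \<le> \<epsilon> n * W x"
  and F [measurable]: "F \<in> borel_measurable borel" and F0: "\<And>x. x \<notin> \<Omega> ==> F x = 0" and F2: "integrable lborel (\<lambda>x. (F x)\<^sup>2)"
  and e: "e > 0"
 shows "\<exists>\<phi>\<in>test_functions \<Omega>. integrable lborel (\<lambda>x. (F x - (\<phi> x + h * Lop \<phi> x) / sqrt (W x))\<^sup>2) \<and>
  (LINT x|lborel. (F x - (\<phi> x + h * Lop \<phi> x) / sqrt (W x))\<^sup>2) < e"
proof -
 define M where "M = restrict_space lborel \<Omega>"
 have \<Omega>s [measurable]: "\<Omega> \<in> sets borel" using \<Omega> by simp
 have \<Omega>i: "\<Omega> \<inter> space lborel \<in> sets lborel" by simp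
 have restr: "f \<in> borel_measurable M \<longleftrightarrow> (\<lambda>x. indicator \<Omega> x * f x) \<in> borel_measurable borel"
  "integrable M f \<longleftrightarrow> integrable lborel (\<lambda>x. indicator \<Omega> x * f x)"
  "(LINT x|M. f x) = (LINT x|lborel. indicator \<Omega> x * f x)" for f :: "real^'n => real"
  unfolding M_def borel_measurable_restrict_space_iff[OF \<Omega>i] integrable_restrict_space[OF \<Omega>i] integral_restrict_space[OF \<Omega>i] by simp_all
 define T where "T \<phi> x = (\<phi> x + h * Lop \<phi> x) / sqrt (W x)" for \<phi> x
 have Tm: "T \<phi> \<in> borel_measurable borel" if \<phi>: "\<phi> \<in> test_functions \<Omega>" for \<phi>
 proof -
  have [measurable]: "\<phi> \<in> borel_measurable borel" "Lop \<phi> \<in> borel_measurable borel"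
   by (rule test_functions_measurable[OF \<phi>], rule Lop_measurable[OF \<phi>])
  show ?thesis unfolding T_def by measurable
 qed
 have T0: "T \<phi> x = 0" if \<phi>: "\<phi> \<in> test_functions \<Omega>" "x \<notin> \<Omega>" for \<phi> x
 proof -
  obtain K where K: "compact K" "K \<subseteq> \<Omega>" "\<And>x. x \<notin> K ==> \<phi> x = 0" using Cc_support[of \<phi> 0 \<Omega>] \<phi> by (auto simp: test_functions_iff)
  have "x \<notin> K" using K(2) \<phi>(2) by blast
  thus ?thesis using Lop_zero_off[of K \<phi> x] K(1,3) by (simp add: T_def)
 qed
 have Ti: "integrable lborel (\<lambda>x. (T \<phi> x)\<^sup>2)" if \<phi>: "\<phi> \<in> test_functions \<Omega>" for \<phi>
 proof -
  have \<phi>C: "\<phi> \<in> Cc 0 \<Omega>" using \<phi> by (simp add: test_functions_iff)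
  obtain K where K: "compact K" "K \<subseteq> \<Omega>" "\<And>x. x \<notin> K ==> \<phi> x = 0" using Cc_support[OF \<phi>C] by blast
  obtain \<delta> where \<delta>: "\<delta> > 0" "\<And>x. x \<in> K ==> \<delta> \<le> W x" using Wloc[OF K(1,2)] by blast
  obtain b1 where b1: "b1 \<ge> 0" "\<And>x. \<bar>\<phi> x\<bar> \<le> b1" using Cc_bounded[OF \<phi>C] by blast
  obtain b2 where b2: "b2 \<ge> 0" "\<And>x. \<bar>Lop \<phi> x\<bar> \<le> b2" using Lop_bounded[OF \<phi>] by blast
  have T00: "T \<phi> x = 0" if "x \<notin> K" for x using Lop_zero_off[of K \<phi> x] K that by (simp add: T_def)
  have bd: "\<bar>(T \<phi> x)\<^sup>2\<bar> \<le> (b1 + h * b2)\<^sup>2 / \<delta>" for x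
  proof (cases "x \<in> K")
   case True
   have "\<bar>\<phi> x + h * Lop \<phi> x\<bar> \<le> b1 + h * b2"
   proof -
    have "\<bar>h * Lop \<phi> x\<bar> \<le> h * b2" using mult_left_mono[OF b2(2)[of x], of h] h by (simp add: abs_mult)
    thus ?thesis using b1(2)[of x] by linarith
   qed
   hence "(\<phi> x + h * Lop \<phi> x)\<^sup>2 \<le> (b1 + h * b2)\<^sup>2" using power_mono[of "\<bar>\<phi> x + h * Lop \<phi> x\<bar>" "b1 + h * b2" 2] by simp
   hence "(\<phi> x + h * Lop \<phi> x)\<^sup>2 / W x \<le> (b1 + h * b2)\<^sup>2 / \<delta>" using \<delta>(1) \<delta>(2)[OF True] by (intro frac_le) auto
   thus ?thesis using W0[of x] by (simp add: T_def power_divide)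
  qed (use T00 \<delta>(1) in simp)
  show ?thesis
  proof (rule integral_abs_le_compact(1)[OF K(1) _ _ bd])
   show "(\<lambda>x. (T \<phi> x)\<^sup>2) \<in> borel_measurable borel" using Tm[OF \<phi>] by measurable
  qed (use T00 in simp)
 qed
 have TL: "T \<phi> \<in> Lq 2 M" if \<phi>: "\<phi> \<in> test_functions \<Omega>" for \<phi>
 proof -
  have [measurable]: "T \<phi> \<in> borel_measurable borel" by (rule Tm[OF \<phi>])
  have eq: "indicator \<Omega> x * (T \<phi> x)\<^sup>2 = (T \<phi> x)\<^sup>2" for x using T0[OF \<phi>, of x] by (cases "x \<in> \<Omega>") auto
  show ?thesis unfolding Lq_2_iff restr eq using Ti[OF \<phi>] by simp
 qed
 define V where "V = T ` test_functions \<Omega>"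
 have lin: "(\<lambda>x. a * T \<phi> x + b * T \<psi> x) = T (\<lambda>x. a * \<phi> x + b * \<psi> x)"
  if "\<phi> \<in> test_functions \<Omega>" "\<psi> \<in> test_functions \<Omega>" for a b \<phi> \<psi>
  by (rule ext) (simp add: T_def Lop_linear(2)[OF that] add_divide_distrib algebra_simps)
 have ne: "test_functions \<Omega> \<noteq> {}" using \<eta> by (auto simp: tends_to_1_def)
 have V: "subspace V"
  unfolding subspace_def
 proof (intro conjI ballI allI)
  obtain \<phi> where \<phi>: "\<phi> \<in> test_functions \<Omega>" using ne by blast
  have "T (\<lambda>x. 0 * \<phi> x + 0 * \<phi> x) = 0" unfolding lin[OF \<phi> \<phi>, symmetric] by (simp add: fun_eq_iff)
  with imageI[OF Lop_linear(1)[OF \<phi> \<phi>, of 0 0], of T] show "0 \<in> V" unfolding V_def by (simp only:)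
 next
  fix v w assume "v \<in> V" "w \<in> V"
  then obtain \<phi> \<psi> where vw: "v = T \<phi>" "w = T \<psi>" and t: "\<phi> \<in> test_functions \<Omega>" "\<psi> \<in> test_functions \<Omega>" by (auto simp: V_def)
  have "T (\<lambda>x. 1 * \<phi> x + 1 * \<psi> x) = v + w" unfolding lin[OF t, symmetric] vw by (simp add: fun_eq_iff)
  with imageI[OF Lop_linear(1)[OF t, of 1 1], of T] show "v + w \<in> V" unfolding V_def by (simp only:)
 next
  fix a v assume "v \<in> V"
  then obtain \<phi> where v: "v = T \<phi>" and t: "\<phi> \<in> test_functions \<Omega>" by (auto simp: V_def)
  have "T (\<lambda>x. a * \<phi> x + 0 * \<phi> x) = a *\<^sub>R v" unfolding lin[OF t t, symmetric] v by (simp add: fun_eq_iff)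
  with imageI[OF Lop_linear(1)[OF t t, of a 0], of T] show "a *\<^sub>R v \<in> V" unfolding V_def by (simp only:)
 qed
 have VL: "V \<subseteq> Lq 2 M" unfolding V_def using TL by blast
 have FL: "F \<in> Lq 2 M"
 proof -
  have eq: "indicator \<Omega> x * (F x)\<^sup>2 = (F x)\<^sup>2" for x using F0[of x] by (cases "x \<in> \<Omega>") auto
  show ?thesis unfolding Lq_2_iff restr eq using F2 by simp
 qed
 have orth: "AE x in M. h0 x = 0" if h0: "h0 \<in> Lq 2 M" and o: "\<And>v. v \<in> V ==> (LINT x|M. h0 x * v x) = 0" for h0
 proof -
  define h1 where "h1 x = indicator \<Omega> x * h0 x" for x
  have h1 [measurable]: "h1 \<in> borel_measurable borel" using h0 by (simp add: Lq_2_iff restr h1_def[abs_def])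
  have "(h1 x)\<^sup>2 = indicator \<Omega> x * (h0 x)\<^sup>2" for x by (simp add: h1_def indicator_def)
  hence h1i: "integrable lborel (\<lambda>x. (h1 x)\<^sup>2)" using h0 by (simp add: Lq_2_iff restr)
  define g where "g x = h1 x / sqrt (W x)" for x
  have gm [measurable]: "g \<in> borel_measurable borel" unfolding g_def by measurable
  have g2: "(g x)\<^sup>2 = (h1 x)\<^sup>2 / W x" for x using W0[of x] by (simp add: g_def power_divide)
  have Wg: "W x * (g x)\<^sup>2 = (h1 x)\<^sup>2" for x using W0[of x] by (simp add: g2)
  have "AE x in lborel. x \<in> \<Omega> \<longrightarrow> g x = 0"
  proof (rule annihilator_trivial[OF \<eta> \<epsilon> h W gm])
   fix K assume K: "compact K" "K \<subseteq> \<Omega>"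
   obtain \<delta> where \<delta>: "\<delta> > 0" "\<And>x. x \<in> K ==> \<delta> \<le> W x" using Wloc[OF K(1,2)] by blast
   have [measurable]: "K \<in> sets borel" using K by (simp add: compact_imp_closed borel_closed)
   show "integrable lborel (\<lambda>x. indicator K x * (g x)\<^sup>2)"
   proof (rule Bochner_Integration.integrable_bound)
    show "integrable lborel (\<lambda>x. (1 / \<delta>) * (h1 x)\<^sup>2)" using h1i by simp
    show "AE x in lborel. norm (indicator K x * (g x)\<^sup>2) \<le> norm ((1 / \<delta>) * (h1 x)\<^sup>2)"
    proof (rule AE_I2)
     fix x
     show "norm (indicator K x * (g x)\<^sup>2) \<le> norm ((1 / \<delta>) * (h1 x)\<^sup>2)"
     proof (cases "x \<in> K")
      case True
      have "(h1 x)\<^sup>2 / W x \<le> (h1 x)\<^sup>2 / \<delta>" using \<delta>(1) \<delta>(2)[OF True] by (intro frac_le) auto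
      thus ?thesis using True \<delta>(1) by (simp add: g2[symmetric])
     qed simp
    qed
   qed measurable
  next
   show "integrable lborel (\<lambda>x. W x * (g x)\<^sup>2)" unfolding Wg by (rule h1i)
   show "AE x in lborel. Gam (\<eta> n) x * (g x)\<^sup>2 \<le> \<epsilon> n * (W x * (g x)\<^sup>2)" for n
    using Gam[of n] by eventually_elim (simp add: mult_right_mono flip: mult.assoc)
   fix \<phi> assume \<phi>: "\<phi> \<in> test_functions \<Omega>"
   have "g x * (\<phi> x + h * Lop \<phi> x) = indicator \<Omega> x * (h0 x * T \<phi> x)" for x by (simp add: g_def h1_def T_def)
   thus "(LINT x|lborel. g x * (\<phi> x + h * Lop \<phi> x)) = 0" using o[of "T \<phi>"] \<phi> by (simp add: restr V_def)
  qed
  hence "AE x in lborel. x \<in> \<Omega> \<longrightarrow> h0 x = 0"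
  proof eventually_elim
   case (elim x)
   show ?case using elim W0[of x] by (auto simp: g_def h1_def)
  qed
  thus ?thesis unfolding M_def by (subst AE_restrict_space_iff[OF \<Omega>i]) simp
 qed
 obtain \<phi> where \<phi>: "\<phi> \<in> test_functions \<Omega>" and N: "Lp_norm 2 M (F - T \<phi>) < sqrt e"
  using L2_dense_if_orthogonal_trivial[OF V VL orth FL, of "sqrt e"] e by (auto simp: V_def)
 have D: "F - T \<phi> \<in> Lq 2 M" using Lq_diff[of 2 F M "T \<phi>"] FL TL[OF \<phi>] by simp
 have eq: "indicator \<Omega> x * ((F - T \<phi>) x)\<^sup>2 = (F x - T \<phi> x)\<^sup>2" for x using F0[of x] T0[OF \<phi>, of x] by (cases "x \<in> \<Omega>") auto
 have "(Lp_norm 2 M (F - T \<phi>))\<^sup>2 < (sqrt e)\<^sup>2" using N by (intro power_strict_mono) auto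
 hence "(LINT x|lborel. (F x - T \<phi> x)\<^sup>2) < e"
  unfolding Lp_norm_2_sq[OF D] restr eq using e by simp
 moreover have "integrable lborel (\<lambda>x. (F x - T \<phi> x)\<^sup>2)" using D unfolding Lq_2_iff restr eq by blast
 ultimately show ?thesis using \<phi> unfolding T_def by blast
qed

text \<open>Density passes from \<open>L\<^sub>2(W\<^sup>-\<^sup>1)\<close> to \<open>L\<^sub>p\<close> because \<open>d = y \<surd>W\<close> satisfies \<open>\<bar>d\<bar>\<^sup>p = \<bar>y\<bar>\<^sup>p W\<^bsup>p/2\<^esup>\<close>, which Young's
  inequality bounds by an integrable function \<open>R\<close> of small integral and a multiple of \<open>y\<^sup>2\<close>.\<close>

lemma range_dense:
 assumes \<eta>: "tends_to_1 \<Omega> \<eta>" and \<epsilon>: "\<epsilon> \<longlonglongrightarrow> 0" and h: "h > 0" and p: "1 \<le> p"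
  and W [measurable]: "W \<in> borel_measurable borel" and W0: "\<And>x. W x > 0"
  and Wloc: "\<And>K. compact K ==> K \<subseteq> \<Omega> ==> \<exists>\<delta>>0. \<forall>x\<in>K. \<delta> \<le> W x"
  and Gam: "\<And>n. AE x in lborel. Gam (\<eta> n) x \<le> \<epsilon> n * W x"
  and young: "\<And>s. s > 0 ==> \<exists>R A. integrable lborel R \<and> (LINT x|lborel. R x) \<le> s \<and> A > 0 \<and>
    (\<forall>x y. \<bar>y\<bar> powr p * W x powr (p / 2) \<le> R x + A * y\<^sup>2)"
  and f [measurable]: "f \<in> borel_measurable borel" and f0: "\<And>x. x \<notin> \<Omega> ==> f x = 0" and int: "integrable lborel (\<lambda>x. \<bar>f x\<bar> powr p)"
  and e: "e > 0"
 shows "\<exists>\<phi>\<in>test_functions \<Omega>. (LINT x|lborel. \<bar>f x - (\<phi> x + h * Lop \<phi> x)\<bar> powr p) < e"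
proof -
 define e' where "e' = e / (2 * 2 powr p)"
 have e': "e' > 0" using e by (simp add: e'_def)
 obtain f1 K b where f1 [measurable]: "f1 \<in> borel_measurable borel" and K: "compact K" "K \<subseteq> \<Omega>" and f10: "\<And>x. x \<notin> K ==> f1 x = 0"
  and b: "\<And>x. \<bar>f1 x\<bar> \<le> b" and d1: "integrable lborel (\<lambda>x. \<bar>f x - f1 x\<bar> powr p)" "(LINT x|lborel. \<bar>f x - f1 x\<bar> powr p) < e'"
  using truncate_Lp[of \<Omega> f p e', OF \<Omega> f f0 int p e'] by blast
 obtain \<delta> where \<delta>: "\<delta> > 0" "\<And>x. x \<in> K ==> \<delta> \<le> W x" using Wloc[OF K] by blast
 define F where "F x = f1 x / sqrt (W x)" for x
 have Fm [measurable]: "F \<in> borel_measurable borel" unfolding F_def by measurable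
 have F0: "F x = 0" if "x \<notin> K" for x using f10[OF that] by (simp add: F_def)
 have F2: "integrable lborel (\<lambda>x. (F x)\<^sup>2)"
 proof (rule integral_abs_le_compact(1)[OF K(1)])
  fix x
  show "\<bar>(F x)\<^sup>2\<bar> \<le> b\<^sup>2 / \<delta>"
  proof (cases "x \<in> K")
   case True
   have "(f1 x)\<^sup>2 \<le> b\<^sup>2" using power_mono[OF b[of x], of 2] by simp
   hence "(f1 x)\<^sup>2 / W x \<le> b\<^sup>2 / \<delta>" using \<delta>(1) \<delta>(2)[OF True] by (intro frac_le) auto
   thus ?thesis using W0[of x] by (simp add: F_def power_divide)
  qed (use F0 \<delta>(1) in simp)
 qed (use F0 in simp_all)
 obtain R A where R: "integrable lborel R" "(LINT x|lborel. R x) \<le> e' / 2" and A: "A > 0"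
  and RA: "\<And>x y. \<bar>y\<bar> powr p * W x powr (p / 2) \<le> R x + A * y\<^sup>2" using young[of "e' / 2"] e' by auto
 have F\<Omega>: "F x = 0" if "x \<notin> \<Omega>" for x using F0[of x] K(2) that by blast
 have "e' / (2 * A) > 0" using e' A by simp
 then obtain \<phi> where \<phi>: "\<phi> \<in> test_functions \<Omega>"
  and d: "integrable lborel (\<lambda>x. (F x - (\<phi> x + h * Lop \<phi> x) / sqrt (W x))\<^sup>2)"
   "(LINT x|lborel. (F x - (\<phi> x + h * Lop \<phi> x) / sqrt (W x))\<^sup>2) < e' / (2 * A)"
  using weighted_range_dense[OF \<eta> \<epsilon> h W W0 Wloc Gam Fm F\<Omega> F2] by blast
 have [measurable]: "\<phi> \<in> borel_measurable borel" "Lop \<phi> \<in> borel_measurable borel"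
  by (rule test_functions_measurable[OF \<phi>], rule Lop_measurable[OF \<phi>])
 define y where "y x = F x - (\<phi> x + h * Lop \<phi> x) / sqrt (W x)" for x
 have pt: "\<bar>f1 x - (\<phi> x + h * Lop \<phi> x)\<bar> powr p \<le> R x + A * (y x)\<^sup>2" for x
 proof -
  have "f1 x - (\<phi> x + h * Lop \<phi> x) = y x * sqrt (W x)" using W0[of x] by (simp add: y_def F_def left_diff_distrib)
  hence "\<bar>f1 x - (\<phi> x + h * Lop \<phi> x)\<bar> powr p = \<bar>y x\<bar> powr p * sqrt (W x) powr p"
   using W0[of x] by (simp add: abs_mult powr_mult)
  also have "sqrt (W x) powr p = W x powr (p / 2)" using W0[of x] by (simp add: powr_half_sqrt[symmetric] powr_powr)
  finally show ?thesis using RA[of "y x" x] by simp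
 qed
 have yi: "integrable lborel (\<lambda>x. R x + A * (y x)\<^sup>2)" using R d by (simp add: y_def)
 have d2: "integrable lborel (\<lambda>x. \<bar>f1 x - (\<phi> x + h * Lop \<phi> x)\<bar> powr p)"
  by (rule Bochner_Integration.integrable_bound[OF yi]) (use pt in \<open>auto intro!: AE_I2 intro: order_trans[OF _ abs_ge_self]\<close>)
 have "(LINT x|lborel. \<bar>f1 x - (\<phi> x + h * Lop \<phi> x)\<bar> powr p) \<le> (LINT x|lborel. R x + A * (y x)\<^sup>2)"
  by (rule integral_mono[OF d2 yi pt])
 also have "\<dots> = (LINT x|lborel. R x) + A * (LINT x|lborel. (y x)\<^sup>2)" using R d by (simp add: y_def)
 also have "\<dots> < e' / 2 + A * (e' / (2 * A))"
  using R(2) d(2) A by (intro add_le_less_mono mult_strict_left_mono) (auto simp: y_def)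
 also have "\<dots> = e'" using A by simp
 finally have "(LINT x|lborel. \<bar>f1 x - (\<phi> x + h * Lop \<phi> x)\<bar> powr p) < e'" .
 thus ?thesis using Lp_triangle_small[OF p _ _ _ d1(1) d2, of e] d1(2) \<phi> by (auto simp: e'_def)
qed

end

lemma tends_to_1_subsequence:
 assumes \<eta>: "tends_to_1 \<Omega> \<eta>" and \<sigma>: "\<And>k. \<sigma> k \<ge> k"
 shows "tends_to_1 \<Omega> (\<lambda>k. \<eta> (\<sigma> k))"
proof -
 have "filterlim \<sigma> at_top sequentially"
  by (rule filterlim_at_top_mono[OF filterlim_ident]) (simp add: \<sigma>)
 thus ?thesis using \<eta> filterlim_compose[of _ _ sequentially \<sigma> sequentially] unfolding tends_to_1_def by blast
qed

context elliptic
begin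

lemma Gam_nonneg': "\<eta> \<in> test_functions \<Omega> ==> 0 \<le> Gam \<eta> x"
proof (cases "x \<in> \<Omega>")
 case False
 assume "\<eta> \<in> test_functions \<Omega>"
 then obtain K where K: "compact K" "K \<subseteq> \<Omega>" "\<And>x. x \<notin> K ==> \<eta> x = 0" using Cc_support[of \<eta> 0 \<Omega>] by (auto simp: test_functions_iff)
 have "x \<notin> K" using K(2) False by blast
 thus ?thesis using Gam_zero_off[of K \<eta> x] K by simp
qed (rule Gam_nonneg)

text \<open>Along a subsequence the functions \<open>2\<^sup>k \<Gamma>(\<eta>\<^sub>k)\<^sup>q\<close> are summable in \<open>L\<^sub>1\<close>. A weight \<open>W\<close> with
  \<open>W\<^sup>q\<close> equal to their sum dominates \<open>2\<^bsup>k/q\<^esup> \<Gamma>(\<eta>\<^sub>k)\<close> for all \<open>k\<close>, and integrability of \<open>W\<^sup>q\<close> is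
  exactly what the passage from the weighted \<open>L\<^sub>2\<close> space to \<open>L\<^sub>p\<close> requires. The multiples of
  indicators of balls keep \<open>W\<close> away from zero on compact sets.\<close>

lemma range_dense_below_2:
 assumes \<eta>: "tends_to_1 \<Omega> \<eta>" and h: "h > 0" and p: "1 \<le> p" "p < 2"
  and small: "\<And>e. e > 0 ==> \<exists>N. \<forall>n\<ge>N. (\<integral>\<^sup>+x. ennreal (Gam (\<eta> n) x powr (p / (2 - p))) \<partial>lborel) \<le> ennreal e"
  and f: "f \<in> borel_measurable borel" and f0: "\<And>x. x \<notin> \<Omega> ==> f x = 0" and int: "integrable lborel (\<lambda>x. \<bar>f x\<bar> powr p)"
  and e: "e > 0"
 shows "\<exists>\<phi>\<in>test_functions \<Omega>. (LINT x|lborel. \<bar>f x - (\<phi> x + h * Lop \<phi> x)\<bar> powr p) < e"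
proof -
 define q where "q = p / (2 - p)"
 have q: "q > 0" using p by (simp add: q_def)
 have "\<forall>k. \<exists>n\<ge>k. (\<integral>\<^sup>+x. ennreal (Gam (\<eta> n) x powr q) \<partial>lborel) \<le> ennreal ((1/4) ^ k)"
 proof
  fix k :: nat
  obtain N where N: "\<And>n. n \<ge> N ==> (\<integral>\<^sup>+x. ennreal (Gam (\<eta> n) x powr q) \<partial>lborel) \<le> ennreal ((1/4) ^ k)"
   using small[of "(1/4) ^ k"] unfolding q_def by auto
  thus "\<exists>n\<ge>k. (\<integral>\<^sup>+x. ennreal (Gam (\<eta> n) x powr q) \<partial>lborel) \<le> ennreal ((1/4) ^ k)"
   by (intro exI[of _ "max k N"]) simp
 qed
 then obtain \<sigma> where \<sigma>: "\<And>k. \<sigma> k \<ge> k" "\<And>k. (\<integral>\<^sup>+x. ennreal (Gam (\<eta> (\<sigma> k)) x powr q) \<partial>lborel) \<le> ennreal ((1/4) ^ k)"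
  by metis
 define G where "G k = Gam (\<eta> (\<sigma> k))" for k
 have \<eta>t: "\<eta> n \<in> test_functions \<Omega>" for n using \<eta> by (simp add: tends_to_1_def)
 have Gm [measurable]: "G k \<in> borel_measurable borel" for k unfolding G_def by (rule Gam_measurable[OF \<eta>t])
 have G0: "0 \<le> G k x" for k x unfolding G_def by (rule Gam_nonneg'[OF \<eta>t])
 \<comment> \<open>summable masses for the balls that keep the weight positive\<close>
 define a where "a k = (1/2) ^ k / (1 + measure lborel (cball 0 (real k) :: (real^'n) set))" for k
 have a: "a k > 0" for k unfolding a_def by (intro divide_pos_pos add_pos_nonneg) auto
 define t where "t k x = 2 ^ k * G k x powr q + a k * indicator (cball 0 (real k)) x" for k x
 have [measurable]: "(cball 0 (real k) :: (real^'n) set) \<in> sets borel" for k by simp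
 have tm [measurable]: "t k \<in> borel_measurable borel" for k unfolding t_def by measurable
 have t0: "0 \<le> t k x" for k x unfolding t_def using a[of k] by (intro add_nonneg_nonneg mult_nonneg_nonneg) auto
 have tI: "(\<integral>\<^sup>+x. ennreal (t k x) \<partial>lborel) \<le> ennreal (2 * (1/2) ^ k)" for k
 proof -
  have "(\<integral>\<^sup>+x. ennreal (t k x) \<partial>lborel) = (\<integral>\<^sup>+x. ennreal (2 ^ k) * ennreal (G k x powr q) + ennreal (a k) * indicator (cball 0 (real k)) x \<partial>lborel)"
   unfolding t_def using less_imp_le[OF a[of k]] by (intro nn_integral_cong) (simp add: ennreal_plus[symmetric] ennreal_mult[symmetric] indicator_def del: ennreal_plus)
  also have "\<dots> = ennreal (2 ^ k) * (\<integral>\<^sup>+x. ennreal (G k x powr q) \<partial>lborel) + ennreal (a k) * emeasure lborel (cball 0 (real k) :: (real^'n) set)"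
   by (subst nn_integral_add) (auto simp: nn_integral_cmult nn_integral_cmult_indicator)
  also have "\<dots> \<le> ennreal (2 ^ k) * ennreal ((1/4) ^ k) + ennreal (a k) * ennreal (measure lborel (cball 0 (real k) :: (real^'n) set))"
   using \<sigma>(2)[of k] emeasure_eq_ennreal_measure[of lborel "cball 0 (real k) :: (real^'n) set"]
    emeasure_bounded_finite[OF bounded_cball, of "0 :: real^'n" "real k"]
   by (intro add_mono mult_left_mono) (auto simp: G_def)
  also have "\<dots> = ennreal (2 ^ k * (1/4) ^ k + a k * measure lborel (cball 0 (real k) :: (real^'n) set))"
   using less_imp_le[OF a[of k]] by (simp add: ennreal_mult)
  also have "\<dots> \<le> ennreal (2 * (1/2) ^ k)"
  proof (rule ennreal_leI)
   have "(2::real) ^ k * (1/4) ^ k = (1/2) ^ k" by (simp flip: power_mult_distrib)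
   moreover have "a k * measure lborel (cball 0 (real k) :: (real^'n) set) \<le> a k * (1 + measure lborel (cball 0 (real k) :: (real^'n) set))"
    using less_imp_le[OF a[of k]] by (intro mult_left_mono) auto
   moreover have "a k * (1 + measure lborel (cball 0 (real k) :: (real^'n) set)) = (1/2) ^ k"
    proof -
    have ne: "1 + measure lborel (cball 0 (real k) :: (real^'n) set) \<noteq> 0"
     using measure_nonneg[of lborel "cball 0 (real k) :: (real^'n) set"] by linarith
    show ?thesis unfolding a_def by (simp only: times_divide_eq_left nonzero_mult_div_cancel_right[OF ne])
   qed
   ultimately show "2 ^ k * (1/4) ^ k + a k * measure lborel (cball 0 (real k) :: (real^'n) set) \<le> 2 * (1/2) ^ k" by linarith
  qed
  finally show ?thesis .
 qed
 define S where "S x = (\<Sum>k. ennreal (t k x))" for x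
 have Sm [measurable]: "S \<in> borel_measurable borel" unfolding S_def by measurable
 have Sge: "ennreal (t k x) \<le> S x" for k x unfolding S_def by (rule le_suminf)
 have "(\<integral>\<^sup>+x. S x \<partial>lborel) = (\<Sum>k. \<integral>\<^sup>+x. ennreal (t k x) \<partial>lborel)" unfolding S_def by (rule nn_integral_suminf) measurable
 also have "\<dots> \<le> (\<Sum>k. ennreal (2 * (1/2) ^ k))" by (rule suminf_le[OF tI]) auto
 also have "\<dots> = ennreal (\<Sum>k. 2 * (1/2) ^ k)" by (rule suminf_ennreal2) (auto intro!: summable_mult summable_geometric)
 also have "\<dots> < \<infinity>" by simp
 finally have SI: "(\<integral>\<^sup>+x. S x \<partial>lborel) < \<infinity>" .
 have Sfin: "AE x in lborel. S x \<noteq> \<infinity>" by (rule nn_integral_noteq_infinite) (use SI in auto)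
 \<comment> \<open>the value 1 on the null set of divergence keeps \<open>V\<close> finite and positive\<close>
 define V where "V x = (if S x = \<infinity> then 1 else enn2real (S x))" for x
 have Vm [measurable]: "V \<in> borel_measurable borel" unfolding V_def by measurable
 have Vge: "t k x \<le> V x" if "S x \<noteq> \<infinity>" for k x
 proof -
  have "ennreal (t k x) \<le> ennreal (enn2real (S x))" using Sge[of k x] that by (simp add: ennreal_enn2real_if)
  thus ?thesis using that by (simp add: V_def ennreal_le_iff)
 qed
 have tge: "a k \<le> t k x" if "norm x \<le> real k" for k x using that by (simp add: t_def)
 have Vmin: "min 1 (a k) \<le> V x" if "norm x \<le> real k" for k x
  using tge[OF that] Vge[of x k] by (cases "S x = \<infinity>") (auto simp: V_def)
 have V0: "V x > 0" for x
 proof -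
  obtain k where "norm x \<le> real k" using real_arch_simple by blast
  thus ?thesis using Vmin[of x k] a[of k] by linarith
 qed
 have VI: "integrable lborel V"
 proof (rule integrableI_nonneg)
  have "(\<integral>\<^sup>+x. ennreal (V x) \<partial>lborel) = (\<integral>\<^sup>+x. S x \<partial>lborel)"
  proof (rule nn_integral_cong_AE)
   show "AE x in lborel. ennreal (V x) = S x" using Sfin by eventually_elim (simp add: V_def ennreal_enn2real_if)
  qed
  thus "(\<integral>\<^sup>+x. ennreal (V x) \<partial>lborel) < \<infinity>" using SI by simp
 qed (use V0 less_imp_le in auto)
 define W where "W x = V x powr (1 / q)" for x
 have Wq: "W x powr q = V x" for x using V0[of x] q by (simp add: W_def powr_powr)
 define \<epsilon> where "\<epsilon> k = ((1/2) ^ k) powr (1 / q)" for k :: nat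
 have \<epsilon>: "\<epsilon> \<longlonglongrightarrow> 0"
 proof -
  have "(\<lambda>k. ((1/2::real) ^ k) powr (1 / q)) \<longlonglongrightarrow> 0 powr (1 / q)"
   by (rule tendsto_powr2[OF LIMSEQ_realpow_zero tendsto_const]) (use q in auto)
  thus ?thesis using q by (simp add: \<epsilon>_def[abs_def])
 qed
 define J where "J = (LINT x|lborel. V x)"
 have J: "J \<ge> 0" unfolding J_def using V0 less_imp_le by (intro Bochner_Integration.integral_nonneg) blast
 show ?thesis
 proof (rule range_dense[OF tends_to_1_subsequence[OF \<eta> \<sigma>(1)] \<epsilon> h p(1) _ _ _ _ _ f f0 int e])
  show "W \<in> borel_measurable borel" unfolding W_def by measurable
  show "W x > 0" for x using V0[of x] by (simp add: W_def)
 next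
  fix K :: "(real^'n) set" assume K: "compact K" "K \<subseteq> \<Omega>"
  obtain b where b: "\<And>x. x \<in> K ==> norm x \<le> b" using compact_imp_bounded[OF K(1)] unfolding bounded_iff by blast
  obtain k where k: "b \<le> real k" using real_arch_simple by blast
  show "\<exists>\<delta>>0. \<forall>x\<in>K. \<delta> \<le> W x"
  proof (intro exI[of _ "min 1 (a k) powr (1 / q)"] conjI ballI)
   show "min 1 (a k) powr (1 / q) > 0" using a[of k] by simp
   fix x assume "x \<in> K"
   have "min 1 (a k) \<le> V x" by (rule Vmin[OF order_trans[OF b[OF \<open>x \<in> K\<close>] k]])
   thus "min 1 (a k) powr (1 / q) \<le> W x" unfolding W_def using a[of k] q by (intro powr_mono2) auto
  qed
 next
  fix k
  show "AE x in lborel. Gam (\<eta> (\<sigma> k)) x \<le> \<epsilon> k * W x"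
   using Sfin
  proof eventually_elim
   case (elim x)
   have "2 ^ k * G k x powr q \<le> t k x" using a[of k] by (simp add: t_def)
   also have "\<dots> \<le> V x" by (rule Vge[OF elim])
   finally have "G k x powr q \<le> (1/2) ^ k * V x" by (simp add: field_simps)
   hence "(G k x powr q) powr (1 / q) \<le> ((1/2) ^ k * V x) powr (1 / q)" using q by (intro powr_mono2) auto
   thus ?case using G0[of k x] q V0[of x] by (simp add: powr_powr powr_mult \<epsilon>_def W_def G_def)
  qed
 next
  fix s :: real assume s: "s > 0"
  define \<tau> where "\<tau> = (s / (J + 1)) powr (1 / p)"
  have \<tau>: "\<tau> > 0" "\<tau> powr p = s / (J + 1)" using s J p by (auto simp: \<tau>_def powr_powr)
  show "\<exists>R A. integrable lborel R \<and> (LINT x|lborel. R x) \<le> s \<and> A > 0 \<and> (\<forall>x y. \<bar>y\<bar> powr p * W x powr (p / 2) \<le> R x + A * y\<^sup>2)"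
  proof (intro exI[of _ "\<lambda>x. \<tau> powr p * V x"] exI[of _ "\<tau> powr (p - 2)"] conjI allI)
   show "integrable lborel (\<lambda>x. \<tau> powr p * V x)" using VI by simp
   have "(LINT x|lborel. \<tau> powr p * V x) = s / (J + 1) * J" using VI by (simp add: \<tau>(2) J_def)
   also have "\<dots> \<le> s / (J + 1) * (J + 1)" using s J by (intro mult_left_mono) auto
   finally show "(LINT x|lborel. \<tau> powr p * V x) \<le> s" using J by simp
   show "\<tau> powr (p - 2) > 0" using \<tau> by simp
   show "\<bar>y\<bar> powr p * W x powr (p / 2) \<le> \<tau> powr p * V x + \<tau> powr (p - 2) * y\<^sup>2" for x y
    using young_weighted[OF p _ \<tau>(1), of "W x" y] Wq[of x] by (simp add: q_def W_def)
  qed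
 qed
qed

text \<open>For \<open>p = 2\<close> the bound for \<open>\<Gamma>(\<eta>\<^sub>n)\<close> is uniform already, and the constant weight suffices.\<close>

lemma range_dense_2:
 assumes \<eta>: "tends_to_1 \<Omega> \<eta>" and h: "h > 0"
  and \<epsilon>: "\<epsilon> \<longlonglongrightarrow> 0" and Gam: "\<And>n. AE x in lborel. Gam (\<eta> n) x \<le> \<epsilon> n"
  and f: "f \<in> borel_measurable borel" and f0: "\<And>x. x \<notin> \<Omega> ==> f x = 0" and int: "integrable lborel (\<lambda>x. \<bar>f x\<bar> powr 2)"
  and e: "e > 0"
 shows "\<exists>\<phi>\<in>test_functions \<Omega>. (LINT x|lborel. \<bar>f x - (\<phi> x + h * Lop \<phi> x)\<bar> powr 2) < e"
proof (rule range_dense[OF \<eta> \<epsilon> h _ _ _ _ _ _ f f0 int e, of "\<lambda>_. 1"])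
 fix s :: real assume "s > 0"
 have "\<bar>y\<bar> powr 2 = y\<^sup>2" for y :: real by (cases "y = 0") simp_all
 thus "\<exists>R A. integrable lborel R \<and> (LINT x|lborel. R x) \<le> s \<and> A > 0 \<and>
   (\<forall>x y. \<bar>y\<bar> powr 2 * 1 powr (2 / 2) \<le> R (x::real^'n) + A * y\<^sup>2)"
  using \<open>s > 0\<close> by (intro exI[of _ "\<lambda>_. 0"] exI[of _ 1]) simp
qed (use Gam in \<open>auto intro!: exI[of _ 1]\<close>)

end

section \<open>Borel representatives\<close>

lemma lebesgue_on_measurable:
 fixes f :: "real^'n::finite => real"
 assumes "open \<Omega>"
 shows "f \<in> borel_measurable (lebesgue_on \<Omega>) \<longleftrightarrow> (\<lambda>x. indicator \<Omega> x * f x) \<in> borel_measurable lebesgue"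
proof -
 have "\<Omega> \<inter> space lebesgue \<in> sets (lebesgue :: (real^'n) measure)" using assms by simp
 from borel_measurable_restrict_space_iff[OF this, of f] show ?thesis by simp
qed

lemma borel_imp_lebesgue_on: "f \<in> borel_measurable borel ==> (f :: real^'n::finite => real) \<in> borel_measurable (lebesgue_on \<Omega>)"
 by (intro measurable_restrict_space1 measurable_completion) simp

lemma AE_lebesgue_on:
 assumes "open (\<Omega> :: (real^'n::finite) set)"
 shows "(AE x in lebesgue_on \<Omega>. P x) \<longleftrightarrow> (AE x in lborel. x \<in> \<Omega> \<longrightarrow> P x)"
proof -
 have "\<Omega> \<inter> space lebesgue \<in> sets (lebesgue :: (real^'n) measure)" using assms by simp
 from AE_restrict_space_iff[OF this, of P] show ?thesis by (simp add: AE_completion_iff)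
qed

lemma
 fixes f :: "real^'n::finite => real"
 assumes \<Omega>: "open \<Omega>" and f: "f \<in> borel_measurable borel" "\<And>x. x \<notin> \<Omega> ==> f x = 0"
 shows integral_lebesgue_on: "(LINT x|lebesgue_on \<Omega>. f x) = (LINT x|lborel. f x)"
  and integrable_lebesgue_on: "integrable (lebesgue_on \<Omega>) f \<longleftrightarrow> integrable lborel f"
proof -
 have s: "\<Omega> \<inter> space lebesgue \<in> sets (lebesgue :: (real^'n) measure)" using \<Omega> by simp
 have eq: "indicator \<Omega> x *\<^sub>R f x = f x" for x using f(2)[of x] by (cases "x \<in> \<Omega>") auto
 show "(LINT x|lebesgue_on \<Omega>. f x) = (LINT x|lborel. f x)"
  unfolding integral_restrict_space[OF s] eq using f(1) by (intro integral_completion) simp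
 show "integrable (lebesgue_on \<Omega>) f \<longleftrightarrow> integrable lborel f"
  unfolding integrable_restrict_space[OF s] eq using f(1) by (intro integrable_completion) simp
qed

lemma nn_integral_lebesgue_on:
 assumes \<Omega>: "open (\<Omega> :: (real^'n::finite) set)"
 shows "(\<integral>\<^sup>+x. f x \<partial>lebesgue_on \<Omega>) = (\<integral>\<^sup>+x. f x * indicator \<Omega> x \<partial>lborel)"
proof -
 have s: "\<Omega> \<inter> space lebesgue \<in> sets (lebesgue :: (real^'n) measure)" using \<Omega> by simp
 show ?thesis unfolding nn_integral_restrict_space[OF s] by (rule nn_integral_completion)
qed

text \<open>A Borel representative, extended by zero, of a class on \<open>\<Omega>\<close>. All integrals over \<open>\<Omega>\<close> with respect to
  Lebesgue measure become integrals of Borel functions over the whole space.\<close>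

definition borel_version :: "(real^'n::finite) set => (real^'n => real) => (real^'n => real) => bool" where
 "borel_version \<Omega> f f' \<longleftrightarrow> f \<in> borel_measurable (lebesgue_on \<Omega>) \<and> f' \<in> borel_measurable borel \<and>
   (\<forall>x. x \<notin> \<Omega> \<longrightarrow> f' x = 0) \<and> (AE x in lebesgue_on \<Omega>. f x = f' x)"

lemma borel_version_exists:
 fixes f :: "real^'n::finite => real"
 assumes \<Omega>: "open \<Omega>" and f: "f \<in> borel_measurable (lebesgue_on \<Omega>)"
 obtains f' where "borel_version \<Omega> f f'"
proof -
 have [measurable]: "\<Omega> \<in> sets borel" using \<Omega> by simp
 obtain g where g: "g \<in> borel_measurable lborel" "AE x in lborel. indicator \<Omega> x * f x = g x"
  using completion_ex_borel_measurable_real[of "\<lambda>x. indicator \<Omega> x * f x" lborel] f unfolding lebesgue_on_measurable[OF \<Omega>] by auto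
 have [measurable]: "g \<in> borel_measurable borel" using g(1) by simp
 have "AE x in lborel. x \<in> \<Omega> \<longrightarrow> f x = indicator \<Omega> x * g x" using g(2) by eventually_elim auto
 moreover have "(\<lambda>x. indicator \<Omega> x * g x) \<in> borel_measurable borel" by measurable
 ultimately have "borel_version \<Omega> f (\<lambda>x. indicator \<Omega> x * g x)"
  using f unfolding borel_version_def AE_lebesgue_on[OF \<Omega>] by simp
 thus ?thesis by (rule that)
qed

text \<open>The chosen weak derivative is merely known to be locally integrable; measurability follows by
  exhausting \<open>\<Omega>\<close> with compact sets.\<close>

lemma locally_integrable_measurable:
 fixes f :: "real^'n::finite => real"
 assumes \<Omega>: "open \<Omega>" and f: "locally_integrable \<Omega> f"
 shows "f \<in> borel_measurable (lebesgue_on \<Omega>)"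
proof -
 obtain C where C: "\<And>n::nat. compact (C n)" "\<And>n. C n \<subseteq> \<Omega>" "\<Union> (range C) = \<Omega>" "\<And>K. compact K ==> K \<subseteq> \<Omega> ==> \<exists>N. \<forall>n\<ge>N. K \<subseteq> C n"
  using open_Union_compact_subsets[OF \<Omega>] by metis
 have m: "(\<lambda>x. indicator (C n) x * f x) \<in> borel_measurable lebesgue" for n
  using f C(1,2)[of n] borel_measurable_integrable unfolding locally_integrable_def set_integrable_def by force
 have "(\<lambda>x. indicator \<Omega> x * f x) \<in> borel_measurable lebesgue"
 proof (rule borel_measurable_LIMSEQ_real[OF _ m])
  fix x
  have "eventually (\<lambda>n. indicator (C n) x * f x = indicator \<Omega> x * f x) sequentially"
  proof (cases "x \<in> \<Omega>")
   case True
   then obtain N where "\<And>n. n \<ge> N ==> x \<in> C n" using C(4)[of "{x}"] by auto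
   thus ?thesis using True unfolding eventually_sequentially by (intro exI[of _ N]) simp
  next
   case False
   hence "x \<notin> C n" for n using C(2) by blast
   thus ?thesis using False by simp
  qed
  thus "(\<lambda>n. indicator (C n) x * f x) \<longlonglongrightarrow> indicator \<Omega> x * f x" by (rule tendsto_eventually)
 qed
 thus ?thesis unfolding lebesgue_on_measurable[OF \<Omega>] .
qed

lemma has_weak_pd_iff_wpd:
 fixes f g :: "real^'n::finite => real"
 assumes \<Omega>: "open \<Omega>" and f: "borel_version \<Omega> f f'" and g: "borel_version \<Omega> g g'"
 shows "has_weak_pd \<Omega> i f g \<longleftrightarrow> wpd \<Omega> i f' g'"
proof -
 have loc: "locally_integrable \<Omega> f \<longleftrightarrow> (\<forall>K. compact K \<and> K \<subseteq> \<Omega> \<longrightarrow> integrable lborel (\<lambda>x. indicator K x * f' x))"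
  if f: "borel_version \<Omega> f f'" for f f'
 proof -
  have "set_integrable lebesgue K f \<longleftrightarrow> integrable lborel (\<lambda>x. indicator K x * f' x)" if K: "compact K" "K \<subseteq> \<Omega>" for K
  proof -
   have Kb [measurable]: "K \<in> sets borel" using K by (simp add: compact_imp_closed borel_closed)
   have f'm [measurable]: "f' \<in> borel_measurable borel" using f by (simp add: borel_version_def)
   have b: "(\<lambda>x. indicator K x * f' x) \<in> borel_measurable lborel" by measurable
   have "(indicator K :: _ => real) \<in> borel_measurable lebesgue"
    by (rule measurable_completion) measurable
   moreover have "(\<lambda>x. indicator \<Omega> x * f x) \<in> borel_measurable lebesgue"
    using f unfolding borel_version_def lebesgue_on_measurable[OF \<Omega>] by blast
   ultimately have "(\<lambda>x. indicator K x * (indicator \<Omega> x * f x)) \<in> borel_measurable lebesgue"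
    by (rule borel_measurable_times)
   moreover have "indicator K x * (indicator \<Omega> x * f x) = indicator K x *\<^sub>R f x" for x using K(2) by (auto simp: indicator_def)
   ultimately have "(\<lambda>x. indicator K x *\<^sub>R f x) \<in> borel_measurable lebesgue" by simp
   moreover have "AE x in lebesgue. indicator K x *\<^sub>R f x = indicator K x * f' x"
   proof -
    have "AE x in lborel. x \<in> \<Omega> \<longrightarrow> f x = f' x" using f unfolding borel_version_def AE_lebesgue_on[OF \<Omega>] by blast
    hence "AE x in lborel. indicator K x *\<^sub>R f x = indicator K x * f' x"
     by eventually_elim (use K(2) in \<open>auto simp: indicator_def\<close>)
    thus ?thesis by (simp only: AE_completion_iff)
   qed
   ultimately have "integrable lebesgue (\<lambda>x. indicator K x *\<^sub>R f x) \<longleftrightarrow> integrable lebesgue (\<lambda>x. indicator K x * f' x)"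
    using measurable_completion[OF b] by (intro integrable_cong_AE) auto
   thus ?thesis unfolding set_integrable_def using integrable_completion[OF b] by simp
  qed
  thus ?thesis unfolding locally_integrable_def by blast
 qed
 have int: "(LINT x|lebesgue_on \<Omega>. f x * u x) = (LINT x|lborel. f' x * u x)"
  if f: "borel_version \<Omega> f f'" and u: "u \<in> borel_measurable borel" for f f' u
 proof -
  have f': "f' \<in> borel_measurable borel" "\<And>x. x \<notin> \<Omega> ==> f' x = 0" using f by (auto simp: borel_version_def)
  have fu: "(\<lambda>x. f' x * u x) \<in> borel_measurable borel" using f'(1) u by measurable
  have "(LINT x|lebesgue_on \<Omega>. f x * u x) = (LINT x|lebesgue_on \<Omega>. f' x * u x)"
  proof (rule integral_cong_AE)
   show "(\<lambda>x. f x * u x) \<in> borel_measurable (lebesgue_on \<Omega>)"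
    using f borel_imp_lebesgue_on[OF u] unfolding borel_version_def by (intro borel_measurable_times) auto
   show "(\<lambda>x. f' x * u x) \<in> borel_measurable (lebesgue_on \<Omega>)" by (rule borel_imp_lebesgue_on[OF fu])
   have "AE x in lebesgue_on \<Omega>. f x = f' x" using f by (simp add: borel_version_def)
   thus "AE x in lebesgue_on \<Omega>. f x * u x = f' x * u x" by eventually_elim simp
  qed
  also have "\<dots> = (LINT x|lborel. f' x * u x)"
   by (rule integral_lebesgue_on[OF \<Omega> fu]) (simp add: f'(2))
  finally show ?thesis .
 qed
 have t: "(LINT x|lebesgue_on \<Omega>. f x * pd i \<phi> x) = (LINT x|lborel. f' x * pd i \<phi> x)"
  "(LINT x|lebesgue_on \<Omega>. g x * \<phi> x) = (LINT x|lborel. g' x * \<phi> x)" if \<phi>: "\<phi> \<in> test_functions \<Omega>" for \<phi>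
  using int[OF f Cc_measurable[OF Cc_pd[of \<phi> 0 \<Omega> i]]] int[OF g test_functions_measurable[OF \<phi>]] \<phi>
  unfolding test_functions_iff by blast+
 show ?thesis
  unfolding has_weak_pd_def wpd_def loc[OF f] loc[OF g] using t f g by (auto simp: borel_version_def)
qed

lemma Lq_infty_borel_version:
 fixes f :: "real^'n::finite => real"
 assumes \<Omega>: "open \<Omega>" and f: "f \<in> Lq \<infinity> (lebesgue_on \<Omega>)"
 shows "\<exists>f' B. borel_version \<Omega> f f' \<and> (\<forall>x. \<bar>f' x\<bar> \<le> B)"
proof -
 have fm: "f \<in> borel_measurable (lebesgue_on \<Omega>)" and fin: "esssup (lebesgue_on \<Omega>) (\<lambda>x. ennreal \<bar>f x\<bar>) < \<infinity>"
  using f by (auto simp: Lq_def Lq_norm_def)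
 define B where "B = enn2real (esssup (lebesgue_on \<Omega>) (\<lambda>x. ennreal \<bar>f x\<bar>))"
 have B: "esssup (lebesgue_on \<Omega>) (\<lambda>x. ennreal \<bar>f x\<bar>) = ennreal B" "B \<ge> 0" using fin by (auto simp: B_def)
 have AE: "AE x in lebesgue_on \<Omega>. \<bar>f x\<bar> \<le> B"
  using esssup_AE[of "\<lambda>x. ennreal \<bar>f x\<bar>" "lebesgue_on \<Omega>"] unfolding B(1) by eventually_elim (use B(2) in simp)
 obtain g where g: "borel_version \<Omega> f g" by (rule borel_version_exists[OF \<Omega> fm])
 have [measurable]: "g \<in> borel_measurable borel" using g by (simp add: borel_version_def)
 define f' where "f' x = (if \<bar>g x\<bar> \<le> B then g x else 0)" for x
 have "f' \<in> borel_measurable borel" unfolding f'_def by measurable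
 moreover have "AE x in lebesgue_on \<Omega>. f x = g x" using g by (simp add: borel_version_def)
 hence "AE x in lebesgue_on \<Omega>. f x = f' x" using AE by eventually_elim (simp add: f'_def)
 ultimately have "borel_version \<Omega> f f'" using g by (auto simp: borel_version_def f'_def)
 moreover have "\<bar>f' x\<bar> \<le> B" for x using B(2) by (simp add: f'_def)
 ultimately show ?thesis by blast
qed

lemma Lq_borel_version:
 fixes f :: "real^'n::finite => real"
 assumes \<Omega>: "open \<Omega>" and p: "1 \<le> p" and f: "borel_version \<Omega> f f'"
 shows "f \<in> Lq (ennreal p) (lebesgue_on \<Omega>) \<longleftrightarrow> integrable lborel (\<lambda>x. \<bar>f' x\<bar> powr p)"
  and "Lp_norm p (lebesgue_on \<Omega>) f = (LINT x|lborel. \<bar>f' x\<bar> powr p) powr (1 / p)"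
proof -
 have fm: "f \<in> borel_measurable (lebesgue_on \<Omega>)" and f'm [measurable]: "f' \<in> borel_measurable borel" and f'0: "\<And>x. x \<notin> \<Omega> ==> f' x = 0"
  and AE: "AE x in lebesgue_on \<Omega>. f x = f' x" using f by (auto simp: borel_version_def)
 have m: "(\<lambda>x. \<bar>f' x\<bar> powr p) \<in> borel_measurable borel" by measurable
 have m1: "(\<lambda>x. \<bar>f x\<bar> powr p) \<in> borel_measurable (lebesgue_on \<Omega>)" using fm by measurable
 have AE': "AE x in lebesgue_on \<Omega>. \<bar>f x\<bar> powr p = \<bar>f' x\<bar> powr p" using AE by eventually_elim simp
 have z: "\<bar>f' x\<bar> powr p = 0" if "x \<notin> \<Omega>" for x using f'0[OF that] by simp
 show "f \<in> Lq (ennreal p) (lebesgue_on \<Omega>) \<longleftrightarrow> integrable lborel (\<lambda>x. \<bar>f' x\<bar> powr p)"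
  unfolding Lq_iff[OF p] integrable_cong_AE[OF m1 borel_imp_lebesgue_on[OF m] AE'] using fm integrable_lebesgue_on[OF \<Omega> m z] by blast
 show "Lp_norm p (lebesgue_on \<Omega>) f = (LINT x|lborel. \<bar>f' x\<bar> powr p) powr (1 / p)"
  unfolding Lp_norm_def integral_cong_AE[OF m1 borel_imp_lebesgue_on[OF m] AE'] using integral_lebesgue_on[OF \<Omega> m z] by simp
qed

lemma borel_version_refl:
 "f \<in> borel_measurable borel ==> (\<And>x. x \<notin> \<Omega> ==> f x = 0) ==> borel_version \<Omega> f f"
 using borel_imp_lebesgue_on by (auto simp: borel_version_def)

lemma borel_version_add:
 assumes "borel_version \<Omega> f f'" "borel_version \<Omega> g g'"
 shows "borel_version \<Omega> (\<lambda>x. a * f x + b * g x) (\<lambda>x. a * f' x + b * g' x)"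
proof -
 have "AE x in lebesgue_on \<Omega>. f x = f' x" "AE x in lebesgue_on \<Omega>. g x = g' x" using assms by (auto simp: borel_version_def)
 hence "AE x in lebesgue_on \<Omega>. a * f x + b * g x = a * f' x + b * g' x" by eventually_elim simp
 thus ?thesis using assms by (auto simp: borel_version_def intro!: borel_measurable_add borel_measurable_times)
qed

lemma test_functions_borel_version:
 assumes "\<phi> \<in> test_functions \<Omega>" shows "borel_version \<Omega> \<phi> \<phi>"
 using assms test_functions_measurable Cc_outside[of \<phi> 0 \<Omega>] by (intro borel_version_refl) (auto simp: test_functions_iff)

section \<open>The operator on \<open>L\<^sub>p\<close>\<close>

lemma Lp_norm_less:
 fixes F :: "real^'n::finite => real"
 assumes \<Omega>: "open \<Omega>" and p: "1 \<le> p" and F: "borel_version \<Omega> F F'"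
  and l: "(LINT x|lborel. \<bar>F' x\<bar> powr p) < e powr p" and e: "e > 0"
 shows "Lp_norm p (lebesgue_on \<Omega>) F < e"
proof -
 have "(LINT x|lborel. \<bar>F' x\<bar> powr p) powr (1 / p) < (e powr p) powr (1 / p)"
  using p l by (intro powr_less_mono2 Bochner_Integration.integral_nonneg) auto
 also have "\<dots> = e" using p e by (simp add: powr_powr)
 finally show ?thesis unfolding Lq_borel_version(2)[OF \<Omega> p F] .
qed

lemma tends_to_1_if_Lq_norm:
 fixes \<eta> :: "nat => real^'n::finite => real"
 assumes \<Omega>: "open \<Omega>" and \<eta>: "\<And>n. \<eta> n \<in> test_functions \<Omega>"
  and lim: "\<And>\<psi>. \<psi> \<in> Lq 2 (lebesgue_on \<Omega>) ==> (\<lambda>n. Lq_norm 2 (lebesgue_on \<Omega>) (\<lambda>x. (\<eta> n x - 1) * \<psi> x)) \<longlonglongrightarrow> 0"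
 shows "tends_to_1 \<Omega> \<eta>"
 unfolding tends_to_1_def
proof (intro conjI allI impI \<eta>)
 fix \<psi> :: "real^'n => real"
 assume \<psi> [measurable]: "\<psi> \<in> borel_measurable borel" and i: "integrable lborel (\<lambda>x. (\<psi> x)\<^sup>2)" and \<psi>0: "\<forall>x. x \<notin> \<Omega> \<longrightarrow> \<psi> x = 0"
 have sq: "\<bar>y\<bar> powr 2 = y\<^sup>2" for y :: real by (cases "y = 0") simp_all
 have [measurable]: "\<eta> n \<in> borel_measurable borel" for n by (rule test_functions_measurable[OF \<eta>])
 define F where "F n x = (\<eta> n x - 1) * \<psi> x" for n x
 have [measurable]: "F n \<in> borel_measurable borel" for n unfolding F_def by measurable
 have \<psi>v: "borel_version \<Omega> \<psi> \<psi>" using \<psi>0 by (intro borel_version_refl) auto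
 have Fv: "borel_version \<Omega> (F n) (F n)" for n using \<psi>0 by (intro borel_version_refl) (auto simp: F_def)
 have "integrable lborel (\<lambda>x. (F n x)\<^sup>2)" for n
 proof -
  have "\<eta> n \<in> Cc 0 \<Omega>" using \<eta> by (simp add: test_functions_iff)
  then obtain b where b: "\<And>x. \<bar>\<eta> n x\<bar> \<le> b" using Cc_bounded by blast
  have b2: "\<bar>(\<eta> n x - 1)\<^sup>2\<bar> \<le> (b + 1)\<^sup>2" for x
  proof -
   have "\<bar>\<eta> n x - 1\<bar> \<le> b + 1" using b[of x] by linarith
   from power_mono[OF this, of 2] show ?thesis by simp
  qed
  have "integrable lborel (\<lambda>x. (\<psi> x)\<^sup>2 * (\<eta> n x - 1)\<^sup>2)" by (rule integrable_mult_bounded[OF i _ b2]) measurable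
  thus ?thesis by (simp add: F_def power_mult_distrib mult.commute)
 qed
 hence FL: "F n \<in> Lq (ennreal 2) (lebesgue_on \<Omega>)" for n using Lq_borel_version(1)[OF \<Omega> _ Fv, of 2] by (simp add: sq)
 have "\<psi> \<in> Lq 2 (lebesgue_on \<Omega>)" using Lq_borel_version(1)[OF \<Omega> _ \<psi>v, of 2] i by (simp add: sq)
 hence "(\<lambda>n. Lq_norm (ennreal 2) (lebesgue_on \<Omega>) (F n)) \<longlonglongrightarrow> 0" using lim unfolding F_def[abs_def] by simp
 hence "(\<lambda>n. Lp_norm 2 (lebesgue_on \<Omega>) (F n)) \<longlonglongrightarrow> 0" using tendsto_Lq_norm_iff[of 2 F] FL by simp
 hence "(\<lambda>n. (Lp_norm 2 (lebesgue_on \<Omega>) (F n))\<^sup>2) \<longlonglongrightarrow> 0\<^sup>2" by (rule tendsto_power)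
 moreover have "(Lp_norm 2 (lebesgue_on \<Omega>) (F n))\<^sup>2 = (LINT x|lborel. (F n x)\<^sup>2)" for n
  using Lq_borel_version(2)[OF \<Omega> _ Fv, of 2 n] by (simp add: sq powr_half_sqrt)
 ultimately show "(\<lambda>n. LINT x|lborel. ((\<eta> n x - 1) * \<psi> x)\<^sup>2) \<longlonglongrightarrow> 0" by (simp add: F_def)
qed

text \<open>If all \<open>\<eta> n\<close> vanished, then the indicator of a closed ball in \<open>\<Omega>\<close> would have norm zero. So one of the
  given cutoff functions can serve as the profile of a mollifier.\<close>

lemma tends_to_1_nonzero:
 fixes \<eta> :: "nat => real^'n::finite => real"
 assumes \<Omega>: "open \<Omega>" "\<Omega> \<noteq> {}" and \<eta>: "tends_to_1 \<Omega> \<eta>"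
 shows "\<exists>n x. \<eta> n x \<noteq> 0"
proof (rule ccontr)
 assume c: "\<not> (\<exists>n x. \<eta> n x \<noteq> 0)"
 obtain x0 r where r: "r > 0" "cball x0 r \<subseteq> \<Omega>" using \<Omega> open_contains_cball by blast
 define \<psi> where "\<psi> = (indicator (cball x0 r) :: real^'n => real)"
 have m: "\<psi> \<in> borel_measurable borel" unfolding \<psi>_def by (intro borel_measurable_indicator borel_closed closed_cball)
 have sq: "(\<psi> x)\<^sup>2 = indicator (cball x0 r) x" for x by (simp add: \<psi>_def indicator_def)
 have fin: "emeasure lborel (cball x0 r) < \<infinity>" by (rule emeasure_bounded_finite[OF bounded_cball])
 have i: "integrable lborel (\<lambda>x. (\<psi> x)\<^sup>2)" unfolding sq using fin by simp
 have z: "\<forall>x. x \<notin> \<Omega> \<longrightarrow> \<psi> x = 0" using r(2) by (auto simp: \<psi>_def indicator_def)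
 have "(\<lambda>n. LINT x|lborel. ((\<eta> n x - 1) * \<psi> x)\<^sup>2) \<longlonglongrightarrow> 0" using \<eta> m i z unfolding tends_to_1_def by blast
 moreover have "((\<eta> n x - 1) * \<psi> x)\<^sup>2 = indicator (cball x0 r) x" for n x using c sq[of x] by simp
 ultimately have "(\<lambda>n::nat. measure lborel (cball x0 r)) \<longlonglongrightarrow> 0" by simp
 hence "measure lborel (cball x0 r) = 0" using LIMSEQ_unique tendsto_const by blast
 moreover have "measure lborel (cball x0 r) > 0" using content_cball_pos[of r x0] r(1) by simp
 ultimately show False by simp
qed

lemma carre_du_champ_small:
 fixes f :: "real^'n::finite => real"
 assumes \<Omega>: "open \<Omega>" and q: "q > 0" and e: "e > 0" and G: "\<And>x. x \<in> \<Omega> ==> f x = G x" "\<And>x. 0 \<le> G x" "\<And>x. x \<notin> \<Omega> ==> G x = 0"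
  and l: "Lq_norm (ennreal q) (lebesgue_on \<Omega>) f < ennreal (e powr (1 / q))"
 shows "(\<integral>\<^sup>+x. ennreal (G x powr q) \<partial>lborel) \<le> ennreal e"
proof -
 define I where "I = (\<integral>\<^sup>+x. ennreal (\<bar>f x\<bar> powr q) \<partial>lebesgue_on \<Omega>)"
 have N: "Lq_norm (ennreal q) (lebesgue_on \<Omega>) f = (if I = \<infinity> then \<infinity> else ennreal (enn2real I powr (1 / q)))"
  using q by (simp add: Lq_norm_def I_def Let_def)
 have fin: "I \<noteq> \<infinity>" using l unfolding N by (cases "I = \<infinity>") auto
 have "enn2real I powr (1 / q) < e powr (1 / q)" using l fin unfolding N by (simp add: ennreal_less_iff)
 hence "enn2real I < e" using q e powr_mono2[of "1 / q" e "enn2real I"] by (intro not_le_imp_less notI) auto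
 hence "I \<le> ennreal e" using fin eq_ennreal_enn2real[OF fin] by (metis ennreal_leI less_imp_le)
 moreover have "I = (\<integral>\<^sup>+x. ennreal (G x powr q) \<partial>lborel)"
  unfolding I_def nn_integral_lebesgue_on[OF \<Omega>]
 proof (rule nn_integral_cong)
  fix x
  show "ennreal (\<bar>f x\<bar> powr q) * indicator \<Omega> x = ennreal (G x powr q)"
   using G(1)[of x] G(2)[of x] G(3)[of x] q by (cases "x \<in> \<Omega>") auto
 qed
 ultimately show ?thesis by simp
qed

lemma coefficients_exist:
 fixes C :: "real^'n::finite => real^'n^'n"
 assumes \<Omega>: "open \<Omega>" and C: "\<And>i j. (\<lambda>x. C x $ i $ j) \<in> W1_infty \<Omega>"
  and sym: "\<And>x i j. x \<in> \<Omega> ==> C x $ i $ j = C x $ j $ i"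
  and pos: "\<And>x \<xi>. x \<in> \<Omega> ==> \<xi> \<noteq> 0 ==> \<xi> \<bullet> (C x *v \<xi>) > 0"
  and mol: "mollifier \<rho> \<kappa>"
 defines "c \<equiv> \<lambda>i j x. indicator \<Omega> x * C x $ i $ j"
 shows "\<And>i j. borel_version \<Omega> (\<lambda>x. C x $ i $ j) (c i j)"
  and "\<exists>D B. elliptic \<rho> \<kappa> \<Omega> c D B"
proof -
 have cont: "continuous_on \<Omega> (\<lambda>x. C x $ i $ j)" for i j using C by (simp add: W1_infty_def)
 have meas: "(\<lambda>x. C x $ i $ j) \<in> borel_measurable (lebesgue_on \<Omega>)" for i j using C by (simp add: W1_infty_def Lq_def)
 have \<Omega>b: "\<Omega> \<in> sets borel" using \<Omega> by simp
 have cm: "c i j \<in> borel_measurable borel" for i j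
  using borel_measurable_continuous_on_indicator[OF \<Omega>b cont[of i j]] by (simp add: c_def)
 show cv: "borel_version \<Omega> (\<lambda>x. C x $ i $ j) (c i j)" for i j
  unfolding borel_version_def AE_lebesgue_on[OF \<Omega>] using meas cm by (auto simp: c_def)
 have ex: "\<exists>D B. wpd \<Omega> k (c i j) D \<and> (\<forall>x. \<bar>D x\<bar> \<le> B)" for i j k
 proof -
  obtain g where g: "g \<in> Lq \<infinity> (lebesgue_on \<Omega>)" "has_weak_pd \<Omega> k (\<lambda>x. C x $ i $ j) g"
   using C[of i j] unfolding W1_infty_def by blast
  obtain D B where "borel_version \<Omega> g D" "\<And>x. \<bar>D x\<bar> \<le> B" using Lq_infty_borel_version[OF \<Omega> g(1)] by blast
  thus ?thesis using has_weak_pd_iff_wpd[OF \<Omega> cv[of i j]] g(2) by blast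
 qed
 define D where "D i j k = (SOME D. \<exists>B. wpd \<Omega> k (c i j) D \<and> (\<forall>x. \<bar>D x\<bar> \<le> B))" for i j k
 have DB: "\<exists>B. wpd \<Omega> k (c i j) (D i j k) \<and> (\<forall>x. \<bar>D i j k x\<bar> \<le> B)" for i j k
  unfolding D_def by (rule someI_ex[OF ex])
 hence D: "wpd \<Omega> k (c i j) (D i j k)" for i j k by blast
 define B where "B i j k = (SOME B. \<forall>x. \<bar>D i j k x\<bar> \<le> B)" for i j k
 have B: "\<bar>D i j k x\<bar> \<le> B i j k" for i j k x
  using someI_ex[of "\<lambda>B. \<forall>x. \<bar>D i j k x\<bar> \<le> B"] DB unfolding B_def by blast
 define B' where "B' = (\<Sum>i\<in>UNIV. \<Sum>j\<in>UNIV. \<Sum>k\<in>UNIV. B i j k)"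
 have B0: "0 \<le> B i j k" for i j k using B[of i j k undefined] by linarith
 have B': "B i j k \<le> B'" for i j k
 proof -
  have "B i j k \<le> (\<Sum>k\<in>UNIV. B i j k)" by (rule member_le_sum) (auto simp: B0)
  also have "\<dots> \<le> (\<Sum>j\<in>UNIV. \<Sum>k\<in>UNIV. B i j k)"
   using member_le_sum[of j UNIV "\<lambda>j. \<Sum>k\<in>UNIV. B i j k"] by (simp add: B0 sum_nonneg)
  also have "\<dots> \<le> B'" unfolding B'_def
   using member_le_sum[of i UNIV "\<lambda>i. \<Sum>j\<in>UNIV. \<Sum>k\<in>UNIV. B i j k"] by (simp add: B0 sum_nonneg)
  finally show ?thesis .
 qed
 have "elliptic \<rho> \<kappa> \<Omega> c D B'"
 proof (intro elliptic.intro elliptic_axioms.intro mol \<Omega> D)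
  show "\<bar>D i j k x\<bar> \<le> B'" for i j k x using B[of i j k x] B'[of i j k] by linarith
  show "continuous_on \<Omega> (c i j)" for i j
   by (rule continuous_on_cong[OF refl, THEN iffD1, OF _ cont]) (simp add: c_def)
  show "c i j x = c j i x" for i j x using sym[of x i j] by (cases "x \<in> \<Omega>") (auto simp: c_def)
  show "0 < (\<Sum>i\<in>UNIV. \<Sum>j\<in>UNIV. c i j x * \<xi> $ i * \<xi> $ j)" if "x \<in> \<Omega>" "\<xi> \<noteq> 0" for x \<xi>
   using pos[OF that] that(1) by (simp add: c_def inner_vec_def matrix_vector_mult_def sum_distrib_left mult_ac)
 qed
 thus "\<exists>D B. elliptic \<rho> \<kappa> \<Omega> c D B" by blast
qed

text \<open>The product rule for weak derivatives computes a weak derivative of each \<open>c\<^sub>i\<^sub>j \<partial>\<^sub>j \<phi>\<close>, and by uniqueness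
  the arbitrarily chosen one agrees with it almost everywhere.\<close>

lemma elliptic_op_borel_version:
 fixes C :: "real^'n::finite => real^'n^'n"
 assumes ell: "elliptic \<rho> \<kappa> \<Omega> c D B" and C: "\<And>i j. borel_version \<Omega> (\<lambda>x. C x $ i $ j) (c i j)"
  and \<phi>: "\<phi> \<in> test_functions \<Omega>"
 shows "borel_version \<Omega> (elliptic_op \<Omega> C \<phi>) (elliptic.Lop c D \<phi>)"
proof -
 interpret elliptic \<rho> \<kappa> \<Omega> c D B by (rule ell)
 have \<phi>C: "\<phi> \<in> Cc k \<Omega>" for k using \<phi> by (simp add: test_functions_iff)
 define G where "G i j x = D i j i x * pd j \<phi> x + c i j x * pd i (pd j \<phi>) x" for i j x
 have [measurable]: "pd j \<phi> \<in> borel_measurable borel" "pd i (pd j \<phi>) \<in> borel_measurable borel" for i j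
  using Cc_measurable[OF Cc_pd[OF \<phi>C]] Cc_measurable[OF Cc_pd[OF Cc_pd[OF \<phi>C]]] by auto
 have pd0: "pd j \<phi> x = 0" "pd i (pd j \<phi>) x = 0" if "x \<notin> \<Omega>" for i j x
  using Cc_outside[OF Cc_pd[OF \<phi>C[of "Suc 0"]] that] Cc_outside[OF Cc_pd[OF Cc_pd[OF \<phi>C[of "Suc (Suc 0)"]]] that] by auto
 have Gm [measurable]: "G i j \<in> borel_measurable borel" for i j unfolding G_def by measurable
 have G: "borel_version \<Omega> (G i j) (G i j)" for i j using pd0 by (intro borel_version_refl) (auto simp: G_def)
 define w where "w i j = weak_pd \<Omega> i (\<lambda>y. C y $ i $ j * pd j \<phi> y)" for i j
 have w: "borel_version \<Omega> (w i j) (G i j)" for i j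
 proof -
  have cm: "(\<lambda>y. c i j y * pd j \<phi> y) \<in> borel_measurable borel" by measurable
  have AE: "AE x in lebesgue_on \<Omega>. C x $ i $ j = c i j x" using C[of i j] by (simp add: borel_version_def)
  have fv: "borel_version \<Omega> (\<lambda>y. C y $ i $ j * pd j \<phi> y) (\<lambda>y. c i j y * pd j \<phi> y)"
   unfolding borel_version_def
  proof (intro conjI cm)
   show "(\<lambda>y. C y $ i $ j * pd j \<phi> y) \<in> borel_measurable (lebesgue_on \<Omega>)"
    using C[of i j] borel_measurable_times[OF _ borel_imp_lebesgue_on[of "pd j \<phi>" \<Omega>], of "\<lambda>x. C x $ i $ j"]
    by (simp add: borel_version_def)
   show "AE x in lebesgue_on \<Omega>. C x $ i $ j * pd j \<phi> x = c i j x * pd j \<phi> x" using AE by eventually_elim simp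
  qed (use pd0 in simp)
  have "has_weak_pd \<Omega> i (\<lambda>y. C y $ i $ j * pd j \<phi> y) (G i j)"
   unfolding has_weak_pd_iff_wpd[OF \<Omega> fv G] using wpd_flux[OF \<phi>, of i j] by (simp add: G_def[abs_def])
  hence W: "has_weak_pd \<Omega> i (\<lambda>y. C y $ i $ j * pd j \<phi> y) (w i j)" unfolding w_def weak_pd_def by (rule someI[of "has_weak_pd \<Omega> i (\<lambda>y. C y $ i $ j * pd j \<phi> y)"])
  hence wm: "w i j \<in> borel_measurable (lebesgue_on \<Omega>)"
   by (intro locally_integrable_measurable[OF \<Omega>]) (simp add: has_weak_pd_def)
  obtain w' where w': "borel_version \<Omega> (w i j) w'" by (rule borel_version_exists[OF \<Omega> wm])
  have "wpd \<Omega> i (\<lambda>y. c i j y * pd j \<phi> y) w'" using W unfolding has_weak_pd_iff_wpd[OF \<Omega> fv w'] .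
  from wpd_unique[OF \<Omega> this wpd_flux[OF \<phi>]] have "AE x in lebesgue_on \<Omega>. w' x = G i j x"
   unfolding AE_lebesgue_on[OF \<Omega>] G_def .
  moreover have "AE x in lebesgue_on \<Omega>. w i j x = w' x" using w' by (simp add: borel_version_def)
  ultimately have "AE x in lebesgue_on \<Omega>. w i j x = G i j x" by eventually_elim simp
  thus ?thesis using wm G by (simp add: borel_version_def)
 qed
 have "AE x in lebesgue_on \<Omega>. \<forall>i j. w i j x = G i j x"
  unfolding AE_all_countable using w by (simp add: borel_version_def)
 hence "AE x in lebesgue_on \<Omega>. elliptic_op \<Omega> C \<phi> x = Lop \<phi> x"
  by eventually_elim (simp add: elliptic_op_def Lop_def w_def[symmetric] G_def[symmetric])
 moreover have "elliptic_op \<Omega> C \<phi> \<in> borel_measurable (lebesgue_on \<Omega>)"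
 proof -
  have "(\<lambda>x. - (\<Sum>i\<in>UNIV. \<Sum>j\<in>UNIV. w i j x)) \<in> borel_measurable (lebesgue_on \<Omega>)"
   using w unfolding borel_version_def by (intro borel_measurable_uminus borel_measurable_sum) auto
  thus ?thesis by (simp add: elliptic_op_def[abs_def] w_def)
 qed
 moreover have "Lop \<phi> x = 0" if "x \<notin> \<Omega>" for x using pd0[OF that] by (simp add: Lop_def)
 ultimately show ?thesis using Lop_measurable[OF \<phi>] by (simp add: borel_version_def)
qed

text \<open>Representatives turn the estimates for test functions on the whole space into those for \<open>L\<^sub>p(\<Omega>)\<close>. The
  graph is linear only up to null sets, since weak derivatives are chosen arbitrarily.\<close>

lemma elliptic_graph_core:
 fixes C :: "real^'n::finite => real^'n^'n"
 assumes ell: "elliptic \<rho> \<kappa> \<Omega> c D B" and C: "\<And>i j. borel_version \<Omega> (\<lambda>x. C x $ i $ j) (c i j)" and p: "1 \<le> p" "p \<le> 2"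
  and range: "\<And>f h e. f \<in> borel_measurable borel ==> (\<And>x. x \<notin> \<Omega> ==> f x = 0) ==> integrable lborel (\<lambda>x. \<bar>f x\<bar> powr p) ==>
   h > 0 ==> e > 0 ==> \<exists>\<phi>\<in>test_functions \<Omega>. (LINT x|lborel. \<bar>f x - (\<phi> x + h * elliptic.Lop c D \<phi> x)\<bar> powr p) < e"
 shows "dissipative_core (Lq (ennreal p) (lebesgue_on \<Omega>)) (Lp_norm p (lebesgue_on \<Omega>)) (elliptic_graph \<Omega> C)"
proof -
 interpret elliptic \<rho> \<kappa> \<Omega> c D B by (rule ell)
 note ver = test_functions_borel_version elliptic_op_borel_version[OF ell C]
 note Lqv = Lq_borel_version[OF \<Omega> p(1)]
 define E where "E = elliptic_op \<Omega> C"
 have vE: "borel_version \<Omega> (E \<phi>) (Lop \<phi>)" if "\<phi> \<in> test_functions \<Omega>" for \<phi> unfolding E_def by (rule ver(2)[OF that])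
 have vs: "borel_version \<Omega> (\<phi> + h *\<^sub>R E \<phi>) (\<lambda>x. \<phi> x + h * Lop \<phi> x)" if "\<phi> \<in> test_functions \<Omega>" for \<phi> h
 proof -
  have "\<phi> + h *\<^sub>R E \<phi> = (\<lambda>x. 1 * \<phi> x + h * E \<phi> x)" by (simp add: fun_eq_iff)
  thus ?thesis using borel_version_add[OF ver(1)[OF that] vE[OF that], of 1 h] by simp
 qed
 have vd: "borel_version \<Omega> (f - g) (\<lambda>x. f' x - g' x)" if "borel_version \<Omega> f f'" "borel_version \<Omega> g g'" for f f' g g'
 proof -
  have "f - g = (\<lambda>x. 1 * f x + (-1) * g x)" by (simp add: fun_eq_iff)
  thus ?thesis using borel_version_add[OF that, of 1 "-1"] by simp
 qed
 show ?thesis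
 proof (intro dissipative_core.intro Lp_complete_seminorm[OF p(1)] dissipative_core_axioms.intro)
  fix x y assume "(x, y) \<in> elliptic_graph \<Omega> C"
  hence x: "x \<in> test_functions \<Omega>" and y: "y = E x" by (auto simp: elliptic_graph_def E_def)
  have xX: "x \<in> Lq (ennreal p) (lebesgue_on \<Omega>)" unfolding Lqv(1)[OF ver(1)[OF x]] by (rule Lop_accretive(2)[OF x p(1) zero_less_one])
  moreover have "y = (x + 1 *\<^sub>R E x) - x" unfolding y by simp
  moreover have "x + 1 *\<^sub>R E x \<in> Lq (ennreal p) (lebesgue_on \<Omega>)"
   unfolding Lqv(1)[OF vs[OF x]] by (rule Lop_accretive(3)[OF x p(1) zero_less_one])
  ultimately show "x \<in> Lq (ennreal p) (lebesgue_on \<Omega>) \<and> y \<in> Lq (ennreal p) (lebesgue_on \<Omega>)"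
   using Lq_diff[OF p(1)] by metis
 next
  fix x y x' y' :: "real^'n => real" and a b :: real
  assume "(x, y) \<in> elliptic_graph \<Omega> C" "(x', y') \<in> elliptic_graph \<Omega> C"
  hence x: "x \<in> test_functions \<Omega>" "y = E x" "x' \<in> test_functions \<Omega>" "y' = E x'" by (auto simp: elliptic_graph_def E_def)
  define z where "z = (\<lambda>t. a * x t + b * x' t)"
  have z: "z \<in> test_functions \<Omega>" "Lop z t = a * Lop x t + b * Lop x' t" for t
   unfolding z_def by (rule Lop_linear[OF x(1,3)])+
  have e1: "a *\<^sub>R x + b *\<^sub>R x' = z" "a *\<^sub>R y + b *\<^sub>R y' = (\<lambda>t. a * E x t + b * E x' t)" by (simp_all add: fun_eq_iff z_def x)
  have "borel_version \<Omega> (E z - (a *\<^sub>R y + b *\<^sub>R y')) (\<lambda>t. Lop z t - (a * Lop x t + b * Lop x' t))"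
   unfolding e1 by (rule vd[OF vE[OF z(1)] borel_version_add[OF vE[OF x(1)] vE[OF x(3)]]])
  hence "Lp_norm p (lebesgue_on \<Omega>) (E z - (a *\<^sub>R y + b *\<^sub>R y')) = 0" using Lqv(2) by (simp add: z(2))
  moreover have "(a *\<^sub>R x + b *\<^sub>R x', E z) \<in> elliptic_graph \<Omega> C" unfolding e1 using z(1) by (auto simp: elliptic_graph_def E_def)
  ultimately show "\<exists>z. (a *\<^sub>R x + b *\<^sub>R x', z) \<in> elliptic_graph \<Omega> C \<and> Lp_norm p (lebesgue_on \<Omega>) (z - (a *\<^sub>R y + b *\<^sub>R y')) = 0" by blast
 next
  fix x y and h :: real assume "(x, y) \<in> elliptic_graph \<Omega> C" and h: "h > 0"
  hence x: "x \<in> test_functions \<Omega>" and y: "y = E x" by (auto simp: elliptic_graph_def E_def)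
  show "Lp_norm p (lebesgue_on \<Omega>) x \<le> Lp_norm p (lebesgue_on \<Omega>) (x + h *\<^sub>R y)"
   unfolding y Lqv(2)[OF ver(1)[OF x]] Lqv(2)[OF vs[OF x]]
   using p by (intro powr_mono2 Lop_accretive(1)[OF x p(1) h] Bochner_Integration.integral_nonneg) auto
 next
  fix f and e :: real assume f: "f \<in> Lq (ennreal p) (lebesgue_on \<Omega>)" and e: "e > 0"
  have fm: "f \<in> borel_measurable (lebesgue_on \<Omega>)" using f unfolding Lq_def by blast
  obtain f' where f': "borel_version \<Omega> f f'" by (rule borel_version_exists[OF \<Omega> fm])
  have f'm: "f' \<in> borel_measurable borel" and f'0: "\<And>x. x \<notin> \<Omega> ==> f' x = 0" using f' by (auto simp: borel_version_def)
  have f'i: "integrable lborel (\<lambda>x. \<bar>f' x\<bar> powr p)" using f unfolding Lqv(1)[OF f'] .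
  have ep: "e powr p > 0" using e by simp
  obtain \<phi> where \<phi>: "\<phi> \<in> test_functions \<Omega>" "(LINT x|lborel. \<bar>f' x - \<phi> x\<bar> powr p) < e powr p"
   using test_functions_dense[OF \<Omega> f'm f'0 f'i p ep] by blast
  have "Lp_norm p (lebesgue_on \<Omega>) (f - \<phi>) < e" by (rule Lp_norm_less[OF \<Omega> p(1) vd[OF f' ver(1)[OF \<phi>(1)]] \<phi>(2) e])
  thus "\<exists>(x, y)\<in>elliptic_graph \<Omega> C. Lp_norm p (lebesgue_on \<Omega>) (f - x) < e" using \<phi>(1) by (auto simp: elliptic_graph_def)
  fix h :: real assume h: "h > 0"
  obtain \<psi> where \<psi>: "\<psi> \<in> test_functions \<Omega>" "(LINT x|lborel. \<bar>f' x - (\<psi> x + h * Lop \<psi> x)\<bar> powr p) < e powr p"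
   using range[OF f'm f'0 f'i h ep] by blast
  have "Lp_norm p (lebesgue_on \<Omega>) (f - (\<psi> + h *\<^sub>R E \<psi>)) < e" by (rule Lp_norm_less[OF \<Omega> p(1) vd[OF f' vs[OF \<psi>(1)]] \<psi>(2) e])
  thus "\<exists>(x, y)\<in>elliptic_graph \<Omega> C. Lp_norm p (lebesgue_on \<Omega>) (f - (x + h *\<^sub>R y)) < e"
   using \<psi>(1) by (auto simp: elliptic_graph_def E_def)
 qed
qed

text \<open>For empty \<open>\<Omega>\<close> no cutoff function supplies a mollifier, but all norms are zero.\<close>

lemma elliptic_graph_core_empty:
 fixes C :: "real^'n::finite => real^'n^'n"
 assumes p: "1 \<le> p"
 shows "dissipative_core (Lq (ennreal p) (lebesgue_on {})) (Lp_norm p (lebesgue_on {})) (elliptic_graph {} C)"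
proof -
 have v: "borel_version {} f (\<lambda>_. 0)" for f :: "real^'n => real"
  using lebesgue_on_measurable[of "{}" f] AE_lebesgue_on[of "{}"] by (simp add: borel_version_def)
 have X: "f \<in> Lq (ennreal p) (lebesgue_on {})" and N: "Lp_norm p (lebesgue_on {}) f = 0" for f :: "real^'n => real"
  using Lq_borel_version[OF open_empty p v[of f]] by simp_all
 have z: "(\<lambda>_. 0) \<in> test_functions ({} :: (real^'n) set)"
  unfolding test_functions_iff by (intro allI CcI[of _ _ "{}"] Ck_const) auto
 hence g: "(\<lambda>_. 0, elliptic_op {} C (\<lambda>_. 0)) \<in> elliptic_graph {} C" by (auto simp: elliptic_graph_def)
 have 0: "x = (\<lambda>_. 0)" if "(x, y) \<in> elliptic_graph {} C" for x y
  using that Cc_outside[of x 0 "{}"] by (auto simp: elliptic_graph_def test_functions_iff)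
 show ?thesis
 proof (intro dissipative_core.intro Lp_complete_seminorm[OF p] dissipative_core_axioms.intro)
  fix x y x' y' :: "real^'n => real" and a b :: real
  assume "(x, y) \<in> elliptic_graph {} C" "(x', y') \<in> elliptic_graph {} C"
  hence "x = (\<lambda>_. 0)" "x' = (\<lambda>_. 0)" using 0 by blast+
  hence "a *\<^sub>R x + b *\<^sub>R x' = (\<lambda>_. 0)" by (simp add: fun_eq_iff)
  thus "\<exists>z. (a *\<^sub>R x + b *\<^sub>R x', z) \<in> elliptic_graph {} C \<and> Lp_norm p (lebesgue_on {}) (z - (a *\<^sub>R y + b *\<^sub>R y')) = 0"
   using g N by auto
 qed (use X N g in auto)
qed

theorem proposition6p1:
  fixes \<Omega> :: "(real^'n::finite) set"
    and C :: "real^'n \<Rightarrow> real^'n^'n"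
    and p :: real
  assumes "open \<Omega>"
    and "\<And>i j. (\<lambda>x. C x $ i $ j) \<in> W1_infty \<Omega>"
    and "\<And>x i j. x \<in> \<Omega> \<Longrightarrow> C x $ i $ j = C x $ j $ i"
    and "\<And>x \<xi>. x \<in> \<Omega> \<Longrightarrow> \<xi> \<noteq> 0 \<Longrightarrow> \<xi> \<bullet> (C x *v \<xi>) > 0"
    and "1 \<le> p" and "p \<le> 2"
    and "\<exists>\<eta> :: nat \<Rightarrow> real^'n \<Rightarrow> real.
           (\<forall>n. \<eta> n \<in> test_functions \<Omega>) \<and>
           (\<forall>n. \<forall>x\<in>\<Omega>. 0 \<le> \<eta> n x \<and> \<eta> n x \<le> 1) \<and>
           (\<forall>\<psi> \<in> Lq 2 (lebesgue_on \<Omega>).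
              (\<lambda>n. Lq_norm 2 (lebesgue_on \<Omega>) (\<lambda>x. (\<eta> n x - 1) * \<psi> x)) \<longlonglongrightarrow> 0) \<and>
           (\<lambda>n. Lq_norm (if p = 2 then \<infinity> else ennreal (p / (2 - p))) (lebesgue_on \<Omega>)
                  (carre_du_champ C (\<eta> n))) \<longlonglongrightarrow> 0"
  shows "Lq_unique (ennreal p) (lebesgue_on \<Omega>) (elliptic_graph \<Omega> C)"
proof -
 note \<Omega> = assms(1) and p = assms(5,6)
 have "dissipative_core (Lq (ennreal p) (lebesgue_on \<Omega>)) (Lp_norm p (lebesgue_on \<Omega>)) (elliptic_graph \<Omega> C)"
 proof (cases "\<Omega> = {}")
  case True
  thus ?thesis using elliptic_graph_core_empty[OF p(1)] by simp
 next
  case False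
  obtain \<eta> where \<eta>t: "\<And>n. \<eta> n \<in> test_functions \<Omega>" and \<eta>0: "\<And>n x. x \<in> \<Omega> ==> 0 \<le> \<eta> n x"
   and \<eta>1: "\<And>\<psi>. \<psi> \<in> Lq 2 (lebesgue_on \<Omega>) ==> (\<lambda>n. Lq_norm 2 (lebesgue_on \<Omega>) (\<lambda>x. (\<eta> n x - 1) * \<psi> x)) \<longlonglongrightarrow> 0"
   and \<Gamma>: "(\<lambda>n. Lq_norm (if p = 2 then \<infinity> else ennreal (p / (2 - p))) (lebesgue_on \<Omega>) (carre_du_champ C (\<eta> n))) \<longlonglongrightarrow> 0"
   using assms(7) by blast
  have t1: "tends_to_1 \<Omega> \<eta>" by (rule tends_to_1_if_Lq_norm[OF \<Omega> \<eta>t \<eta>1])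
  obtain n x where nx: "\<eta> n x \<noteq> 0" using tends_to_1_nonzero[OF \<Omega> False t1] by blast
  have "0 \<le> \<eta> n y" for y using \<eta>0[of y n] Cc_outside[of "\<eta> n" 0 \<Omega> y] \<eta>t[of n] by (cases "y \<in> \<Omega>") (auto simp: test_functions_iff)
  then obtain \<rho> :: "nat => real^'n => real" and \<kappa> where mol: "mollifier \<rho> \<kappa>" using mollifier_exists[OF \<eta>t[of n] _ nx] by blast
  define c where "c = (\<lambda>i j x. indicator \<Omega> x * C x $ i $ j)"
  have cv: "borel_version \<Omega> (\<lambda>x. C x $ i $ j) (c i j)" for i j
   unfolding c_def by (rule coefficients_exist(1)[OF \<Omega> assms(2-4) mol])
  obtain D B where ell: "elliptic \<rho> \<kappa> \<Omega> c D B"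
   using coefficients_exist(2)[OF \<Omega> assms(2-4) mol] unfolding c_def by blast
  interpret elliptic \<rho> \<kappa> \<Omega> c D B by (rule ell)
  have carre: "carre_du_champ C \<phi> x = Gam \<phi> x" if "x \<in> \<Omega>" for \<phi> x unfolding carre_du_champ_def Gam_def using that by (simp add: c_def)
  have Gam0: "Gam (\<eta> n) x = 0" if "x \<notin> \<Omega>" for n x unfolding Gam_def using that by (simp add: c_def)
  show ?thesis
  proof (rule elliptic_graph_core[OF ell cv p])
   fix f :: "real^'n => real" and h e :: real
   assume f: "f \<in> borel_measurable borel" and f0: "\<And>x. x \<notin> \<Omega> ==> f x = 0" and fi: "integrable lborel (\<lambda>x. \<bar>f x\<bar> powr p)"
    and h: "h > 0" and e: "e > 0"
   show "\<exists>\<phi>\<in>test_functions \<Omega>. (LINT x|lborel. \<bar>f x - (\<phi> x + h * Lop \<phi> x)\<bar> powr p) < e"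
   proof (cases "p = 2")
    case False
    hence p2: "p < 2" and q: "p / (2 - p) > 0" using p by auto
    have small: "\<exists>N. \<forall>n\<ge>N. (\<integral>\<^sup>+x. ennreal (Gam (\<eta> n) x powr (p / (2 - p))) \<partial>lborel) \<le> ennreal s" if s: "s > 0" for s
    proof -
     have "(0::ennreal) < ennreal (s powr (1 / (p / (2 - p))))" using s by simp
     from order_tendstoD(2)[OF \<Gamma> this] obtain N where
      N: "\<And>n. n \<ge> N ==> Lq_norm (ennreal (p / (2 - p))) (lebesgue_on \<Omega>) (carre_du_champ C (\<eta> n)) < ennreal (s powr (1 / (p / (2 - p))))"
      using False unfolding eventually_sequentially by auto
     show ?thesis
      using carre_du_champ_small[OF \<Omega> q s carre Gam_nonneg'[OF \<eta>t] Gam0 N] by blast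
    qed
    show ?thesis by (rule range_dense_below_2[OF t1 h p(1) p2 small f f0 fi e])
   next
    case True
    define \<epsilon> where "\<epsilon> n = esssup (lebesgue_on \<Omega>) (\<lambda>x. ennreal \<bar>carre_du_champ C (\<eta> n) x\<bar>)" for n
    have \<epsilon>: "\<epsilon> \<longlonglongrightarrow> 0" using \<Gamma> True by (simp add: \<epsilon>_def[abs_def] Lq_norm_def)
    obtain N where N: "\<And>n. n \<ge> N ==> \<epsilon> n < 1"
     using order_tendstoD(2)[OF \<epsilon>, of 1] unfolding eventually_sequentially by auto
    \<comment> \<open>\<open>enn2real\<close> sends infinity to zero, so the first terms must be skipped\<close>
    have fin: "\<epsilon> (n + N) < top" for n using N[of "n + N"] by (simp add: less_trans[OF _ ennreal_one_less_top])
    have lim: "(\<lambda>n. enn2real (\<epsilon> (n + N))) \<longlonglongrightarrow> 0"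
     using tendsto_enn2real[OF LIMSEQ_ignore_initial_segment[OF \<epsilon>, of N, folded ennreal_0]] by simp
    have "AE x in lborel. Gam (\<eta> (n + N)) x \<le> enn2real (\<epsilon> (n + N))" for n
    proof -
     have "AE x in lebesgue_on \<Omega>. ennreal \<bar>carre_du_champ C (\<eta> (n + N)) x\<bar> \<le> \<epsilon> (n + N)"
      unfolding \<epsilon>_def by (rule esssup_AE)
     hence "AE x in lborel. x \<in> \<Omega> \<longrightarrow> ennreal \<bar>Gam (\<eta> (n + N)) x\<bar> \<le> \<epsilon> (n + N)"
      unfolding AE_lebesgue_on[OF \<Omega>] by eventually_elim (simp add: carre)
     thus ?thesis
     proof eventually_elim
      case (elim x)
      show ?case
      proof (cases "x \<in> \<Omega>")
       case True
       hence "enn2real (ennreal \<bar>Gam (\<eta> (n + N)) x\<bar>) \<le> enn2real (\<epsilon> (n + N))" using elim fin by (intro enn2real_mono) auto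
       thus ?thesis by simp
      qed (simp add: Gam0)
     qed
    qed
    from range_dense_2[OF tends_to_1_subsequence[OF t1, of "\<lambda>n. n + N"] h lim this f f0 _ e] fi True
    show ?thesis by simp
   qed
  qed
 qed
 from dissipative_core.unique_generator[OF this] show ?thesis unfolding Lq_unique_iff[OF p(1)] .
qed

end
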